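(* There exist double functors $$\Phi\colon \mathsf{Ring}\to\mathbb{BIMOD},\qquad \Psi\colon\mathsf{Ring}\to\mathbb{CENTRAL},\qquad \Omega\colon\mathbb{CENTRAL}\to\mathbb{BIMOD}$$ (not asserted to satisfy $\Omega\circ\Psi=\Phi$) such that: $\Phi$ takes a ring $R$ to $R$ and a ring map $\sigma\colon R\to S$ to the $S$-$R$-bimodule $S$ with right $R$-action given by restriction along $\sigma$; $\Psi$ takes a ring $R$ to its centre $Z(R)$ and a ring map $\sigma\colon R\to S$ to the horizontal morphism $(Z(S),i,Z(\sigma),j,Z(R))$, where $i(s)=s$ for $s\in Z(S)$ and $j(r)=\sigma(r)$ for $r\in Z(R)$; and $\Omega$ takes a commutative ring $A$ to $A$ and a horizontal morphism $(A,\alpha,E,\beta,B)$ to $E$ regarded as an $A$-$B$-bimodule by restriction along $\alpha$ and $\beta$. Furthermore, for any double category $\mathcal D=(\mathcal V,\mathcal H,\dots)$ with $\mathcal V,\mathcal H$ small, with $\mathsf C$ the object set of $\mathcal V$, and for any subset $\mathsf S\subseteq\mathsf C^3$, the assignment $F\mapsto\mathscr T(\mathfrak S(F))/\mathscr I(\boldsymbol c(F))$ defines a functor from the category of double functors $\mathcal D\to\mathbb{BIMOD}$ (with double transformations as morphisms) to the category of small preadditive categories (with additive functors as morphisms).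
   Context: Rings are associative and unital, possibly noncommutative. **Double categories.** A double category $(\mathcal V,\mathcal H,\Delta,\mathscr L,\mathscr R,\odot,\boldsymbol\alpha,\boldsymbol\lambda,\boldsymbol\rho)$ consists of categories $\mathcal V,\mathcal H$, functors $\Delta\colon\mathcal V\to\mathcal H$, $\mathscr L,\mathscr R\colon\mathcal H\to\mathcal V$ and $\odot\colon\mathcal H\times_{\mathcal V}\mathcal H\to\mathcal H$, where $\mathcal H\times_{\mathcal V}\mathcal H$ has objects the pairs $(\mathfrak g,\mathfrak f)$ with $\mathscr R(\mathfrak g)=\mathscr L(\mathfrak f)$ and morphisms the pairs $(\delta,\varepsilon)$ with $\mathscr R(\delta)=\mathscr L(\varepsilon)$, such that $\mathscr L(\Delta(x))=x=\mathscr R(\Delta(x))$, $\mathscr L(\mathfrak g\odot\mathfrak f)=\mathscr L(\mathfrak g)$, $\mathscr R(\mathfrak g\odot\mathfrak f)=\mathscr R(\mathfrak f)$; together with natural isomorphisms $\boldsymbol\alpha_{\mathfrak h,\mathfrak g,\mathfrak f}\colon(\mathfrak h\odot\mathfrak g)\odot\mathfrak f\to\mathfrak h\odot(\mathfrak g\odot\mathfrak f)$, $\boldsymbol\lambda_{\mathfrak i}\colon\Delta(\mathscr L(\mathfrak i))\odot\mathfrak i\to\mathfrak i$, $\boldsymbol\rho_{\mathfrak j}\colon\mathfrak j\odot\Delta(\mathscr R(\mathfrak j))\to\mathfrak j$ in $\mathcal H$, sent to identities by $\mathscr L$ and $\mathscr R$, and satisfying the usual pentagon and triangle axioms. Objects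 (morphisms) of $\mathcal V$ are called objects (vertical morphisms); objects (morphisms) of $\mathcal H$ are called horizontal morphisms (square morphisms). **Double functors (lax).** A double functor $F=(F_0,F_1,F_\odot,F_\Delta)\colon(\mathcal V,\mathcal H,\dots)\to(\mathcal V',\mathcal H',\dots)$ consists of functors $F_0\colon\mathcal V\to\mathcal V'$, $F_1\colon\mathcal H\to\mathcal H'$ with $\mathscr L'F_1=F_0\mathscr L$, $\mathscr R'F_1=F_0\mathscr R$, and morphisms in $\mathcal H'$, $(F_\odot)_{\mathfrak g,\mathfrak f}\colon F_1(\mathfrak g)\odot'F_1(\mathfrak f)\to F_1(\mathfrak g\odot\mathfrak f)$ and $(F_\Delta)_x\colon\Delta'(F_0(x))\to F_1(\Delta(x))$, natural in $\mathfrak g,\mathfrak f,x$, sent to identities by $\mathscr L',\mathscr R'$, such that $F_1(\boldsymbol\alpha_{\mathfrak h,\mathfrak g,\mathfrak f})\circ(F_\odot)_{\mathfrak h\odot\mathfrak g,\mathfrak f}\circ((F_\odot)_{\mathfrak h,\mathfrak g}\odot'1)=(F_\odot)_{\mathfrak h,\mathfrak g\odot\mathfrak f}\circ(1\odot'(F_\odot)_{\mathfrak g,\mathfrak f})\circ\boldsymbol\alpha'$, $F_1(\boldsymbol\lambda_{\mathfrak f})\circ(F_\odot)_{\Delta(x),\mathfrak f}\circ((F_\Delta)_x\odot'1)=\boldsymbol\lambda'_{F_1(\mathfrak f)}$, and $F_1(\boldsymbol\rho_{\mathfrak g})\circ(F_\odot)_{\mathfrak g,\Delta(x)}\circ(1\odot'(F_\Delta)_x)=\boldsymbol\rho'_{F_1(\mathfrak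 g)}$. **Double transformations.** A double transformation $T=(T_0,T_1)\colon F\Rightarrow F'$ consists of natural transformations $T_0\colon F_0\Rightarrow F_0'$, $T_1\colon F_1\Rightarrow F'_1$ with $\mathscr L'((T_1)_{\mathfrak f})=(T_0)_{\mathscr L(\mathfrak f)}$, $\mathscr R'((T_1)_{\mathfrak f})=(T_0)_{\mathscr R(\mathfrak f)}$, $(T_1)_{\mathfrak g\odot\mathfrak f}\circ(F_\odot)_{\mathfrak g,\mathfrak f}=(F'_\odot)_{\mathfrak g,\mathfrak f}\circ((T_1)_{\mathfrak g}\odot'(T_1)_{\mathfrak f})$ and $(T_1)_{\Delta(x)}\circ(F_\Delta)_x=(F'_\Delta)_x\circ\Delta'((T_0)_x)$. They compose componentwise. **$\mathsf{Ring}$** is the category of rings viewed as a double category: objects are rings, vertical morphisms are identities, horizontal morphisms are ring maps $\sigma\colon R\to S$ with $\mathscr L(\sigma)=S$, $\mathscr R(\sigma)=R$, square morphisms are identities, $\odot$ is composition and $\Delta(R)=1_R$. **$\mathbb{BIMOD}$**: objects are rings, vertical morphisms are ring maps, horizontal morphisms are bimodules ${}_QA_R$ with $\mathscr L({}_QA_R)=Q$ and $\mathscr R({}_QA_R)=R$; a square morphism ${}_QA_R\to{}_SB_T$ is a triple $(\theta,\Gamma,\varphi)$ with $\theta\colon Q\to S$, $\varphi\colon R\to T$ ring maps and $\Gamma\colon A\to B$ additive with $\Gamma(qar)=\theta(q)\Gamma(a)\varphi(r)$; $\mathscr L,\mathscr R$ send it to $\theta,\varphi$. $\Delta(R)={}_RR_R$,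 and $\odot$ is the tensor product ${}_QA_R\otimes_R{}_RB_S$ (on squares, the induced map of tensor products), with the canonical $\boldsymbol\alpha,\boldsymbol\lambda,\boldsymbol\rho$. **$\mathbb{CENTRAL}$** (written $\mathbb{CENTRAL}^{\mathsf{Ring}}_{\mathsf{Com}}$ in the source): objects are commutative rings; vertical morphisms are identities; horizontal morphisms are quintuples $(A,\alpha,E,\beta,B)$ with $A,B$ commutative rings, $E$ a ring, and $\alpha\colon A\to E$, $\beta\colon B\to E$ ring maps with image in the centre of $E$; $\mathscr L$ and $\mathscr R$ of this are $A$ and $B$. Square morphisms $(A,\alpha,E,\beta,B)\to(A,\sigma,E',\tau,B)$ are ring maps $\varepsilon\colon E\to E'$ with $\sigma=\varepsilon\alpha$, $\tau=\varepsilon\beta$. $\Delta(A)=(A,1_A,A,1_A,A)$. The horizontal composite of $(A,\alpha,E,\beta,B)$ and $(B,\gamma,F,\delta,C)$ is $(A,\alpha(-)\otimes1_F,E\otimes_BF,1_E\otimes\delta(-),C)$, where $E\otimes_BF$ has multiplication $(e\otimes f)(e'\otimes f')=ee'\otimes ff'$. For a ring map $\sigma\colon R\to S$, $Z(\sigma)=\{s\in S\mid s\sigma(r)=\sigma(r)s\text{ for all }r\in R\}$, a subring of $S$. **The category $\mathscr T(\mathfrak S(F))/\mathscr I(\boldsymbol c(F))$.** Let $F\colon\mathcal D\to\mathbb{BIMOD}$ be a double functor. Put $R_x=F_0(x)$ for $x\in\mathsf C$, and ${}_yA_x=\bigoplus F_1(\mathfrak f)$, the sum over objects $\mathfrak f$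 of $\mathcal H$ with $\mathscr L(\mathfrak f)=y$, $\mathscr R(\mathfrak f)=x$, an $R_y$-$R_x$-bimodule; the family $\mathfrak S(F)=(R_x,{}_yA_x)$ is a species. For a path $\underline x=(x_n,\dots,x_0)$ in $\mathsf C$ with $x_n=h$, $x_0=t$ put $A_{(x)}=R_x$ if $n=0$, and $A_{\underline x}={}_{x_n}A_{x_{n-1}}\otimes_{R_{x_{n-1}}}\cdots\otimes_{R_{x_1}}{}_{x_1}A_{x_0}$ if $n\ge1$; let ${}_h\underline A_t=\bigoplus A_{\underline x}$ over all $n\ge 0$ and all such paths from $t$ to $h$. $\mathscr T(\mathfrak S(F))$ is the preadditive category with object set $\mathsf C$, $\mathrm{Hom}(t,h)={}_h\underline A_t$, and composition given by concatenation of tensors. For $(z,y,x)\in\mathsf S$ let $c_{zyx}\colon{}_zA_y\otimes_{R_y}{}_yA_x\to{}_zA_x$ be the bimodule map whose restriction to $F_1(\mathfrak g)\otimes F_1(\mathfrak f)$ is $(F_\odot)_{\mathfrak g,\mathfrak f}$ followed by the inclusion of $F_1(\mathfrak g\odot\mathfrak f)$; $\boldsymbol c(F)=(c_{zyx})$. $\mathscr I(\boldsymbol c(F))=({}_hI_t)$ is the ideal where ${}_hI_t\subseteq{}_h\underline A_t$ is the subgroup generated by all $\underline a-(1\otimes\cdots\otimes c_{x_{m+1}x_mx_{m-1}}\otimes\cdots\otimes1)(\underline a)$ with $\underline a\in A_{\underline x}$, $\underline x$ a path of length $n\ge2$ from $t$ to $h$, $1\le m\le n-1$ and $(x_{m+1},x_m,x_{m-1})\in\mathsf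 S$. A double transformation $T\colon F\Rightarrow F'$ is sent to the functor that is the identity on objects and is induced on morphisms by the ring maps $(T_0)_x$ and the additive maps $\bigoplus_{\mathfrak f}(T_1)_{\mathfrak f}$, applied tensor-factor-wise. *)

theory Defs
  imports "HOL-Algebra.Free_Abelian_Groups" "HOL-Algebra.Weak_Morphisms" "HOL-Library.Infinite_Typeclass"
begin

text \<open>
  Conventions. All rings and bimodules forming \<open>BIMOD\<close>, \<open>CENTRAL\<close> and \<open>RING\<close> have carriers contained in
  a fixed type \<open>'u\<close>, which plays the role of the universe and is only required to be infinite, so that
  tensor products over \<open>'u\<close> can be carried back into \<open>'u\<close>. Functions that are morphisms (or parts of
  morphisms) are \<open>extensional\<close>, so that equality in HOL is equality of morphisms.
  Unique maps determined by their values on pure tensors are specified by \<open>THE\<close>.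
\<close>

section \<open>Categories, double categories\<close>

record ('o, 'm) category =
  Obj :: "'o set"
  Arr :: "'m set"
  Dom :: "'m \<Rightarrow> 'o"
  Cod :: "'m \<Rightarrow> 'o"
  Ident :: "'o \<Rightarrow> 'm"
  Comp :: "'m \<Rightarrow> 'm \<Rightarrow> 'm" (infixl \<open>\<cdot>\<index>\<close> 70)

locale category =
  fixes C :: "('o, 'm) category" (structure)
  assumes Dom_Obj: "f \<in> Arr C \<Longrightarrow> Dom C f \<in> Obj C"
    and Cod_Obj: "f \<in> Arr C \<Longrightarrow> Cod C f \<in> Obj C"
    and Ident_Arr: "x \<in> Obj C \<Longrightarrow> Ident C x \<in> Arr C"
    and Dom_Ident: "x \<in> Obj C \<Longrightarrow> Dom C (Ident C x) = x"
    and Cod_Ident: "x \<in> Obj C \<Longrightarrow> Cod C (Ident C x) = x"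
    and Comp_Arr: "\<lbrakk>g \<in> Arr C; f \<in> Arr C; Dom C g = Cod C f\<rbrakk> \<Longrightarrow> g \<cdot> f \<in> Arr C"
    and Dom_Comp: "\<lbrakk>g \<in> Arr C; f \<in> Arr C; Dom C g = Cod C f\<rbrakk> \<Longrightarrow> Dom C (g \<cdot> f) = Dom C f"
    and Cod_Comp: "\<lbrakk>g \<in> Arr C; f \<in> Arr C; Dom C g = Cod C f\<rbrakk> \<Longrightarrow> Cod C (g \<cdot> f) = Cod C g"
    and Comp_assoc: "\<lbrakk>h \<in> Arr C; g \<in> Arr C; f \<in> Arr C; Dom C h = Cod C g; Dom C g = Cod C f\<rbrakk>
      \<Longrightarrow> (h \<cdot> g) \<cdot> f = h \<cdot> (g \<cdot> f)"
    and Comp_Ident_left: "f \<in> Arr C \<Longrightarrow> Ident C (Cod C f) \<cdot> f = f"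
    and Comp_Ident_right: "f \<in> Arr C \<Longrightarrow> f \<cdot> Ident C (Dom C f) = f"

definition hom_arr :: "('o, 'm) category \<Rightarrow> 'o \<Rightarrow> 'o \<Rightarrow> 'm set" where
  "hom_arr C x y = {f \<in> Arr C. Dom C f = x \<and> Cod C f = y}"

definition is_iso :: "('o, 'm) category \<Rightarrow> 'm \<Rightarrow> bool" where
  "is_iso C f \<longleftrightarrow> f \<in> Arr C \<and>
    (\<exists>g \<in> hom_arr C (Cod C f) (Dom C f).
      g \<cdot>\<^bsub>C\<^esub> f = Ident C (Dom C f) \<and> f \<cdot>\<^bsub>C\<^esub> g = Ident C (Cod C f))"

definition discrete_cat :: "'o set \<Rightarrow> ('o, 'o) category" where
  "discrete_cat X = \<lparr>Obj = X, Arr = X, Dom = (\<lambda>x. x), Cod = (\<lambda>x. x), Ident = (\<lambda>x. x),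
     Comp = (\<lambda>g f. f)\<rparr>"

record ('o, 'm, 'p, 'n) fctr =
  OMap :: "'o \<Rightarrow> 'p"
  AMap :: "'m \<Rightarrow> 'n"

locale cat_functor = A: category A + B: category B
  for A :: "('o, 'm) category" and B :: "('p, 'n) category" +
  fixes F :: "('o, 'm, 'p, 'n) fctr"
  assumes OMap_Obj: "x \<in> Obj A \<Longrightarrow> OMap F x \<in> Obj B"
    and AMap_Arr: "f \<in> Arr A \<Longrightarrow> AMap F f \<in> Arr B"
    and Dom_AMap: "f \<in> Arr A \<Longrightarrow> Dom B (AMap F f) = OMap F (Dom A f)"
    and Cod_AMap: "f \<in> Arr A \<Longrightarrow> Cod B (AMap F f) = OMap F (Cod A f)"
    and AMap_Ident: "x \<in> Obj A \<Longrightarrow> AMap F (Ident A x) = Ident B (OMap F x)"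
    and AMap_Comp: "\<lbrakk>g \<in> Arr A; f \<in> Arr A; Dom A g = Cod A f\<rbrakk>
      \<Longrightarrow> AMap F (g \<cdot>\<^bsub>A\<^esub> f) = AMap F g \<cdot>\<^bsub>B\<^esub> AMap F f"

definition pullback_cat ::
  "('h, 's) category \<Rightarrow> ('h, 's, 'o, 'v) fctr \<Rightarrow> ('h, 's, 'o, 'v) fctr \<Rightarrow> ('h \<times> 'h, 's \<times> 's) category"
where
  "pullback_cat H R L =
    \<lparr>Obj = {(g, f). g \<in> Obj H \<and> f \<in> Obj H \<and> OMap R g = OMap L f},
     Arr = {(\<delta>, \<epsilon>). \<delta> \<in> Arr H \<and> \<epsilon> \<in> Arr H \<and> AMap R \<delta> = AMap L \<epsilon>},
     Dom = map_prod (Dom H) (Dom H),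
     Cod = map_prod (Cod H) (Cod H),
     Ident = map_prod (Ident H) (Ident H),
     Comp = (\<lambda>(\<delta>', \<epsilon>') (\<delta>, \<epsilon>). (\<delta>' \<cdot>\<^bsub>H\<^esub> \<delta>, \<epsilon>' \<cdot>\<^bsub>H\<^esub> \<epsilon>))\<rparr>"

record ('o, 'v, 'h, 's) double_cat =
  Vert :: "('o, 'v) category"
  Horz :: "('h, 's) category"
  Delta :: "('o, 'v, 'h, 's) fctr"
  Lft :: "('h, 's, 'o, 'v) fctr"
  Rgt :: "('h, 's, 'o, 'v) fctr"
  HComp :: "('h \<times> 'h, 's \<times> 's, 'h, 's) fctr"
  Assoc :: "'h \<Rightarrow> 'h \<Rightarrow> 'h \<Rightarrow> 's"
  LUnit :: "'h \<Rightarrow> 's"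
  RUnit :: "'h \<Rightarrow> 's"

abbreviation hcomp_obj :: "('o, 'v, 'h, 's) double_cat \<Rightarrow> 'h \<Rightarrow> 'h \<Rightarrow> 'h" (infixl \<open>\<star>\<index>\<close> 75) where
  "g \<star>\<^bsub>D\<^esub> f \<equiv> OMap (HComp D) (g, f)"

abbreviation hcomp_arr :: "('o, 'v, 'h, 's) double_cat \<Rightarrow> 's \<Rightarrow> 's \<Rightarrow> 's" (infixl \<open>\<star>\<star>\<index>\<close> 75) where
  "\<delta> \<star>\<star>\<^bsub>D\<^esub> \<epsilon> \<equiv> AMap (HComp D) (\<delta>, \<epsilon>)"

abbreviation hcomposable :: "('o, 'v, 'h, 's) double_cat \<Rightarrow> ('h \<times> 'h, 's \<times> 's) category" where
  "hcomposable D \<equiv> pullback_cat (Horz D) (Rgt D) (Lft D)"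

locale double_category =
  Delta: cat_functor "Vert D" "Horz D" "Delta D" +
  Lft: cat_functor "Horz D" "Vert D" "Lft D" +
  Rgt: cat_functor "Horz D" "Vert D" "Rgt D" +
  HComp: cat_functor "hcomposable D" "Horz D" "HComp D"
  for D :: "('o, 'v, 'h, 's) double_cat" (structure) +
  assumes Lft_Delta_Obj: "x \<in> Obj (Vert D) \<Longrightarrow> OMap (Lft D) (OMap (Delta D) x) = x"
    and Rgt_Delta_Obj: "x \<in> Obj (Vert D) \<Longrightarrow> OMap (Rgt D) (OMap (Delta D) x) = x"
    and Lft_Delta_Arr: "\<theta> \<in> Arr (Vert D) \<Longrightarrow> AMap (Lft D) (AMap (Delta D) \<theta>) = \<theta>"
    and Rgt_Delta_Arr: "\<theta> \<in> Arr (Vert D) \<Longrightarrow> AMap (Rgt D) (AMap (Delta D) \<theta>) = \<theta>"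
    and Lft_HComp_Obj: "(g, f) \<in> Obj (hcomposable D) \<Longrightarrow> OMap (Lft D) (g \<star> f) = OMap (Lft D) g"
    and Rgt_HComp_Obj: "(g, f) \<in> Obj (hcomposable D) \<Longrightarrow> OMap (Rgt D) (g \<star> f) = OMap (Rgt D) f"
    and Lft_HComp_Arr: "(\<delta>, \<epsilon>) \<in> Arr (hcomposable D) \<Longrightarrow> AMap (Lft D) (\<delta> \<star>\<star> \<epsilon>) = AMap (Lft D) \<delta>"
    and Rgt_HComp_Arr: "(\<delta>, \<epsilon>) \<in> Arr (hcomposable D) \<Longrightarrow> AMap (Rgt D) (\<delta> \<star>\<star> \<epsilon>) = AMap (Rgt D) \<epsilon>"
    and Assoc_hom: "\<lbrakk>(h, g) \<in> Obj (hcomposable D); (g, f) \<in> Obj (hcomposable D)\<rbrakk>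
      \<Longrightarrow> Assoc D h g f \<in> hom_arr (Horz D) ((h \<star> g) \<star> f) (h \<star> (g \<star> f))"
    and Assoc_iso: "\<lbrakk>(h, g) \<in> Obj (hcomposable D); (g, f) \<in> Obj (hcomposable D)\<rbrakk>
      \<Longrightarrow> is_iso (Horz D) (Assoc D h g f)"
    and Assoc_natural: "\<lbrakk>(\<gamma>, \<delta>) \<in> Arr (hcomposable D); (\<delta>, \<epsilon>) \<in> Arr (hcomposable D)\<rbrakk>
      \<Longrightarrow> Assoc D (Cod (Horz D) \<gamma>) (Cod (Horz D) \<delta>) (Cod (Horz D) \<epsilon>) \<cdot>\<^bsub>Horz D\<^esub> ((\<gamma> \<star>\<star> \<delta>) \<star>\<star> \<epsilon>)
        = (\<gamma> \<star>\<star> (\<delta> \<star>\<star> \<epsilon>)) \<cdot>\<^bsub>Horz D\<^esub> Assoc D (Dom (Horz D) \<gamma>) (Dom (Horz D) \<delta>) (Dom (Horz D) \<epsilon>)"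
    and LUnit_hom: "f \<in> Obj (Horz D)
      \<Longrightarrow> LUnit D f \<in> hom_arr (Horz D) (OMap (Delta D) (OMap (Lft D) f) \<star> f) f"
    and LUnit_iso: "f \<in> Obj (Horz D) \<Longrightarrow> is_iso (Horz D) (LUnit D f)"
    and LUnit_natural: "\<epsilon> \<in> Arr (Horz D)
      \<Longrightarrow> LUnit D (Cod (Horz D) \<epsilon>) \<cdot>\<^bsub>Horz D\<^esub> (AMap (Delta D) (AMap (Lft D) \<epsilon>) \<star>\<star> \<epsilon>)
        = \<epsilon> \<cdot>\<^bsub>Horz D\<^esub> LUnit D (Dom (Horz D) \<epsilon>)"
    and RUnit_hom: "f \<in> Obj (Horz D)
      \<Longrightarrow> RUnit D f \<in> hom_arr (Horz D) (f \<star> OMap (Delta D) (OMap (Rgt D) f)) f"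
    and RUnit_iso: "f \<in> Obj (Horz D) \<Longrightarrow> is_iso (Horz D) (RUnit D f)"
    and RUnit_natural: "\<epsilon> \<in> Arr (Horz D)
      \<Longrightarrow> RUnit D (Cod (Horz D) \<epsilon>) \<cdot>\<^bsub>Horz D\<^esub> (\<epsilon> \<star>\<star> AMap (Delta D) (AMap (Rgt D) \<epsilon>))
        = \<epsilon> \<cdot>\<^bsub>Horz D\<^esub> RUnit D (Dom (Horz D) \<epsilon>)"
    and Lft_Assoc: "\<lbrakk>(h, g) \<in> Obj (hcomposable D); (g, f) \<in> Obj (hcomposable D)\<rbrakk>
      \<Longrightarrow> AMap (Lft D) (Assoc D h g f) = Ident (Vert D) (OMap (Lft D) h)"
    and Rgt_Assoc: "\<lbrakk>(h, g) \<in> Obj (hcomposable D); (g, f) \<in> Obj (hcomposable D)\<rbrakk>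
      \<Longrightarrow> AMap (Rgt D) (Assoc D h g f) = Ident (Vert D) (OMap (Rgt D) f)"
    and Lft_LUnit: "f \<in> Obj (Horz D) \<Longrightarrow> AMap (Lft D) (LUnit D f) = Ident (Vert D) (OMap (Lft D) f)"
    and Rgt_LUnit: "f \<in> Obj (Horz D) \<Longrightarrow> AMap (Rgt D) (LUnit D f) = Ident (Vert D) (OMap (Rgt D) f)"
    and Lft_RUnit: "f \<in> Obj (Horz D) \<Longrightarrow> AMap (Lft D) (RUnit D f) = Ident (Vert D) (OMap (Lft D) f)"
    and Rgt_RUnit: "f \<in> Obj (Horz D) \<Longrightarrow> AMap (Rgt D) (RUnit D f) = Ident (Vert D) (OMap (Rgt D) f)"
    and pentagon: "\<lbrakk>(k, h) \<in> Obj (hcomposable D); (h, g) \<in> Obj (hcomposable D); (g, f) \<in> Obj (hcomposable D)\<rbrakk>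
      \<Longrightarrow> Assoc D k h (g \<star> f) \<cdot>\<^bsub>Horz D\<^esub> Assoc D (k \<star> h) g f
        = (Ident (Horz D) k \<star>\<star> Assoc D h g f) \<cdot>\<^bsub>Horz D\<^esub> Assoc D k (h \<star> g) f
            \<cdot>\<^bsub>Horz D\<^esub> (Assoc D k h g \<star>\<star> Ident (Horz D) f)"
    and triangle: "(g, f) \<in> Obj (hcomposable D)
      \<Longrightarrow> (Ident (Horz D) g \<star>\<star> LUnit D f) \<cdot>\<^bsub>Horz D\<^esub> Assoc D g (OMap (Delta D) (OMap (Rgt D) g)) f
        = RUnit D g \<star>\<star> Ident (Horz D) f"

section \<open>Double functors and double transformations\<close>

record ('o, 'v, 'h, 's, 'o1, 'v1, 'h1, 's1) double_fctr =
  Fun0 :: "('o, 'v, 'o1, 'v1) fctr"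
  Fun1 :: "('h, 's, 'h1, 's1) fctr"
  FComp :: "'h \<times> 'h \<Rightarrow> 's1"
  FUnit :: "'o \<Rightarrow> 's1"

locale double_functor =
  D: double_category D + E: double_category E +
  Fun0: cat_functor "Vert D" "Vert E" "Fun0 F" +
  Fun1: cat_functor "Horz D" "Horz E" "Fun1 F"
  for D :: "('o, 'v, 'h, 's) double_cat"
    and E :: "('o1, 'v1, 'h1, 's1) double_cat"
    and F :: "('o, 'v, 'h, 's, 'o1, 'v1, 'h1, 's1) double_fctr" +
  assumes extensional:
      "OMap (Fun0 F) \<in> extensional (Obj (Vert D))" "AMap (Fun0 F) \<in> extensional (Arr (Vert D))"
      "OMap (Fun1 F) \<in> extensional (Obj (Horz D))" "AMap (Fun1 F) \<in> extensional (Arr (Horz D))"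
      "FComp F \<in> extensional (Obj (hcomposable D))" "FUnit F \<in> extensional (Obj (Vert D))"
    and Lft_Obj: "f \<in> Obj (Horz D) \<Longrightarrow> OMap (Lft E) (OMap (Fun1 F) f) = OMap (Fun0 F) (OMap (Lft D) f)"
    and Rgt_Obj: "f \<in> Obj (Horz D) \<Longrightarrow> OMap (Rgt E) (OMap (Fun1 F) f) = OMap (Fun0 F) (OMap (Rgt D) f)"
    and Lft_Arr: "\<epsilon> \<in> Arr (Horz D) \<Longrightarrow> AMap (Lft E) (AMap (Fun1 F) \<epsilon>) = AMap (Fun0 F) (AMap (Lft D) \<epsilon>)"
    and Rgt_Arr: "\<epsilon> \<in> Arr (Horz D) \<Longrightarrow> AMap (Rgt E) (AMap (Fun1 F) \<epsilon>) = AMap (Fun0 F) (AMap (Rgt D) \<epsilon>)"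
    and FComp_hom: "(g, f) \<in> Obj (hcomposable D)
      \<Longrightarrow> FComp F (g, f) \<in> hom_arr (Horz E)
            (OMap (Fun1 F) g \<star>\<^bsub>E\<^esub> OMap (Fun1 F) f) (OMap (Fun1 F) (g \<star>\<^bsub>D\<^esub> f))"
    and FUnit_hom: "x \<in> Obj (Vert D)
      \<Longrightarrow> FUnit F x \<in> hom_arr (Horz E)
            (OMap (Delta E) (OMap (Fun0 F) x)) (OMap (Fun1 F) (OMap (Delta D) x))"
    and FComp_natural: "(\<delta>, \<epsilon>) \<in> Arr (hcomposable D)
      \<Longrightarrow> FComp F (Cod (Horz D) \<delta>, Cod (Horz D) \<epsilon>) \<cdot>\<^bsub>Horz E\<^esub> (AMap (Fun1 F) \<delta> \<star>\<star>\<^bsub>E\<^esub> AMap (Fun1 F) \<epsilon>)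
        = AMap (Fun1 F) (\<delta> \<star>\<star>\<^bsub>D\<^esub> \<epsilon>) \<cdot>\<^bsub>Horz E\<^esub> FComp F (Dom (Horz D) \<delta>, Dom (Horz D) \<epsilon>)"
    and FUnit_natural: "\<theta> \<in> Arr (Vert D)
      \<Longrightarrow> FUnit F (Cod (Vert D) \<theta>) \<cdot>\<^bsub>Horz E\<^esub> AMap (Delta E) (AMap (Fun0 F) \<theta>)
        = AMap (Fun1 F) (AMap (Delta D) \<theta>) \<cdot>\<^bsub>Horz E\<^esub> FUnit F (Dom (Vert D) \<theta>)"
    and Lft_FComp: "(g, f) \<in> Obj (hcomposable D)
      \<Longrightarrow> AMap (Lft E) (FComp F (g, f)) = Ident (Vert E) (OMap (Fun0 F) (OMap (Lft D) g))"
    and Rgt_FComp: "(g, f) \<in> Obj (hcomposable D)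
      \<Longrightarrow> AMap (Rgt E) (FComp F (g, f)) = Ident (Vert E) (OMap (Fun0 F) (OMap (Rgt D) f))"
    and Lft_FUnit: "x \<in> Obj (Vert D) \<Longrightarrow> AMap (Lft E) (FUnit F x) = Ident (Vert E) (OMap (Fun0 F) x)"
    and Rgt_FUnit: "x \<in> Obj (Vert D) \<Longrightarrow> AMap (Rgt E) (FUnit F x) = Ident (Vert E) (OMap (Fun0 F) x)"
    and FComp_Assoc: "\<lbrakk>(h, g) \<in> Obj (hcomposable D); (g, f) \<in> Obj (hcomposable D)\<rbrakk>
      \<Longrightarrow> AMap (Fun1 F) (Assoc D h g f) \<cdot>\<^bsub>Horz E\<^esub> FComp F (h \<star>\<^bsub>D\<^esub> g, f)
            \<cdot>\<^bsub>Horz E\<^esub> (FComp F (h, g) \<star>\<star>\<^bsub>E\<^esub> Ident (Horz E) (OMap (Fun1 F) f))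
        = FComp F (h, g \<star>\<^bsub>D\<^esub> f)
            \<cdot>\<^bsub>Horz E\<^esub> (Ident (Horz E) (OMap (Fun1 F) h) \<star>\<star>\<^bsub>E\<^esub> FComp F (g, f))
            \<cdot>\<^bsub>Horz E\<^esub> Assoc E (OMap (Fun1 F) h) (OMap (Fun1 F) g) (OMap (Fun1 F) f)"
    and FUnit_LUnit: "\<lbrakk>f \<in> Obj (Horz D); x = OMap (Lft D) f\<rbrakk>
      \<Longrightarrow> AMap (Fun1 F) (LUnit D f) \<cdot>\<^bsub>Horz E\<^esub> FComp F (OMap (Delta D) x, f)
            \<cdot>\<^bsub>Horz E\<^esub> (FUnit F x \<star>\<star>\<^bsub>E\<^esub> Ident (Horz E) (OMap (Fun1 F) f))
        = LUnit E (OMap (Fun1 F) f)"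
    and FUnit_RUnit: "\<lbrakk>g \<in> Obj (Horz D); x = OMap (Rgt D) g\<rbrakk>
      \<Longrightarrow> AMap (Fun1 F) (RUnit D g) \<cdot>\<^bsub>Horz E\<^esub> FComp F (g, OMap (Delta D) x)
            \<cdot>\<^bsub>Horz E\<^esub> (Ident (Horz E) (OMap (Fun1 F) g) \<star>\<star>\<^bsub>E\<^esub> FUnit F x)
        = RUnit E (OMap (Fun1 F) g)"

text \<open>Arrows carrying their source and target.\<close>

record ('o, 'm) arrow =
  src :: 'o
  fn :: 'm
  tgt :: 'o

locale double_transformation =
  F: double_functor D E F + F': double_functor D E F'
  for D :: "('o, 'v, 'h, 's) double_cat"
    and E :: "('o1, 'v1, 'h1, 's1) double_cat"
    and F F' :: "('o, 'v, 'h, 's, 'o1, 'v1, 'h1, 's1) double_fctr" +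
  fixes T0 :: "'o \<Rightarrow> 'v1" and T1 :: "'h \<Rightarrow> 's1"
  assumes extensional: "T0 \<in> extensional (Obj (Vert D))" "T1 \<in> extensional (Obj (Horz D))"
    and T0_hom: "x \<in> Obj (Vert D) \<Longrightarrow> T0 x \<in> hom_arr (Vert E) (OMap (Fun0 F) x) (OMap (Fun0 F') x)"
    and T1_hom: "f \<in> Obj (Horz D) \<Longrightarrow> T1 f \<in> hom_arr (Horz E) (OMap (Fun1 F) f) (OMap (Fun1 F') f)"
    and T0_natural: "\<theta> \<in> Arr (Vert D)
      \<Longrightarrow> T0 (Cod (Vert D) \<theta>) \<cdot>\<^bsub>Vert E\<^esub> AMap (Fun0 F) \<theta> = AMap (Fun0 F') \<theta> \<cdot>\<^bsub>Vert E\<^esub> T0 (Dom (Vert D) \<theta>)"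
    and T1_natural: "\<epsilon> \<in> Arr (Horz D)
      \<Longrightarrow> T1 (Cod (Horz D) \<epsilon>) \<cdot>\<^bsub>Horz E\<^esub> AMap (Fun1 F) \<epsilon> = AMap (Fun1 F') \<epsilon> \<cdot>\<^bsub>Horz E\<^esub> T1 (Dom (Horz D) \<epsilon>)"
    and Lft_T1: "f \<in> Obj (Horz D) \<Longrightarrow> AMap (Lft E) (T1 f) = T0 (OMap (Lft D) f)"
    and Rgt_T1: "f \<in> Obj (Horz D) \<Longrightarrow> AMap (Rgt E) (T1 f) = T0 (OMap (Rgt D) f)"
    and T1_FComp: "(g, f) \<in> Obj (hcomposable D)
      \<Longrightarrow> T1 (g \<star>\<^bsub>D\<^esub> f) \<cdot>\<^bsub>Horz E\<^esub> FComp F (g, f) = FComp F' (g, f) \<cdot>\<^bsub>Horz E\<^esub> (T1 g \<star>\<star>\<^bsub>E\<^esub> T1 f)"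
    and T1_FUnit: "x \<in> Obj (Vert D)
      \<Longrightarrow> T1 (OMap (Delta D) x) \<cdot>\<^bsub>Horz E\<^esub> FUnit F x = FUnit F' x \<cdot>\<^bsub>Horz E\<^esub> AMap (Delta E) (T0 x)"

type_synonym ('o, 'v, 'h, 's, 'o1, 'v1, 'h1, 's1) double_trans =
  "(('o, 'v, 'h, 's, 'o1, 'v1, 'h1, 's1) double_fctr, ('o \<Rightarrow> 'v1) \<times> ('h \<Rightarrow> 's1)) arrow"

definition double_functor_cat ::
  "('o, 'v, 'h, 's) double_cat \<Rightarrow> ('o1, 'v1, 'h1, 's1) double_cat \<Rightarrow>
   (('o, 'v, 'h, 's, 'o1, 'v1, 'h1, 's1) double_fctr,
    ('o, 'v, 'h, 's, 'o1, 'v1, 'h1, 's1) double_trans) category"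
where
  "double_functor_cat D E =
    \<lparr>Obj = {F. double_functor D E F},
     Arr = {t. double_transformation D E (src t) (tgt t) (fst (fn t)) (snd (fn t))},
     Dom = src,
     Cod = tgt,
     Ident = (\<lambda>F. \<lparr>src = F,
       fn = (\<lambda>x\<in>Obj (Vert D). Ident (Vert E) (OMap (Fun0 F) x),
             \<lambda>f\<in>Obj (Horz D). Ident (Horz E) (OMap (Fun1 F) f)),
       tgt = F\<rparr>),
     Comp = (\<lambda>t' t. \<lparr>src = src t,
       fn = (\<lambda>x\<in>Obj (Vert D). fst (fn t') x \<cdot>\<^bsub>Vert E\<^esub> fst (fn t) x,
             \<lambda>f\<in>Obj (Horz D). snd (fn t') f \<cdot>\<^bsub>Horz E\<^esub> snd (fn t) f),
       tgt = tgt t'\<rparr>)\<rparr>"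

section \<open>Ring maps and the double category of rings\<close>

type_synonym 'u ring_map = "('u ring, 'u \<Rightarrow> 'u) arrow"

definition ring_maps :: "'u ring_map set" where
  "ring_maps = {\<sigma>. ring (src \<sigma>) \<and> ring (tgt \<sigma>) \<and>
     fn \<sigma> \<in> ring_hom (src \<sigma>) (tgt \<sigma>) \<and> fn \<sigma> \<in> extensional (carrier (src \<sigma>))}"

definition ring_map_id :: "'u ring \<Rightarrow> 'u ring_map" where
  "ring_map_id R = \<lparr>src = R, fn = (\<lambda>x\<in>carrier R. x), tgt = R\<rparr>"

definition ring_map_comp :: "'u ring_map \<Rightarrow> 'u ring_map \<Rightarrow> 'u ring_map" where
  "ring_map_comp \<tau> \<sigma> = \<lparr>src = src \<sigma>, fn = compose (carrier (src \<sigma>)) (fn \<tau>) (fn \<sigma>), tgt = tgt \<tau>\<rparr>"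

definition RING :: "('u ring, 'u ring, 'u ring_map, 'u ring_map) double_cat" where
  "RING =
    \<lparr>Vert = discrete_cat {R. ring R},
     Horz = discrete_cat ring_maps,
     Delta = \<lparr>OMap = ring_map_id, AMap = ring_map_id\<rparr>,
     Lft = \<lparr>OMap = tgt, AMap = tgt\<rparr>,
     Rgt = \<lparr>OMap = src, AMap = src\<rparr>,
     HComp = \<lparr>OMap = (\<lambda>(\<tau>, \<sigma>). ring_map_comp \<tau> \<sigma>), AMap = (\<lambda>(\<tau>, \<sigma>). ring_map_comp \<tau> \<sigma>)\<rparr>,
     Assoc = (\<lambda>\<upsilon> \<tau> \<sigma>. ring_map_comp \<upsilon> (ring_map_comp \<tau> \<sigma>)),
     LUnit = (\<lambda>\<sigma>. \<sigma>),
     RUnit = (\<lambda>\<sigma>. \<sigma>)\<rparr>"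

section \<open>Bimodules and tensor products\<close>

text \<open>The underlying abelian group \<open>bgrp\<close> is a multiplicatively written record, as provided by
  \<open>free_Abelian_group\<close>, \<open>Mod\<close> and \<open>sum_group\<close>.\<close>

record ('r, 'a) bimod =
  lring :: "'r ring"
  rring :: "'r ring"
  bgrp :: "'a monoid"
  lact :: "'r \<Rightarrow> 'a \<Rightarrow> 'a"
  ract :: "'a \<Rightarrow> 'r \<Rightarrow> 'a"

abbreviation bcar :: "('r, 'a) bimod \<Rightarrow> 'a set" where
  "bcar M \<equiv> carrier (bgrp M)"

locale bimodule =
  fixes M :: "('r, 'a) bimod"
  assumes ring_left: "ring (lring M)"
    and ring_right: "ring (rring M)"
    and comm_group: "comm_group (bgrp M)"
    and lact_closed: "\<lbrakk>q \<in> carrier (lring M); a \<in> bcar M\<rbrakk> \<Longrightarrow> lact M q a \<in> bcar M"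
    and ract_closed: "\<lbrakk>a \<in> bcar M; r \<in> carrier (rring M)\<rbrakk> \<Longrightarrow> ract M a r \<in> bcar M"
    and lact_add: "\<lbrakk>q \<in> carrier (lring M); a \<in> bcar M; b \<in> bcar M\<rbrakk>
      \<Longrightarrow> lact M q (a \<otimes>\<^bsub>bgrp M\<^esub> b) = lact M q a \<otimes>\<^bsub>bgrp M\<^esub> lact M q b"
    and add_lact: "\<lbrakk>q \<in> carrier (lring M); q' \<in> carrier (lring M); a \<in> bcar M\<rbrakk>
      \<Longrightarrow> lact M (q \<oplus>\<^bsub>lring M\<^esub> q') a = lact M q a \<otimes>\<^bsub>bgrp M\<^esub> lact M q' a"
    and mult_lact: "\<lbrakk>q \<in> carrier (lring M); q' \<in> carrier (lring M); a \<in> bcar M\<rbrakk>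
      \<Longrightarrow> lact M (q \<otimes>\<^bsub>lring M\<^esub> q') a = lact M q (lact M q' a)"
    and one_lact: "a \<in> bcar M \<Longrightarrow> lact M \<one>\<^bsub>lring M\<^esub> a = a"
    and ract_add: "\<lbrakk>r \<in> carrier (rring M); a \<in> bcar M; b \<in> bcar M\<rbrakk>
      \<Longrightarrow> ract M (a \<otimes>\<^bsub>bgrp M\<^esub> b) r = ract M a r \<otimes>\<^bsub>bgrp M\<^esub> ract M b r"
    and add_ract: "\<lbrakk>r \<in> carrier (rring M); r' \<in> carrier (rring M); a \<in> bcar M\<rbrakk>
      \<Longrightarrow> ract M a (r \<oplus>\<^bsub>rring M\<^esub> r') = ract M a r \<otimes>\<^bsub>bgrp M\<^esub> ract M a r'"
    and mult_ract: "\<lbrakk>r \<in> carrier (rring M); r' \<in> carrier (rring M); a \<in> bcar M\<rbrakk>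
      \<Longrightarrow> ract M a (r \<otimes>\<^bsub>rring M\<^esub> r') = ract M (ract M a r) r'"
    and one_ract: "a \<in> bcar M \<Longrightarrow> ract M a \<one>\<^bsub>rring M\<^esub> = a"
    and lact_ract: "\<lbrakk>q \<in> carrier (lring M); a \<in> bcar M; r \<in> carrier (rring M)\<rbrakk>
      \<Longrightarrow> ract M (lact M q a) r = lact M q (ract M a r)"

text \<open>The unique additive map satisfying \<open>Q\<close> (normalised outside the carrier), and the same for
  biadditive maps.\<close>

definition the_hom :: "'a monoid \<Rightarrow> 'b monoid \<Rightarrow> (('a \<Rightarrow> 'b) \<Rightarrow> bool) \<Rightarrow> 'a \<Rightarrow> 'b" where
  "the_hom G H Q = (THE h. h \<in> hom G H \<and> h \<in> extensional (carrier G) \<and> Q h)"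

definition biadditive :: "'a monoid \<Rightarrow> 'b monoid \<Rightarrow> 'c monoid \<Rightarrow> ('a \<Rightarrow> 'b \<Rightarrow> 'c) \<Rightarrow> bool" where
  "biadditive G H K m \<longleftrightarrow>
    (\<forall>x\<in>carrier G. m x \<in> hom H K) \<and> (\<forall>y\<in>carrier H. (\<lambda>x. m x y) \<in> hom G K)"

definition the_biadditive ::
  "'a monoid \<Rightarrow> 'b monoid \<Rightarrow> 'c monoid \<Rightarrow> (('a \<Rightarrow> 'b \<Rightarrow> 'c) \<Rightarrow> bool) \<Rightarrow> 'a \<Rightarrow> 'b \<Rightarrow> 'c"
where
  "the_biadditive G H K Q =
    (THE m. biadditive G H K m \<and> case_prod m \<in> extensional (carrier G \<times> carrier H) \<and> Q m)"

definition tensor_relations :: "('r, 'a) bimod \<Rightarrow> ('r, 'b) bimod \<Rightarrow> (('a \<times> 'b) \<Rightarrow>\<^sub>0 int) set" where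
  "tensor_relations A B =
    {frag_of (a \<otimes>\<^bsub>bgrp A\<^esub> a', b) - frag_of (a, b) - frag_of (a', b) | a a' b.
       a \<in> bcar A \<and> a' \<in> bcar A \<and> b \<in> bcar B} \<union>
    {frag_of (a, b \<otimes>\<^bsub>bgrp B\<^esub> b') - frag_of (a, b) - frag_of (a, b') | a b b'.
       a \<in> bcar A \<and> b \<in> bcar B \<and> b' \<in> bcar B} \<union>
    {frag_of (ract A a r, b) - frag_of (a, lact B r b) | a r b.
       a \<in> bcar A \<and> r \<in> carrier (rring A) \<and> b \<in> bcar B}"

definition tensor_kernel :: "('r, 'a) bimod \<Rightarrow> ('r, 'b) bimod \<Rightarrow> (('a \<times> 'b) \<Rightarrow>\<^sub>0 int) set" where
  "tensor_kernel A B = generate (free_Abelian_group (bcar A \<times> bcar B)) (tensor_relations A B)"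

definition tensor_group :: "('r, 'a) bimod \<Rightarrow> ('r, 'b) bimod \<Rightarrow> (('a \<times> 'b) \<Rightarrow>\<^sub>0 int) set monoid" where
  "tensor_group A B = free_Abelian_group (bcar A \<times> bcar B) Mod tensor_kernel A B"

definition tensor_elem :: "('r, 'a) bimod \<Rightarrow> ('r, 'b) bimod \<Rightarrow> 'a \<Rightarrow> 'b \<Rightarrow> (('a \<times> 'b) \<Rightarrow>\<^sub>0 int) set" where
  "tensor_elem A B a b = tensor_kernel A B #>\<^bsub>free_Abelian_group (bcar A \<times> bcar B)\<^esub> frag_of (a, b)"

text \<open>For an infinite type \<open>'u\<close> the tensor product of \<open>A\<close> and \<open>B\<close> has at most as many elements as \<open>'u\<close>;
  \<open>tensor_code A B\<close> is an arbitrary injection of it into \<open>'u\<close>, along which all structure is transported.\<close>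

definition tensor_code :: "('u, 'u) bimod \<Rightarrow> ('u, 'u) bimod \<Rightarrow> (('u \<times> 'u) \<Rightarrow>\<^sub>0 int) set \<Rightarrow> 'u" where
  "tensor_code A B = (SOME e. inj_on e (carrier (tensor_group A B)))"

definition utensor_group :: "('u, 'u) bimod \<Rightarrow> ('u, 'u) bimod \<Rightarrow> 'u monoid" where
  "utensor_group A B = image_group (tensor_code A B) (tensor_group A B)"

definition tens :: "('u, 'u) bimod \<Rightarrow> ('u, 'u) bimod \<Rightarrow> 'u \<Rightarrow> 'u \<Rightarrow> 'u" where
  "tens A B a b = tensor_code A B (tensor_elem A B a b)"

definition bimod_tensor :: "('u, 'u) bimod \<Rightarrow> ('u, 'u) bimod \<Rightarrow> ('u, 'u) bimod" where
  "bimod_tensor A B =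
    \<lparr>lring = lring A,
     rring = rring B,
     bgrp = utensor_group A B,
     lact = (\<lambda>q. the_hom (utensor_group A B) (utensor_group A B)
       (\<lambda>h. \<forall>a\<in>bcar A. \<forall>b\<in>bcar B. h (tens A B a b) = tens A B (lact A q a) b)),
     ract = (\<lambda>x r. the_hom (utensor_group A B) (utensor_group A B)
       (\<lambda>h. \<forall>a\<in>bcar A. \<forall>b\<in>bcar B. h (tens A B a b) = tens A B a (ract B b r)) x)\<rparr>"

definition tensor_fun :: "('u, 'u) bimod \<Rightarrow> ('u, 'u) bimod \<Rightarrow> ('u, 'u) bimod \<Rightarrow> ('u, 'u) bimod \<Rightarrow>
    ('u \<Rightarrow> 'u) \<Rightarrow> ('u \<Rightarrow> 'u) \<Rightarrow> 'u \<Rightarrow> 'u" where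
  "tensor_fun A B A' B' \<Gamma> \<Lambda> = the_hom (utensor_group A B) (utensor_group A' B')
     (\<lambda>h. \<forall>a\<in>bcar A. \<forall>b\<in>bcar B. h (tens A B a b) = tens A' B' (\<Gamma> a) (\<Lambda> b))"

definition assoc_fun :: "('u, 'u) bimod \<Rightarrow> ('u, 'u) bimod \<Rightarrow> ('u, 'u) bimod \<Rightarrow> 'u \<Rightarrow> 'u" where
  "assoc_fun A B C =
    the_hom (utensor_group (bimod_tensor A B) C) (utensor_group A (bimod_tensor B C))
     (\<lambda>h. \<forall>a\<in>bcar A. \<forall>b\<in>bcar B. \<forall>c\<in>bcar C.
        h (tens (bimod_tensor A B) C (tens A B a b) c) = tens A (bimod_tensor B C) a (tens B C b c))"

definition regular_bimod :: "'u ring \<Rightarrow> ('u, 'u) bimod" where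
  "regular_bimod R =
    \<lparr>lring = R, rring = R, bgrp = add_monoid R, lact = mult R, ract = mult R\<rparr>"

definition lunit_fun :: "('u, 'u) bimod \<Rightarrow> 'u \<Rightarrow> 'u" where
  "lunit_fun A = the_hom (utensor_group (regular_bimod (lring A)) A) (bgrp A)
     (\<lambda>h. \<forall>q\<in>carrier (lring A). \<forall>a\<in>bcar A. h (tens (regular_bimod (lring A)) A q a) = lact A q a)"

definition runit_fun :: "('u, 'u) bimod \<Rightarrow> 'u \<Rightarrow> 'u" where
  "runit_fun A = the_hom (utensor_group A (regular_bimod (rring A))) (bgrp A)
     (\<lambda>h. \<forall>a\<in>bcar A. \<forall>r\<in>carrier (rring A). h (tens A (regular_bimod (rring A)) a r) = ract A a r)"

section \<open>The double category of bimodules\<close>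

text \<open>A square is a triple \<open>(lmor, fn, rmor)\<close> together with its source and target bimodules.\<close>

record 'u square = "(('u, 'u) bimod, 'u \<Rightarrow> 'u) arrow" +
  lmor :: "'u ring_map"
  rmor :: "'u ring_map"

definition squares :: "'u square set" where
  "squares = {s. bimodule (src s) \<and> bimodule (tgt s) \<and>
     lmor s \<in> ring_maps \<and> src (lmor s) = lring (src s) \<and> tgt (lmor s) = lring (tgt s) \<and>
     rmor s \<in> ring_maps \<and> src (rmor s) = rring (src s) \<and> tgt (rmor s) = rring (tgt s) \<and>
     fn s \<in> hom (bgrp (src s)) (bgrp (tgt s)) \<and> fn s \<in> extensional (bcar (src s)) \<and>
     (\<forall>q\<in>carrier (lring (src s)). \<forall>a\<in>bcar (src s). \<forall>r\<in>carrier (rring (src s)).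
        fn s (ract (src s) (lact (src s) q a) r)
          = ract (tgt s) (lact (tgt s) (fn (lmor s) q) (fn s a)) (fn (rmor s) r))}"

definition BIMOD :: "('u::infinite ring, 'u ring_map, ('u, 'u) bimod, 'u square) double_cat" where
  "BIMOD =
    \<lparr>Vert = \<lparr>Obj = {R. ring R}, Arr = ring_maps, Dom = src, Cod = tgt,
       Ident = ring_map_id, Comp = ring_map_comp\<rparr>,
     Horz = \<lparr>Obj = {M. bimodule M}, Arr = squares, Dom = src, Cod = tgt,
       Ident = (\<lambda>M. \<lparr>src = M, fn = (\<lambda>a\<in>bcar M. a), tgt = M,
         lmor = ring_map_id (lring M), rmor = ring_map_id (rring M)\<rparr>),
       Comp = (\<lambda>t s. \<lparr>src = src s, fn = compose (bcar (src s)) (fn t) (fn s), tgt = tgt t,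
         lmor = ring_map_comp (lmor t) (lmor s), rmor = ring_map_comp (rmor t) (rmor s)\<rparr>)\<rparr>,
     Delta = \<lparr>OMap = regular_bimod,
       AMap = (\<lambda>\<theta>. \<lparr>src = regular_bimod (src \<theta>), fn = fn \<theta>, tgt = regular_bimod (tgt \<theta>),
         lmor = \<theta>, rmor = \<theta>\<rparr>)\<rparr>,
     Lft = \<lparr>OMap = lring, AMap = lmor\<rparr>,
     Rgt = \<lparr>OMap = rring, AMap = rmor\<rparr>,
     HComp = \<lparr>OMap = (\<lambda>(A, B). bimod_tensor A B),
       AMap = (\<lambda>(s, t). \<lparr>src = bimod_tensor (src s) (src t),
         fn = tensor_fun (src s) (src t) (tgt s) (tgt t) (fn s) (fn t),
         tgt = bimod_tensor (tgt s) (tgt t), lmor = lmor s, rmor = rmor t\<rparr>)\<rparr>,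
     Assoc = (\<lambda>A B C. \<lparr>src = bimod_tensor (bimod_tensor A B) C, fn = assoc_fun A B C,
       tgt = bimod_tensor A (bimod_tensor B C),
       lmor = ring_map_id (lring A), rmor = ring_map_id (rring C)\<rparr>),
     LUnit = (\<lambda>A. \<lparr>src = bimod_tensor (regular_bimod (lring A)) A, fn = lunit_fun A, tgt = A,
       lmor = ring_map_id (lring A), rmor = ring_map_id (rring A)\<rparr>),
     RUnit = (\<lambda>A. \<lparr>src = bimod_tensor A (regular_bimod (rring A)), fn = runit_fun A, tgt = A,
       lmor = ring_map_id (lring A), rmor = ring_map_id (rring A)\<rparr>)\<rparr>"

definition restriction_bimod :: "'u ring_map \<Rightarrow> ('u, 'u) bimod" where
  "restriction_bimod \<sigma> =
    \<lparr>lring = tgt \<sigma>, rring = src \<sigma>, bgrp = add_monoid (tgt \<sigma>),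
     lact = mult (tgt \<sigma>), ract = (\<lambda>s r. s \<otimes>\<^bsub>tgt \<sigma>\<^esub> fn \<sigma> r)\<rparr>"

section \<open>The double category of central maps\<close>

definition centre :: "'u ring \<Rightarrow> 'u set" where
  "centre R = {z \<in> carrier R. \<forall>x\<in>carrier R. z \<otimes>\<^bsub>R\<^esub> x = x \<otimes>\<^bsub>R\<^esub> z}"

definition centre_ring :: "'u ring \<Rightarrow> 'u ring" where
  "centre_ring R = R\<lparr>carrier := centre R\<rparr>"

definition centralizer_ring :: "'u ring_map \<Rightarrow> 'u ring" where
  "centralizer_ring \<sigma> = (tgt \<sigma>)\<lparr>carrier :=
     {s \<in> carrier (tgt \<sigma>). \<forall>r\<in>carrier (src \<sigma>). s \<otimes>\<^bsub>tgt \<sigma>\<^esub> fn \<sigma> r = fn \<sigma> r \<otimes>\<^bsub>tgt \<sigma>\<^esub> s}\<rparr>"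

record 'u central =
  lbase :: "'u ring"
  lmap :: "'u \<Rightarrow> 'u"
  midring :: "'u ring"
  rmap :: "'u \<Rightarrow> 'u"
  rbase :: "'u ring"

definition centrals :: "'u central set" where
  "centrals = {X. cring (lbase X) \<and> cring (rbase X) \<and> ring (midring X) \<and>
     lmap X \<in> ring_hom (lbase X) (midring X) \<and> lmap X \<in> extensional (carrier (lbase X)) \<and>
     rmap X \<in> ring_hom (rbase X) (midring X) \<and> rmap X \<in> extensional (carrier (rbase X)) \<and>
     lmap X ` carrier (lbase X) \<subseteq> centre (midring X) \<and>
     rmap X ` carrier (rbase X) \<subseteq> centre (midring X)}"

definition central_bimod :: "'u central \<Rightarrow> ('u, 'u) bimod" where
  "central_bimod X =
    \<lparr>lring = lbase X, rring = rbase X, bgrp = add_monoid (midring X),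
     lact = (\<lambda>a e. lmap X a \<otimes>\<^bsub>midring X\<^esub> e), ract = (\<lambda>e b. e \<otimes>\<^bsub>midring X\<^esub> rmap X b)\<rparr>"

type_synonym 'u central_square = "('u central, 'u \<Rightarrow> 'u) arrow"

definition central_squares :: "'u central_square set" where
  "central_squares = {s. src s \<in> centrals \<and> tgt s \<in> centrals \<and>
     lbase (src s) = lbase (tgt s) \<and> rbase (src s) = rbase (tgt s) \<and>
     fn s \<in> ring_hom (midring (src s)) (midring (tgt s)) \<and>
     fn s \<in> extensional (carrier (midring (src s))) \<and>
     (\<forall>a\<in>carrier (lbase (src s)). lmap (tgt s) a = fn s (lmap (src s) a)) \<and>
     (\<forall>b\<in>carrier (rbase (src s)). rmap (tgt s) b = fn s (rmap (src s) b))}"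

definition central_unit :: "'u ring \<Rightarrow> 'u central" where
  "central_unit A =
    \<lparr>lbase = A, lmap = (\<lambda>a\<in>carrier A. a), midring = A, rmap = (\<lambda>a\<in>carrier A. a), rbase = A\<rparr>"

definition central_tensor_ring :: "'u central \<Rightarrow> 'u central \<Rightarrow> 'u ring" where
  "central_tensor_ring X Y =
    (let t = tens (central_bimod X) (central_bimod Y);
         T = utensor_group (central_bimod X) (central_bimod Y);
         E = midring X;
         F = midring Y
     in \<lparr>carrier = carrier T,
         monoid.mult = the_biadditive T T T (\<lambda>m.
           \<forall>e\<in>carrier E. \<forall>f\<in>carrier F. \<forall>e'\<in>carrier E. \<forall>f'\<in>carrier F.
             m (t e f) (t e' f') = t (e \<otimes>\<^bsub>E\<^esub> e') (f \<otimes>\<^bsub>F\<^esub> f')),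
         one = t \<one>\<^bsub>E\<^esub> \<one>\<^bsub>F\<^esub>,
         zero = \<one>\<^bsub>T\<^esub>,
         add = mult T\<rparr>)"

definition central_comp :: "'u central \<Rightarrow> 'u central \<Rightarrow> 'u central" where
  "central_comp X Y =
    \<lparr>lbase = lbase X,
     lmap = (\<lambda>a\<in>carrier (lbase X). tens (central_bimod X) (central_bimod Y) (lmap X a) \<one>\<^bsub>midring Y\<^esub>),
     midring = central_tensor_ring X Y,
     rmap = (\<lambda>c\<in>carrier (rbase Y). tens (central_bimod X) (central_bimod Y) \<one>\<^bsub>midring X\<^esub> (rmap Y c)),
     rbase = rbase Y\<rparr>"

definition central_square_id :: "'u central \<Rightarrow> 'u central_square" where
  "central_square_id X = \<lparr>src = X, fn = (\<lambda>e\<in>carrier (midring X). e), tgt = X\<rparr>"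

text \<open>The associativity and unit squares are given by the same functions as in \<open>BIMOD\<close>; note that
  \<open>central_bimod (central_comp X Y)\<close> and \<open>bimod_tensor (central_bimod X) (central_bimod Y)\<close> may differ
  as records (outside the carriers), hence \<open>central_assoc\<close> is spelled out.\<close>

definition central_assoc :: "'u central \<Rightarrow> 'u central \<Rightarrow> 'u central \<Rightarrow> 'u \<Rightarrow> 'u" where
  "central_assoc X Y Z =
    (let t = (\<lambda>X Y. tens (central_bimod X) (central_bimod Y));
         T = (\<lambda>X Y. utensor_group (central_bimod X) (central_bimod Y))
     in the_hom (T (central_comp X Y) Z) (T X (central_comp Y Z))
       (\<lambda>h. \<forall>e\<in>carrier (midring X). \<forall>f\<in>carrier (midring Y). \<forall>g\<in>carrier (midring Z).
          h (t (central_comp X Y) Z (t X Y e f) g) = t X (central_comp Y Z) e (t Y Z f g)))"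

definition central_lunit :: "'u central \<Rightarrow> 'u \<Rightarrow> 'u" where
  "central_lunit X =
    the_hom (utensor_group (central_bimod (central_unit (lbase X))) (central_bimod X)) (add_monoid (midring X))
     (\<lambda>h. \<forall>a\<in>carrier (lbase X). \<forall>e\<in>carrier (midring X).
        h (tens (central_bimod (central_unit (lbase X))) (central_bimod X) a e) = lmap X a \<otimes>\<^bsub>midring X\<^esub> e)"

definition central_runit :: "'u central \<Rightarrow> 'u \<Rightarrow> 'u" where
  "central_runit X =
    the_hom (utensor_group (central_bimod X) (central_bimod (central_unit (rbase X)))) (add_monoid (midring X))
     (\<lambda>h. \<forall>e\<in>carrier (midring X). \<forall>b\<in>carrier (rbase X).
        h (tens (central_bimod X) (central_bimod (central_unit (rbase X))) e b) = e \<otimes>\<^bsub>midring X\<^esub> rmap X b)"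

definition CENTRAL :: "('u::infinite ring, 'u ring, 'u central, 'u central_square) double_cat" where
  "CENTRAL =
    \<lparr>Vert = discrete_cat {A. cring A},
     Horz = \<lparr>Obj = centrals, Arr = central_squares, Dom = src, Cod = tgt,
       Ident = central_square_id,
       Comp = (\<lambda>t s. \<lparr>src = src s,
         fn = compose (carrier (midring (src s))) (fn t) (fn s), tgt = tgt t\<rparr>)\<rparr>,
     Delta = \<lparr>OMap = central_unit, AMap = (\<lambda>A. central_square_id (central_unit A))\<rparr>,
     Lft = \<lparr>OMap = lbase, AMap = (\<lambda>s. lbase (src s))\<rparr>,
     Rgt = \<lparr>OMap = rbase, AMap = (\<lambda>s. rbase (src s))\<rparr>,
     HComp = \<lparr>OMap = (\<lambda>(X, Y). central_comp X Y),
       AMap = (\<lambda>(s, t). \<lparr>src = central_comp (src s) (src t),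
         fn = tensor_fun (central_bimod (src s)) (central_bimod (src t))
                (central_bimod (tgt s)) (central_bimod (tgt t)) (fn s) (fn t),
         tgt = central_comp (tgt s) (tgt t)\<rparr>)\<rparr>,
     Assoc = (\<lambda>X Y Z. \<lparr>src = central_comp (central_comp X Y) Z, fn = central_assoc X Y Z,
       tgt = central_comp X (central_comp Y Z)\<rparr>),
     LUnit = (\<lambda>X. \<lparr>src = central_comp (central_unit (lbase X)) X, fn = central_lunit X, tgt = X\<rparr>),
     RUnit = (\<lambda>X. \<lparr>src = central_comp X (central_unit (rbase X)), fn = central_runit X, tgt = X\<rparr>)\<rparr>"

definition centralizer_central :: "'u ring_map \<Rightarrow> 'u central" where
  "centralizer_central \<sigma> =
    \<lparr>lbase = centre_ring (tgt \<sigma>), lmap = (\<lambda>s\<in>centre (tgt \<sigma>). s),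
     midring = centralizer_ring \<sigma>,
     rmap = (\<lambda>r\<in>centre (src \<sigma>). fn \<sigma> r), rbase = centre_ring (src \<sigma>)\<rparr>"

section \<open>Preadditive categories\<close>

text \<open>\<open>PHom C t h\<close> is the group of morphisms from \<open>t\<close> to \<open>h\<close>; \<open>PComp C t u h g f\<close> is the composite of
  \<open>g\<close> from \<open>u\<close> to \<open>h\<close> with \<open>f\<close> from \<open>t\<close> to \<open>u\<close>.\<close>

record ('o, 'm) preadd =
  PObj :: "'o set"
  PHom :: "'o \<Rightarrow> 'o \<Rightarrow> 'm monoid"
  PComp :: "'o \<Rightarrow> 'o \<Rightarrow> 'o \<Rightarrow> 'm \<Rightarrow> 'm \<Rightarrow> 'm"
  PIdent :: "'o \<Rightarrow> 'm"

locale preadditive_category =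
  fixes C :: "('o, 'm) preadd"
  assumes comm_group: "\<lbrakk>t \<in> PObj C; h \<in> PObj C\<rbrakk> \<Longrightarrow> comm_group (PHom C t h)"
    and biadditive: "\<lbrakk>t \<in> PObj C; u \<in> PObj C; h \<in> PObj C\<rbrakk>
      \<Longrightarrow> biadditive (PHom C u h) (PHom C t u) (PHom C t h) (PComp C t u h)"
    and PComp_assoc: "\<lbrakk>t \<in> PObj C; u \<in> PObj C; v \<in> PObj C; h \<in> PObj C;
        c \<in> carrier (PHom C v h); b \<in> carrier (PHom C u v); a \<in> carrier (PHom C t u)\<rbrakk>
      \<Longrightarrow> PComp C t u h (PComp C u v h c b) a = PComp C t v h c (PComp C t u v b a)"
    and PIdent_closed: "x \<in> PObj C \<Longrightarrow> PIdent C x \<in> carrier (PHom C x x)"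
    and PComp_PIdent_left: "\<lbrakk>t \<in> PObj C; h \<in> PObj C; a \<in> carrier (PHom C t h)\<rbrakk>
      \<Longrightarrow> PComp C t h h (PIdent C h) a = a"
    and PComp_PIdent_right: "\<lbrakk>t \<in> PObj C; h \<in> PObj C; a \<in> carrier (PHom C t h)\<rbrakk>
      \<Longrightarrow> PComp C t t h a (PIdent C t) = a"

text \<open>Here \<open>fm t h\<close> is the action on morphisms from \<open>t\<close> to \<open>h\<close>.\<close>

locale additive_functor =
  C: preadditive_category C + C': preadditive_category C'
  for C :: "('o, 'm) preadd" and C' :: "('p, 'n) preadd" +
  fixes fo :: "'o \<Rightarrow> 'p" and fm :: "'o \<Rightarrow> 'o \<Rightarrow> 'm \<Rightarrow> 'n"
  assumes extensional: "fo \<in> extensional (PObj C)" "case_prod fm \<in> extensional (PObj C \<times> PObj C)"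
      "\<lbrakk>t \<in> PObj C; h \<in> PObj C\<rbrakk> \<Longrightarrow> fm t h \<in> extensional (carrier (PHom C t h))"
    and fo_PObj: "x \<in> PObj C \<Longrightarrow> fo x \<in> PObj C'"
    and fm_hom: "\<lbrakk>t \<in> PObj C; h \<in> PObj C\<rbrakk> \<Longrightarrow> fm t h \<in> hom (PHom C t h) (PHom C' (fo t) (fo h))"
    and fm_PIdent: "x \<in> PObj C \<Longrightarrow> fm x x (PIdent C x) = PIdent C' (fo x)"
    and fm_PComp: "\<lbrakk>t \<in> PObj C; u \<in> PObj C; h \<in> PObj C;
        b \<in> carrier (PHom C u h); a \<in> carrier (PHom C t u)\<rbrakk>
      \<Longrightarrow> fm t h (PComp C t u h b a) = PComp C' (fo t) (fo u) (fo h) (fm u h b) (fm t u a)"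

type_synonym ('o, 'm) preadd_functor =
  "(('o, 'm) preadd, ('o \<Rightarrow> 'o) \<times> ('o \<Rightarrow> 'o \<Rightarrow> 'm \<Rightarrow> 'm)) arrow"

text \<open>The category of preadditive categories with objects in \<open>'o\<close> and morphisms in \<open>'m\<close>.\<close>

definition preadd_cat :: "(('o, 'm) preadd, ('o, 'm) preadd_functor) category" where
  "preadd_cat =
    \<lparr>Obj = {C. preadditive_category C},
     Arr = {k. additive_functor (src k) (tgt k) (fst (fn k)) (snd (fn k))},
     Dom = src,
     Cod = tgt,
     Ident = (\<lambda>C. \<lparr>src = C,
       fn = (\<lambda>x\<in>PObj C. x,
         curry (\<lambda>(t, h)\<in>PObj C \<times> PObj C. \<lambda>a\<in>carrier (PHom C t h). a)),
       tgt = C\<rparr>),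
     Comp = (\<lambda>k' k. \<lparr>src = src k,
       fn = (compose (PObj (src k)) (fst (fn k')) (fst (fn k)),
         curry (\<lambda>(t, h)\<in>PObj (src k) \<times> PObj (src k).
           compose (carrier (PHom (src k) t h))
             (snd (fn k') (fst (fn k) t) (fst (fn k) h)) (snd (fn k) t h))),
       tgt = tgt k'\<rparr>)\<rparr>"

definition quotient_preadd :: "('o, 'm) preadd \<Rightarrow> ('o \<Rightarrow> 'o \<Rightarrow> 'm set) \<Rightarrow> ('o, 'm set) preadd" where
  "quotient_preadd C I =
    \<lparr>PObj = PObj C,
     PHom = (\<lambda>t h. PHom C t h Mod I t h),
     PComp = (\<lambda>t u h B A. \<Union>b\<in>B. \<Union>a\<in>A. I t h #>\<^bsub>PHom C t h\<^esub> PComp C t u h b a),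
     PIdent = (\<lambda>x. I x x #>\<^bsub>PHom C x x\<^esub> PIdent C x)\<rparr>"

section \<open>Species and their tensor categories\<close>

record ('o, 'r, 'a) species =
  sp_obj :: "'o set"
  sp_ring :: "'o \<Rightarrow> 'r ring"
  sp_mod :: "'o \<Rightarrow> 'o \<Rightarrow> ('r, 'a) bimod"

text \<open>A path \<open>(x\<^sub>n, \<dots>, x\<^sub>0)\<close> is the list \<open>[x\<^sub>n, \<dots>, x\<^sub>0]\<close>, of length \<open>n + 1\<close>.\<close>

definition paths :: "'o set \<Rightarrow> 'o \<Rightarrow> 'o \<Rightarrow> 'o list set" where
  "paths X t h = {xs. xs \<noteq> [] \<and> set xs \<subseteq> X \<and> hd xs = h \<and> last xs = t}"

definition path_words :: "('o, 'r, 'a) species \<Rightarrow> 'o list \<Rightarrow> 'a list set" where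
  "path_words Sp xs = {as. Suc (length as) = length xs \<and>
     (\<forall>i<length as. as ! i \<in> bcar (sp_mod Sp (xs ! i) (xs ! Suc i)))}"

definition path_relations :: "('o, 'r, 'a) species \<Rightarrow> 'o list \<Rightarrow> ('a list \<Rightarrow>\<^sub>0 int) set" where
  "path_relations Sp xs =
    {frag_of (as[i := a \<otimes>\<^bsub>bgrp (sp_mod Sp (xs ! i) (xs ! Suc i))\<^esub> b])
       - frag_of (as[i := a]) - frag_of (as[i := b]) | as i a b.
       as \<in> path_words Sp xs \<and> i < length as \<and>
       a \<in> bcar (sp_mod Sp (xs ! i) (xs ! Suc i)) \<and> b \<in> bcar (sp_mod Sp (xs ! i) (xs ! Suc i))} \<union>
    {frag_of (as[i := ract (sp_mod Sp (xs ! i) (xs ! Suc i)) (as ! i) r])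
       - frag_of (as[Suc i := lact (sp_mod Sp (xs ! Suc i) (xs ! Suc (Suc i))) r (as ! Suc i)]) | as i r.
       as \<in> path_words Sp xs \<and> Suc i < length as \<and> r \<in> carrier (sp_ring Sp (xs ! Suc i))}"

definition path_kernel :: "('o, 'r, 'a) species \<Rightarrow> 'o list \<Rightarrow> ('a list \<Rightarrow>\<^sub>0 int) set" where
  "path_kernel Sp xs = generate (free_Abelian_group (path_words Sp xs)) (path_relations Sp xs)"

text \<open>The group attached to a path: the ring itself for a path of length \<open>0\<close>, and the multiple tensor
  product of the bimodules along the path otherwise. \<open>Scalar\<close> and \<open>Word\<close> are the generators
  (scalars and pure tensors).\<close>

type_synonym ('r, 'a) path_elem = "'r + ('a list \<Rightarrow>\<^sub>0 int) set"

definition path_group :: "('o, 'r, 'a) species \<Rightarrow> 'o list \<Rightarrow> ('r, 'a) path_elem monoid" where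
  "path_group Sp xs =
    (if length xs = 1 then image_group Inl (add_monoid (sp_ring Sp (hd xs)))
     else image_group Inr (free_Abelian_group (path_words Sp xs) Mod path_kernel Sp xs))"

datatype ('r, 'a) generator = Scalar 'r | Word "'a list"

definition generators :: "('o, 'r, 'a) species \<Rightarrow> 'o list \<Rightarrow> ('r, 'a) generator set" where
  "generators Sp xs =
    (if length xs = 1 then Scalar ` carrier (sp_ring Sp (hd xs)) else Word ` path_words Sp xs)"

fun pure :: "('o, 'r, 'a) species \<Rightarrow> 'o list \<Rightarrow> ('r, 'a) generator \<Rightarrow> ('r, 'a) path_elem" where
  "pure Sp xs (Scalar r) = Inl r"
| "pure Sp xs (Word as) = Inr (path_kernel Sp xs #>\<^bsub>free_Abelian_group (path_words Sp xs)\<^esub> frag_of as)"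

definition summand :: "'i set \<Rightarrow> ('i \<Rightarrow> 'a monoid) \<Rightarrow> 'i \<Rightarrow> 'a \<Rightarrow> 'i \<Rightarrow> 'a" where
  "summand I G i x = (\<lambda>j\<in>I. if j = i then x else \<one>\<^bsub>G j\<^esub>)"

definition tensor_hom :: "('o, 'r, 'a) species \<Rightarrow> 'o \<Rightarrow> 'o \<Rightarrow> ('o list \<Rightarrow> ('r, 'a) path_elem) monoid" where
  "tensor_hom Sp t h = sum_group (paths (sp_obj Sp) t h) (path_group Sp)"

definition in_path :: "('o, 'r, 'a) species \<Rightarrow> 'o list \<Rightarrow> ('r, 'a) path_elem \<Rightarrow>
    'o list \<Rightarrow> ('r, 'a) path_elem" where
  "in_path Sp xs = summand (paths (sp_obj Sp) (last xs) (hd xs)) (path_group Sp) xs"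

text \<open>Concatenation of a generator along \<open>ys\<close> with a generator along \<open>xs\<close>, where \<open>last ys = hd xs\<close>;
  scalars act through the bimodule structure of the adjacent factor.\<close>

fun conc :: "('o, 'r, 'a) species \<Rightarrow> 'o list \<Rightarrow> 'o list \<Rightarrow>
    ('r, 'a) generator \<Rightarrow> ('r, 'a) generator \<Rightarrow> ('r, 'a) generator" where
  "conc Sp ys xs (Scalar r) (Scalar s) = Scalar (r \<otimes>\<^bsub>sp_ring Sp (hd xs)\<^esub> s)"
| "conc Sp ys xs (Scalar r) (Word as) = Word (lact (sp_mod Sp (xs ! 0) (xs ! 1)) r (hd as) # tl as)"
| "conc Sp ys xs (Word bs) (Scalar s) =
     Word (butlast bs @ [ract (sp_mod Sp (ys ! (length ys - 2)) (ys ! (length ys - 1))) (last bs) s])"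
| "conc Sp ys xs (Word bs) (Word as) = Word (bs @ as)"

definition tensor_category ::
  "('o, 'r, 'a) species \<Rightarrow> ('o, 'o list \<Rightarrow> ('r, 'a) path_elem) preadd"
where
  "tensor_category Sp =
    \<lparr>PObj = sp_obj Sp,
     PHom = tensor_hom Sp,
     PComp = (\<lambda>t u h. the_biadditive (tensor_hom Sp u h) (tensor_hom Sp t u) (tensor_hom Sp t h)
       (\<lambda>m. \<forall>ys\<in>paths (sp_obj Sp) u h. \<forall>xs\<in>paths (sp_obj Sp) t u.
            \<forall>v\<in>generators Sp ys. \<forall>w\<in>generators Sp xs.
          m (in_path Sp ys (pure Sp ys v)) (in_path Sp xs (pure Sp xs w))
            = in_path Sp (ys @ tl xs) (pure Sp (ys @ tl xs) (conc Sp ys xs v w)))),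
     PIdent = (\<lambda>x. in_path Sp [x] (Inl \<one>\<^bsub>sp_ring Sp x\<^esub>))\<rparr>"

text \<open>For \<open>xs = [x\<^sub>n, \<dots>, x\<^sub>0]\<close> the vertex removed by \<open>contract_path j\<close> is \<open>xs ! Suc j\<close>, that is
  \<open>x\<^sub>m\<close> with \<open>m = n - 1 - j\<close>; accordingly \<open>contraction\<close> is \<open>1 \<otimes> \<dots> \<otimes> c \<otimes> \<dots> \<otimes> 1\<close> with \<open>c\<close> applied to
  the tensor factors with list indices \<open>j\<close> and \<open>Suc j\<close>.\<close>

definition contract_path :: "nat \<Rightarrow> 'o list \<Rightarrow> 'o list" where
  "contract_path j xs = take (Suc j) xs @ drop (j + 2) xs"

type_synonym ('o, 'a) composition_family =
  "'o \<Rightarrow> 'o \<Rightarrow> 'o \<Rightarrow> (('a \<times> 'a) \<Rightarrow>\<^sub>0 int) set \<Rightarrow> 'a"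

definition contraction :: "('o, 'r, 'a) species \<Rightarrow> ('o, 'a) composition_family \<Rightarrow> 'o list \<Rightarrow> nat \<Rightarrow>
    ('r, 'a) path_elem \<Rightarrow> ('r, 'a) path_elem" where
  "contraction Sp c xs j =
    the_hom (path_group Sp xs) (path_group Sp (contract_path j xs))
     (\<lambda>h. \<forall>as\<in>path_words Sp xs.
        h (pure Sp xs (Word as)) = pure Sp (contract_path j xs) (Word
          (take j as @
           [c (xs ! j) (xs ! Suc j) (xs ! Suc (Suc j))
              (tensor_elem (sp_mod Sp (xs ! j) (xs ! Suc j)) (sp_mod Sp (xs ! Suc j) (xs ! Suc (Suc j)))
                 (as ! j) (as ! Suc j))] @
           drop (j + 2) as)))"

definition composition_ideal :: "('o, 'r, 'a) species \<Rightarrow> ('o, 'a) composition_family \<Rightarrow>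
    ('o \<times> 'o \<times> 'o) set \<Rightarrow> 'o \<Rightarrow> 'o \<Rightarrow> ('o list \<Rightarrow> ('r, 'a) path_elem) set" where
  "composition_ideal Sp c S t h =
    generate (tensor_hom Sp t h)
     {in_path Sp xs a \<otimes>\<^bsub>tensor_hom Sp t h\<^esub>
        inv\<^bsub>tensor_hom Sp t h\<^esub> in_path Sp (contract_path j xs) (contraction Sp c xs j a) | xs j a.
      xs \<in> paths (sp_obj Sp) t h \<and> j + 2 < length xs \<and>
      (xs ! j, xs ! Suc j, xs ! Suc (Suc j)) \<in> S \<and> a \<in> carrier (path_group Sp xs)}"

text \<open>The maps of tensor categories induced, tensor factor by tensor factor, by \<open>f0\<close> on the rings and
  \<open>f1\<close> on the bimodules.\<close>

fun map_generator :: "('o \<Rightarrow> 'r \<Rightarrow> 'r) \<Rightarrow> ('o \<Rightarrow> 'o \<Rightarrow> 'a \<Rightarrow> 'a) \<Rightarrow> 'o list \<Rightarrow>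
    ('r, 'a) generator \<Rightarrow> ('r, 'a) generator" where
  "map_generator f0 f1 xs (Scalar r) = Scalar (f0 (hd xs) r)"
| "map_generator f0 f1 xs (Word as) = Word (map (\<lambda>i. f1 (xs ! i) (xs ! Suc i) (as ! i)) [0..<length as])"

definition tensor_hom_map :: "('o, 'r, 'a) species \<Rightarrow> ('o, 'r, 'a) species \<Rightarrow>
    ('o \<Rightarrow> 'r \<Rightarrow> 'r) \<Rightarrow> ('o \<Rightarrow> 'o \<Rightarrow> 'a \<Rightarrow> 'a) \<Rightarrow> 'o \<Rightarrow> 'o \<Rightarrow>
    ('o list \<Rightarrow> ('r, 'a) path_elem) \<Rightarrow> 'o list \<Rightarrow> ('r, 'a) path_elem" where
  "tensor_hom_map Sp Sp' f0 f1 t h =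
    the_hom (tensor_hom Sp t h) (tensor_hom Sp' t h)
     (\<lambda>k. \<forall>xs\<in>paths (sp_obj Sp) t h. \<forall>v\<in>generators Sp xs.
        k (in_path Sp xs (pure Sp xs v)) = in_path Sp' xs (pure Sp' xs (map_generator f0 f1 xs v)))"

section \<open>The preadditive category of a double functor into the bimodules\<close>

type_synonym ('o, 'v, 'h, 's, 'u) bimod_fctr =
  "('o, 'v, 'h, 's, 'u ring, 'u ring_map, ('u, 'u) bimod, 'u square) double_fctr"

definition horizontals :: "('o, 'v, 'h, 's) double_cat \<Rightarrow> 'o \<Rightarrow> 'o \<Rightarrow> 'h set" where
  "horizontals D y x = {f \<in> Obj (Horz D). OMap (Lft D) f = y \<and> OMap (Rgt D) f = x}"

definition species_of :: "('o, 'v, 'h, 's) double_cat \<Rightarrow> ('o, 'v, 'h, 's, 'u::infinite) bimod_fctr \<Rightarrow>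
    ('o, 'u, 'h \<Rightarrow> 'u) species" where
  "species_of D F =
    \<lparr>sp_obj = Obj (Vert D),
     sp_ring = OMap (Fun0 F),
     sp_mod = (\<lambda>y x.
       \<lparr>lring = OMap (Fun0 F) y,
        rring = OMap (Fun0 F) x,
        bgrp = sum_group (horizontals D y x) (\<lambda>f. bgrp (OMap (Fun1 F) f)),
        lact = (\<lambda>q a. \<lambda>f\<in>horizontals D y x. lact (OMap (Fun1 F) f) q (a f)),
        ract = (\<lambda>a r. \<lambda>f\<in>horizontals D y x. ract (OMap (Fun1 F) f) (a f) r)\<rparr>)\<rparr>"

definition compositions_of :: "('o, 'v, 'h, 's) double_cat \<Rightarrow> ('o, 'v, 'h, 's, 'u::infinite) bimod_fctr \<Rightarrow>
    ('o, 'h \<Rightarrow> 'u) composition_family" where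
  "compositions_of D F z y x =
    (let M = sp_mod (species_of D F);
         \<iota> = (\<lambda>y x. summand (horizontals D y x) (\<lambda>f. bgrp (OMap (Fun1 F) f)))
     in the_hom (tensor_group (M z y) (M y x)) (bgrp (M z x))
       (\<lambda>c. \<forall>g\<in>horizontals D z y. \<forall>f\<in>horizontals D y x.
            \<forall>b\<in>bcar (OMap (Fun1 F) g). \<forall>a\<in>bcar (OMap (Fun1 F) f).
          c (tensor_elem (M z y) (M y x) (\<iota> z y g b) (\<iota> y x f a))
            = \<iota> z x (g \<star>\<^bsub>D\<^esub> f) (fn (FComp F (g, f)) (tens (OMap (Fun1 F) g) (OMap (Fun1 F) f) b a))))"

definition ideal_of :: "('o, 'v, 'h, 's) double_cat \<Rightarrow> ('o \<times> 'o \<times> 'o) set \<Rightarrow>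
    ('o, 'v, 'h, 's, 'u::infinite) bimod_fctr \<Rightarrow> 'o \<Rightarrow> 'o \<Rightarrow>
    ('o list \<Rightarrow> ('u, 'h \<Rightarrow> 'u) path_elem) set" where
  "ideal_of D S F = composition_ideal (species_of D F) (compositions_of D F) S"

definition quotient_cat_of :: "('o, 'v, 'h, 's) double_cat \<Rightarrow> ('o \<times> 'o \<times> 'o) set \<Rightarrow>
    ('o, 'v, 'h, 's, 'u::infinite) bimod_fctr \<Rightarrow>
    ('o, ('o list \<Rightarrow> ('u, 'h \<Rightarrow> 'u) path_elem) set) preadd" where
  "quotient_cat_of D S F = quotient_preadd (tensor_category (species_of D F)) (ideal_of D S F)"

definition quotient_functor_of :: "('o, 'v, 'h, 's) double_cat \<Rightarrow> ('o \<times> 'o \<times> 'o) set \<Rightarrow>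
    ('o, 'v, 'h, 's, 'u::infinite ring, 'u ring_map, ('u, 'u) bimod, 'u square) double_trans \<Rightarrow>
    ('o, ('o list \<Rightarrow> ('u, 'h \<Rightarrow> 'u) path_elem) set) preadd_functor" where
  "quotient_functor_of D S T =
    (let F = src T; F' = tgt T; Sp = species_of D F; Sp' = species_of D F';
         f0 = (\<lambda>x. fn (fst (fn T) x));
         f1 = (\<lambda>y x a. \<lambda>f\<in>horizontals D y x. fn (snd (fn T) f) (a f));
         C = Obj (Vert D)
     in \<lparr>src = quotient_cat_of D S F,
         fn = (\<lambda>x\<in>C. x,
           curry (\<lambda>(t, h)\<in>C \<times> C. \<lambda>A\<in>carrier (PHom (quotient_cat_of D S F) t h).
             \<Union>a\<in>A. ideal_of D S F' t h #>\<^bsub>tensor_hom Sp' t h\<^esub> tensor_hom_map Sp Sp' f0 f1 t h a)),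
         tgt = quotient_cat_of D S F'\<rparr>)"

end

theory Submission
 imports Defs "HOL-Algebra.Subrings"
begin

text \<open>
 A double functor \<open>F\<close> into \<open>BIMOD\<close> gives ring maps on objects and, after summing over horizontal
 morphisms, a species with maps \<open>c\<close>; additivity and balancedness are checked on summands and pure
 tensors, which span. Concatenation of pure tensors is multiadditive and hence extends to the tensor
 category. Concatenating a generator of the ideal (a pure tensor minus one of its contractions) with a
 pure tensor is again such a generator, because \<open>c\<close> is bilinear over the outer rings; so the relations
 form an ideal, and a double transformation, being compatible with \<open>F\<^sub>\<odot>\<close>, maps generators to generators.
 The laws of \<open>CENTRAL\<close> are transported from those of \<open>BIMOD\<close>: \<open>central_bimod\<close> is faithful on squares,
 and centrality is what makes \<open>(e \<otimes> f)(e' \<otimes> f') = ee' \<otimes> ff'\<close> well defined.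
\<close>

text \<open>Two obstacles shape the development. Morphisms are equal only as HOL functions, so every
  map must be normalised outside its carrier, and most induced maps are picked by
  \<open>THE\<close>. Such a map needs a lift, for existence, and a spanning set on which its values
  are forced, for uniqueness; from then on only its values on generators matter. Lifts in several
  variables are made one variable at a time, often with values in a group of homomorphisms, instead
  of from a universal property for each shape of tensor product. The second obstacle is that tensor
  products must lie in the universe again. They are carried there by an injection chosen by
  \<open>SOME\<close>, of which only injectivity is known, so associators and unitors are honest
  isomorphisms and never equalities. The choice depends on the tensor group alone, however, which
  makes tensor products of bimodules with the same actions on carriers literally equal. Along paths
  no iterated binary tensor product is formed: a word is a list with one letter per step, and the
  relations are indexed by positions in the list. Concatenation of words is then strictly
  associative, and case distinctions come from the scalars on paths of length zero.\<close>

abbreviation (input) "car \<equiv> carrier"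
abbreviation (input) "FA \<equiv> free_Abelian_group"
abbreviation (input) "mid \<equiv> midring"
abbreviation (input) "cbim \<equiv> central_bimod"
abbreviation (input) "btens \<equiv> bimod_tensor"
abbreviation (input) "ccomp \<equiv> central_comp"
abbreviation (input) "words \<equiv> path_words"
abbreviation (input) "cpath \<equiv> contract_path"
abbreviation (input) "csquares \<equiv> central_squares"
abbreviation (input) "rbim \<equiv> restriction_bimod"
abbreviation (input) "zcentral \<equiv> centralizer_central"
abbreviation (input) "rid \<equiv> ring_map_id"
abbreviation (input) "regb \<equiv> regular_bimod"
abbreviation (input) "gens \<equiv> generators"
abbreviation (input) "cunit \<equiv> central_unit"
abbreviation (input) "amon \<equiv> add_monoid"
abbreviation (input) "zring \<equiv> centralizer_ring"
abbreviation (input) "uten \<equiv> utensor_group"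
abbreviation (input) bimod_vcomp (infixl "\<bullet>" 70) where "t \<bullet> s \<equiv> t \<cdot>\<^bsub>Horz BIMOD\<^esub> s"
abbreviation (input) bimod_hcomp (infixl "\<diamondop>" 75) where "s \<diamondop> t \<equiv> s \<star>\<star>\<^bsub>BIMOD\<^esub> t"
abbreviation (input) central_vcomp (infixl "\<circ>\<^sub>c" 70) where "t \<circ>\<^sub>c s \<equiv> t \<cdot>\<^bsub>Horz CENTRAL\<^esub> s"
abbreviation (input) central_hcomp (infixl "\<diamondop>\<^sub>c" 75) where "s \<diamondop>\<^sub>c t \<equiv> s \<star>\<star>\<^bsub>CENTRAL\<^esub> t"

section \<open>Homomorphisms of abelian groups\<close>

text \<open>Generation as a group, hence with inverses. That \<open>X\<close> lies in the carrier is
  part of the notion, because \<open>generate\<close> accepts any set.\<close>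

definition spans :: "'a monoid \<Rightarrow> 'a set \<Rightarrow> bool" where
 "spans G X \<longleftrightarrow> X \<subseteq> car G \<and> car G \<subseteq> generate G X"

lemma spans_subset: "spans G X ==> x:X ==> x:car G"
 by (auto simp: spans_def)

text \<open>The elements on which two homomorphisms agree are closed under products and inverses.
  This is the uniqueness half of the maps specified by \<open>THE\<close>, and the way in which
  identities between additive maps are reduced to pure tensors.\<close>

lemma spans_hom_eq:
 assumes "group G" "group K" "h:hom G K" "k:hom G K" "spans G X"
  and eq: "\<And>x. x:X ==> h x = k x" and "a:car G"
 shows "h a = k a"
proof -
 interpret h: group_hom G K h using assms by (simp add: group_hom_def group_hom_axioms_def)
 interpret k: group_hom G K k using assms by (simp add: group_hom_def group_hom_axioms_def)
 have X: "X \<subseteq> car G" using assms by (simp add: spans_def)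
 have "a:generate G X" using assms by (auto simp: spans_def)
 then show ?thesis
 proof (induction rule: generate.induct)
  case (eng x y)
  then have "x:car G" "y:car G" using h.G.generate_in_carrier X by auto
  with eng show ?case by simp
 qed (use X eq in auto)
qed

lemma spans_subgroup:
 assumes "group G" "spans G X" "subgroup H G" "X \<subseteq> H" "a:car G"
 shows "a:H"
 using group.generate_subgroup_incl[OF assms(1) assms(4,3)] assms(2,5) by (auto simp: spans_def)

text \<open>Applied to quotient maps and to coding injections, both of which are onto their targets:
  basis elements of a free group become cosets, and cosets become codes.\<close>

lemma spans_image:
 assumes "group G" "group K" "h:hom G K" "spans G X" "h ` car G = car K"
 shows "spans K (h ` X)"
proof -
 interpret h: group_hom G K h using assms by (simp add: group_hom_def group_hom_axioms_def)
 have "h ` generate G X = generate K (h ` X)"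
  using h.generate_img[of X] assms by (simp add: spans_def)
 moreover have "h ` car G \<subseteq> h ` generate G X"
  using assms(4) by (intro image_mono) (simp add: spans_def)
 ultimately show ?thesis using assms by (auto simp: spans_def)
qed

text \<open>Being a homomorphism depends only on the values on the carrier, which is closed under
  the product. A lift with arbitrary values elsewhere can thus be replaced by its extensional normal
  form.\<close>

lemma hom_restrict_iff:
 assumes "group G"
 shows "restrict h (car G):hom G K \<longleftrightarrow> h:hom G K"
proof -
 interpret group G by fact
 show ?thesis by (auto simp: hom_def Pi_def)
qed

lemma hom_cong:
 assumes "group G" "h:hom G K" "\<And>x. x:car G ==> k x = h x"
 shows "k:hom G K"
proof -
 interpret group G by fact
 show ?thesis using assms(2,3) by (auto simp: hom_def Pi_def)
qed

definition hom_group :: "'a monoid \<Rightarrow> 'b monoid \<Rightarrow> ('a \<Rightarrow> 'b) monoid" where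
 "hom_group G K = \<lparr>carrier = hom G K \<inter> extensional (car G),
  mult = (\<lambda>h k. \<lambda>x\<in>car G. h x \<otimes>\<^bsub>K\<^esub> k x), one = (\<lambda>x\<in>car G. \<one>\<^bsub>K\<^esub>)\<rparr>"

lemma comm_group_hom_group:
 assumes "group G" "comm_group K"
 shows "comm_group (hom_group G K)"
proof -
 interpret G: group G by fact
 interpret K: comm_group K by fact
 show ?thesis
 proof (rule comm_groupI)
  fix h assume h: "h:car (hom_group G K)"
  then interpret h: group_hom G K h
   by (auto simp: hom_group_def group_hom_def group_hom_axioms_def)
  have "(\<lambda>x\<in>car G. inv\<^bsub>K\<^esub> h x):car (hom_group G K)"
   by (auto simp: hom_group_def hom_def K.inv_mult)
  then show "\<exists>k\<in>car (hom_group G K). k \<otimes>\<^bsub>hom_group G K\<^esub> h = \<one>\<^bsub>hom_group G K\<^esub>"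
   by (intro bexI) (auto simp: hom_group_def)
 next
  fix h k assume "h:car (hom_group G K)" "k:car (hom_group G K)"
  then show "h \<otimes>\<^bsub>hom_group G K\<^esub> k:car (hom_group G K)"
   by (auto simp: hom_group_def hom_def Pi_def K.m_ac)
 next
  show "\<one>\<^bsub>hom_group G K\<^esub>:car (hom_group G K)"
   by (auto simp: hom_group_def hom_def)
 qed (auto simp: hom_group_def hom_in_carrier K.m_ac intro!: extensionalityI[of _ "car G"])
qed

lemma biadditive_hom_group:
 assumes "group G" "group H" "\<phi>:hom G (hom_group H K)"
 shows "biadditive G H K \<phi>"
 using assms by (auto simp: biadditive_def hom_def hom_group_def Pi_def)

lemma biadditiveD:
 assumes "biadditive G H K m"
 shows "x:car G ==> m x:hom H K"
  and "y:car H ==> (\<lambda>x. m x y):hom G K"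
  and "x:car G ==> y:car H ==> m x y:car K"
  and "x:car G ==> x':car G ==> y:car H ==> m (x \<otimes>\<^bsub>G\<^esub> x') y = m x y \<otimes>\<^bsub>K\<^esub> m x' y"
  and "x:car G ==> y:car H ==> y':car H ==> m x (y \<otimes>\<^bsub>H\<^esub> y') = m x y \<otimes>\<^bsub>K\<^esub> m x y'"
 subgoal using assms by (simp add: biadditive_def)
 subgoal using assms by (simp add: biadditive_def)
 subgoal using assms by (auto simp: biadditive_def hom_def)
 subgoal using assms by (simp add: biadditive_def hom_def)
 subgoal using assms by (simp add: biadditive_def hom_def)
 done

lemma biadditiveI:
 assumes "\<And>x y. x:car G ==> y:car H ==> m x y:car K"
  and "\<And>x x' y. x:car G ==> x':car G ==> y:car H ==>
   m (x \<otimes>\<^bsub>G\<^esub> x') y = m x y \<otimes>\<^bsub>K\<^esub> m x' y"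
  and "\<And>x y y'. x:car G ==> y:car H ==> y':car H ==>
   m x (y \<otimes>\<^bsub>H\<^esub> y') = m x y \<otimes>\<^bsub>K\<^esub> m x y'"
 shows "biadditive G H K m"
 using assms by (auto simp: biadditive_def hom_def)

text \<open>Uniqueness in one variable at a time: with the first argument in \<open>X\<close> the
  second is released, and with the second one fixed the first is released.\<close>

lemma biadditive_spans_eq:
 assumes "group G" "group H" "group K" "biadditive G H K m" "biadditive G H K m'"
  and "spans G X" "spans H Y" "\<And>x y. x:X ==> y:Y ==> m x y = m' x y"
  and "a:car G" "b:car H"
 shows "m a b = m' a b"
proof -
 have "m x b = m' x b" if x: "x:X" for x
  by (rule spans_hom_eq[OF assms(2,3) _ _ assms(7) assms(8)[OF x] assms(10)])
   (use assms(4-6) x in \<open>auto simp: spans_def intro: biadditiveD(1)\<close>)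
 then show ?thesis
  by (rule spans_hom_eq[OF assms(1,3) biadditiveD(2)[OF assms(4,10)] biadditiveD(2)[OF assms(5,10)] assms(6) _ assms(9)])
qed

text \<open>The two conditions on \<open>Q\<close> give the two halves of \<open>THE\<close>: the
  normalised lift satisfies \<open>Q\<close>, which is existence, and every homomorphism with
  \<open>Q\<close> has prescribed values on a spanning set, which is uniqueness. How
  \<open>Q\<close> describes the generators is left open.\<close>

lemma the_hom_eq:
 assumes "group G" "group H" "h:hom G H" "spans G X" "Q (restrict h (car G))"
  and Q: "\<And>k x. k:hom G H ==> Q k ==> x:X ==> k x = h x"
 shows "the_hom G H Q = restrict h (car G)"
 unfolding the_hom_def
proof (rule the_equality)
 show "restrict h (car G):hom G H \<and> restrict h (car G):extensional (car G) \<and> Q (restrict h (car G))"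
  using assms by (simp add: hom_restrict_iff)
next
 fix k assume k: "k:hom G H \<and> k:extensional (car G) \<and> Q k"
 have "k a = h a" if "a:car G" for a
  by (rule spans_hom_eq[OF assms(1,2) _ assms(3,4)]) (use k that Q in auto)
 then show "k = restrict h (car G)"
  using k by (auto intro!: extensionalityI[of k "car G"])
qed

text \<open>The condition \<open>Qm\<close> is required for every function that agrees with
  \<open>m\<close> on the carriers, because the witness is the normal form of \<open>m\<close> and
  not \<open>m\<close> itself. For the same reason the conclusion is an equation on
  carriers.\<close>

lemma the_biadditive_eq:
 assumes "group G" "group H" "group K" "biadditive G H K m" "spans G X" "spans H Y"
  and Qm: "\<And>m'. (\<And>a b. a:car G ==> b:car H ==> m' a b = m a b) ==> Q m'"
  and Q: "\<And>m' x y. Q m' ==> x:X ==> y:Y ==> m' x y = m x y"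
  and "a:car G" "b:car H"
 shows "the_biadditive G H K Q a b = m a b"
proof -
 interpret G: group G by fact
 interpret H: group H by fact
 \<comment> \<open>\<open>the_biadditive\<close> normalises the uncurried function on the product of
   the carriers; the witness has to be normalised in the same way.\<close>
 define m0 where "m0 = curry (restrict (case_prod m) (car G \<times> car H))"
 have m0: "m0 a b = m a b" if "a:car G" "b:car H" for a b
  using that by (simp add: m0_def)
 have "the_biadditive G H K Q = m0"
  unfolding the_biadditive_def
 proof (rule the_equality)
  have "biadditive G H K m0"
   using assms(4) by (intro biadditiveI) (auto simp: m0 biadditiveD)
  moreover have "case_prod m0:extensional (car G \<times> car H)"
   by (auto simp: m0_def extensional_def)
  ultimately show "biadditive G H K m0 \<and> case_prod m0:extensional (car G \<times> car H) \<and> Q m0"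
   using Qm m0 by blast
 next
  fix k assume k: "biadditive G H K k \<and> case_prod k:extensional (car G \<times> car H) \<and> Q k"
  have "k a b = m0 a b" if "a:car G" "b:car H" for a b
   using biadditive_spans_eq[OF assms(1-3) _ assms(4-6), of k a b] k that Q m0 by auto
  moreover have "k a b = m0 a b" if "\<not> (a:car G \<and> b:car H)" for a b
  proof -
   have "case_prod k (a, b) = undefined" "case_prod m0 (a, b) = undefined"
    using k that by (auto simp: extensional_def m0_def)
   then show ?thesis by simp
  qed
  ultimately show "k = m0" by blast
 qed
 then show ?thesis using assms(9,10) m0 by simp
qed

section \<open>Abelian groups given by generators and relations\<close>

lemma frag_diff_closed:
 assumes "c:car (FA X)" "d:car (FA X)"
 shows "c - d:car (FA X)"
 using assms keys_diff[of c d] by auto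

lemma generate_normal_free:
 assumes "Rel \<subseteq> car (FA X)"
 shows "generate (FA X) Rel \<lhd> FA X"
 using comm_group.subgroup_imp_normal[OF abelian_free_Abelian_group]
  group.generate_is_subgroup[OF group_free_Abelian_group assms] by blast

text \<open>A relation that is a difference \<open>c - d\<close> identifies the cosets of
  \<open>c\<close> and \<open>d\<close>. Additivity relations take this shape after their two
  subtracted terms are collected into one sum.\<close>

lemma frag_class_eq:
 assumes "Rel \<subseteq> car (FA X)" "c - d:Rel"
  and cd: "c:car (FA X)" "d:car (FA X)"
 shows "generate (FA X) Rel #>\<^bsub>FA X\<^esub> c
  = generate (FA X) Rel #>\<^bsub>FA X\<^esub> d"
proof -
 let ?F = "FA X"
 let ?N = "generate ?F Rel"
 interpret N: normal ?N ?F by (rule generate_normal_free[OF assms(1)])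
 have "c - d:?N" using assms(2) by (rule generate.incl)
 then have "c:?N #>\<^bsub>?F\<^esub> d"
  using cd by (auto simp: r_coset_def intro!: bexI[of _ "c - d"])
 then show ?thesis
  using N.repr_independence[OF _ cd(2) N.subgroup_axioms] by simp
qed

text \<open>The basis spans the free abelian group, by induction over differences of elements, and
  the quotient map is onto.\<close>

lemma spans_presented:
 assumes "Rel \<subseteq> car (FA X)"
 shows "spans (FA X Mod generate (FA X) Rel)
  ((\<lambda>x. generate (FA X) Rel #>\<^bsub>FA X\<^esub> frag_of x) ` X)"
proof -
 let ?F = "FA X"
 let ?N = "generate ?F Rel"
 interpret N: normal ?N ?F by (rule generate_normal_free[OF assms])
 have "c:generate ?F (frag_of ` X)" if "Poly_Mapping.keys c \<subseteq> X" for c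
 proof -
  interpret S: subgroup "generate ?F (frag_of ` X)" ?F
   by (rule N.generate_is_subgroup) auto
  show ?thesis
  proof (rule free_Abelian_group_induct[OF that])
   fix x y assume *: "Poly_Mapping.keys x \<subseteq> X" "Poly_Mapping.keys y \<subseteq> X"
    "x:generate ?F (frag_of ` X)" "y:generate ?F (frag_of ` X)"
   from S.m_closed[OF *(3) S.m_inv_closed[OF *(4)]] *(2)
   show "x - y:generate ?F (frag_of ` X)" by simp
  qed (use S.one_closed in \<open>auto intro: generate.incl\<close>)
 qed
 then have "spans ?F (frag_of ` X)" by (auto simp: spans_def)
 from spans_image[OF N.is_group N.factorgroup_is_group N.r_coset_hom_Mod this]
 show ?thesis by (simp add: image_image carrier_FactGroup)
qed

text \<open>The universal property of a presented abelian group. The extension of \<open>f\<close>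
  to the free group is found only inside the argument, so the hypothesis \<open>kill\<close> speaks
  of an arbitrary homomorphism with the prescribed values on the basis.\<close>

lemma presented_lift:
 assumes Rel: "Rel \<subseteq> car (FA X)" and K: "comm_group K"
  and f: "\<And>x. x:X ==> f x:car K"
  and kill: "\<And>h r. h:hom (FA X) K ==> (\<And>x. x:X ==> h (frag_of x) = f x)
   ==> r:Rel ==> h r = \<one>\<^bsub>K\<^esub>"
 obtains h where "h:hom (FA X Mod generate (FA X) Rel) K"
  "\<And>x. x:X ==> h (generate (FA X) Rel #>\<^bsub>FA X\<^esub> frag_of x) = f x"
proof -
 let ?F = "FA X"
 interpret K: comm_group K by fact
 obtain h where h: "h:hom ?F K" "\<And>x. x:X ==> h (frag_of x) = f x"
  using K.free_Abelian_group_universal[of f X] f by auto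
 interpret h: group_hom ?F K h
  using h K.is_group by (simp add: group_hom_def group_hom_axioms_def)
 have "generate ?F Rel \<subseteq> kernel ?F K h"
  by (rule h.G.generate_subgroup_incl[OF _ h.subgroup_kernel])
   (use Rel kill[OF h] in \<open>auto simp: kernel_def simp del: carrier_free_Abelian_group_iff\<close>)
 from h.FactGroup_universal_kernel[OF generate_normal_free[OF Rel] this] obtain g
  where "g:hom (?F Mod generate ?F Rel) K"
   "\<And>c. c:car ?F ==> g (generate ?F Rel #>\<^bsub>?F\<^esub> c) = h c" by blast
 then show ?thesis using that h(2) by auto
qed

lemma hom_frag_diff_one:
 assumes "group K" "h:hom (FA X) K" "c:car (FA X)"
  "d:car (FA X)" "h c = h d"
 shows "h (c - d) = \<one>\<^bsub>K\<^esub>"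
proof -
 interpret h: group_hom "FA X" K h
  using assms by (simp add: group_hom_def group_hom_axioms_def)
 have "h (c - d) = h (c \<otimes>\<^bsub>FA X\<^esub> inv\<^bsub>FA X\<^esub> d)"
  using assms(4) by simp
 also have "\<dots> = \<one>\<^bsub>K\<^esub>"
  using assms(3-5) h.hom_closed[OF assms(4)] by (simp only: h.hom_mult h.hom_inv h.G.inv_closed h.H.r_inv)
 finally show ?thesis .
qed

lemma hom_frag_diff2_one:
 assumes "group K" "h:hom (FA X) K" "x:X" "y:X" "z:X"
  and "h (frag_of x) = h (frag_of y) \<otimes>\<^bsub>K\<^esub> h (frag_of z)"
 shows "h (frag_of x - frag_of y - frag_of z) = \<one>\<^bsub>K\<^esub>"
proof -
 have "h (frag_of y + frag_of z) = h (frag_of y) \<otimes>\<^bsub>K\<^esub> h (frag_of z)"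
  using hom_mult[OF assms(2), of "frag_of y" "frag_of z"] assms(4,5) by simp
 moreover have "frag_of y + frag_of z:car (FA X)"
  using assms(4,5) keys_add[of "frag_of y" "frag_of z"] by auto
 ultimately have "h (frag_of x - (frag_of y + frag_of z)) = \<one>\<^bsub>K\<^esub>"
  using assms by (intro hom_frag_diff_one) auto
 then show ?thesis by (simp add: diff_diff_eq)
qed

subsection \<open>Direct sums and transport of structure\<close>

lemma comm_group_sum_group:
 assumes "\<And>i. i:I ==> comm_group (G i)"
 shows "comm_group (sum_group I G)"
proof -
 have g: "group (G i)" if "i:I" for i using assms[OF that] by (simp add: comm_group_def)
 then have "group (sum_group I G)" by (rule sum_group)
 moreover have "x i \<otimes>\<^bsub>G i\<^esub> y i = y i \<otimes>\<^bsub>G i\<^esub> x i" if "x:car (sum_group I G)" "y:car (sum_group I G)" "i:I" for x y i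
  using that g assms by (auto simp: carrier_sum_group PiE_def Pi_def comm_group_def intro: comm_monoid.m_comm)
 ultimately show ?thesis
  by (intro group.group_comm_groupI) (auto simp: intro!: restrict_ext)
qed

lemma summand_hom:
 assumes "\<And>i. i:I ==> group (G i)" "i:I"
 shows "summand I G i:hom (G i) (sum_group I G)"
proof -
 have [simp]: "\<one>\<^bsub>G j\<^esub>:car (G j)" "\<one>\<^bsub>G j\<^esub> \<otimes>\<^bsub>G j\<^esub> \<one>\<^bsub>G j\<^esub> = \<one>\<^bsub>G j\<^esub>" if "j:I" for j
  using assms(1)[OF that] by (simp_all add: group.is_monoid)
 have "finite {j:I. summand I G i x j \<noteq> \<one>\<^bsub>G j\<^esub>}" for x
  by (rule finite_subset[of _ "{i}"]) (auto simp: summand_def)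
 then show ?thesis
  using assms by (auto simp: hom_def carrier_sum_group summand_def)
qed

lemma summand_closed:
 assumes "\<And>i. i:I ==> group (G i)" "i:I" "x:car (G i)"
 shows "summand I G i x:car (sum_group I G)"
 using summand_hom[of I G i] assms by (auto simp: hom_def)

text \<open>An element of a direct sum has finite support and can be taken apart one coordinate at a
  time; the induction is over the support.\<close>

lemma spans_sum_group:
 assumes G: "\<And>i. i:I ==> group (G i)" and X: "\<And>i. i:I ==> spans (G i) (X i)"
 shows "spans (sum_group I G) (\<Union>i\<in>I. summand I G i ` X i)" (is "spans ?S ?Y")
proof -
 have S: "group ?S" using G by (rule sum_group)
 then interpret S: group ?S .
 have Y: "?Y \<subseteq> car ?S" using X by (auto simp: spans_def intro!: summand_closed[OF G])
 interpret Z: subgroup "generate ?S ?Y" ?S using Y by (rule S.generate_is_subgroup)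
 have one: "summand I G i x:generate ?S ?Y" if i: "i:I" and x: "x:car (G i)" for i x
 proof -
  interpret h: group_hom "G i" ?S "summand I G i"
   using G[OF i] S summand_hom[OF G i] by (simp add: group_hom_def group_hom_axioms_def)
  have "summand I G i ` generate (G i) (X i) = generate ?S (summand I G i ` X i)"
   using h.generate_img[of "X i"] X[OF i] by (simp add: spans_def)
  moreover have "generate ?S (summand I G i ` X i) \<subseteq> generate ?S ?Y"
   by (rule S.mono_generate) (use i in auto)
  moreover have "summand I G i x:summand I G i ` generate (G i) (X i)"
   using X[OF i] x by (auto simp: spans_def)
  ultimately show ?thesis by blast
 qed
 have "a:generate ?S ?Y" if "finite J" "J = {i\<in>I. a i \<noteq> \<one>\<^bsub>G i\<^esub>}" "a:car ?S" for a J
  using that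
 proof (induction J arbitrary: a)
  case empty
  then have "a = \<one>\<^bsub>?S\<^esub>" by (auto simp: carrier_sum_group[OF G] PiE_def extensional_def fun_eq_iff)
  then show ?case by (metis generate.one)
 next
  case (insert i J)
  have i: "i:I" "a i:car (G i)" using insert(4,5) by (auto simp: carrier_sum_group[OF G])
  \<comment> \<open>The same element with its coordinate \<open>i\<close> erased. Its support is
    \<open>J\<close>, so the induction hypothesis applies, and the erased part is an element of a
    single summand.\<close>
  let ?b = "\<lambda>j\<in>I. if j = i then \<one>\<^bsub>G j\<^esub> else a j"
  have J: "J = {j:I. ?b j \<noteq> \<one>\<^bsub>G j\<^esub>}" using insert(2,4) by auto
  have "finite {j:I. ?b j \<noteq> \<one>\<^bsub>G j\<^esub>}" using insert(1) unfolding J .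
  moreover have "\<one>\<^bsub>G j\<^esub>:car (G j)" "a j:car (G j)" if "j:I" for j
   using that G insert(5) by (auto simp: carrier_sum_group[OF G] group.is_monoid)
  ultimately have "?b:car ?S"
   by (auto simp: carrier_sum_group[OF G])
  with J have b: "?b:generate ?S ?Y" by (rule insert(3))
  have "a j = (summand I G i (a i) \<otimes>\<^bsub>?S\<^esub> ?b) j" for j
  proof (cases "j:I")
   case True
   then have "group (G j)" "a j:car (G j)"
    using G insert(5) by (auto simp: carrier_sum_group[OF G])
   then show ?thesis using True G[OF i(1)] i(2) by (auto simp: summand_def group.is_monoid)
  next
   case False
   then show ?thesis using insert(5) by (auto simp: carrier_sum_group[OF G])
  qed
  then have eq: "a = summand I G i (a i) \<otimes>\<^bsub>?S\<^esub> ?b" by (rule ext)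
  show ?case by (subst eq) (rule Z.m_closed[OF one[OF i] b])
 qed
 then show ?thesis using Y G by (auto simp: spans_def carrier_sum_group)
qed

text \<open>The images of the coordinates are combined by \<open>gfinprod\<close>, which takes into
  account only the finitely many nontrivial factors and is therefore meaningful over an infinite
  index set.\<close>

lemma sum_group_lift:
 assumes G: "\<And>i. i:I ==> group (G i)" and K: "comm_group K"
  and f: "\<And>i. i:I ==> f i:hom (G i) K"
 obtains h where "h:hom (sum_group I G) K"
  "\<And>i x. i:I ==> x:car (G i) ==> h (summand I G i x) = f i x"
proof -
 interpret K: comm_group K by fact
 let ?h = "\<lambda>x. gfinprod K (\<lambda>i. (f i) (x i)) I"
 have "?h:hom (sum_group I G) K" by (rule K.hom_group_sum[OF f G])
 moreover have "?h (summand I G i x) = f i x" if i: "i:I" and x: "x:car (G i)" for i x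
 proof -
  have c: "f i x:car K" using f[OF i] x by (auto simp: hom_def)
  have "f j \<one>\<^bsub>G j\<^esub> = \<one>\<^bsub>K\<^esub>" if "j:I" for j
   using hom_one[OF f[OF that] G[OF that] K.is_group] .
  then have *: "f j (summand I G i x j) = (if j = i then f i x else \<one>\<^bsub>K\<^esub>)" if "j:I" for j
   using that by (simp add: summand_def)
  have "?h (summand I G i x) = gfinprod K (\<lambda>j. if j = i then f i x else \<one>\<^bsub>K\<^esub>) I"
   by (rule K.gfinprod_cong) (use * c in auto)
  also have "\<dots> = gfinprod K (\<lambda>j. if j = i then f i x else \<one>\<^bsub>K\<^esub>) {i}"
   by (rule K.gfinprod_mono_neutral_cong_right) (use i c in auto)
  also have "\<dots> = f i x" using c by (simp add: K.finprod_singleton)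
  finally show ?thesis .
 qed
 ultimately show ?thesis by (rule that)
qed

section \<open>Transport of group structure along an injection\<close>

lemma image_group_iso:
 assumes "inj_on e (car G)" "group G"
 shows "e:iso G (image_group e G)"
proof -
 interpret group G by fact
 show ?thesis using assms(1) by (simp add: iso_def hom_def image_group_def bij_betw_def)
qed

lemma image_group_comm_group:
 assumes "inj_on e (car G)" "comm_group G"
 shows "comm_group (image_group e G)"
proof -
 interpret comm_group G by fact
 show ?thesis
 proof (rule comm_groupI)
  fix x assume "x:car (image_group e G)"
  then obtain a where "x = e a" "a:car G" by (auto simp: image_group_def)
  then show "\<exists>y\<in>car (image_group e G). y \<otimes>\<^bsub>image_group e G\<^esub> x = \<one>\<^bsub>image_group e G\<^esub>"
   using assms(1) by (auto simp: image_group_def intro!: bexI[of _ "inv\<^bsub>G\<^esub> a"])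
 next
  fix x y z assume "x:car (image_group e G)" "y:car (image_group e G)" "z:car (image_group e G)"
  then obtain a b c where "x = e a" "a:car G" "y = e b" "b:car G" "z = e c" "c:car G"
   by (auto simp: image_group_def)
  then show "x \<otimes>\<^bsub>image_group e G\<^esub> y \<otimes>\<^bsub>image_group e G\<^esub> z = x \<otimes>\<^bsub>image_group e G\<^esub> (y \<otimes>\<^bsub>image_group e G\<^esub> z)"
   using assms(1) by (simp add: image_group_def m_assoc)
 next
  fix x y assume "x:car (image_group e G)" "y:car (image_group e G)"
  then show "x \<otimes>\<^bsub>image_group e G\<^esub> y = y \<otimes>\<^bsub>image_group e G\<^esub> x"
   using assms(1) by (auto simp: image_group_def m_comm)
 qed (use assms(1) in \<open>auto simp: image_group_def\<close>)
qed

lemma image_group_hom: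
 assumes "inj_on e (car G)" "group G"
 shows "e:hom G (image_group e G)"
 using image_group_iso[OF assms] by (simp add: iso_def)

lemma spans_image_group:
 assumes "inj_on e (car G)" "comm_group G" "spans G X"
 shows "spans (image_group e G) (e ` X)"
proof (rule spans_image)
 show "group G" "group (image_group e G)"
  using image_group_comm_group[OF assms(1,2)] assms(2) by (simp_all add: comm_group_def)
 then show "e:hom G (image_group e G)" using assms(1) by (simp add: image_group_hom)
qed (use assms(3) in \<open>simp_all add: image_group_def\<close>)

text \<open>Maps out of a coded group are read through the inverse of the code, so injectivity is
  all that has to be known about it.\<close>

lemma image_group_lift:
 assumes "inj_on e (car G)" "group G" "h:hom G K"
 obtains k where "k:hom (image_group e G) K" "\<And>x. x:car G ==> k (e x) = h x"
proof (rule that)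
 interpret group G by fact
 show "(\<lambda>y. h (inv_into (car G) e y)):hom (image_group e G) K"
 proof (rule homI)
  fix x y assume "x:car (image_group e G)" "y:car (image_group e G)"
  then obtain a b where "x = e a" "a:car G" "y = e b" "b:car G"
   by (auto simp: image_group_def)
  then show "h (inv_into (car G) e (x \<otimes>\<^bsub>image_group e G\<^esub> y))
   = h (inv_into (car G) e x) \<otimes>\<^bsub>K\<^esub> h (inv_into (car G) e y)"
   using assms(1,3) by (simp add: image_group_def hom_mult)
 qed (use assms(1,3) in \<open>auto simp: image_group_def hom_in_carrier\<close>)
 show "h (inv_into (car G) e (e x)) = h x" if "x:car G" for x
  using assms(1) that by simp
qed

lemma hom_comp: "k:hom G H ==> h:hom H K ==> (\<lambda>x. h (k x)):hom G K"
 using hom_compose[of k G H h K] by (simp add: o_def)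

lemma hom_pointwise_mult:
 assumes "comm_group K" "h:hom G K" "k:hom G K"
 shows "(\<lambda>x. h x \<otimes>\<^bsub>K\<^esub> k x):hom G K"
proof -
 interpret comm_group K by fact
 show ?thesis using assms(2,3) by (auto simp: hom_def Pi_def m_ac)
qed

lemma hom_ident: "(\<lambda>x. x):hom G G"
 by (simp add: hom_def)

section \<open>Tensor products\<close>

definition balanced :: "('r, 'a) bimod \<Rightarrow> ('r, 'b) bimod \<Rightarrow> 'c monoid \<Rightarrow> ('a \<Rightarrow> 'b \<Rightarrow> 'c) \<Rightarrow> bool" where
 "balanced A B K m \<longleftrightarrow> biadditive (bgrp A) (bgrp B) K m \<and>
  (\<forall>a\<in>bcar A. \<forall>r\<in>car (rring A). \<forall>b\<in>bcar B. m (ract A a r) b = m a (lact B r b))"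

lemma balancedI:
 assumes "\<And>a b. a:bcar A ==> b:bcar B ==> m a b:car K"
  and "\<And>a a' b. a:bcar A ==> a':bcar A ==> b:bcar B ==> m (a \<otimes>\<^bsub>bgrp A\<^esub> a') b = m a b \<otimes>\<^bsub>K\<^esub> m a' b"
  and "\<And>a b b'. a:bcar A ==> b:bcar B ==> b':bcar B ==> m a (b \<otimes>\<^bsub>bgrp B\<^esub> b') = m a b \<otimes>\<^bsub>K\<^esub> m a b'"
  and "\<And>a r b. a:bcar A ==> r:car (rring A) ==> b:bcar B ==> m (ract A a r) b = m a (lact B r b)"
 shows "balanced A B K m"
 using assms by (simp add: balanced_def biadditiveI)

lemma balancedD:
 assumes "balanced A B K m"
 shows "a:bcar A ==> b:bcar B ==> m a b:car K"
  and "a:bcar A ==> a':bcar A ==> b:bcar B ==> m (a \<otimes>\<^bsub>bgrp A\<^esub> a') b = m a b \<otimes>\<^bsub>K\<^esub> m a' b"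
  and "a:bcar A ==> b:bcar B ==> b':bcar B ==> m a (b \<otimes>\<^bsub>bgrp B\<^esub> b') = m a b \<otimes>\<^bsub>K\<^esub> m a b'"
  and "a:bcar A ==> r:car (rring A) ==> b:bcar B ==> m (ract A a r) b = m a (lact B r b)"
 using assms by (auto simp: balanced_def biadditiveD)

lemma balanced_hom:
 assumes "balanced A B K m" "h:hom K L"
 shows "balanced A B L (\<lambda>a b. h (m a b))"
 using assms(2) by (intro balancedI) (auto simp: balancedD[OF assms(1)] hom_mult hom_in_carrier)

text \<open>The element types are left free: the bimodules of a species consist of functions on a
  set of horizontal morphisms and do not lie in the universe type, so their tensor products stay
  uncoded.\<close>

locale bimodule_pair = A: bimodule A + B: bimodule B
 for A :: "('r, 'a) bimod" and B :: "('r, 'b) bimod" +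
 assumes match: "rring A = lring B"
begin

sublocale GA: comm_group "bgrp A" by (rule A.comm_group)
sublocale GB: comm_group "bgrp B" by (rule B.comm_group)

lemma tensor_relations_closed:
 "tensor_relations A B \<subseteq> car (FA (bcar A \<times> bcar B))"
 unfolding tensor_relations_def
 by (auto simp del: carrier_free_Abelian_group_iff simp: match A.ract_closed B.lact_closed
   intro!: frag_diff_closed)

lemma comm_group_tensor_group: "comm_group (tensor_group A B)"
 unfolding tensor_group_def tensor_kernel_def
 using comm_group.abelian_FactGroup[OF abelian_free_Abelian_group]
  group.generate_is_subgroup[OF group_free_Abelian_group tensor_relations_closed] by blast

lemma spans_tensor_group:
 "spans (tensor_group A B) (case_prod (tensor_elem A B) ` (bcar A \<times> bcar B))"
proof -
 have "case_prod (tensor_elem A B) = (\<lambda>x. tensor_kernel A B #>\<^bsub>FA (bcar A \<times> bcar B)\<^esub> frag_of x)"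
  by (auto simp: tensor_elem_def)
 then show ?thesis
  using spans_presented[OF tensor_relations_closed] by (simp add: tensor_group_def tensor_kernel_def)
qed

lemma tensor_elem_closed: "a:bcar A ==> b:bcar B ==> tensor_elem A B a b:car (tensor_group A B)"
 using spans_tensor_group by (auto simp: spans_def)

lemma balanced_tensor_elem: "balanced A B (tensor_group A B) (tensor_elem A B)"
proof -
 let ?F = "FA (bcar A \<times> bcar B)"
 interpret N: normal "tensor_kernel A B" ?F
  unfolding tensor_kernel_def by (rule generate_normal_free[OF tensor_relations_closed])
 have sum: "tensor_kernel A B #>\<^bsub>?F\<^esub> (frag_of x + frag_of y) =
   (tensor_kernel A B #>\<^bsub>?F\<^esub> frag_of x) \<otimes>\<^bsub>tensor_group A B\<^esub> (tensor_kernel A B #>\<^bsub>?F\<^esub> frag_of y)"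
  if "x:bcar A \<times> bcar B" "y:bcar A \<times> bcar B" for x y
  using N.rcos_sum[of "frag_of x" "frag_of y"] that by (simp add: tensor_group_def)
 have eq: "tensor_kernel A B #>\<^bsub>?F\<^esub> c = tensor_kernel A B #>\<^bsub>?F\<^esub> d"
  if "c - d:tensor_relations A B" "c:car ?F" "d:car ?F" for c d
  using frag_class_eq[OF tensor_relations_closed that] by (simp add: tensor_kernel_def)
 have pl: "frag_of x + frag_of y:car ?F" if "x:bcar A \<times> bcar B" "y:bcar A \<times> bcar B" for x y
  using N.m_closed[of "frag_of x" "frag_of y"] that by simp
 show ?thesis
 proof (rule balancedI)
  fix a a' b assume *: "a:bcar A" "a':bcar A" "b:bcar B"
  have "tensor_kernel A B #>\<^bsub>?F\<^esub> frag_of (a \<otimes>\<^bsub>bgrp A\<^esub> a', b)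
    = tensor_kernel A B #>\<^bsub>?F\<^esub> (frag_of (a, b) + frag_of (a', b))"
  proof (rule eq)
   show "frag_of (a \<otimes>\<^bsub>bgrp A\<^esub> a', b) - (frag_of (a, b) + frag_of (a', b)):tensor_relations A B"
    using * by (auto simp: tensor_relations_def diff_diff_eq)
  qed (use * pl in auto)
  with * show "tensor_elem A B (a \<otimes>\<^bsub>bgrp A\<^esub> a') b = tensor_elem A B a b \<otimes>\<^bsub>tensor_group A B\<^esub> tensor_elem A B a' b"
   by (simp add: tensor_elem_def sum)
 next
  fix a b b' assume *: "a:bcar A" "b:bcar B" "b':bcar B"
  have "tensor_kernel A B #>\<^bsub>?F\<^esub> frag_of (a, b \<otimes>\<^bsub>bgrp B\<^esub> b')
    = tensor_kernel A B #>\<^bsub>?F\<^esub> (frag_of (a, b) + frag_of (a, b'))"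
  proof (rule eq)
   show "frag_of (a, b \<otimes>\<^bsub>bgrp B\<^esub> b') - (frag_of (a, b) + frag_of (a, b')):tensor_relations A B"
    using * by (auto simp: tensor_relations_def diff_diff_eq)
  qed (use * pl in auto)
  with * show "tensor_elem A B a (b \<otimes>\<^bsub>bgrp B\<^esub> b') = tensor_elem A B a b \<otimes>\<^bsub>tensor_group A B\<^esub> tensor_elem A B a b'"
   by (simp add: tensor_elem_def sum)
 next
  fix a r b assume *: "a:bcar A" "r:car (rring A)" "b:bcar B"
  show "tensor_elem A B (ract A a r) b = tensor_elem A B a (lact B r b)"
   unfolding tensor_elem_def
  proof (rule eq)
   show "frag_of (ract A a r, b) - frag_of (a, lact B r b):tensor_relations A B"
    using * by (auto simp: tensor_relations_def)
  qed (use * match in \<open>auto simp: A.ract_closed B.lact_closed\<close>)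
 qed (rule tensor_elem_closed)
qed

text \<open>Balancedness says precisely that the extension to the free group kills the three
  families of tensor relations.\<close>

lemma tensor_group_lift:
 assumes K: "comm_group K" and m: "balanced A B K m"
 obtains h where "h:hom (tensor_group A B) K"
  "\<And>a b. a:bcar A ==> b:bcar B ==> h (tensor_elem A B a b) = m a b"
proof -
 interpret K: comm_group K by fact
 have "\<exists>h\<in>hom (tensor_group A B) K. \<forall>x\<in>bcar A \<times> bcar B. h (case_prod (tensor_elem A B) x) = case_prod m x"
 proof (rule presented_lift[OF tensor_relations_closed K])
  fix h r assume h: "h:hom (FA (bcar A \<times> bcar B)) K"
   "\<And>x. x:bcar A \<times> bcar B ==> h (frag_of x) = case_prod m x"
  have "h (frag_of (a \<otimes>\<^bsub>bgrp A\<^esub> a', b) - frag_of (a, b) - frag_of (a', b)) = \<one>\<^bsub>K\<^esub>"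
   if "a:bcar A" "a':bcar A" "b:bcar B" for a a' b
   by (rule hom_frag_diff2_one[OF K.is_group h(1)]) (use that in \<open>auto simp: h(2) balancedD[OF m]\<close>)
  moreover have "h (frag_of (a, b \<otimes>\<^bsub>bgrp B\<^esub> b') - frag_of (a, b) - frag_of (a, b')) = \<one>\<^bsub>K\<^esub>"
   if "a:bcar A" "b:bcar B" "b':bcar B" for a b b'
   by (rule hom_frag_diff2_one[OF K.is_group h(1)]) (use that in \<open>auto simp: h(2) balancedD[OF m]\<close>)
  moreover have "h (frag_of (ract A a r, b) - frag_of (a, lact B r b)) = \<one>\<^bsub>K\<^esub>"
   if "a:bcar A" "r:car (rring A)" "b:bcar B" for a r b
   by (rule hom_frag_diff_one[OF K.is_group h(1)])
    (use that match in \<open>auto simp: h(2) balancedD[OF m] A.ract_closed B.lact_closed\<close>)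
  ultimately show "r:tensor_relations A B ==> h r = \<one>\<^bsub>K\<^esub>"
   by (auto simp: tensor_relations_def)
 qed (auto simp: balancedD[OF m] tensor_group_def tensor_kernel_def tensor_elem_def)
 then show ?thesis using that by auto
qed

end

section \<open>Tensor products coded inside the universe\<close>

locale ubimodule_pair = bimodule_pair A B
 for A :: "('u::infinite, 'u) bimod" and B :: "('u, 'u) bimod"
begin

abbreviation (input) T where "T \<equiv> uten A B"
abbreviation (input) t where "t \<equiv> tens A B"

text \<open>Infinity of the universe enters here. The tensor group is a quotient of a free abelian
  group on a subset of \<open>'u \<times> 'u\<close>; a free abelian group on an infinite set has
  the cardinality of that set, and \<open>'u \<times> 'u\<close> is equipollent to
  \<open>'u\<close>. So an injection exists, and the one chosen by \<open>SOME\<close> is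
  injective.\<close>

lemma inj_tensor_code: "inj_on (tensor_code A B) (car (tensor_group A B))"
proof -
 have sq: "(UNIV :: 'u set) \<times> (UNIV :: 'u set) \<approx> (UNIV :: 'u set)"
  using card_of_Times_same_infinite[OF infinite_UNIV[where 'a='u]] by (simp add: eqpoll_iff_card_of_ordIso)
 then have inf: "infinite ((UNIV :: 'u set) \<times> (UNIV :: 'u set))"
  using eqpoll_finite_iff infinite_UNIV by blast
 have "car (tensor_group A B) \<lesssim> car (FA (bcar A \<times> bcar B))"
  by (simp only: tensor_group_def carrier_FactGroup image_lepoll)
 also have "\<dots> \<lesssim> car (FA ((UNIV :: 'u set) \<times> (UNIV :: 'u set)))"
  by (rule subset_imp_lepoll) auto
 also have "\<dots> \<approx> (UNIV :: 'u set) \<times> (UNIV :: 'u set)"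
  by (rule eqpoll_free_Abelian_group_infinite[OF inf])
 also note sq
 finally show ?thesis
  unfolding tensor_code_def lepoll_def by (metis (mono_tags, lifting) someI_ex)
qed

lemma comm_group_utensor: "comm_group T"
 unfolding utensor_group_def by (rule image_group_comm_group[OF inj_tensor_code comm_group_tensor_group])

sublocale T: comm_group T by (rule comm_group_utensor)

lemma tensor_code_hom: "tensor_code A B:hom (tensor_group A B) T"
 unfolding utensor_group_def
 using image_group_hom[OF inj_tensor_code] comm_group_tensor_group by (simp add: comm_group_def)

lemma balanced_tens: "balanced A B T t"
 using balanced_hom[OF balanced_tensor_elem tensor_code_hom] by (simp add: tens_def[abs_def])

lemmas tens_closed [simp] = balancedD(1)[OF balanced_tens]
 and tens_add_left = balancedD(2)[OF balanced_tens]
 and tens_add_right = balancedD(3)[OF balanced_tens]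
 and tens_balanced = balancedD(4)[OF balanced_tens]

lemma spans_utensor: "spans T (case_prod t ` (bcar A \<times> bcar B))"
proof -
 have "case_prod t ` (bcar A \<times> bcar B) = tensor_code A B ` case_prod (tensor_elem A B) ` (bcar A \<times> bcar B)"
  by (force simp: tens_def)
 then show ?thesis
  using spans_image_group[OF inj_tensor_code comm_group_tensor_group spans_tensor_group]
  by (simp add: utensor_group_def)
qed

lemma utensor_hom_eq:
 assumes "group K" "h:hom T K" "k:hom T K"
  and "\<And>a b. a:bcar A ==> b:bcar B ==> h (t a b) = k (t a b)" and "x:car T"
 shows "h x = k x"
 by (rule spans_hom_eq[OF T.is_group assms(1-3) spans_utensor _ assms(5)]) (use assms(4) in auto)

lemma utensor_lift:
 assumes "comm_group K" "balanced A B K m"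
 obtains h where "h:hom T K" "\<And>a b. a:bcar A ==> b:bcar B ==> h (t a b) = m a b"
proof -
 obtain h where h: "h:hom (tensor_group A B) K"
  "\<And>a b. a:bcar A ==> b:bcar B ==> h (tensor_elem A B a b) = m a b"
  using tensor_group_lift[OF assms] by blast
 have "group (tensor_group A B)" using comm_group_tensor_group by (simp add: comm_group_def)
 from image_group_lift[OF inj_tensor_code this h(1)] obtain k where k: "k:hom T K"
  "\<And>x. x:car (tensor_group A B) ==> k (tensor_code A B x) = h x"
  unfolding utensor_group_def by blast
 show ?thesis
  by (rule that[OF k(1)]) (simp add: tens_def k(2) tensor_elem_closed h(2))
qed

lemma
 assumes "comm_group K" "balanced A B K m"
 shows utensor_the_hom: "the_hom T K (\<lambda>h. \<forall>a\<in>bcar A. \<forall>b\<in>bcar B. h (t a b) = m a b):hom T K"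
  and utensor_the_hom_ext: "the_hom T K (\<lambda>h. \<forall>a\<in>bcar A. \<forall>b\<in>bcar B. h (t a b) = m a b):extensional (car T)"
  and utensor_the_hom_tens: "a:bcar A ==> b:bcar B ==>
   the_hom T K (\<lambda>h. \<forall>a\<in>bcar A. \<forall>b\<in>bcar B. h (t a b) = m a b) (t a b) = m a b"
proof -
 obtain h where h: "h:hom T K" "\<And>a b. a:bcar A ==> b:bcar B ==> h (t a b) = m a b"
  using utensor_lift[OF assms] by blast
 have eq: "the_hom T K (\<lambda>h. \<forall>a\<in>bcar A. \<forall>b\<in>bcar B. h (t a b) = m a b) = restrict h (car T)"
  by (rule the_hom_eq[OF T.is_group _ h(1) spans_utensor])
   (use assms(1) h(2) in \<open>auto simp: comm_group_def\<close>)
 show "the_hom T K (\<lambda>h. \<forall>a\<in>bcar A. \<forall>b\<in>bcar B. h (t a b) = m a b):hom T K"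
  unfolding eq using h(1) by (simp add: hom_restrict_iff)
 show "the_hom T K (\<lambda>h. \<forall>a\<in>bcar A. \<forall>b\<in>bcar B. h (t a b) = m a b):extensional (car T)"
  unfolding eq by simp
 show "the_hom T K (\<lambda>h. \<forall>a\<in>bcar A. \<forall>b\<in>bcar B. h (t a b) = m a b) (t a b) = m a b"
  if "a:bcar A" "b:bcar B"
  unfolding eq using that h(2) by simp
qed

lemma bimod_tensor_sel [simp]:
 "lring (btens A B) = lring A" "rring (btens A B) = rring B"
 "bgrp (btens A B) = T"
 by (simp_all add: bimod_tensor_def)

text \<open>The left action changes only the first factor. It respects the tensor relation over the
  middle ring because it commutes with the right action of that ring on \<open>A\<close>.\<close>

lemma balanced_lact: "q:car (lring A) ==> balanced A B T (\<lambda>a b. t (lact A q a) b)"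
 by (rule balancedI)
  (simp_all add: A.lact_closed A.lact_add A.ract_closed tens_add_left tens_add_right tens_balanced flip: A.lact_ract)

lemma balanced_ract: "r:car (rring B) ==> balanced A B T (\<lambda>a b. t a (ract B b r))"
 by (rule balancedI)
  (simp_all add: B.ract_closed B.ract_add B.lact_ract B.lact_closed match tens_add_left tens_add_right tens_balanced)

lemma lact_bimod_tensor_hom: "q:car (lring A) ==> lact (btens A B) q:hom T T"
 using utensor_the_hom[OF comm_group_utensor balanced_lact] by (simp add: bimod_tensor_def)

lemma ract_bimod_tensor_hom: "r:car (rring B) ==> (\<lambda>x. ract (btens A B) x r):hom T T"
 using utensor_the_hom[OF comm_group_utensor balanced_ract] by (simp add: bimod_tensor_def)

lemma lact_tens [simp]:
 "q:car (lring A) ==> a:bcar A ==> b:bcar B ==>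
  lact (btens A B) q (t a b) = t (lact A q a) b"
 using utensor_the_hom_tens[OF comm_group_utensor balanced_lact] by (simp add: bimod_tensor_def)

lemma ract_tens [simp]:
 "r:car (rring B) ==> a:bcar A ==> b:bcar B ==>
  ract (btens A B) (t a b) r = t a (ract B b r)"
 using utensor_the_hom_tens[OF comm_group_utensor balanced_ract] by (simp add: bimod_tensor_def)

text \<open>Additivity of the actions in the tensor is built into their definition. In the laws for
  unit, sum and product of scalars, and in the law relating the two actions, both sides are additive
  in the tensor, so a comparison on pure tensors reduces them to laws of \<open>A\<close> and
  \<open>B\<close>.\<close>

lemma bimodule_bimod_tensor: "bimodule (btens A B)"
proof (rule bimodule.intro)
 interpret L: ring "lring A" by (rule A.ring_left)
 interpret R: ring "rring B" by (rule B.ring_right)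
 let ?l = "lact (btens A B)" and ?r = "ract (btens A B)"
 note lh = lact_bimod_tensor_hom and rh = ract_bimod_tensor_hom
 note eq = utensor_hom_eq[OF T.is_group] and pm = hom_pointwise_mult[OF comm_group_utensor]
 show "ring (lring (btens A B))" "ring (rring (btens A B))" "comm_group (bgrp (btens A B))"
  using A.ring_left B.ring_right comm_group_utensor by simp_all
 fix q q' r r' x y
 show "q:car (lring (btens A B)) ==> x:bcar (btens A B) ==> ?l q x:bcar (btens A B)"
  using hom_in_carrier[OF lh] by auto
 show "x:bcar (btens A B) ==> r:car (rring (btens A B)) ==> ?r x r:bcar (btens A B)"
  using hom_in_carrier[OF rh] by auto
 show "q:car (lring (btens A B)) ==> x:bcar (btens A B) ==> y:bcar (btens A B) ==>
  ?l q (x \<otimes>\<^bsub>bgrp (btens A B)\<^esub> y) = ?l q x \<otimes>\<^bsub>bgrp (btens A B)\<^esub> ?l q y"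
  using hom_mult[OF lh] by auto
 show "r:car (rring (btens A B)) ==> x:bcar (btens A B) ==> y:bcar (btens A B) ==>
  ?r (x \<otimes>\<^bsub>bgrp (btens A B)\<^esub> y) r = ?r x r \<otimes>\<^bsub>bgrp (btens A B)\<^esub> ?r y r"
  using hom_mult[OF rh] by auto
 show "x:bcar (btens A B) ==> ?l \<one>\<^bsub>lring (btens A B)\<^esub> x = x"
  by simp (rule eq[OF lh hom_ident], auto simp: A.one_lact)
 show "x:bcar (btens A B) ==> ?r x \<one>\<^bsub>rring (btens A B)\<^esub> = x"
  by simp (rule eq[OF rh hom_ident], auto simp: B.one_ract)
 show "?l (q \<oplus>\<^bsub>lring (btens A B)\<^esub> q') x = ?l q x \<otimes>\<^bsub>bgrp (btens A B)\<^esub> ?l q' x"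
  if "q:car (lring (btens A B))" "q':car (lring (btens A B))" "x:bcar (btens A B)"
  using that by simp (rule eq[OF lh pm[OF lh lh]], auto simp: A.add_lact A.lact_closed tens_add_left)
 show "?r x (r \<oplus>\<^bsub>rring (btens A B)\<^esub> r') = ?r x r \<otimes>\<^bsub>bgrp (btens A B)\<^esub> ?r x r'"
  if "r:car (rring (btens A B))" "r':car (rring (btens A B))" "x:bcar (btens A B)"
  using that by simp (rule eq[OF rh pm[OF rh rh]], auto simp: B.add_ract B.ract_closed tens_add_right)
 show "?l (q \<otimes>\<^bsub>lring (btens A B)\<^esub> q') x = ?l q (?l q' x)"
  if "q:car (lring (btens A B))" "q':car (lring (btens A B))" "x:bcar (btens A B)"
  using that by simp (rule eq[OF lh hom_comp[OF lh lh]], auto simp: A.mult_lact A.lact_closed)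
 show "?r x (r \<otimes>\<^bsub>rring (btens A B)\<^esub> r') = ?r (?r x r) r'"
  if "r:car (rring (btens A B))" "r':car (rring (btens A B))" "x:bcar (btens A B)"
  using that by simp (rule eq[OF rh hom_comp[OF rh rh]], auto simp: B.mult_ract B.ract_closed)
 show "?r (?l q x) r = ?l q (?r x r)"
  if "q:car (lring (btens A B))" "x:bcar (btens A B)" "r:car (rring (btens A B))"
  using that by simp (rule eq[OF hom_comp[OF lh rh] hom_comp[OF rh lh]], auto simp: A.lact_closed B.ract_closed)
qed

end

section \<open>Triple tensor products and associativity\<close>

locale ubimodule_triple = AB: ubimodule_pair A B + BC: ubimodule_pair B C
 for A B C :: "('u::infinite, 'u) bimod"
begin

sublocale L: ubimodule_pair "btens A B" C
 by (intro_locales; (rule AB.bimodule_bimod_tensor)?; unfold_locales)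
  (simp_all add: BC.match)

sublocale R: ubimodule_pair A "btens B C"
 by (intro_locales; (rule BC.bimodule_bimod_tensor)?; unfold_locales)
  (simp_all add: AB.match)

lemmas left_add = L.tens_add_left[unfolded AB.bimod_tensor_sel] L.tens_add_right[unfolded AB.bimod_tensor_sel]
 and right_add = R.tens_add_left[unfolded BC.bimod_tensor_sel] R.tens_add_right[unfolded BC.bimod_tensor_sel]
 and left_balanced = L.tens_balanced[unfolded AB.bimod_tensor_sel]
 and right_balanced = R.tens_balanced[unfolded BC.bimod_tensor_sel]

text \<open>Balanced in each pair of adjacent variables while the third is fixed; this includes
  additivity in all three variables, the middle one being covered twice.\<close>

definition trilinear :: "'c monoid \<Rightarrow> ('u \<Rightarrow> 'u \<Rightarrow> 'u \<Rightarrow> 'c) \<Rightarrow> bool" where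
 "trilinear K f \<longleftrightarrow> (\<forall>c\<in>bcar C. balanced A B K (\<lambda>a b. f a b c)) \<and> (\<forall>a\<in>bcar A. balanced B C K (f a))"

text \<open>For fixed \<open>c\<close> the function lifts over the tensor product of
  \<open>A\<close> and \<open>B\<close> to a map \<open>m c\<close>. Uniqueness on pure tensors
  shows that \<open>m\<close> is additive in \<open>c\<close> and balanced over the ring between
  \<open>B\<close> and \<open>C\<close>, so that it lifts a second time.\<close>

lemma left_lift:
 assumes K: "comm_group K" and f: "trilinear K f"
 obtains h where "h:hom (uten (btens A B) C) K"
  "\<And>a b c. a:bcar A ==> b:bcar B ==> c:bcar C ==>
   h (tens (btens A B) C (tens A B a b) c) = f a b c"
proof -
 interpret K: comm_group K by fact
 have f1: "\<And>c. c:bcar C ==> balanced A B K (\<lambda>a b. f a b c)"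
  and f2: "\<And>a. a:bcar A ==> balanced B C K (f a)"
  using f by (simp_all add: trilinear_def)
 define m where "m c = the_hom AB.T K (\<lambda>h. \<forall>a\<in>bcar A. \<forall>b\<in>bcar B. h (tens A B a b) = f a b c)" for c
 have m: "m c:hom AB.T K" "\<And>a b. a:bcar A ==> b:bcar B ==> m c (tens A B a b) = f a b c"
  if "c:bcar C" for c
  unfolding m_def using AB.utensor_the_hom[OF K f1[OF that]] AB.utensor_the_hom_tens[OF K f1[OF that]] by auto
 have "balanced (btens A B) C K (\<lambda>x c. m c x)"
 proof (rule balancedI)
  fix x c c' assume *: "x:bcar (btens A B)" "c:bcar C" "c':bcar C"
  show "m (c \<otimes>\<^bsub>bgrp C\<^esub> c') x = m c x \<otimes>\<^bsub>K\<^esub> m c' x"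
   by (rule AB.utensor_hom_eq[OF K.is_group m(1) hom_pointwise_mult[OF K m(1) m(1)]])
    (use * in \<open>auto simp: m balancedD(3)[OF f2]\<close>)
 next
  fix x r c assume *: "x:bcar (btens A B)" "r:car (rring (btens A B))" "c:bcar C"
  then have r: "r:car (rring B)" "lact C r c:bcar C"
   using BC.B.lact_closed BC.match by simp_all
  show "m c (ract (btens A B) x r) = m (lact C r c) x"
   by (rule AB.utensor_hom_eq[OF K.is_group hom_comp[OF AB.ract_bimod_tensor_hom[OF r(1)] m(1)] m(1)])
    (use * r in \<open>auto simp: m AB.B.ract_closed balancedD(4)[OF f2]\<close>)
 qed (auto simp: m(2) hom_mult[OF m(1)] intro: hom_in_carrier[OF m(1)])
 from L.utensor_lift[OF K this] obtain h where h: "h:hom (uten (btens A B) C) K"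
  "\<And>x c. x:bcar (btens A B) ==> c:bcar C ==> h (tens (btens A B) C x c) = m c x"
  by blast
 show ?thesis by (rule that[OF h(1)]) (simp add: h(2) m(2))
qed

text \<open>The mirror image of the preceding lift, with \<open>a\<close> as the fixed variable. It
  supplies the inverse of the associator.\<close>

lemma right_lift:
 assumes K: "comm_group K" and f: "trilinear K f"
 obtains h where "h:hom (uten A (btens B C)) K"
  "\<And>a b c. a:bcar A ==> b:bcar B ==> c:bcar C ==>
   h (tens A (btens B C) a (tens B C b c)) = f a b c"
proof -
 interpret K: comm_group K by fact
 have f1: "\<And>c. c:bcar C ==> balanced A B K (\<lambda>a b. f a b c)"
  and f2: "\<And>a. a:bcar A ==> balanced B C K (f a)"
  using f by (simp_all add: trilinear_def)
 define m where "m a = the_hom BC.T K (\<lambda>h. \<forall>b\<in>bcar B. \<forall>c\<in>bcar C. h (tens B C b c) = f a b c)" for a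
 have m: "m a:hom BC.T K" "\<And>b c. b:bcar B ==> c:bcar C ==> m a (tens B C b c) = f a b c"
  if "a:bcar A" for a
  unfolding m_def using BC.utensor_the_hom[OF K f2[OF that]] BC.utensor_the_hom_tens[OF K f2[OF that]] by auto
 have "balanced A (btens B C) K m"
 proof (rule balancedI)
  fix a a' x assume *: "a:bcar A" "a':bcar A" "x:bcar (btens B C)"
  show "m (a \<otimes>\<^bsub>bgrp A\<^esub> a') x = m a x \<otimes>\<^bsub>K\<^esub> m a' x"
   by (rule BC.utensor_hom_eq[OF K.is_group m(1) hom_pointwise_mult[OF K m(1) m(1)]])
    (use * in \<open>auto simp: m balancedD(2)[OF f1]\<close>)
 next
  fix a r x assume *: "a:bcar A" "r:car (rring A)" "x:bcar (btens B C)"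
  then have r: "r:car (lring B)" "ract A a r:bcar A"
   using AB.A.ract_closed AB.match by simp_all
  show "m (ract A a r) x = m a (lact (btens B C) r x)"
   by (rule BC.utensor_hom_eq[OF K.is_group m(1) hom_comp[OF BC.lact_bimod_tensor_hom[OF r(1)] m(1)]])
    (use * r in \<open>auto simp: m AB.B.lact_closed balancedD(4)[OF f1]\<close>)
 qed (auto simp: m(2) hom_mult[OF m(1)] intro: hom_in_carrier[OF m(1)])
 from R.utensor_lift[OF K this] obtain h where h: "h:hom (uten A (btens B C)) K"
  "\<And>a x. a:bcar A ==> x:bcar (btens B C) ==> h (tens A (btens B C) a x) = m a x"
  by blast
 show ?thesis by (rule that[OF h(1)]) (simp add: h(2) m(2))
qed

text \<open>Tensoring with a fixed \<open>c\<close> is additive, so uniqueness for the outer tensor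
  product reduces to uniqueness for the inner one.\<close>

lemma left_hom_eq:
 assumes K: "group K" and h: "h:hom (uten (btens A B) C) K" "k:hom (uten (btens A B) C) K"
  and eq: "\<And>a b c. a:bcar A ==> b:bcar B ==> c:bcar C ==>
   h (tens (btens A B) C (tens A B a b) c) = k (tens (btens A B) C (tens A B a b) c)"
  and x: "x:car (uten (btens A B) C)"
 shows "h x = k x"
proof (rule L.utensor_hom_eq[OF K h _ x])
 fix y c assume y: "y:bcar (btens A B)" and c: "c:bcar C"
 have t: "(\<lambda>y. tens (btens A B) C y c):hom AB.T L.T"
  by (rule homI) (use c L.tens_add_left in auto)
 show "h (tens (btens A B) C y c) = k (tens (btens A B) C y c)"
  by (rule AB.utensor_hom_eq[OF K hom_comp[OF t h(1)] hom_comp[OF t h(2)]]) (use c y eq in auto)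
qed

lemma right_hom_eq:
 assumes K: "group K" and h: "h:hom (uten A (btens B C)) K" "k:hom (uten A (btens B C)) K"
  and eq: "\<And>a b c. a:bcar A ==> b:bcar B ==> c:bcar C ==>
   h (tens A (btens B C) a (tens B C b c)) = k (tens A (btens B C) a (tens B C b c))"
  and x: "x:car (uten A (btens B C))"
 shows "h x = k x"
proof (rule R.utensor_hom_eq[OF K h _ x])
 fix a y assume a: "a:bcar A" and y: "y:bcar (btens B C)"
 have t: "tens A (btens B C) a:hom BC.T R.T"
  by (rule homI) (use a R.tens_add_right in auto)
 show "h (tens A (btens B C) a y) = k (tens A (btens B C) a y)"
  by (rule BC.utensor_hom_eq[OF K hom_comp[OF t h(1)] hom_comp[OF t h(2)]]) (use a y eq in auto)
qed

lemma trilinear_right: "trilinear R.T (\<lambda>a b c. tens A (btens B C) a (tens B C b c))"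
 unfolding trilinear_def
proof safe
 fix c assume "c:bcar C"
 then show "balanced A B R.T (\<lambda>a b. tens A (btens B C) a (tens B C b c))"
  by (intro balancedI)
   (simp_all add: right_add BC.tens_add_left right_balanced AB.match AB.B.lact_closed)
next
 fix a assume "a:bcar A"
 then show "balanced B C R.T (\<lambda>b c. tens A (btens B C) a (tens B C b c))"
  by (intro balancedI)
   (simp_all add: right_add BC.tens_add_left BC.tens_add_right BC.tens_balanced)
qed

lemma trilinear_left: "trilinear L.T (\<lambda>a b c. tens (btens A B) C (tens A B a b) c)"
 unfolding trilinear_def
proof safe
 fix a assume "a:bcar A"
 then show "balanced B C L.T (\<lambda>b c. tens (btens A B) C (tens A B a b) c)"
  by (intro balancedI)
   (simp_all add: left_add AB.tens_add_right BC.match AB.B.ract_closed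
    flip: left_balanced)
next
 fix c assume "c:bcar C"
 then show "balanced A B L.T (\<lambda>a b. tens (btens A B) C (tens A B a b) c)"
  by (intro balancedI)
   (simp_all add: left_add AB.tens_add_left AB.tens_add_right AB.tens_balanced)
qed

text \<open>Existence is the left lift. The specification fixes values only on iterated pure
  tensors, so uniqueness comes from \<open>left_hom_eq\<close>, which already performs the reduction
  in two stages.\<close>

lemma
 shows assoc_fun_hom: "assoc_fun A B C:hom L.T R.T"
  and assoc_fun_ext: "assoc_fun A B C:extensional (car L.T)"
  and assoc_fun_tens: "a:bcar A ==> b:bcar B ==> c:bcar C ==>
   assoc_fun A B C (tens (btens A B) C (tens A B a b) c) = tens A (btens B C) a (tens B C b c)"
proof -
 let ?X = "(\<lambda>(a, b, c). tens (btens A B) C (tens A B a b) c) ` (bcar A \<times> bcar B \<times> bcar C)"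
 obtain h where h: "h:hom L.T R.T" "\<And>a b c. a:bcar A ==> b:bcar B ==> c:bcar C ==>
   h (tens (btens A B) C (tens A B a b) c) = tens A (btens B C) a (tens B C b c)"
  using left_lift[OF R.comm_group_utensor trilinear_right] by blast
 have eq: "assoc_fun A B C = restrict h (car L.T)"
  unfolding assoc_fun_def the_hom_def
 proof (rule the_equality)
  fix k assume k: "k:hom L.T R.T \<and> k:extensional (car L.T) \<and>
   (\<forall>a\<in>bcar A. \<forall>b\<in>bcar B. \<forall>c\<in>bcar C.
    k (tens (btens A B) C (tens A B a b) c) = tens A (btens B C) a (tens B C b c))"
  have "k x = h x" if "x:car L.T" for x
   by (rule left_hom_eq[OF R.T.is_group _ h(1) _ that]) (use k h(2) in auto)
  then show "k = restrict h (car L.T)"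
   using k by (auto intro!: extensionalityI[of k "car L.T"])
 qed (use h in \<open>auto simp: hom_restrict_iff\<close>)
 show "assoc_fun A B C:hom L.T R.T" unfolding eq using h(1) by (simp add: hom_restrict_iff)
 show "assoc_fun A B C:extensional (car L.T)" unfolding eq by simp
 show "a:bcar A ==> b:bcar B ==> c:bcar C ==>
   assoc_fun A B C (tens (btens A B) C (tens A B a b) c) = tens A (btens B C) a (tens B C b c)"
  unfolding eq using h(2) by simp
qed

end

lemma ubimodule_pairI:
 "bimodule A ==> bimodule B ==> rring A = lring B ==> ubimodule_pair A B"
 by (simp add: ubimodule_pair_def bimodule_pair_def bimodule_pair_axioms_def)

lemma ubimodule_tripleI:
 "bimodule A ==> bimodule B ==> bimodule C ==> rring A = lring B ==> rring B = lring C ==>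
  ubimodule_triple A B C"
 by (simp add: ubimodule_triple_def ubimodule_pairI)

lemma lring_bimod_tensor [simp]: "lring (btens A B) = lring A"
 and rring_bimod_tensor [simp]: "rring (btens A B) = rring B"
 and bgrp_bimod_tensor [simp]: "bgrp (btens A B) = uten A B"
 by (simp_all add: bimod_tensor_def)

lemmas bimodule_tensor [simp] = ubimodule_pair.bimodule_bimod_tensor[OF ubimodule_pairI]
 and tens_closed [simp] = ubimodule_pair.tens_closed[OF ubimodule_pairI]
 and lact_tens [simp] = ubimodule_pair.lact_tens[OF ubimodule_pairI]
 and ract_tens [simp] = ubimodule_pair.ract_tens[OF ubimodule_pairI]
 and assoc_fun_tens [simp] = ubimodule_triple.assoc_fun_tens[OF ubimodule_tripleI]
 and comm_group_utensor [simp] = ubimodule_pair.comm_group_utensor[OF ubimodule_pairI]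

lemma group_utensor [simp]:
 fixes A B :: "('u::infinite, 'u) bimod"
 shows "bimodule A ==> bimodule B ==> rring A = lring B ==> group (uten A B)"
 using comm_group_utensor[of A B] by (simp add: comm_group_def)

lemma bimodule_group: "bimodule M ==> group (bgrp M)"
 using bimodule.comm_group[of M] by (simp add: comm_group_def)

lemma lact_hom: "bimodule M ==> q:car (lring M) ==> lact M q:hom (bgrp M) (bgrp M)"
 by (simp add: hom_def bimodule.lact_closed bimodule.lact_add)

lemma ract_hom: "bimodule M ==> r:car (rring M) ==> (\<lambda>a. ract M a r):hom (bgrp M) (bgrp M)"
 by (simp add: hom_def bimodule.ract_closed bimodule.ract_add)

section \<open>The double category of bimodules\<close>

lemma ring_mapsD:
 assumes "\<sigma>:ring_maps"
 shows "ring (src \<sigma>)" "ring (tgt \<sigma>)" "fn \<sigma>:ring_hom (src \<sigma>) (tgt \<sigma>)"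
  "fn \<sigma>:extensional (car (src \<sigma>))"
 using assms by (simp_all add: ring_maps_def)

lemma ring_map_closed [simp]: "\<sigma>:ring_maps ==> x:car (src \<sigma>) ==> fn \<sigma> x:car (tgt \<sigma>)"
 using ring_hom_closed[OF ring_mapsD(3)] .

lemma ring_map_hom:
 assumes "\<sigma>:ring_maps"
 shows "fn \<sigma> \<one>\<^bsub>src \<sigma>\<^esub> = \<one>\<^bsub>tgt \<sigma>\<^esub>"
  and "x:car (src \<sigma>) ==> y:car (src \<sigma>) ==> fn \<sigma> (x \<otimes>\<^bsub>src \<sigma>\<^esub> y) = fn \<sigma> x \<otimes>\<^bsub>tgt \<sigma>\<^esub> fn \<sigma> y"
  and "x:car (src \<sigma>) ==> y:car (src \<sigma>) ==> fn \<sigma> (x \<oplus>\<^bsub>src \<sigma>\<^esub> y) = fn \<sigma> x \<oplus>\<^bsub>tgt \<sigma>\<^esub> fn \<sigma> y"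
 using ring_mapsD(3)[OF assms] by (simp_all add: ring_hom_def)

lemma ring_map_id_sel [simp]:
 "src (rid R) = R" "tgt (rid R) = R" "x:car R ==> fn (rid R) x = x"
 by (simp_all add: ring_map_id_def)

lemma ring_map_comp_sel [simp]:
 "src (ring_map_comp \<tau> \<sigma>) = src \<sigma>" "tgt (ring_map_comp \<tau> \<sigma>) = tgt \<tau>"
 "x:car (src \<sigma>) ==> fn (ring_map_comp \<tau> \<sigma>) x = fn \<tau> (fn \<sigma> x)"
 by (simp_all add: ring_map_comp_def compose_eq)

lemma ring_map_id_in [simp]: "rid R:ring_maps \<longleftrightarrow> ring R"
proof
 assume "ring R"
 then interpret R: ring R .
 have "fn (rid R):ring_hom R R" by (rule ring_hom_memI) simp_all
 moreover have "fn (rid R):extensional (car R)" by (simp add: ring_map_id_def)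
 ultimately show "rid R:ring_maps"
  using \<open>ring R\<close> unfolding ring_maps_def by simp
next
 assume "rid R:ring_maps"
 from ring_mapsD(1)[OF this] show "ring R" by simp
qed

lemma ring_map_comp_in [simp]:
 assumes "\<tau>:ring_maps" "\<sigma>:ring_maps" "src \<tau> = tgt \<sigma>"
 shows "ring_map_comp \<tau> \<sigma>:ring_maps"
proof -
 interpret ring "src \<sigma>" by (rule ring_mapsD(1)[OF assms(2)])
 have "fn (ring_map_comp \<tau> \<sigma>):ring_hom (src \<sigma>) (tgt \<tau>)"
  using assms ring_map_closed[OF assms(1)] ring_map_closed[OF assms(2)]
  by (intro ring_hom_memI)
   (simp_all add: ring_map_hom[OF assms(1), unfolded assms(3)] ring_map_hom[OF assms(2)] assms(3))
 then show ?thesis using assms by (simp add: ring_maps_def) (simp add: ring_map_comp_def)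
qed

lemma ring_map_eqI:
 assumes "\<sigma>:ring_maps" "\<tau>:ring_maps" "src \<sigma> = src \<tau>" "tgt \<sigma> = tgt \<tau>"
  "\<And>x. x:car (src \<sigma>) ==> fn \<sigma> x = fn \<tau> x"
 shows "\<sigma> = \<tau>"
proof (rule arrow.equality)
 show "fn \<sigma> = fn \<tau>"
  by (rule extensionalityI[of _ "car (src \<sigma>)"]) (use assms ring_mapsD(4)[OF assms(1)] ring_mapsD(4)[OF assms(2)] in auto)
qed (use assms in auto)

lemma ring_map_comp_id_left [simp]: "\<sigma>:ring_maps ==> tgt \<sigma> = R ==> ring_map_comp (rid R) \<sigma> = \<sigma>"
 by (rule ring_map_eqI) (auto simp: ring_mapsD)

lemma ring_map_comp_id_right [simp]: "\<sigma>:ring_maps ==> src \<sigma> = R ==> ring_map_comp \<sigma> (rid R) = \<sigma>"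
 by (rule ring_map_eqI) (auto simp: ring_mapsD)

lemma ring_map_comp_id_id [simp]: "ring_map_comp (rid R) (rid R) = rid R"
 by (simp add: ring_map_comp_def ring_map_id_def compose_def restrict_def fun_eq_iff)

lemma ring_map_comp_assoc:
 assumes "\<upsilon>:ring_maps" "\<tau>:ring_maps" "\<sigma>:ring_maps" "src \<upsilon> = tgt \<tau>" "src \<tau> = tgt \<sigma>"
 shows "ring_map_comp (ring_map_comp \<upsilon> \<tau>) \<sigma> = ring_map_comp \<upsilon> (ring_map_comp \<tau> \<sigma>)"
 by (rule ring_map_eqI) (use assms ring_map_closed[OF assms(3)] in auto)

section \<open>Squares of bimodules and when two of them are equal\<close>

lemma squaresD:
 assumes "s:squares"
 shows "bimodule (src s)" "bimodule (tgt s)" "lmor s:ring_maps" "rmor s:ring_maps"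
  "src (lmor s) = lring (src s)" "tgt (lmor s) = lring (tgt s)"
  "src (rmor s) = rring (src s)" "tgt (rmor s) = rring (tgt s)"
  "fn s:hom (bgrp (src s)) (bgrp (tgt s))" "fn s:extensional (bcar (src s))"
 using assms by (simp_all add: squares_def)

lemma square_closed: "s:squares ==> a:bcar (src s) ==> fn s a:bcar (tgt s)"
 using hom_in_carrier[OF squaresD(9)] .

lemma square_add: "s:squares ==> a:bcar (src s) ==> b:bcar (src s) ==>
  fn s (a \<otimes>\<^bsub>bgrp (src s)\<^esub> b) = fn s a \<otimes>\<^bsub>bgrp (tgt s)\<^esub> fn s b"
 using hom_mult[OF squaresD(9)] .

lemma square_biact:
 assumes "s:squares" "q:car (lring (src s))" "a:bcar (src s)" "r:car (rring (src s))"
 shows "fn s (ract (src s) (lact (src s) q a) r)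
     = ract (tgt s) (lact (tgt s) (fn (lmor s) q) (fn s a)) (fn (rmor s) r)"
 using assms by (simp add: squares_def)

text \<open>The right-hand scalar in the two-sided condition is set to one; the ring map on that
  side preserves it, and it acts trivially on both bimodules.\<close>

lemma square_lact:
 assumes "s:squares" "q:car (lring (src s))" "a:bcar (src s)"
 shows "fn s (lact (src s) q a) = lact (tgt s) (fn (lmor s) q) (fn s a)"
proof -
 interpret S: bimodule "src s" using assms squaresD by blast
 interpret T: bimodule "tgt s" using assms squaresD by blast
 have l: "fn (lmor s) q:car (lring (tgt s))"
  using ring_map_closed[OF squaresD(3)[OF assms(1)]] assms by (simp add: squaresD)
 have "\<one>\<^bsub>rring (src s)\<^esub>:car (rring (src s))" using S.ring_right ring.ring_simprules(6) by blast
 from square_biact[OF assms this] show ?thesis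
  using ring_map_hom(1)[OF squaresD(4)[OF assms(1)]] l assms
  by (simp add: squaresD S.one_ract S.lact_closed T.one_ract T.lact_closed square_closed)
qed

lemma square_ract:
 assumes "s:squares" "a:bcar (src s)" "r:car (rring (src s))"
 shows "fn s (ract (src s) a r) = ract (tgt s) (fn s a) (fn (rmor s) r)"
proof -
 interpret S: bimodule "src s" using assms squaresD by blast
 interpret T: bimodule "tgt s" using assms squaresD by blast
 have "\<one>\<^bsub>lring (src s)\<^esub>:car (lring (src s))" using S.ring_left ring.ring_simprules(6) by blast
 from square_biact[OF assms(1) this assms(2,3)] show ?thesis
  using ring_map_hom(1)[OF squaresD(3)[OF assms(1)]] assms
  by (simp add: squaresD S.one_lact T.one_lact square_closed)
qed

lemma squaresI:
 assumes "bimodule (src s)" "bimodule (tgt s)" "lmor s:ring_maps" "rmor s:ring_maps"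
  "src (lmor s) = lring (src s)" "tgt (lmor s) = lring (tgt s)"
  "src (rmor s) = rring (src s)" "tgt (rmor s) = rring (tgt s)"
  "fn s:hom (bgrp (src s)) (bgrp (tgt s))" "fn s:extensional (bcar (src s))"
  "\<And>q a. q:car (lring (src s)) ==> a:bcar (src s) ==>
   fn s (lact (src s) q a) = lact (tgt s) (fn (lmor s) q) (fn s a)"
  "\<And>a r. a:bcar (src s) ==> r:car (rring (src s)) ==>
   fn s (ract (src s) a r) = ract (tgt s) (fn s a) (fn (rmor s) r)"
 shows "s:squares"
 using assms bimodule.lact_closed[OF assms(1)] by (simp add: squares_def)

lemma square_eqI:
 assumes "s:squares" "s':squares" "src s = src s'" "tgt s = tgt s'" "lmor s = lmor s'" "rmor s = rmor s'"
  "\<And>a. a:bcar (src s) ==> fn s a = fn s' a"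
 shows "s = s'"
proof (rule square.equality)
 show "fn s = fn s'"
  by (rule extensionalityI[of _ "bcar (src s)"]) (use assms squaresD(10)[OF assms(1)] squaresD(10)[OF assms(2)] in auto)
qed (use assms in auto)

text \<open>The coherence laws compare squares whose source is a tensor product. This form serves
  the unit laws; the variants for three and four factors serve the laws with associators, up to the
  pentagon.\<close>

lemma square_eqI_tens:
 fixes s s' :: "'u::infinite square"
 assumes "s:squares" "s':squares" "src s = btens A B" "src s' = btens A B"
  "tgt s = tgt s'" "lmor s = lmor s'" "rmor s = rmor s'"
  "bimodule A" "bimodule B" "rring A = lring B"
  "\<And>a b. a:bcar A ==> b:bcar B ==> fn s (tens A B a b) = fn s' (tens A B a b)"
 shows "s = s'"
proof (rule square_eqI)
 interpret ubimodule_pair A B using assms by (intro ubimodule_pairI)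
 show "fn s a = fn s' a" if "a:bcar (src s)" for a
  by (rule utensor_hom_eq[of "bgrp (tgt s)"])
   (use assms that squaresD(9)[OF assms(1)] squaresD(9)[OF assms(2)] squaresD(2)[OF assms(2)] in \<open>auto simp: bimodule_group\<close>)
qed (use assms in auto)

lemma square_eqI_tens3:
 fixes s s' :: "'u::infinite square"
 assumes "s:squares" "s':squares" "src s = btens (btens A B) C" "src s' = btens (btens A B) C"
  "tgt s = tgt s'" "lmor s = lmor s'" "rmor s = rmor s'"
  "bimodule A" "bimodule B" "bimodule C" "rring A = lring B" "rring B = lring C"
  "\<And>a b c. a:bcar A ==> b:bcar B ==> c:bcar C ==>
   fn s (tens (btens A B) C (tens A B a b) c) = fn s' (tens (btens A B) C (tens A B a b) c)"
 shows "s = s'"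
proof (rule square_eqI)
 interpret ubimodule_triple A B C using assms by (intro ubimodule_tripleI)
 show "fn s a = fn s' a" if "a:bcar (src s)" for a
  by (rule left_hom_eq[of "bgrp (tgt s)"])
   (use assms that squaresD(9)[OF assms(1)] squaresD(9)[OF assms(2)] squaresD(2)[OF assms(2)] in \<open>auto simp: bimodule_group\<close>)
qed (use assms in auto)

lemma square_eqI_tens4:
 fixes s s' :: "'u::infinite square"
 assumes "s:squares" "s':squares"
  "src s = btens (btens (btens A B) C) E" "src s' = btens (btens (btens A B) C) E"
  "tgt s = tgt s'" "lmor s = lmor s'" "rmor s = rmor s'"
  and mod: "bimodule A" "bimodule B" "bimodule C" "bimodule E" "rring A = lring B" "rring B = lring C" "rring C = lring E"
  and eq: "\<And>a b c e. a:bcar A ==> b:bcar B ==> c:bcar C ==> e:bcar E ==>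
   fn s (tens (btens (btens A B) C) E (tens (btens A B) C (tens A B a b) c) e)
    = fn s' (tens (btens (btens A B) C) E (tens (btens A B) C (tens A B a b) c) e)"
 shows "s = s'"
proof (rule square_eqI_tens3[OF assms(1-7)])
 interpret ABC: ubimodule_triple A B C using mod by (intro ubimodule_tripleI)
 interpret ABCE: ubimodule_triple "btens A B" C E using mod by (intro ubimodule_tripleI) auto
 fix x c e assume x: "x:bcar (btens A B)" "c:bcar C" "e:bcar E"
 \<comment> \<open>Only the innermost tensor is still arbitrary. With \<open>c\<close> and
   \<open>e\<close> fixed, both sides are additive in it and can be compared on pure
   tensors.\<close>
 let ?t = "\<lambda>x. tens (btens (btens A B) C) E (tens (btens A B) C x c) e"
 have t: "?t:hom (uten A B) (uten (btens (btens A B) C) E)"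
  by (rule homI) (use x mod in \<open>simp_all add: ABC.left_add ABCE.left_add\<close>)
 have h: "fn s:hom (uten (btens (btens A B) C) E) (bgrp (tgt s))"
  "fn s':hom (uten (btens (btens A B) C) E) (bgrp (tgt s))"
  using squaresD(9)[OF assms(1)] squaresD(9)[OF assms(2)] assms(3-5) by auto
 show "fn s (?t x) = fn s' (?t x)"
  by (rule ABC.AB.utensor_hom_eq[OF _ hom_comp[OF t h(1)] hom_comp[OF t h(2)]])
   (use x eq squaresD(2)[OF assms(1)] in \<open>auto simp: bimodule_group\<close>)
qed (use mod in auto)

section \<open>Components of the double category of bimodules\<close>

lemma BIMOD_Vert [simp]:
 "Obj (Vert BIMOD) = {R. ring R}" "Arr (Vert BIMOD) = ring_maps" "Dom (Vert BIMOD) = src"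
 "Cod (Vert BIMOD) = tgt" "Ident (Vert BIMOD) = rid" "Comp (Vert BIMOD) = ring_map_comp"
 by (simp_all add: BIMOD_def)

lemma BIMOD_Horz [simp]:
 "Obj (Horz BIMOD) = {M. bimodule M}" "Arr (Horz BIMOD) = squares" "Dom (Horz BIMOD) = src"
 "Cod (Horz BIMOD) = tgt"
 by (simp_all add: BIMOD_def)

lemma BIMOD_Ident [simp]:
 "src (Ident (Horz BIMOD) M) = M" "tgt (Ident (Horz BIMOD) M) = M"
 "lmor (Ident (Horz BIMOD) M) = rid (lring M)" "rmor (Ident (Horz BIMOD) M) = rid (rring M)"
 "a:bcar M ==> fn (Ident (Horz BIMOD) M) a = a"
 by (simp_all add: BIMOD_def)

lemma BIMOD_Comp [simp]:
 "src (t \<bullet> s) = src s" "tgt (t \<bullet> s) = tgt t"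
 "lmor (t \<bullet> s) = ring_map_comp (lmor t) (lmor s)"
 "rmor (t \<bullet> s) = ring_map_comp (rmor t) (rmor s)"
 "a:bcar (src s) ==> fn (t \<bullet> s) a = fn t (fn s a)"
 by (simp_all add: BIMOD_def compose_eq)

lemma BIMOD_Delta [simp]:
 "OMap (Delta BIMOD) = regb"
 "src (AMap (Delta BIMOD) \<theta>) = regb (src \<theta>)" "tgt (AMap (Delta BIMOD) \<theta>) = regb (tgt \<theta>)"
 "fn (AMap (Delta BIMOD) \<theta>) = fn \<theta>" "lmor (AMap (Delta BIMOD) \<theta>) = \<theta>" "rmor (AMap (Delta BIMOD) \<theta>) = \<theta>"
 by (simp_all add: BIMOD_def)

lemma BIMOD_Lft_Rgt [simp]:
 "OMap (Lft BIMOD) = lring" "AMap (Lft BIMOD) = lmor" "OMap (Rgt BIMOD) = rring" "AMap (Rgt BIMOD) = rmor"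
 by (simp_all add: BIMOD_def)

lemma BIMOD_HComp [simp]:
 "A \<star>\<^bsub>BIMOD\<^esub> B = btens A B"
 "src (s \<diamondop> t) = btens (src s) (src t)"
 "tgt (s \<diamondop> t) = btens (tgt s) (tgt t)"
 "lmor (s \<diamondop> t) = lmor s" "rmor (s \<diamondop> t) = rmor t"
 "fn (s \<diamondop> t) = tensor_fun (src s) (src t) (tgt s) (tgt t) (fn s) (fn t)"
 by (simp_all add: BIMOD_def)

lemma BIMOD_Assoc [simp]:
 "src (Assoc BIMOD A B C) = btens (btens A B) C"
 "tgt (Assoc BIMOD A B C) = btens A (btens B C)"
 "lmor (Assoc BIMOD A B C) = rid (lring A)" "rmor (Assoc BIMOD A B C) = rid (rring C)"
 "fn (Assoc BIMOD A B C) = assoc_fun A B C"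
 by (simp_all add: BIMOD_def)

lemma BIMOD_LUnit [simp]:
 "src (LUnit BIMOD A) = btens (regb (lring A)) A" "tgt (LUnit BIMOD A) = A"
 "lmor (LUnit BIMOD A) = rid (lring A)" "rmor (LUnit BIMOD A) = rid (rring A)"
 "fn (LUnit BIMOD A) = lunit_fun A"
 by (simp_all add: BIMOD_def)

lemma BIMOD_RUnit [simp]:
 "src (RUnit BIMOD A) = btens A (regb (rring A))" "tgt (RUnit BIMOD A) = A"
 "lmor (RUnit BIMOD A) = rid (lring A)" "rmor (RUnit BIMOD A) = rid (rring A)"
 "fn (RUnit BIMOD A) = runit_fun A"
 by (simp_all add: BIMOD_def)

lemma regular_bimod_sel [simp]:
 "lring (regb R) = R" "rring (regb R) = R" "bgrp (regb R) = amon R"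
 "lact (regb R) = mult R" "ract (regb R) = mult R"
 by (simp_all add: regular_bimod_def)

lemma bimodule_regular [simp]: "ring R ==> bimodule (regb R)"
proof -
 assume "ring R"
 then interpret ring R .
 show ?thesis
 proof (rule bimodule.intro)
  show "comm_group (bgrp (regb R))"
   unfolding regular_bimod_sel by (rule a_comm_group)
 qed (simp_all add: \<open>ring R\<close> l_distr r_distr m_assoc)
qed

lemma square_Ident [simp]: "bimodule M ==> Ident (Horz BIMOD) M:squares"
 by (rule squaresI)
  (auto simp: bimodule.ring_left bimodule.ring_right bimodule.lact_closed bimodule.ract_closed
   intro!: hom_cong[OF bimodule_group hom_ident], simp add: BIMOD_def)

lemma square_Comp [simp]:
 assumes s: "s:squares" and t: "t:squares" and st: "src t = tgt s"
 shows "t \<bullet> s:squares"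
proof (rule squaresI)
 have "fn (t \<bullet> s):hom (bgrp (src s)) (bgrp (tgt t))"
  by (rule hom_cong[OF _ hom_comp[OF squaresD(9)[OF s] squaresD(9)[OF t, unfolded st]]])
   (use s t in \<open>simp_all add: squaresD bimodule_group\<close>)
 then show "fn (t \<bullet> s):hom (bgrp (src (t \<bullet> s))) (bgrp (tgt (t \<bullet> s)))"
  by simp
 show "fn (t \<bullet> s):extensional (bcar (src (t \<bullet> s)))"
  by (simp add: BIMOD_def)
next
 fix q a assume "q:car (lring (src (t \<bullet> s)))" "a:bcar (src (t \<bullet> s))"
 then show "fn (t \<bullet> s) (lact (src (t \<bullet> s)) q a) =
   lact (tgt (t \<bullet> s)) (fn (lmor (t \<bullet> s)) q) (fn (t \<bullet> s) a)"
  using square_lact[OF s] square_lact[OF t] square_closed[OF s] ring_map_closed[OF squaresD(3)[OF s]] s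
  by (simp add: squaresD st bimodule.lact_closed)
next
 fix a r assume "a:bcar (src (t \<bullet> s))" "r:car (rring (src (t \<bullet> s)))"
 then show "fn (t \<bullet> s) (ract (src (t \<bullet> s)) a r) =
   ract (tgt (t \<bullet> s)) (fn (t \<bullet> s) a) (fn (rmor (t \<bullet> s)) r)"
  using square_ract[OF s] square_ract[OF t] square_closed[OF s] ring_map_closed[OF squaresD(4)[OF s]] s
  by (simp add: squaresD st bimodule.ract_closed)
qed (use s t st in \<open>simp_all add: squaresD\<close>)

lemma square_Delta [simp]: "\<theta>:ring_maps ==> AMap (Delta BIMOD) \<theta>:squares"
 by (rule squaresI) (auto simp: ring_mapsD ring_map_hom hom_def)

section \<open>Horizontal composition of squares of bimodules\<close>

locale square_pair =
 fixes s t :: "'u::infinite square"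
 assumes s: "s:squares" and t: "t:squares" and match: "rmor s = lmor t"
begin

sublocale S: ubimodule_pair "src s" "src t"
 using s t match by (intro ubimodule_pairI) (simp_all add: squaresD flip: squaresD(5,7))

sublocale T: ubimodule_pair "tgt s" "tgt t"
 using s t match by (intro ubimodule_pairI) (simp_all add: squaresD flip: squaresD(6,8))

text \<open>A scalar of the middle ring leaves \<open>s\<close> on the right and enters
  \<open>t\<close> on the left through the same ring map, since \<open>rmor s = lmor t\<close>; the
  tensor relation of the targets then moves it across.\<close>

lemma balanced_tensor_fun: "balanced (src s) (src t) T.T (\<lambda>a b. T.t (fn s a) (fn t b))"
proof (rule balancedI)
 fix a r b assume *: "a:bcar (src s)" "r:car (rring (src s))" "b:bcar (src t)"
 then have "fn (rmor s) r:car (rring (tgt s))"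
  using ring_map_closed[OF squaresD(4)[OF s]] by (simp add: squaresD s)
 then show "T.t (fn s (ract (src s) a r)) (fn t b) = T.t (fn s a) (fn t (lact (src t) r b))"
  using * s t S.match by (simp add: square_ract square_lact square_closed T.tens_balanced match)
qed (simp_all add: s t square_closed square_add T.tens_add_left T.tens_add_right)

lemma tensor_fun_hom: "tensor_fun (src s) (src t) (tgt s) (tgt t) (fn s) (fn t):hom S.T T.T"
 and tensor_fun_ext: "tensor_fun (src s) (src t) (tgt s) (tgt t) (fn s) (fn t):extensional (car S.T)"
 and tensor_fun_tens: "a:bcar (src s) ==> b:bcar (src t) ==>
  tensor_fun (src s) (src t) (tgt s) (tgt t) (fn s) (fn t) (S.t a b) = T.t (fn s a) (fn t b)"
 unfolding tensor_fun_def
 using S.utensor_the_hom[OF T.comm_group_utensor balanced_tensor_fun]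
  S.utensor_the_hom_ext[OF T.comm_group_utensor balanced_tensor_fun]
  S.utensor_the_hom_tens[OF T.comm_group_utensor balanced_tensor_fun] by auto

lemma square_HComp: "s \<diamondop> t:squares"
proof (rule squaresI)
 let ?f = "tensor_fun (src s) (src t) (tgt s) (tgt t) (fn s) (fn t)"
 fix q x assume *: "q:car (lring (src (s \<diamondop> t)))" "x:bcar (src (s \<diamondop> t))"
 then have q: "q:car (lring (src s))" "fn (lmor s) q:car (lring (tgt s))"
  using ring_map_closed[OF squaresD(3)[OF s]] by (simp_all add: squaresD s)
 have "?f (lact (btens (src s) (src t)) q x) = lact (btens (tgt s) (tgt t)) (fn (lmor s) q) (?f x)"
  by (rule S.utensor_hom_eq[OF T.T.is_group hom_comp[OF S.lact_bimod_tensor_hom[OF q(1)] tensor_fun_hom]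
     hom_comp[OF tensor_fun_hom T.lact_bimod_tensor_hom[OF q(2)]]])
   (use * q in \<open>simp_all add: tensor_fun_tens S.A.lact_closed square_lact s t square_closed S.lact_tens T.lact_tens\<close>)
 then show "fn (s \<diamondop> t) (lact (src (s \<diamondop> t)) q x) =
   lact (tgt (s \<diamondop> t)) (fn (lmor (s \<diamondop> t)) q) (fn (s \<diamondop> t) x)"
  by simp
next
 let ?f = "tensor_fun (src s) (src t) (tgt s) (tgt t) (fn s) (fn t)"
 fix x r assume *: "x:bcar (src (s \<diamondop> t))" "r:car (rring (src (s \<diamondop> t)))"
 then have r: "r:car (rring (src t))" "fn (rmor t) r:car (rring (tgt t))"
  using ring_map_closed[OF squaresD(4)[OF t]] by (simp_all add: squaresD t)
 have "?f (ract (btens (src s) (src t)) x r) = ract (btens (tgt s) (tgt t)) (?f x) (fn (rmor t) r)"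
  by (rule S.utensor_hom_eq[OF T.T.is_group hom_comp[OF S.ract_bimod_tensor_hom[OF r(1)] tensor_fun_hom]
     hom_comp[OF tensor_fun_hom T.ract_bimod_tensor_hom[OF r(2)]]])
   (use * r in \<open>simp_all add: tensor_fun_tens S.B.ract_closed square_ract s t square_closed S.ract_tens T.ract_tens\<close>)
 then show "fn (s \<diamondop> t) (ract (src (s \<diamondop> t)) x r) =
   ract (tgt (s \<diamondop> t)) (fn (s \<diamondop> t) x) (fn (rmor (s \<diamondop> t)) r)"
  by simp
qed (use s t S.bimodule_bimod_tensor T.bimodule_bimod_tensor tensor_fun_hom tensor_fun_ext in \<open>simp_all add: squaresD\<close>)

end

lemmas square_HComp [simp] = square_pair.square_HComp[OF square_pair.intro]
 and tensor_fun_tens [simp] = square_pair.tensor_fun_tens[OF square_pair.intro]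

text \<open>The matching condition is stable under identities and composition because both legs are
  functors. Stated for an arbitrary pair of functors, since the categories of composable pairs of
  all three double categories are instances.\<close>

lemma category_pullback_cat:
 assumes "cat_functor H V R" "cat_functor H V L"
 shows "category (pullback_cat H R L)"
proof -
 interpret R: cat_functor H V R by fact
 interpret L: cat_functor H V L by fact
 note ax = R.A.Dom_Obj R.A.Cod_Obj R.A.Ident_Arr R.A.Dom_Ident R.A.Cod_Ident R.A.Comp_Arr R.A.Dom_Comp
  R.A.Cod_Comp R.A.Comp_assoc R.A.Comp_Ident_left R.A.Comp_Ident_right
 show ?thesis
  by unfold_locales
   (auto simp: pullback_cat_def ax R.AMap_Ident L.AMap_Ident R.AMap_Comp L.AMap_Comp
    simp flip: R.Dom_AMap L.Dom_AMap R.Cod_AMap L.Cod_AMap)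
qed

lemma pullback_cat_sel:
 "(g, f):Obj (pullback_cat H R L) \<longleftrightarrow> g:Obj H \<and> f:Obj H \<and> OMap R g = OMap L f"
 "(\<delta>, \<epsilon>):Arr (pullback_cat H R L) \<longleftrightarrow> \<delta>:Arr H \<and> \<epsilon>:Arr H \<and> AMap R \<delta> = AMap L \<epsilon>"
 "Dom (pullback_cat H R L) (\<delta>, \<epsilon>) = (Dom H \<delta>, Dom H \<epsilon>)"
 "Cod (pullback_cat H R L) (\<delta>, \<epsilon>) = (Cod H \<delta>, Cod H \<epsilon>)"
 "Ident (pullback_cat H R L) (g, f) = (Ident H g, Ident H f)"
 "(\<delta>', \<epsilon>') \<cdot>\<^bsub>pullback_cat H R L\<^esub> (\<delta>, \<epsilon>) = (\<delta>' \<cdot>\<^bsub>H\<^esub> \<delta>, \<epsilon>' \<cdot>\<^bsub>H\<^esub> \<epsilon>)"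
 by (simp_all add: pullback_cat_def)

text \<open>The inverse \<open>k\<close> is asked to be additive only. Its compatibility with the
  actions follows: it holds after applying \<open>s\<close>, and \<open>ks\<close> cancels
  \<open>s\<close>. Identity ring maps on the boundary are the case of the associators and
  unitors.\<close>

lemma square_isoI:
 fixes s :: "'u::infinite square"
 assumes s: "s:squares" and l: "lmor s = rid (lring (src s))" and r: "rmor s = rid (rring (src s))"
  and k: "k:hom (bgrp (tgt s)) (bgrp (src s))"
  and ks: "\<And>a. a:bcar (src s) ==> k (fn s a) = a" and sk: "\<And>b. b:bcar (tgt s) ==> fn s (k b) = b"
 shows "is_iso (Horz BIMOD) s"
proof -
 have m: "bimodule (src s)" "bimodule (tgt s)" using s squaresD by blast+
 have rings: "lring (tgt s) = lring (src s)" "rring (tgt s) = rring (src s)"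
  using squaresD(6,8)[OF s] l r by simp_all
 have kc: "k b:bcar (src s)" if "b:bcar (tgt s)" for b using hom_in_carrier[OF k that] .
 have ext: "(\<lambda>b\<in>bcar (tgt s). k b):hom (bgrp (tgt s)) (bgrp (src s))"
  using k m by (simp add: hom_restrict_iff bimodule_group)
 define g where "g = \<lparr>src = tgt s, fn = (\<lambda>b\<in>bcar (tgt s). k b), tgt = src s, lmor = lmor s, rmor = rmor s\<rparr>"
 have g: "g:squares"
 proof (rule squaresI)
  fix q b assume "q:car (lring (src g))" "b:bcar (src g)"
  then have *: "q:car (lring (src s))" "b:bcar (tgt s)" by (simp_all add: g_def rings)
  have "fn s (lact (src s) q (k b)) = lact (tgt s) q b"
   using square_lact[OF s *(1) kc[OF *(2)]] * by (simp add: l sk)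
  then have "k (lact (tgt s) q b) = lact (src s) q (k b)"
   using ks[of "lact (src s) q (k b)"] * m kc by (simp add: bimodule.lact_closed)
  then show "fn g (lact (src g) q b) = lact (tgt g) (fn (lmor g) q) (fn g b)"
   using * m by (simp add: g_def l bimodule.lact_closed rings)
 next
  fix q b assume "b:bcar (src g)" "q:car (rring (src g))"
  then have *: "q:car (rring (src s))" "b:bcar (tgt s)" by (simp_all add: g_def rings)
  have "fn s (ract (src s) (k b) q) = ract (tgt s) b q"
   using square_ract[OF s kc[OF *(2)] *(1)] * by (simp add: r sk)
  then have "k (ract (tgt s) b q) = ract (src s) (k b) q"
   using ks[of "ract (src s) (k b) q"] * m kc by (simp add: bimodule.ract_closed)
  then show "fn g (ract (src g) b q) = ract (tgt g) (fn g b) (fn (rmor g) q)"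
   using * m by (simp add: g_def r bimodule.ract_closed rings)
 qed (use m s ext in \<open>auto simp: g_def rings squaresD\<close>)
 have "g \<bullet> s = Ident (Horz BIMOD) (src s)"
  by (rule square_eqI) (use s g in \<open>auto simp: m, auto simp: g_def l r ks square_closed m\<close>)
 moreover have "s \<bullet> g = Ident (Horz BIMOD) (tgt s)"
 proof (rule square_eqI)
  show "fn (s \<bullet> g) a = fn (Ident (Horz BIMOD) (tgt s)) a" if "a:bcar (src (s \<bullet> g))" for a
  proof -
   have "a:bcar (src g)" "a:bcar (tgt s)" using that by (simp_all add: g_def)
   then show ?thesis by (simp add: sk) (simp add: g_def sk)
  qed
  show "s \<bullet> g:squares" by (rule square_Comp[OF g s]) (simp add: g_def)
 qed (simp_all add: m, simp_all add: g_def l r rings)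
 moreover have "src g = tgt s" "tgt g = src s" by (simp_all add: g_def)
 ultimately show ?thesis
  unfolding is_iso_def using s g by (auto simp: hom_arr_def)
qed

section \<open>Associators and unitors of bimodules\<close>

lemma square_Assoc [simp]:
 fixes A B C :: "('u::infinite, 'u) bimod"
 assumes "bimodule A" "bimodule B" "bimodule C" "rring A = lring B" "rring B = lring C"
 shows "Assoc BIMOD A B C:squares"
proof (rule squaresI)
 interpret ubimodule_triple A B C using assms by (intro ubimodule_tripleI)
 let ?L = "btens (btens A B) C" and ?R = "btens A (btens B C)"
 fix q x assume "q:car (lring (src (Assoc BIMOD A B C)))" "x:bcar (src (Assoc BIMOD A B C))"
 then have *: "q:car (lring A)" "x:car L.T" by simp_all
 then have q: "lact ?L q:hom L.T L.T" "lact ?R q:hom R.T R.T"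
  using L.lact_bimod_tensor_hom R.lact_bimod_tensor_hom by simp_all
 have "assoc_fun A B C (lact ?L q x) = lact ?R q (assoc_fun A B C x)"
  by (rule left_hom_eq[OF R.T.is_group hom_comp[OF q(1) assoc_fun_hom] hom_comp[OF assoc_fun_hom q(2)]])
   (use * assms in \<open>simp_all add: bimodule.lact_closed\<close>)
 then show "fn (Assoc BIMOD A B C) (lact (src (Assoc BIMOD A B C)) q x) =
   lact (tgt (Assoc BIMOD A B C)) (fn (lmor (Assoc BIMOD A B C)) q) (fn (Assoc BIMOD A B C) x)"
  using * by simp
next
 interpret ubimodule_triple A B C using assms by (intro ubimodule_tripleI)
 let ?L = "btens (btens A B) C" and ?R = "btens A (btens B C)"
 fix r x assume "x:bcar (src (Assoc BIMOD A B C))" "r:car (rring (src (Assoc BIMOD A B C)))"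
 then have *: "r:car (rring C)" "x:car L.T" by simp_all
 then have q: "(\<lambda>x. ract ?L x r):hom L.T L.T" "(\<lambda>x. ract ?R x r):hom R.T R.T"
  using L.ract_bimod_tensor_hom R.ract_bimod_tensor_hom by simp_all
 have "assoc_fun A B C (ract ?L x r) = ract ?R (assoc_fun A B C x) r"
  by (rule left_hom_eq[OF R.T.is_group hom_comp[OF q(1) assoc_fun_hom] hom_comp[OF assoc_fun_hom q(2)]])
   (use * assms in \<open>simp_all add: bimodule.ract_closed\<close>)
 then show "fn (Assoc BIMOD A B C) (ract (src (Assoc BIMOD A B C)) x r) =
   ract (tgt (Assoc BIMOD A B C)) (fn (Assoc BIMOD A B C) x) (fn (rmor (Assoc BIMOD A B C)) r)"
  using * by simp
next
 interpret ubimodule_triple A B C using assms by (intro ubimodule_tripleI)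
 show "fn (Assoc BIMOD A B C):hom (bgrp (src (Assoc BIMOD A B C))) (bgrp (tgt (Assoc BIMOD A B C)))"
  "fn (Assoc BIMOD A B C):extensional (bcar (src (Assoc BIMOD A B C)))"
  using assoc_fun_hom assoc_fun_ext by simp_all
qed (use assms in \<open>simp_all add: bimodule.ring_left bimodule.ring_right\<close>)

lemma iso_Assoc:
 fixes A B C :: "('u::infinite, 'u) bimod"
 assumes "bimodule A" "bimodule B" "bimodule C" "rring A = lring B" "rring B = lring C"
 shows "is_iso (Horz BIMOD) (Assoc BIMOD A B C)"
proof -
 interpret ubimodule_triple A B C using assms by (intro ubimodule_tripleI)
 obtain k where k: "k:hom R.T L.T" "\<And>a b c. a:bcar A ==> b:bcar B ==> c:bcar C ==>
   k (tens A (btens B C) a (tens B C b c)) = tens (btens A B) C (tens A B a b) c"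
  using right_lift[OF L.comm_group_utensor trilinear_left] by blast
 show ?thesis
 proof (rule square_isoI[where k=k])
  show "k (fn (Assoc BIMOD A B C) x) = x" if "x:bcar (src (Assoc BIMOD A B C))" for x
  proof -
   have x: "x:car L.T" using that by simp
   show ?thesis
    unfolding BIMOD_Assoc
    by (rule left_hom_eq[OF L.T.is_group hom_comp[OF assoc_fun_hom k(1)] hom_ident _ x])
     (use assms in \<open>simp add: k(2)\<close>)
  qed
  show "fn (Assoc BIMOD A B C) (k x) = x" if "x:bcar (tgt (Assoc BIMOD A B C))" for x
  proof -
   have x: "x:car R.T" using that by simp
   show ?thesis
    unfolding BIMOD_Assoc
    by (rule right_hom_eq[OF R.T.is_group hom_comp[OF k(1) assoc_fun_hom] hom_ident _ x])
     (use assms in \<open>simp add: k(2)\<close>)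
  qed
 qed (use assms k(1) in simp_all)
qed

context
 fixes A :: "('u::infinite, 'u) bimod"
 assumes A: "bimodule A"
begin

interpretation A: bimodule A by (rule A)
interpretation L: ubimodule_pair "regb (lring A)" A
 by (intro ubimodule_pairI) (simp_all add: A A.ring_left)
interpretation R: ubimodule_pair A "regb (rring A)"
 by (intro ubimodule_pairI) (simp_all add: A A.ring_right)

lemma balanced_lunit: "balanced (regb (lring A)) A (bgrp A) (lact A)"
 by (rule balancedI) (simp_all add: A.lact_closed A.lact_add A.add_lact A.mult_lact)

lemma balanced_runit: "balanced A (regb (rring A)) (bgrp A) (ract A)"
 by (rule balancedI) (simp_all add: A.ract_closed A.ract_add A.add_ract A.mult_ract)

lemma lunit_fun_hom: "lunit_fun A:hom L.T (bgrp A)"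
 and lunit_fun_ext: "lunit_fun A:extensional (car L.T)"
 and lunit_fun_tens [simp]: "q:car (lring A) ==> a:bcar A ==>
  lunit_fun A (tens (regb (lring A)) A q a) = lact A q a"
 using L.utensor_the_hom[OF A.comm_group balanced_lunit] L.utensor_the_hom_ext[OF A.comm_group balanced_lunit]
  L.utensor_the_hom_tens[OF A.comm_group balanced_lunit] by (simp_all add: lunit_fun_def)

lemma runit_fun_hom: "runit_fun A:hom R.T (bgrp A)"
 and runit_fun_ext: "runit_fun A:extensional (car R.T)"
 and runit_fun_tens [simp]: "a:bcar A ==> r:car (rring A) ==>
  runit_fun A (tens A (regb (rring A)) a r) = ract A a r"
 using R.utensor_the_hom[OF A.comm_group balanced_runit] R.utensor_the_hom_ext[OF A.comm_group balanced_runit]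
  R.utensor_the_hom_tens[OF A.comm_group balanced_runit] by (simp_all add: runit_fun_def)

lemma square_LUnit [simp]: "LUnit BIMOD A:squares"
proof (rule squaresI)
 fix q x assume "q:car (lring (src (LUnit BIMOD A)))" "x:bcar (src (LUnit BIMOD A))"
 then have *: "q:car (lring A)" "x:car L.T" by simp_all
 interpret ring "lring A" by (rule A.ring_left)
 have "lunit_fun A (lact (btens (regb (lring A)) A) q x) = lact A q (lunit_fun A x)"
  by (rule L.utensor_hom_eq[OF bimodule_group[OF A] hom_comp[OF L.lact_bimod_tensor_hom lunit_fun_hom]
     hom_comp[OF lunit_fun_hom lact_hom[OF A]]])
   (use * A A.ring_left in \<open>simp_all add: A.mult_lact\<close>)
 then show "fn (LUnit BIMOD A) (lact (src (LUnit BIMOD A)) q x) =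
   lact (tgt (LUnit BIMOD A)) (fn (lmor (LUnit BIMOD A)) q) (fn (LUnit BIMOD A) x)"
  using * by simp
next
 fix r x assume "x:bcar (src (LUnit BIMOD A))" "r:car (rring (src (LUnit BIMOD A)))"
 then have *: "r:car (rring A)" "x:car L.T" by simp_all
 have "lunit_fun A (ract (btens (regb (lring A)) A) x r) = ract A (lunit_fun A x) r"
  by (rule L.utensor_hom_eq[OF bimodule_group[OF A] hom_comp[OF L.ract_bimod_tensor_hom lunit_fun_hom]
     hom_comp[OF lunit_fun_hom ract_hom[OF A]]])
   (use * A A.ring_left in \<open>simp_all add: A.lact_ract A.ract_closed\<close>)
 then show "fn (LUnit BIMOD A) (ract (src (LUnit BIMOD A)) x r) =
   ract (tgt (LUnit BIMOD A)) (fn (LUnit BIMOD A) x) (fn (rmor (LUnit BIMOD A)) r)"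
  using * by simp
qed (use A A.ring_left A.ring_right lunit_fun_hom lunit_fun_ext in simp_all)

lemma square_RUnit [simp]: "RUnit BIMOD A:squares"
proof (rule squaresI)
 fix q x assume "q:car (lring (src (RUnit BIMOD A)))" "x:bcar (src (RUnit BIMOD A))"
 then have *: "q:car (lring A)" "x:car R.T" by simp_all
 have "runit_fun A (lact (btens A (regb (rring A))) q x) = lact A q (runit_fun A x)"
  by (rule R.utensor_hom_eq[OF bimodule_group[OF A] hom_comp[OF R.lact_bimod_tensor_hom runit_fun_hom]
     hom_comp[OF runit_fun_hom lact_hom[OF A]]])
   (use * A A.ring_right in \<open>simp_all add: A.lact_ract A.lact_closed\<close>)
 then show "fn (RUnit BIMOD A) (lact (src (RUnit BIMOD A)) q x) =
   lact (tgt (RUnit BIMOD A)) (fn (lmor (RUnit BIMOD A)) q) (fn (RUnit BIMOD A) x)"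
  using * by simp
next
 fix r x assume "x:bcar (src (RUnit BIMOD A))" "r:car (rring (src (RUnit BIMOD A)))"
 then have *: "r:car (rring A)" "x:car R.T" by simp_all
 interpret ring "rring A" by (rule A.ring_right)
 have "runit_fun A (ract (btens A (regb (rring A))) x r) = ract A (runit_fun A x) r"
  by (rule R.utensor_hom_eq[OF bimodule_group[OF A] hom_comp[OF R.ract_bimod_tensor_hom runit_fun_hom]
     hom_comp[OF runit_fun_hom ract_hom[OF A]]])
   (use * A A.ring_right in \<open>simp_all add: A.mult_ract\<close>)
 then show "fn (RUnit BIMOD A) (ract (src (RUnit BIMOD A)) x r) =
   ract (tgt (RUnit BIMOD A)) (fn (RUnit BIMOD A) x) (fn (rmor (RUnit BIMOD A)) r)"
  using * by simp
qed (use A A.ring_left A.ring_right runit_fun_hom runit_fun_ext in simp_all)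

lemma iso_LUnit: "is_iso (Horz BIMOD) (LUnit BIMOD A)"
proof -
 interpret ring "lring A" by (rule A.ring_left)
 let ?k = "\<lambda>a. tens (regb (lring A)) A \<one>\<^bsub>lring A\<^esub> a"
 have k: "?k:hom (bgrp A) L.T" by (rule homI) (simp_all add: A A.ring_left L.tens_add_right)
 \<comment> \<open>Balancedness gives \<open>1 \<otimes> qa = q \<otimes> a\<close>; hence
   \<open>a \<mapsto> 1 \<otimes> a\<close> is inverse to the action map on pure tensors.\<close>
 have absorb: "q:car (lring A) ==> a:bcar A ==> ?k (lact A q a) = tens (regb (lring A)) A q a" for q a
  using L.tens_balanced[of "\<one>\<^bsub>lring A\<^esub>" q a] by simp
 have ka: "?k (lunit_fun A x) = x" if "x:car L.T" for x
  by (rule L.utensor_hom_eq[OF L.T.is_group hom_comp[OF lunit_fun_hom k] hom_ident _ that])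
   (use absorb in simp)
 show ?thesis
  by (rule square_isoI[where k = ?k]) (use k ka A.ring_left A in \<open>simp_all add: A.one_lact\<close>)
qed

lemma iso_RUnit: "is_iso (Horz BIMOD) (RUnit BIMOD A)"
proof -
 interpret ring "rring A" by (rule A.ring_right)
 let ?k = "\<lambda>a. tens A (regb (rring A)) a \<one>\<^bsub>rring A\<^esub>"
 have k: "?k:hom (bgrp A) R.T" by (rule homI) (simp_all add: A A.ring_right R.tens_add_left)
 have absorb: "q:car (rring A) ==> a:bcar A ==> ?k (ract A a q) = tens A (regb (rring A)) a q" for q a
  using R.tens_balanced[of a q "\<one>\<^bsub>rring A\<^esub>"] by simp
 have ka: "?k (runit_fun A x) = x" if "x:car R.T" for x
  by (rule R.utensor_hom_eq[OF R.T.is_group hom_comp[OF runit_fun_hom k] hom_ident _ that])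
   (use absorb in simp)
 show ?thesis
  by (rule square_isoI[where k = ?k]) (use k ka A.ring_right A in \<open>simp_all add: A.one_ract\<close>)
qed

end

section \<open>Axioms of the double category of bimodules\<close>

lemma category_Vert_BIMOD: "category (Vert BIMOD)"
 by unfold_locales (auto simp: ring_mapsD ring_map_comp_assoc)

lemma category_Horz_BIMOD: "category (Horz (BIMOD :: ('u::infinite ring, 'u ring_map, ('u, 'u) bimod, 'u square) double_cat))"
proof
 fix h g f :: "'u square"
 assume "h:Arr (Horz BIMOD)" "g:Arr (Horz BIMOD)" "f:Arr (Horz BIMOD)"
  "Dom (Horz BIMOD) h = Cod (Horz BIMOD) g" "Dom (Horz BIMOD) g = Cod (Horz BIMOD) f"
 then have *: "h:squares" "g:squares" "f:squares" "src h = tgt g" "src g = tgt f" by simp_all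
 show "h \<bullet> g \<bullet> f = h \<bullet> (g \<bullet> f)"
 proof (rule square_eqI)
  fix a assume "a:bcar (src (h \<bullet> g \<bullet> f))"
  then show "fn (h \<bullet> g \<bullet> f) a = fn (h \<bullet> (g \<bullet> f)) a"
   using * square_closed[OF *(3)] by simp
 qed (use * in \<open>simp_all add: ring_map_comp_assoc squaresD\<close>)
next
 fix f :: "'u square" assume "f:Arr (Horz BIMOD)"
 then have f: "f:squares" by simp
 show "Ident (Horz BIMOD) (Cod (Horz BIMOD) f) \<bullet> f = f"
  by (rule square_eqI) (use f in \<open>simp_all add: squaresD square_closed\<close>)
 show "f \<bullet> Ident (Horz BIMOD) (Dom (Horz BIMOD) f) = f"
  by (rule square_eqI) (use f in \<open>simp_all add: squaresD square_closed\<close>)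
qed (auto simp: squaresD)

lemma functor_Delta_BIMOD: "cat_functor (Vert BIMOD) (Horz BIMOD) (Delta BIMOD)"
proof -
 have c: "AMap (Delta BIMOD) (ring_map_comp g f) = AMap (Delta BIMOD) g \<bullet> AMap (Delta BIMOD) f"
  if "g:ring_maps" "f:ring_maps" "src g = tgt f" for g f :: "'a ring_map"
  by (rule square_eqI) (use that in simp_all)
 have i: "AMap (Delta BIMOD) (rid R) = Ident (Horz BIMOD) (regb R)" if "ring R" for R :: "'a ring"
  by (rule square_eqI) (use that in simp_all)
 show ?thesis
  unfolding cat_functor_def cat_functor_axioms_def
  by (simp add: category_Vert_BIMOD category_Horz_BIMOD ring_mapsD c i)
qed

lemma functor_Lft_BIMOD: "cat_functor (Horz BIMOD) (Vert BIMOD) (Lft BIMOD)"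
 and functor_Rgt_BIMOD: "cat_functor (Horz BIMOD) (Vert BIMOD) (Rgt BIMOD)"
 unfolding cat_functor_def cat_functor_axioms_def
 by (simp_all add: category_Vert_BIMOD category_Horz_BIMOD squaresD bimodule.ring_left bimodule.ring_right)

lemma functor_HComp_BIMOD: "cat_functor (hcomposable BIMOD) (Horz BIMOD) (HComp BIMOD)"
proof -
 have c: "(s' \<bullet> s) \<diamondop> (t' \<bullet> t) = (s' \<diamondop> t') \<bullet> (s \<diamondop> t)"
  if "s':squares" "t':squares" "s:squares" "t:squares" "rmor s' = lmor t'" "rmor s = lmor t"
   "src s' = tgt s" "src t' = tgt t" for s s' t t' :: "'a square"
 proof (rule square_eqI_tens[where A = "src s" and B = "src t"])
  interpret square_pair s t using that by unfold_locales
  interpret st': square_pair s' t' using that by unfold_locales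
  interpret c: square_pair "s' \<bullet> s" "t' \<bullet> t" using that by unfold_locales simp_all
  show "(s' \<bullet> s) \<diamondop> (t' \<bullet> t):squares" by (rule c.square_HComp)
  show "rring (src s) = lring (src t)" by (rule S.match)
  fix a b assume ab: "a:bcar (src s)" "b:bcar (src t)"
  then have "fn ((s' \<bullet> s) \<diamondop> (t' \<bullet> t)) (tens (src s) (src t) a b)
   = tens (tgt s') (tgt t') (fn s' (fn s a)) (fn t' (fn t b))"
   using c.tensor_fun_tens[of a b] by simp
  also have "\<dots> = fn ((s' \<diamondop> t') \<bullet> (s \<diamondop> t)) (tens (src s) (src t) a b)"
   using ab that square_closed[OF s] square_closed[OF t] st'.tensor_fun_tens[of "fn s a" "fn t b"]
   by (simp add: tensor_fun_tens S.tens_closed)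
  finally show "fn ((s' \<bullet> s) \<diamondop> (t' \<bullet> t)) (tens (src s) (src t) a b)
   = fn ((s' \<diamondop> t') \<bullet> (s \<diamondop> t)) (tens (src s) (src t) a b)" .
 qed (use that in \<open>simp_all add: squaresD\<close>)
 have i: "Ident (Horz BIMOD) A \<diamondop> Ident (Horz BIMOD) B = Ident (Horz BIMOD) (btens A B)"
  if "bimodule A" "bimodule B" "rring A = lring B" for A B :: "('a, 'a) bimod"
 proof (rule square_eqI_tens[where A = A and B = B])
  interpret square_pair "Ident (Horz BIMOD) A" "Ident (Horz BIMOD) B" using that by unfold_locales simp_all
  show "fn (Ident (Horz BIMOD) A \<diamondop> Ident (Horz BIMOD) B) (tens A B a b) =
   fn (Ident (Horz BIMOD) (btens A B)) (tens A B a b)" if "a:bcar A" "b:bcar B" for a b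
   using that tensor_fun_tens[of a b] S.tens_closed[of a b] by simp
 qed (use that in simp_all)
 have m: "rring (src s) = lring (src t)" "rring (tgt s) = lring (tgt t)"
  if "s:squares" "t:squares" "rmor s = lmor t" for s t :: "'a square"
  using that by (metis squaresD(5,7)) (metis that squaresD(6,8))
 show ?thesis
  unfolding cat_functor_def cat_functor_axioms_def
  by (auto simp: category_Horz_BIMOD category_pullback_cat[OF functor_Rgt_BIMOD functor_Lft_BIMOD]
    pullback_cat_sel squaresD m c i simp del: BIMOD_HComp(6))
qed

declare BIMOD_HComp(6) [simp del]

text \<open>Replaces the \<open>THE\<close> behind a horizontal composite by its values on pure
  tensors. The sources are named by separate equations so that the formula also fits factors that
  are tensor products themselves.\<close>

lemma fn_HComp [simp]:
 fixes s t :: "'u::infinite square"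
 assumes "s:squares" "t:squares" "rmor s = lmor t" "src s = A" "src t = B" "a:bcar A" "b:bcar B"
 shows "fn (s \<diamondop> t) (tens A B a b) = tens (tgt s) (tgt t) (fn s a) (fn t b)"
 using assms tensor_fun_tens[of s t a b] by (simp add: BIMOD_HComp(6))

lemma square_closed' [simp]:
 assumes "s:squares" "tgt s = B" "a:bcar (src s)"
 shows "fn s a:bcar B"
 using square_closed[OF assms(1,3)] assms(2) by simp

lemma square_match:
 assumes "s:squares" "t:squares" "rmor s = lmor t"
 shows "rring (src s) = lring (src t)" "rring (tgt s) = lring (tgt t)"
 using assms squaresD(5-8)[OF assms(1)] squaresD(5-8)[OF assms(2)] by simp_all

text \<open>In each coherence law both sides have the same boundary and are evaluated on pure
  tensors of two, three or four factors. Naturality of the unitors is linearity of squares, and the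
  triangle is the tensor relation over the middle ring.\<close>

theorem double_category_BIMOD:
 "double_category (BIMOD :: ('u::infinite ring, 'u ring_map, ('u, 'u) bimod, 'u square) double_cat)"
proof (intro double_category.intro functor_Delta_BIMOD functor_Lft_BIMOD functor_Rgt_BIMOD functor_HComp_BIMOD
  double_category_axioms.intro)
 fix \<gamma> \<delta> \<epsilon> :: "'u square"
 assume "(\<gamma>, \<delta>):Arr (hcomposable BIMOD)" "(\<delta>, \<epsilon>):Arr (hcomposable BIMOD)"
 then have s: "\<gamma>:squares" "\<delta>:squares" "\<epsilon>:squares" "rmor \<gamma> = lmor \<delta>" "rmor \<delta> = lmor \<epsilon>"
  by (simp_all add: pullback_cat_sel)
 show "Assoc BIMOD (Cod (Horz BIMOD) \<gamma>) (Cod (Horz BIMOD) \<delta>) (Cod (Horz BIMOD) \<epsilon>) \<bullet>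
   ((\<gamma> \<diamondop> \<delta>) \<diamondop> \<epsilon>) =
  (\<gamma> \<diamondop> (\<delta> \<diamondop> \<epsilon>)) \<bullet>
   Assoc BIMOD (Dom (Horz BIMOD) \<gamma>) (Dom (Horz BIMOD) \<delta>) (Dom (Horz BIMOD) \<epsilon>)"
  by (rule square_eqI_tens3[where A = "src \<gamma>" and B = "src \<delta>" and C = "src \<epsilon>"])
   (use s square_match[OF s(1,2,4)] square_match[OF s(2,3,5)] in \<open>simp_all add: squaresD\<close>)
next
 fix \<epsilon> :: "'u square"
 assume "\<epsilon>:Arr (Horz BIMOD)"
 then have s: "\<epsilon>:squares" by simp
 show "LUnit BIMOD (Cod (Horz BIMOD) \<epsilon>) \<bullet> (AMap (Delta BIMOD) (AMap (Lft BIMOD) \<epsilon>) \<diamondop> \<epsilon>) =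
  \<epsilon> \<bullet> LUnit BIMOD (Dom (Horz BIMOD) \<epsilon>)"
  by (rule square_eqI_tens[where A = "regb (lring (src \<epsilon>))" and B = "src \<epsilon>"])
   (use s ring_map_closed[OF squaresD(3)[OF s]] in
    \<open>simp_all add: squaresD square_lact bimodule.ring_left[OF squaresD(1)]\<close>)
 show "RUnit BIMOD (Cod (Horz BIMOD) \<epsilon>) \<bullet> (\<epsilon> \<diamondop> AMap (Delta BIMOD) (AMap (Rgt BIMOD) \<epsilon>)) =
  \<epsilon> \<bullet> RUnit BIMOD (Dom (Horz BIMOD) \<epsilon>)"
  by (rule square_eqI_tens[where A = "src \<epsilon>" and B = "regb (rring (src \<epsilon>))"])
   (use s ring_map_closed[OF squaresD(4)[OF s]] in
    \<open>simp_all add: squaresD square_ract bimodule.ring_right[OF squaresD(1)]\<close>)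
next
 fix K H G F :: "('u, 'u) bimod"
 assume "(K, H):Obj (hcomposable BIMOD)" "(H, G):Obj (hcomposable BIMOD)" "(G, F):Obj (hcomposable BIMOD)"
 then have m: "bimodule K" "bimodule H" "bimodule G" "bimodule F" "rring K = lring H" "rring H = lring G" "rring G = lring F"
  by (simp_all add: pullback_cat_sel)
 show "Assoc BIMOD K H (G \<star>\<^bsub>BIMOD\<^esub> F) \<bullet> Assoc BIMOD (K \<star>\<^bsub>BIMOD\<^esub> H) G F =
  (Ident (Horz BIMOD) K \<diamondop> Assoc BIMOD H G F) \<bullet> Assoc BIMOD K (H \<star>\<^bsub>BIMOD\<^esub> G) F \<bullet>
   (Assoc BIMOD K H G \<diamondop> Ident (Horz BIMOD) F)"
  by (rule square_eqI_tens4[where A = K and B = H and C = G and E = F]) (use m in simp_all)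
next
 fix G F :: "('u, 'u) bimod"
 assume "(G, F):Obj (hcomposable BIMOD)"
 then have m: "bimodule G" "bimodule F" "rring G = lring F" by (simp_all add: pullback_cat_sel)
 have r: "ring (lring F)" "ring (lring G)" "ring (rring F)" using m bimodule.ring_left bimodule.ring_right by blast+
 have b: "tens G F (ract G a r) b = tens G F a (lact F r b)" if "a:bcar G" "r:car (lring F)" "b:bcar F" for a r b
  using ubimodule_pair.tens_balanced[OF ubimodule_pairI[OF m]] that m by simp
 show "(Ident (Horz BIMOD) G \<diamondop> LUnit BIMOD F) \<bullet>
   Assoc BIMOD G (OMap (Delta BIMOD) (OMap (Rgt BIMOD) G)) F = RUnit BIMOD G \<diamondop> Ident (Horz BIMOD) F"
  by (rule square_eqI_tens3[where A = G and B = "regb (rring G)" and C = F])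
   (use m r lunit_fun_tens[OF m(2)] runit_fun_tens[OF m(1)] in \<open>simp_all add: b\<close>)
qed (auto simp: pullback_cat_sel hom_arr_def iso_Assoc iso_LUnit iso_RUnit bimodule.ring_left bimodule.ring_right)

section \<open>The double functor from rings to bimodules\<close>

lemma category_discrete_cat: "category (discrete_cat X)"
 by unfold_locales (auto simp: discrete_cat_def)

lemma discrete_cat_sel [simp]:
 "Obj (discrete_cat X) = X" "Arr (discrete_cat X) = X" "Dom (discrete_cat X) = (\<lambda>x. x)"
 "Cod (discrete_cat X) = (\<lambda>x. x)" "Ident (discrete_cat X) = (\<lambda>x. x)" "Comp (discrete_cat X) = (\<lambda>g f. f)"
 by (simp_all add: discrete_cat_def)

lemma is_iso_discrete_cat [simp]: "is_iso (discrete_cat X) x \<longleftrightarrow> x:X"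
 by (auto simp: is_iso_def hom_arr_def)

lemma RING_sel [simp]:
 "Vert RING = discrete_cat {R. ring R}" "Horz RING = discrete_cat ring_maps"
 "OMap (Delta RING) = rid" "AMap (Delta RING) = rid"
 "OMap (Lft RING) = tgt" "AMap (Lft RING) = tgt" "OMap (Rgt RING) = src" "AMap (Rgt RING) = src"
 "\<tau> \<star>\<^bsub>RING\<^esub> \<sigma> = ring_map_comp \<tau> \<sigma>" "\<tau> \<star>\<star>\<^bsub>RING\<^esub> \<sigma> = ring_map_comp \<tau> \<sigma>"
 "Assoc RING \<upsilon> \<tau> \<sigma> = ring_map_comp \<upsilon> (ring_map_comp \<tau> \<sigma>)" "LUnit RING \<sigma> = \<sigma>" "RUnit RING \<sigma> = \<sigma>"
 by (simp_all add: RING_def)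

theorem double_category_RING: "double_category RING"
proof -
 have L: "cat_functor (Horz RING) (Vert RING) (Lft RING)" and R: "cat_functor (Horz RING) (Vert RING) (Rgt RING)"
  and D: "cat_functor (Vert RING) (Horz RING) (Delta RING)"
  unfolding cat_functor_def cat_functor_axioms_def by (auto simp: category_discrete_cat ring_mapsD)
 have H: "cat_functor (hcomposable RING) (Horz RING) (HComp RING)"
  unfolding cat_functor_def cat_functor_axioms_def
  by (auto simp: category_pullback_cat[OF R L, simplified] pullback_cat_sel category_discrete_cat)
 show ?thesis
  by (intro double_category.intro D L R H double_category_axioms.intro)
   (auto simp: pullback_cat_sel hom_arr_def ring_map_comp_assoc ring_mapsD)
qed

section \<open>Restriction of scalars along ring maps\<close>

lemma restriction_bimod_sel [simp]:
 "lring (rbim \<sigma>) = tgt \<sigma>" "rring (rbim \<sigma>) = src \<sigma>"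
 "bgrp (rbim \<sigma>) = amon (tgt \<sigma>)" "lact (rbim \<sigma>) = mult (tgt \<sigma>)"
 "ract (rbim \<sigma>) s r = s \<otimes>\<^bsub>tgt \<sigma>\<^esub> fn \<sigma> r"
 by (simp_all add: restriction_bimod_def)

lemma bimodule_restriction [simp]:
 assumes "\<sigma>:ring_maps"
 shows "bimodule (rbim \<sigma>)"
proof -
 interpret S: ring "tgt \<sigma>" by (rule ring_mapsD(2)[OF assms])
 show ?thesis
 proof (rule bimodule.intro)
 show "comm_group (bgrp (rbim \<sigma>))"
  unfolding restriction_bimod_sel by (rule S.a_comm_group)
 fix r r' a b
 show "ract (rbim \<sigma>) (a \<otimes>\<^bsub>bgrp (rbim \<sigma>)\<^esub> b) r =
   ract (rbim \<sigma>) a r \<otimes>\<^bsub>bgrp (rbim \<sigma>)\<^esub> ract (rbim \<sigma>) b r"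
  if "r:car (rring (rbim \<sigma>))" "a:bcar (rbim \<sigma>)" "b:bcar (rbim \<sigma>)"
  using that assms by (simp add: S.l_distr)
qed (use assms in \<open>simp_all add: ring_mapsD ring_map_hom S.l_distr S.r_distr S.m_assoc\<close>)
qed

text \<open>The unit map \<open>T \<otimes> S \<rightarrow> T\<close> of the tensor product over
  \<open>S\<close>, where \<open>S\<close> acts on \<open>T\<close> through \<tau>. Its target is
  \<open>T\<close> as a bimodule over the source of \<sigma>.\<close>

definition restriction_comp :: "'u::infinite ring_map \<Rightarrow> 'u ring_map \<Rightarrow> 'u square" where
 "restriction_comp \<tau> \<sigma> =
  (let A = rbim \<tau>; B = rbim \<sigma>; C = rbim (ring_map_comp \<tau> \<sigma>)
  in \<lparr>src = btens A B,
   fn = the_hom (uten A B) (bgrp C)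
    (\<lambda>h. \<forall>a\<in>bcar A. \<forall>b\<in>bcar B. h (tens A B a b) = a \<otimes>\<^bsub>tgt \<tau>\<^esub> fn \<tau> b),
   tgt = C, lmor = rid (tgt \<tau>), rmor = rid (src \<sigma>)\<rparr>)"

lemma restriction_comp_sel [simp]:
 "src (restriction_comp \<tau> \<sigma>) = btens (rbim \<tau>) (rbim \<sigma>)"
 "tgt (restriction_comp \<tau> \<sigma>) = rbim (ring_map_comp \<tau> \<sigma>)"
 "lmor (restriction_comp \<tau> \<sigma>) = rid (tgt \<tau>)" "rmor (restriction_comp \<tau> \<sigma>) = rid (src \<sigma>)"
 by (simp_all add: restriction_comp_def Let_def)

context
 fixes \<tau> \<sigma> :: "'u::infinite ring_map"
 assumes m: "\<tau>:ring_maps" "\<sigma>:ring_maps" "src \<tau> = tgt \<sigma>"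
begin

interpretation P: ubimodule_pair "rbim \<tau>" "rbim \<sigma>"
 using m by (intro ubimodule_pairI) simp_all
interpretation T: ring "tgt \<tau>" by (rule ring_mapsD(2)[OF m(1)])

lemma fn_closed: "b:car (tgt \<sigma>) ==> fn \<tau> b:car (tgt \<tau>)"
 using ring_map_closed[OF m(1)] m(3) by simp

lemma balanced_restriction:
 "balanced (rbim \<tau>) (rbim \<sigma>) (bgrp (rbim (ring_map_comp \<tau> \<sigma>)))
  (\<lambda>a b. a \<otimes>\<^bsub>tgt \<tau>\<^esub> fn \<tau> b)"
 by (rule balancedI)
  (simp_all add: fn_closed m T.l_distr T.r_distr T.m_assoc ring_map_hom[OF m(1), unfolded m(3)])

lemma fn_restriction_comp [simp]:
 "a:car (tgt \<tau>) ==> b:car (tgt \<sigma>) ==>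
  fn (restriction_comp \<tau> \<sigma>) (tens (rbim \<tau>) (rbim \<sigma>) a b) = a \<otimes>\<^bsub>tgt \<tau>\<^esub> fn \<tau> b"
 using P.utensor_the_hom_tens[OF bimodule.comm_group[OF bimodule_restriction] balanced_restriction] m
 by (simp add: restriction_comp_def Let_def)

lemma restriction_comp_in [simp]: "restriction_comp \<tau> \<sigma>:squares"
proof (rule squaresI)
 let ?C = "rbim (ring_map_comp \<tau> \<sigma>)" and ?f = "fn (restriction_comp \<tau> \<sigma>)"
 let ?AB = "btens (rbim \<tau>) (rbim \<sigma>)"
 have C: "bimodule ?C" using m by simp
 have f: "?f:hom P.T (bgrp ?C)" "?f:extensional (car P.T)"
  using P.utensor_the_hom[OF bimodule.comm_group[OF C] balanced_restriction]
   P.utensor_the_hom_ext[OF bimodule.comm_group[OF C] balanced_restriction]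
  by (simp_all add: restriction_comp_def Let_def)
 show "?f:hom (bgrp (src (restriction_comp \<tau> \<sigma>))) (bgrp (tgt (restriction_comp \<tau> \<sigma>)))"
  "?f:extensional (bcar (src (restriction_comp \<tau> \<sigma>)))"
  using f by simp_all
 show "?f (lact (src (restriction_comp \<tau> \<sigma>)) q x) =
   lact (tgt (restriction_comp \<tau> \<sigma>)) (fn (lmor (restriction_comp \<tau> \<sigma>)) q) (?f x)"
  if "q:car (lring (src (restriction_comp \<tau> \<sigma>)))" "x:bcar (src (restriction_comp \<tau> \<sigma>))" for q x
 proof -
  have q: "q:car (lring (rbim \<tau>))" "q:car (lring ?C)" "x:car P.T" using that by simp_all
  have "?f (lact ?AB q x) = lact ?C q (?f x)"
   by (rule P.utensor_hom_eq[OF bimodule_group[OF C] hom_comp[OF P.lact_bimod_tensor_hom[OF q(1)] f(1)]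
      hom_comp[OF f(1) lact_hom[OF C q(2)]] _ q(3)])
    (use q m in \<open>simp add: T.m_assoc fn_closed\<close>)
  then show ?thesis using q by simp
 qed
 show "?f (ract (src (restriction_comp \<tau> \<sigma>)) x r) =
   ract (tgt (restriction_comp \<tau> \<sigma>)) (?f x) (fn (rmor (restriction_comp \<tau> \<sigma>)) r)"
  if "x:bcar (src (restriction_comp \<tau> \<sigma>))" "r:car (rring (src (restriction_comp \<tau> \<sigma>)))" for x r
 proof -
  have q: "r:car (rring (rbim \<sigma>))" "r:car (rring ?C)" "x:car P.T" using that by simp_all
  interpret S: ring "tgt \<sigma>" by (rule ring_mapsD(2)[OF m(2)])
  have "?f (ract ?AB x r) = ract ?C (?f x) r"
   by (rule P.utensor_hom_eq[OF bimodule_group[OF C] hom_comp[OF P.ract_bimod_tensor_hom[OF q(1)] f(1)]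
      hom_comp[OF f(1) ract_hom[OF C q(2)]] _ q(3)])
    (use q m in \<open>simp add: T.m_assoc fn_closed ring_map_hom[OF m(1), unfolded m(3)]\<close>)
  then show ?thesis using q by simp
 qed
qed (use m in \<open>simp_all add: ring_mapsD\<close>)

end

text \<open>The identity on elements. A separate square is needed because
  \<open>regular_bimod R\<close> and the restriction along the identity map may differ as records,
  in the right action of elements outside \<open>R\<close>.\<close>

definition restriction_unit :: "'u::infinite ring \<Rightarrow> 'u square" where
 "restriction_unit R = \<lparr>src = regb R, fn = (\<lambda>x\<in>car R. x), tgt = rbim (rid R),
  lmor = rid R, rmor = rid R\<rparr>"

lemma restriction_unit_sel [simp]:
 "src (restriction_unit R) = regb R" "tgt (restriction_unit R) = rbim (rid R)"
 "lmor (restriction_unit R) = rid R" "rmor (restriction_unit R) = rid R"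
 "x:car R ==> fn (restriction_unit R) x = x"
 by (simp_all add: restriction_unit_def)

lemma restriction_unit_in [simp]: "ring R ==> restriction_unit R:squares"
proof -
 assume "ring R"
 then interpret R: ring R .
 show ?thesis
 proof (rule squaresI)
  show "fn (restriction_unit R):hom (bgrp (src (restriction_unit R))) (bgrp (tgt (restriction_unit R)))"
   by (simp add: hom_def)
 qed (simp_all add: \<open>ring R\<close>, simp add: restriction_unit_def)
qed

text \<open>All vertical and all square morphisms of \<open>RING\<close> are identities, so the
  arrow parts are forced; the content lies in the two comparison squares.\<close>

definition Phi_fct :: "('u::infinite ring, 'u ring, 'u ring_map, 'u ring_map,
  'u ring, 'u ring_map, ('u, 'u) bimod, 'u square) double_fctr" where
 "Phi_fct =
  \<lparr>Fun0 = \<lparr>OMap = (\<lambda>R\<in>{R. ring R}. R), AMap = (\<lambda>R\<in>{R. ring R}. rid R)\<rparr>,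
  Fun1 = \<lparr>OMap = (\<lambda>\<sigma>\<in>ring_maps. rbim \<sigma>), AMap = (\<lambda>\<sigma>\<in>ring_maps. Ident (Horz BIMOD) (rbim \<sigma>))\<rparr>,
  FComp = (\<lambda>(\<tau>, \<sigma>)\<in>Obj (hcomposable RING). restriction_comp \<tau> \<sigma>),
  FUnit = (\<lambda>R\<in>{R. ring R}. restriction_unit R)\<rparr>"

lemma Phi_fct_sel [simp]:
 "ring R ==> OMap (Fun0 Phi_fct) R = R" "ring R ==> AMap (Fun0 Phi_fct) R = rid R"
 "\<sigma>:ring_maps ==> OMap (Fun1 Phi_fct) \<sigma> = rbim \<sigma>"
 "\<sigma>:ring_maps ==> AMap (Fun1 Phi_fct) \<sigma> = Ident (Horz BIMOD) (rbim \<sigma>)"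
 "\<tau>:ring_maps ==> \<sigma>:ring_maps ==> src \<tau> = tgt \<sigma> ==> FComp Phi_fct (\<tau>, \<sigma>) = restriction_comp \<tau> \<sigma>"
 "ring R ==> FUnit Phi_fct R = restriction_unit R"
 by (simp_all add: Phi_fct_def pullback_cat_sel)

lemma Ident_Comp_BIMOD [simp]:
 fixes s :: "'u::infinite square"
 shows "s:squares ==> tgt s = M ==> Ident (Horz BIMOD) M \<bullet> s = s"
  and "s:squares ==> src s = M ==> s \<bullet> Ident (Horz BIMOD) M = s"
 using category.Comp_Ident_left[OF category_Horz_BIMOD, of s]
  category.Comp_Ident_right[OF category_Horz_BIMOD, of s] by auto

lemma Ident_HComp_Ident_BIMOD [simp]:
 fixes A B :: "('u::infinite, 'u) bimod"
 shows "bimodule A ==> bimodule B ==> rring A = lring B ==>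
  Ident (Horz BIMOD) A \<diamondop> Ident (Horz BIMOD) B = Ident (Horz BIMOD) (btens A B)"
 using cat_functor.AMap_Ident[OF functor_HComp_BIMOD, of "(A, B)"] by (simp add: pullback_cat_sel)

theorem double_functor_ring_bimod:
 "double_functor RING BIMOD (Phi_fct :: ('u::infinite ring, 'u ring, 'u ring_map, 'u ring_map,
  'u ring, 'u ring_map, ('u, 'u) bimod, 'u square) double_fctr)"
proof (intro double_functor.intro double_category_RING double_category_BIMOD double_functor_axioms.intro)
 show "cat_functor (Vert RING) (Vert BIMOD) (Fun0 (Phi_fct ::
  ('u ring, 'u ring, 'u ring_map, 'u ring_map, 'u ring, 'u ring_map, ('u, 'u) bimod, 'u square) double_fctr))"
  unfolding cat_functor_def cat_functor_axioms_def
  by (auto simp: category_Vert_BIMOD category_discrete_cat)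
 show "cat_functor (Horz RING) (Horz BIMOD) (Fun1 (Phi_fct ::
  ('u ring, 'u ring, 'u ring_map, 'u ring_map, 'u ring, 'u ring_map, ('u, 'u) bimod, 'u square) double_fctr))"
  unfolding cat_functor_def cat_functor_axioms_def
  by (auto simp: category_Horz_BIMOD category_discrete_cat)
next
 fix \<upsilon> \<tau> \<sigma> :: "'u ring_map"
 assume "(\<upsilon>, \<tau>):Obj (hcomposable RING)" "(\<tau>, \<sigma>):Obj (hcomposable RING)"
 then have m: "\<upsilon>:ring_maps" "\<tau>:ring_maps" "\<sigma>:ring_maps" "src \<upsilon> = tgt \<tau>" "src \<tau> = tgt \<sigma>"
  by (simp_all add: pullback_cat_sel)
 interpret U: ring "tgt \<upsilon>" by (rule ring_mapsD(2)[OF m(1)])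
 interpret T: ring "tgt \<tau>" by (rule ring_mapsD(2)[OF m(2)])
 have c: "fn \<upsilon> b:car (tgt \<upsilon>)" if "b:car (tgt \<tau>)" for b using ring_map_closed[OF m(1)] m(4) that by simp
 have d: "fn \<tau> b:car (tgt \<tau>)" if "b:car (tgt \<sigma>)" for b using ring_map_closed[OF m(2)] m(5) that by simp
 show "AMap (Fun1 Phi_fct) (Assoc RING \<upsilon> \<tau> \<sigma>) \<bullet> FComp Phi_fct (\<upsilon> \<star>\<^bsub>RING\<^esub> \<tau>, \<sigma>) \<bullet>
   (FComp Phi_fct (\<upsilon>, \<tau>) \<diamondop> Ident (Horz BIMOD) (OMap (Fun1 Phi_fct) \<sigma>)) =
  FComp Phi_fct (\<upsilon>, \<tau> \<star>\<^bsub>RING\<^esub> \<sigma>) \<bullet>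
   (Ident (Horz BIMOD) (OMap (Fun1 Phi_fct) \<upsilon>) \<diamondop> FComp Phi_fct (\<tau>, \<sigma>)) \<bullet>
   Assoc BIMOD (OMap (Fun1 Phi_fct) \<upsilon>) (OMap (Fun1 Phi_fct) \<tau>) (OMap (Fun1 Phi_fct) \<sigma>)"
  by (rule square_eqI_tens3[where A = "rbim \<upsilon>" and B = "rbim \<tau>" and C = "rbim \<sigma>"])
   (use m in \<open>simp_all add: ring_map_comp_assoc c d U.m_assoc ring_map_hom[OF m(1), unfolded m(4)]\<close>)
next
 fix \<sigma> :: "'u ring_map" and x assume "\<sigma>:Obj (Horz RING)" and x: "x = OMap (Lft RING) \<sigma>"
 then have m: "\<sigma>:ring_maps" by simp
 show "AMap (Fun1 Phi_fct) (LUnit RING \<sigma>) \<bullet> FComp Phi_fct (OMap (Delta RING) x, \<sigma>) \<bullet>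
   (FUnit Phi_fct x \<diamondop> Ident (Horz BIMOD) (OMap (Fun1 Phi_fct) \<sigma>)) =
  LUnit BIMOD (OMap (Fun1 Phi_fct) \<sigma>)"
  by (rule square_eqI_tens[where A = "regb (tgt \<sigma>)" and B = "rbim \<sigma>"])
   (use m x lunit_fun_tens[OF bimodule_restriction[OF m]] in \<open>simp_all add: ring_mapsD\<close>)
next
 fix \<sigma> :: "'u ring_map" and x assume "\<sigma>:Obj (Horz RING)" and x: "x = OMap (Rgt RING) \<sigma>"
 then have m: "\<sigma>:ring_maps" by simp
 show "AMap (Fun1 Phi_fct) (RUnit RING \<sigma>) \<bullet> FComp Phi_fct (\<sigma>, OMap (Delta RING) x) \<bullet>
   (Ident (Horz BIMOD) (OMap (Fun1 Phi_fct) \<sigma>) \<diamondop> FUnit Phi_fct x) =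
  RUnit BIMOD (OMap (Fun1 Phi_fct) \<sigma>)"
  by (rule square_eqI_tens[where A = "rbim \<sigma>" and B = "regb (src \<sigma>)"])
   (use m x runit_fun_tens[OF bimodule_restriction[OF m]] in \<open>simp_all add: ring_mapsD\<close>)
next
 fix \<theta> :: "'u ring" assume "\<theta>:Arr (Vert RING)"
 then have r: "ring \<theta>" by simp
 have "AMap (Delta BIMOD) (rid \<theta>) = Ident (Horz BIMOD) (regb \<theta>)"
  using cat_functor.AMap_Ident[OF functor_Delta_BIMOD, of \<theta>] r by simp
 with r show "FUnit Phi_fct (Cod (Vert RING) \<theta>) \<bullet> AMap (Delta BIMOD) (AMap (Fun0 Phi_fct) \<theta>) =
  AMap (Fun1 Phi_fct) (AMap (Delta RING) \<theta>) \<bullet> FUnit Phi_fct (Dom (Vert RING) \<theta>)"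
  by simp
qed (auto simp: pullback_cat_sel hom_arr_def ring_mapsD, auto simp: Phi_fct_def)

section \<open>The double category of central maps\<close>

text \<open>Membership in a subgroup, unlike an equation, is not settled by uniqueness of maps; it
  is carried along the image of a generating set. Spanning sets of tensor products and stability of
  ideals both rest on this.\<close>

lemma hom_spans_into:
 assumes "group G" "group K" "h:hom G K" "spans G X" "subgroup H K" "h ` X \<subseteq> H" "a:car G"
 shows "h a:H"
proof -
 interpret h: group_hom G K h using assms by (simp add: group_hom_def group_hom_axioms_def)
 have "h a:h ` generate G X" using assms(4,7) by (auto simp: spans_def)
 also have "\<dots> = generate K (h ` X)" using h.generate_img[of X] assms(4) by (simp add: spans_def)
 also have "\<dots> \<subseteq> H" by (rule h.H.generate_subgroup_incl[OF assms(6,5)])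
 finally show ?thesis .
qed

text \<open>One factor at a time: for \<open>a\<close> in \<open>S\<close> the span contains the
  tensors with every \<open>b\<close>, and then for each \<open>b\<close> those with every
  \<open>a\<close>. Iterated, this provides nested pure tensors as generators of composites of
  central maps.\<close>

lemma (in ubimodule_pair) spans_tens:
 assumes S: "spans (bgrp A) S" and S': "spans (bgrp B) S'"
 shows "spans T (case_prod t ` (S \<times> S'))"
proof -
 let ?Z = "case_prod t ` (S \<times> S')"
 have Z: "?Z \<subseteq> car T" using S S' by (auto simp: spans_def intro!: tens_closed)
 then have H: "subgroup (generate T ?Z) T" by (rule T.generate_is_subgroup)
 have 1: "t a b:generate T ?Z" if a: "a:S" and b: "b:bcar B" for a b
 proof (rule hom_spans_into[OF GB.is_group T.is_group _ S' H _ b])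
  show "t a:hom (bgrp B) T" using a S by (intro homI) (auto simp: spans_def tens_add_right)
  show "t a ` S' \<subseteq> generate T ?Z" using a by (auto intro!: generate.incl)
 qed
 have 2: "t a b:generate T ?Z" if a: "a:bcar A" and b: "b:bcar B" for a b
 proof (rule hom_spans_into[OF GA.is_group T.is_group _ S H _ a])
  show "(\<lambda>a. t a b):hom (bgrp A) T" using b by (intro homI) (auto simp: tens_add_left)
  show "(\<lambda>a. t a b) ` S \<subseteq> generate T ?Z" using b 1 by auto
 qed
 have "car T \<subseteq> generate T ?Z"
 proof
  fix x assume x: "x:car T"
  show "x:generate T ?Z"
   by (rule spans_subgroup[OF T.is_group spans_utensor H _ x]) (use 2 in auto)
 qed
 then show ?thesis using Z by (simp add: spans_def)
qed

lemma spans_carrier: "spans G (car G)"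
 by (auto simp: spans_def intro: generate.incl)

text \<open>Bimodules that differ only by the values of the actions outside the carriers, which is the
 difference between \<open>central_bimod (central_comp X Y)\<close> and
 \<open>bimod_tensor (central_bimod X) (central_bimod Y)\<close>.\<close>

definition agree :: "('r, 'a) bimod \<Rightarrow> ('r, 'a) bimod \<Rightarrow> bool" where
 "agree A A' \<longleftrightarrow> lring A = lring A' \<and> rring A = rring A' \<and> bgrp A = bgrp A' \<and>
  (\<forall>q\<in>car (lring A). \<forall>a\<in>bcar A. lact A q a = lact A' q a) \<and>
  (\<forall>a\<in>bcar A. \<forall>r\<in>car (rring A). ract A a r = ract A' a r)"

lemma agree_refl [simp]: "agree A A"
 by (simp add: agree_def)

text \<open>The tensor relations mention the actions only on carriers, so both pairs have the same
  relations and the same tensor group. The code chosen by \<open>SOME\<close> depends on that group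
  alone, whence coded groups and pure tensors are literally equal.\<close>

lemma agree_tensor:
 assumes "agree A A'" "agree B B'" "rring A = lring B"
 shows "uten A B = uten A' B'" "tens A B = tens A' B'"
proof -
 have sel: "bgrp A' = bgrp A" "bgrp B' = bgrp B" "rring A' = rring A"
  using assms by (simp_all add: agree_def)
 have r: "ract A' a r = ract A a r" if "a:bcar A" "r:car (rring A)" for a r
  using assms(1) that by (simp add: agree_def)
 have l: "lact B' r b = lact B r b" if "b:bcar B" "r:car (rring A)" for b r
  using assms(2,3) that by (simp add: agree_def)
 have "{frag_of (ract A' a r, b) - frag_of (a, lact B' r b) | a r b. a:bcar A \<and> r:car (rring A) \<and> b:bcar B}
   = {frag_of (ract A a r, b) - frag_of (a, lact B r b) | a r b. a:bcar A \<and> r:car (rring A) \<and> b:bcar B}"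
  by (intro Collect_cong ex_cong1) (auto simp: r l)
 then have "tensor_relations A' B' = tensor_relations A B"
  unfolding tensor_relations_def sel by simp
 then have k: "tensor_kernel A' B' = tensor_kernel A B" by (simp add: tensor_kernel_def sel)
 then have g: "tensor_group A' B' = tensor_group A B" by (simp add: tensor_group_def sel)
 then have c: "tensor_code A' B' = tensor_code A B" by (simp add: tensor_code_def)
 show "uten A B = uten A' B'" by (simp add: utensor_group_def g c)
 show "tens A B = tens A' B'" by (intro ext) (simp add: tens_def tensor_elem_def c k sel)
qed

text \<open>Both sides of the associative law are additive in each argument. The law is therefore
  extended from generators to the carrier one argument at a time, beginning with the last.\<close>

lemma ring_of_biadditive:
 assumes T: "comm_group T" and m: "biadditive T T T m" and X: "spans T X"
  and assoc: "\<And>x y z. x:X ==> y:X ==> z:X ==> m (m x y) z = m x (m y z)"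
  and u: "u:car T" and left: "\<And>x. x:X ==> m u x = x" and right: "\<And>x. x:X ==> m x u = x"
 shows "ring \<lparr>carrier = car T, monoid.mult = m, one = u, zero = \<one>\<^bsub>T\<^esub>, add = mult T\<rparr>" (is "ring ?R")
proof -
 interpret T: comm_group T by fact
 note mh = biadditiveD(1,2)[OF m] and mc [simp] = biadditiveD(3)[OF m]
 note eq = spans_hom_eq[OF T.is_group T.is_group _ _ X]
 have X': "x:car T" if "x:X" for x using that X by (auto simp: spans_def)
 have a1: "m (m x y) c = m x (m y c)" if "x:X" "y:X" "c:car T" for x y c
  by (rule eq[OF mh(1) hom_comp[OF mh(1) mh(1)]]) (use that X' assoc in auto)
 have a2: "m (m x b) c = m x (m b c)" if "x:X" "b:car T" "c:car T" for x b c
  by (rule eq[OF hom_comp[OF mh(1) mh(2)] hom_comp[OF mh(2) mh(1)]]) (use that X' a1 in auto)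
 have a3: "m (m a b) c = m a (m b c)" if "a:car T" "b:car T" "c:car T" for a b c
  by (rule eq[OF hom_comp[OF mh(2) mh(2)] mh(2)]) (use that X' a2 in auto)
 have l: "m u a = a" if "a:car T" for a
  by (rule eq[OF mh(1) hom_ident]) (use that u left in auto)
 have r: "m a u = a" if "a:car T" for a
  by (rule eq[OF mh(2) hom_ident]) (use that u right in auto)
 have "abelian_group ?R"
 proof (rule abelian_groupI)
  fix x assume "x:car ?R"
  then show "\<exists>y\<in>car ?R. y \<oplus>\<^bsub>?R\<^esub> x = \<zero>\<^bsub>?R\<^esub>"
   by (intro bexI[of _ "inv\<^bsub>T\<^esub> x"]) auto
 qed (auto simp: T.m_ac)
 moreover have "monoid ?R"
  by (rule monoidI) (use u a3 l r in auto)
 ultimately show ?thesis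
  by (rule ringI) (simp_all add: biadditiveD[OF m])
qed

text \<open>Multiplicativity of an additive map is an equation between two biadditive maps, so it
  can be tested on generators.\<close>

lemma ring_hom_spansI:
 fixes R :: "'a ring" and S :: "'b ring"
 assumes R: "ring R" and S: "ring S" and h: "h:hom (amon R) (amon S :: 'b monoid)"
  and X: "spans (amon R) X"
  and mult: "\<And>x y. x:X ==> y:X ==> h (x \<otimes>\<^bsub>R\<^esub> y) = h x \<otimes>\<^bsub>S\<^esub> h y" and one: "h \<one>\<^bsub>R\<^esub> = \<one>\<^bsub>S\<^esub>"
 shows "h:ring_hom R S"
proof -
 interpret R: ring R by fact
 interpret S: ring S by fact
 have hc: "h a:car S" if "a:car R" for a using hom_in_carrier[OF h] that by simp
 have ha: "h (a \<oplus>\<^bsub>R\<^esub> b) = h a \<oplus>\<^bsub>S\<^esub> h b" if "a:car R" "b:car R" for a b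
  using hom_mult[OF h] that by simp
 have m: "h (a \<otimes>\<^bsub>R\<^esub> b) = h a \<otimes>\<^bsub>S\<^esub> h b" if "a:car R" "b:car R" for a b
 proof (rule biadditive_spans_eq[of "amon R" "amon R" "amon S"])
  show "biadditive (amon R) (amon R) (amon S) (\<lambda>a b. h (a \<otimes>\<^bsub>R\<^esub> b))"
   by (rule biadditiveI) (simp_all add: hc ha R.l_distr R.r_distr)
  show "biadditive (amon R) (amon R) (amon S) (\<lambda>a b. h a \<otimes>\<^bsub>S\<^esub> h b)"
   by (rule biadditiveI) (simp_all add: hc ha S.l_distr S.r_distr)
 qed (use that mult X R.add.is_group S.add.is_group in simp_all)
 show ?thesis by (rule ring_hom_memI) (simp_all add: hc ha m one)
qed

section \<open>Central maps and their bimodules\<close>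

lemma centralsD:
 assumes "X:centrals"
 shows "cring (lbase X)" "cring (rbase X)" "ring (mid X)"
  "lmap X:ring_hom (lbase X) (mid X)" "lmap X:extensional (car (lbase X))"
  "rmap X:ring_hom (rbase X) (mid X)" "rmap X:extensional (car (rbase X))"
  "\<And>a. a:car (lbase X) ==> lmap X a:car (mid X)"
  "\<And>b. b:car (rbase X) ==> rmap X b:car (mid X)"
  "\<And>a e. a:car (lbase X) ==> e:car (mid X) ==>
   lmap X a \<otimes>\<^bsub>mid X\<^esub> e = e \<otimes>\<^bsub>mid X\<^esub> lmap X a"
  "\<And>b e. b:car (rbase X) ==> e:car (mid X) ==>
   rmap X b \<otimes>\<^bsub>mid X\<^esub> e = e \<otimes>\<^bsub>mid X\<^esub> rmap X b"
 using assms by (auto simp: centrals_def centre_def ring_hom_def)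

lemma central_ring:
 assumes "X:centrals"
 shows "ring (lbase X)" "ring (rbase X)"
 using assms centralsD(1,2) by (auto simp: cring_def)

lemma central_bimod_sel [simp]:
 "lring (cbim X) = lbase X" "rring (cbim X) = rbase X"
 "bgrp (cbim X) = amon (mid X)"
 "lact (cbim X) a e = lmap X a \<otimes>\<^bsub>mid X\<^esub> e"
 "ract (cbim X) e b = e \<otimes>\<^bsub>mid X\<^esub> rmap X b"
 by (simp_all add: central_bimod_def)

lemma central_maps_hom:
 assumes "X:centrals"
 shows "a:car (lbase X) ==> a':car (lbase X) ==> lmap X (a \<oplus>\<^bsub>lbase X\<^esub> a') = lmap X a \<oplus>\<^bsub>mid X\<^esub> lmap X a'"
  and "a:car (lbase X) ==> a':car (lbase X) ==> lmap X (a \<otimes>\<^bsub>lbase X\<^esub> a') = lmap X a \<otimes>\<^bsub>mid X\<^esub> lmap X a'"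
  and "lmap X \<one>\<^bsub>lbase X\<^esub> = \<one>\<^bsub>mid X\<^esub>"
  and "b:car (rbase X) ==> b':car (rbase X) ==> rmap X (b \<oplus>\<^bsub>rbase X\<^esub> b') = rmap X b \<oplus>\<^bsub>mid X\<^esub> rmap X b'"
  and "b:car (rbase X) ==> b':car (rbase X) ==> rmap X (b \<otimes>\<^bsub>rbase X\<^esub> b') = rmap X b \<otimes>\<^bsub>mid X\<^esub> rmap X b'"
  and "rmap X \<one>\<^bsub>rbase X\<^esub> = \<one>\<^bsub>mid X\<^esub>"
 using centralsD(4,6)[OF assms] by (simp_all add: ring_hom_def)

lemma bimodule_central [simp]:
 assumes X: "X:centrals"
 shows "bimodule (cbim X)"
proof -
 interpret E: ring "mid X" by (rule centralsD(3)[OF X])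
 show ?thesis
 proof (rule bimodule.intro)
  show "comm_group (bgrp (cbim X))"
   unfolding central_bimod_sel by (rule E.a_comm_group)
 qed (simp_all add: X central_ring centralsD(8,9) central_maps_hom E.l_distr E.r_distr E.m_assoc)
qed

lemma monoid_eta [simp]: "\<lparr>carrier = car M, monoid.mult = mult M, one = one M\<rparr> = (M :: 'a monoid)"
 by (rule monoid.equality) simp_all

section \<open>The ring structure on the tensor product of two central maps\<close>

locale central_pair =
 fixes X Y :: "'u::infinite central"
 assumes X: "X:centrals" and Y: "Y:centrals" and XY: "rbase X = lbase Y"
begin

sublocale P: ubimodule_pair "cbim X" "cbim Y"
 by (intro ubimodule_pairI) (simp_all add: X Y XY)

sublocale E: ring "mid X" by (rule centralsD(3)[OF X])
sublocale F: ring "mid Y" by (rule centralsD(3)[OF Y])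

lemma tens_add:
 "e:car (mid X) ==> e':car (mid X) ==> f:car (mid Y) ==>
  P.t (e \<oplus>\<^bsub>mid X\<^esub> e') f = P.t e f \<otimes>\<^bsub>P.T\<^esub> P.t e' f"
 "e:car (mid X) ==> f:car (mid Y) ==> f':car (mid Y) ==>
  P.t e (f \<oplus>\<^bsub>mid Y\<^esub> f') = P.t e f \<otimes>\<^bsub>P.T\<^esub> P.t e f'"
 using P.tens_add_left[of e e' f] P.tens_add_right[of e f f'] by simp_all

lemma tens_middle:
 "e:car (mid X) ==> b:car (rbase X) ==> f:car (mid Y) ==>
  P.t (e \<otimes>\<^bsub>mid X\<^esub> rmap X b) f = P.t e (lmap Y b \<otimes>\<^bsub>mid Y\<^esub> f)"
 using P.tens_balanced[of e b f] by simp

text \<open>Two lifts in succession: multiplication by a pure tensor becomes an endomorphism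
  \<open>l e f\<close> of the tensor product, and then \<open>l\<close> itself is lifted into the
  group of endomorphisms. Each lift requires balancedness over the middle ring. The inner one uses
  that the image of \<open>lmap Y\<close> is central, to move it past \<open>f\<close>; the outer
  one that the image of \<open>rmap X\<close> is central, to move it past \<open>e'\<close>.\<close>

lemma tensor_mult_exists:
 obtains m where "biadditive P.T P.T P.T m"
  "\<And>e f e' f'. e:car (mid X) ==> f:car (mid Y) ==> e':car (mid X) ==> f':car (mid Y) ==>
   m (P.t e f) (P.t e' f') = P.t (e \<otimes>\<^bsub>mid X\<^esub> e') (f \<otimes>\<^bsub>mid Y\<^esub> f')"
proof -
 let ?A = "cbim X" and ?B = "cbim Y"
 define l where "l e f = the_hom P.T P.T (\<lambda>h. \<forall>e'\<in>bcar ?A. \<forall>f'\<in>bcar ?B.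
  h (P.t e' f') = P.t (e \<otimes>\<^bsub>mid X\<^esub> e') (f \<otimes>\<^bsub>mid Y\<^esub> f'))" for e f
 have bal: "balanced ?A ?B P.T (\<lambda>e' f'. P.t (e \<otimes>\<^bsub>mid X\<^esub> e') (f \<otimes>\<^bsub>mid Y\<^esub> f'))"
  if *: "e:car (mid X)" "f:car (mid Y)" for e f
 proof (rule balancedI)
  fix e' b f' assume "e':bcar ?A" "b:car (rring ?A)" "f':bcar ?B"
  then have **: "e':car (mid X)" "b:car (rbase X)" "b:car (lbase Y)" "f':car (mid Y)"
   by (simp_all add: XY)
  have "P.t (e \<otimes>\<^bsub>mid X\<^esub> (e' \<otimes>\<^bsub>mid X\<^esub> rmap X b)) (f \<otimes>\<^bsub>mid Y\<^esub> f')
    = P.t (e \<otimes>\<^bsub>mid X\<^esub> e') (lmap Y b \<otimes>\<^bsub>mid Y\<^esub> (f \<otimes>\<^bsub>mid Y\<^esub> f'))"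
   using * ** tens_middle[of "e \<otimes>\<^bsub>mid X\<^esub> e'" b "f \<otimes>\<^bsub>mid Y\<^esub> f'"] X by (simp add: centralsD(8,9) E.m_assoc)
  also have "lmap Y b \<otimes>\<^bsub>mid Y\<^esub> (f \<otimes>\<^bsub>mid Y\<^esub> f') = f \<otimes>\<^bsub>mid Y\<^esub> (lmap Y b \<otimes>\<^bsub>mid Y\<^esub> f')"
   using * ** Y centralsD(10)[OF Y, of b f] by (simp add: centralsD(8) flip: F.m_assoc)
  finally show "P.t (e \<otimes>\<^bsub>mid X\<^esub> (ract ?A e' b)) (f \<otimes>\<^bsub>mid Y\<^esub> f') =
    P.t (e \<otimes>\<^bsub>mid X\<^esub> e') (f \<otimes>\<^bsub>mid Y\<^esub> (lact ?B b f'))" by simp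
 qed (use * in \<open>simp_all add: E.r_distr F.r_distr tens_add\<close>)
 have lh: "l e f:hom P.T P.T" "l e f:extensional (car P.T)"
  and l: "\<And>e' f'. e':car (mid X) ==> f':car (mid Y) ==>
   l e f (P.t e' f') = P.t (e \<otimes>\<^bsub>mid X\<^esub> e') (f \<otimes>\<^bsub>mid Y\<^esub> f')"
  if "e:car (mid X)" "f:car (mid Y)" for e f
  unfolding l_def using P.utensor_the_hom[OF P.comm_group_utensor bal[OF that]]
   P.utensor_the_hom_ext[OF P.comm_group_utensor bal[OF that]]
   P.utensor_the_hom_tens[OF P.comm_group_utensor bal[OF that]] by auto
 have H: "comm_group (hom_group P.T P.T)" by (rule comm_group_hom_group[OF P.T.is_group P.comm_group_utensor])
 have leq: "h = k" if "h:hom P.T P.T" "h:extensional (car P.T)" "k:hom P.T P.T" "k:extensional (car P.T)"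
  "\<And>e' f'. e':car (mid X) ==> f':car (mid Y) ==> h (P.t e' f') = k (P.t e' f')" for h k
  by (rule extensionalityI[OF that(2,4)]) (rule P.utensor_hom_eq[OF P.T.is_group that(1,3)], use that(5) in auto)
 have pm: "h \<otimes>\<^bsub>hom_group P.T P.T\<^esub> k:hom P.T P.T" if "h:hom P.T P.T" "k:hom P.T P.T" for h k
  using hom_pointwise_mult[OF P.comm_group_utensor that] by (simp add: hom_group_def hom_restrict_iff[OF P.T.is_group])
 have "balanced ?A ?B (hom_group P.T P.T) l"
 proof (rule balancedI)
  fix e e' f assume *: "e:bcar ?A" "e':bcar ?A" "f:bcar ?B"
  show "l (e \<otimes>\<^bsub>bgrp ?A\<^esub> e') f = l e f \<otimes>\<^bsub>hom_group P.T P.T\<^esub> l e' f"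
   by (rule leq[OF _ _ pm]) (use * in \<open>simp_all add: lh l, simp_all add: hom_group_def l tens_add E.l_distr\<close>)
 next
  fix e f f' assume *: "e:bcar ?A" "f:bcar ?B" "f':bcar ?B"
  show "l e (f \<otimes>\<^bsub>bgrp ?B\<^esub> f') = l e f \<otimes>\<^bsub>hom_group P.T P.T\<^esub> l e f'"
   by (rule leq[OF _ _ pm]) (use * in \<open>simp_all add: lh l, simp_all add: hom_group_def l tens_add F.l_distr\<close>)
 next
  fix e b f assume "e:bcar ?A" "b:car (rring ?A)" "f:bcar ?B"
  then have *: "e:car (mid X)" "b:car (rbase X)" "b:car (lbase Y)" "f:car (mid Y)"
   by (simp_all add: XY)
  have "l (e \<otimes>\<^bsub>mid X\<^esub> rmap X b) f = l e (lmap Y b \<otimes>\<^bsub>mid Y\<^esub> f)"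
  proof (rule leq)
   fix e' f' assume **: "e':car (mid X)" "f':car (mid Y)"
   have "e \<otimes>\<^bsub>mid X\<^esub> rmap X b \<otimes>\<^bsub>mid X\<^esub> e' = e \<otimes>\<^bsub>mid X\<^esub> e' \<otimes>\<^bsub>mid X\<^esub> rmap X b"
    using * ** centralsD(9,11)[OF X] by (simp add: E.m_assoc)
   then have "P.t (e \<otimes>\<^bsub>mid X\<^esub> rmap X b \<otimes>\<^bsub>mid X\<^esub> e') (f \<otimes>\<^bsub>mid Y\<^esub> f')
     = P.t (e \<otimes>\<^bsub>mid X\<^esub> e') (lmap Y b \<otimes>\<^bsub>mid Y\<^esub> f \<otimes>\<^bsub>mid Y\<^esub> f')"
    using * ** tens_middle[of "e \<otimes>\<^bsub>mid X\<^esub> e'" b "f \<otimes>\<^bsub>mid Y\<^esub> f'"] centralsD(8)[OF Y]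
    by (simp add: F.m_assoc)
   then show "l (e \<otimes>\<^bsub>mid X\<^esub> rmap X b) f (P.t e' f') = l e (lmap Y b \<otimes>\<^bsub>mid Y\<^esub> f) (P.t e' f')"
    using * ** by (simp add: l centralsD(9)[OF X] centralsD(8)[OF Y])
  qed (use * in \<open>simp_all add: lh centralsD(9)[OF X] centralsD(8)[OF Y]\<close>)
  then show "l (ract ?A e b) f = l e (lact ?B b f)" by simp
 qed (use lh in \<open>simp_all add: hom_group_def\<close>)
 from P.utensor_lift[OF H this] obtain m where m: "m:hom P.T (hom_group P.T P.T)"
  "\<And>e f. e:bcar ?A ==> f:bcar ?B ==> m (P.t e f) = l e f" by blast
 show ?thesis
  by (rule that[OF biadditive_hom_group[OF P.T.is_group P.T.is_group m(1)]]) (simp add: m(2) l)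
qed

lemma tensor_ring_sel [simp]:
 "car (central_tensor_ring X Y) = car P.T" "\<zero>\<^bsub>central_tensor_ring X Y\<^esub> = \<one>\<^bsub>P.T\<^esub>"
 "\<one>\<^bsub>central_tensor_ring X Y\<^esub> = P.t \<one>\<^bsub>mid X\<^esub> \<one>\<^bsub>mid Y\<^esub>"
 "add (central_tensor_ring X Y) = mult P.T"
 by (simp_all add: central_tensor_ring_def Let_def)

lemma biadditive_tensor_mult: "biadditive P.T P.T P.T (mult (central_tensor_ring X Y))" (is ?A)
 and tensor_mult [simp]: "\<And>e f e' f'. e:car (mid X) ==> f:car (mid Y) ==>
   e':car (mid X) ==> f':car (mid Y) ==>
   P.t e f \<otimes>\<^bsub>central_tensor_ring X Y\<^esub> P.t e' f' = P.t (e \<otimes>\<^bsub>mid X\<^esub> e') (f \<otimes>\<^bsub>mid Y\<^esub> f')"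
proof -
 obtain m where m: "biadditive P.T P.T P.T m"
  "\<And>e f e' f'. e:car (mid X) ==> f:car (mid Y) ==> e':car (mid X) ==> f':car (mid Y) ==>
   m (P.t e f) (P.t e' f') = P.t (e \<otimes>\<^bsub>mid X\<^esub> e') (f \<otimes>\<^bsub>mid Y\<^esub> f')"
  using tensor_mult_exists by blast
 have eq: "x \<otimes>\<^bsub>central_tensor_ring X Y\<^esub> y = m x y" if "x:car P.T" "y:car P.T" for x y
  unfolding central_tensor_ring_def Let_def monoid.simps
  by (rule the_biadditive_eq[OF P.T.is_group P.T.is_group P.T.is_group m(1) P.spans_utensor P.spans_utensor _ _ that])
   (auto simp: m(2))
 show ?A by (rule biadditiveI) (simp_all add: eq biadditiveD[OF m(1)])
 show "P.t e f \<otimes>\<^bsub>central_tensor_ring X Y\<^esub> P.t e' f' = P.t (e \<otimes>\<^bsub>mid X\<^esub> e') (f \<otimes>\<^bsub>mid Y\<^esub> f')"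
  if "e:car (mid X)" "f:car (mid Y)" "e':car (mid X)" "f':car (mid Y)" for e f e' f'
  using that by (simp add: eq m(2))
qed

lemma ring_tensor: "ring (central_tensor_ring X Y)"
proof -
 have "ring \<lparr>carrier = car P.T, monoid.mult = mult (central_tensor_ring X Y),
   one = P.t \<one>\<^bsub>mid X\<^esub> \<one>\<^bsub>mid Y\<^esub>, zero = \<one>\<^bsub>P.T\<^esub>, add = mult P.T\<rparr>"
  by (rule ring_of_biadditive[OF P.comm_group_utensor biadditive_tensor_mult P.spans_utensor])
   (auto simp: E.m_assoc F.m_assoc)
 then show ?thesis by (simp add: central_tensor_ring_def Let_def)
qed

text \<open>The structure maps have pure tensors as values. Commuting with such a value is an
  equation between additive maps, and on pure tensors it reduces to centrality in one of the
  factors.\<close>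

lemma central_comp_in: "ccomp X Y:centrals"
proof -
 interpret R: ring "central_tensor_ring X Y" by (rule ring_tensor)
 let ?R = "central_tensor_ring X Y"
 have l: "(\<lambda>a\<in>car (lbase X). P.t (lmap X a) \<one>\<^bsub>mid Y\<^esub>):ring_hom (lbase X) ?R"
 proof -
  interpret A: ring "lbase X" by (rule central_ring[OF X])
  show ?thesis by (rule ring_hom_memI) (simp_all add: X centralsD(8,9) central_maps_hom tens_add)
 qed
 have r: "(\<lambda>c\<in>car (rbase Y). P.t \<one>\<^bsub>mid X\<^esub> (rmap Y c)):ring_hom (rbase Y) ?R"
 proof -
  interpret C: ring "rbase Y" by (rule central_ring[OF Y])
  show ?thesis by (rule ring_hom_memI) (simp_all add: Y centralsD(8,9) central_maps_hom tens_add)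
 qed
 note eq = P.utensor_hom_eq[OF P.T.is_group biadditiveD(1)[OF biadditive_tensor_mult] biadditiveD(2)[OF biadditive_tensor_mult]]
 have cl: "P.t (lmap X a) \<one>\<^bsub>mid Y\<^esub> \<otimes>\<^bsub>?R\<^esub> x = x \<otimes>\<^bsub>?R\<^esub> P.t (lmap X a) \<one>\<^bsub>mid Y\<^esub>"
  if "a:car (lbase X)" "x:car P.T" for a x
  by (rule eq) (use that X centralsD(8,10)[OF X] in auto)
 have cr: "P.t \<one>\<^bsub>mid X\<^esub> (rmap Y c) \<otimes>\<^bsub>?R\<^esub> x = x \<otimes>\<^bsub>?R\<^esub> P.t \<one>\<^bsub>mid X\<^esub> (rmap Y c)"
  if "c:car (rbase Y)" "x:car P.T" for c x
  by (rule eq) (use that Y centralsD(9,11)[OF Y] in auto)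
 show ?thesis
  using l r cl cr ring_tensor centralsD(1)[OF X] centralsD(2)[OF Y] centralsD(8)[OF X] centralsD(9)[OF Y]
  by (simp add: centrals_def central_comp_def centre_def image_subset_iff)
qed

text \<open>Multiplication by \<open>lmap X a \<otimes> 1\<close> is the action of \<open>a\<close>
  on the first factor, and multiplication by \<open>1 \<otimes> rmap Y c\<close> that of
  \<open>c\<close> on the second, as is seen on pure tensors. This links composites of central maps
  with tensor products of bimodules.\<close>

lemma agree_comp: "agree (cbim (ccomp X Y)) (btens (cbim X) (cbim Y))"
proof -
 interpret R: ring "central_tensor_ring X Y" by (rule ring_tensor)
 have l: "P.t (lmap X a) \<one>\<^bsub>mid Y\<^esub> \<otimes>\<^bsub>central_tensor_ring X Y\<^esub> x = lact (btens (cbim X) (cbim Y)) a x"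
  if "a:car (lbase X)" "x:car P.T" for a x
  by (rule P.utensor_hom_eq[OF P.T.is_group biadditiveD(1)[OF biadditive_tensor_mult] P.lact_bimod_tensor_hom])
   (use that X Y XY centralsD(8)[OF X] in auto)
 have r: "x \<otimes>\<^bsub>central_tensor_ring X Y\<^esub> P.t \<one>\<^bsub>mid X\<^esub> (rmap Y c) = ract (btens (cbim X) (cbim Y)) x c"
  if "c:car (rbase Y)" "x:car P.T" for c x
  by (rule P.utensor_hom_eq[OF P.T.is_group biadditiveD(2)[OF biadditive_tensor_mult] P.ract_bimod_tensor_hom])
   (use that X Y XY centralsD(9)[OF Y] in auto)
 show ?thesis by (simp add: agree_def central_comp_def l r)
qed

end

lemmas central_comp_in [simp] = central_pair.central_comp_in[OF central_pair.intro]
 and central_tensor_mult [simp] = central_pair.tensor_mult[OF central_pair.intro]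
 and central_agree_comp [simp] = central_pair.agree_comp[OF central_pair.intro]

lemma central_tensor_ring_sel [simp]:
 "car (central_tensor_ring X Y) = car (uten (cbim X) (cbim Y))"
 "\<zero>\<^bsub>central_tensor_ring X Y\<^esub> = \<one>\<^bsub>uten (cbim X) (cbim Y)\<^esub>"
 "\<one>\<^bsub>central_tensor_ring X Y\<^esub> = tens (cbim X) (cbim Y) \<one>\<^bsub>mid X\<^esub> \<one>\<^bsub>mid Y\<^esub>"
 "add (central_tensor_ring X Y) = mult (uten (cbim X) (cbim Y))"
 by (simp_all add: central_tensor_ring_def Let_def)

lemma central_comp_sel [simp]:
 "lbase (ccomp X Y) = lbase X" "rbase (ccomp X Y) = rbase Y"
 "mid (ccomp X Y) = central_tensor_ring X Y"
 "a:car (lbase X) ==> lmap (ccomp X Y) a = tens (cbim X) (cbim Y) (lmap X a) \<one>\<^bsub>mid Y\<^esub>"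
 "b:car (rbase Y) ==> rmap (ccomp X Y) b = tens (cbim X) (cbim Y) \<one>\<^bsub>mid X\<^esub> (rmap Y b)"
 by (simp_all add: central_comp_def)

lemma central_unit_sel [simp]:
 "lbase (cunit A) = A" "rbase (cunit A) = A" "mid (cunit A) = A"
 "a:car A ==> lmap (cunit A) a = a" "a:car A ==> rmap (cunit A) a = a"
 by (simp_all add: central_unit_def)

lemma central_unit_in [simp]:
 assumes "cring A"
 shows "cunit A:centrals"
proof -
 interpret cring A by fact
 have "(\<lambda>a\<in>car A. a):ring_hom A A" by (rule ring_hom_memI) simp_all
 then show ?thesis
  using assms ring_axioms by (simp add: centrals_def central_unit_def centre_def image_subset_iff m_comm)
qed

lemma agree_unit [simp]: "cring A ==> agree (cbim (cunit A)) (regb A)"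
 by (simp add: agree_def)

lemma agree_sym: "agree A B ==> agree B A"
 by (simp add: agree_def)

lemma central_one_zero:
 assumes "X:centrals"
 shows "\<one>\<^bsub>mid X\<^esub>:car (mid X)"
 using centralsD(3)[OF assms] by (rule ring.ring_simprules(6))

lemma midring_mult [simp]:
 assumes "X:centrals"
 shows "e:car (mid X) ==> f:car (mid X) ==> e \<otimes>\<^bsub>mid X\<^esub> f:car (mid X)"
  "e:car (mid X) ==> \<one>\<^bsub>mid X\<^esub> \<otimes>\<^bsub>mid X\<^esub> e = e"
  "e:car (mid X) ==> e \<otimes>\<^bsub>mid X\<^esub> \<one>\<^bsub>mid X\<^esub> = e"
proof -
 interpret ring "mid X" by (rule centralsD(3)[OF assms])
 show "e:car (mid X) ==> f:car (mid X) ==> e \<otimes>\<^bsub>mid X\<^esub> f:car (mid X)"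
  "e:car (mid X) ==> \<one>\<^bsub>mid X\<^esub> \<otimes>\<^bsub>mid X\<^esub> e = e"
  "e:car (mid X) ==> e \<otimes>\<^bsub>mid X\<^esub> \<one>\<^bsub>mid X\<^esub> = e" by simp_all
qed

declare central_one_zero [simp]

section \<open>Squares of central maps\<close>

lemma central_squaresD:
 assumes "s:csquares"
 shows "src s:centrals" "tgt s:centrals" "lbase (tgt s) = lbase (src s)" "rbase (tgt s) = rbase (src s)"
  "fn s:ring_hom (mid (src s)) (mid (tgt s))" "fn s:extensional (car (mid (src s)))"
  "\<And>a. a:car (lbase (src s)) ==> fn s (lmap (src s) a) = lmap (tgt s) a"
  "\<And>b. b:car (rbase (src s)) ==> fn s (rmap (src s) b) = rmap (tgt s) b"
 using assms by (simp_all add: central_squares_def)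

lemma central_square_hom:
 assumes "s:csquares"
 shows "e:car (mid (src s)) ==> fn s e:car (mid (tgt s))"
  "e:car (mid (src s)) ==> f:car (mid (src s)) ==>
   fn s (e \<otimes>\<^bsub>mid (src s)\<^esub> f) = fn s e \<otimes>\<^bsub>mid (tgt s)\<^esub> fn s f"
  "e:car (mid (src s)) ==> f:car (mid (src s)) ==>
   fn s (e \<oplus>\<^bsub>mid (src s)\<^esub> f) = fn s e \<oplus>\<^bsub>mid (tgt s)\<^esub> fn s f"
  "fn s \<one>\<^bsub>mid (src s)\<^esub> = \<one>\<^bsub>mid (tgt s)\<^esub>"
 using central_squaresD(5)[OF assms]
 by (simp_all add: ring_hom_closed ring_hom_mult ring_hom_add ring_hom_one)

lemma central_square_add_hom:
 fixes s :: "'a central_square"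
 assumes "s:csquares"
 shows "fn s:hom (amon (mid (src s)) :: 'a monoid) (amon (mid (tgt s)) :: 'a monoid)"
 by (rule homI) (simp_all add: central_square_hom[OF assms])

lemma central_square_closed [simp]:
 "s:csquares ==> mid (tgt s) = E ==> e:car (mid (src s)) ==> fn s e:car E"
 using central_square_hom(1)[of s e] by simp

lemma central_square_eqI:
 assumes "s:csquares" "s':csquares" "src s = src s'" "tgt s = tgt s'"
  "spans (amon (mid (src s))) X" "\<And>x. x:X ==> fn s x = fn s' x"
 shows "s = s'"
proof (rule arrow.equality)
 interpret E: ring "mid (src s)" by (rule centralsD(3)[OF central_squaresD(1)[OF assms(1)]])
 interpret F: ring "mid (tgt s)" by (rule centralsD(3)[OF central_squaresD(2)[OF assms(1)]])
 have h: "fn s:hom (amon (mid (src s))) (amon (mid (tgt s)) :: 'a monoid)"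
  "fn s':hom (amon (mid (src s))) (amon (mid (tgt s)) :: 'a monoid)"
  using central_square_add_hom[OF assms(1)] central_square_add_hom[OF assms(2)] assms(3,4) by simp_all
 show "fn s = fn s'"
 proof (rule extensionalityI[of _ "car (mid (src s))"])
  fix x assume "x:car (mid (src s))"
  then show "fn s x = fn s' x"
   by (intro spans_hom_eq[OF E.add.is_group F.add.is_group h assms(5,6)]) simp_all
 qed (use central_squaresD(6)[OF assms(1)] central_squaresD(6)[OF assms(2)] assms(3) in simp_all)
qed (use assms in auto)

text \<open>A ring map compatible with the maps from both bases is in particular linear over them.
  Forgetting its multiplicativity keeps the underlying function, so tensor products of squares and
  coherence maps can be imported from \<open>BIMOD\<close>.\<close>

definition csq_bimod :: "'u::infinite central_square \<Rightarrow> 'u square" where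
 "csq_bimod s = \<lparr>src = cbim (src s), fn = fn s, tgt = cbim (tgt s),
  lmor = rid (lbase (src s)), rmor = rid (rbase (src s))\<rparr>"

lemma csq_bimod_sel [simp]:
 "src (csq_bimod s) = cbim (src s)" "tgt (csq_bimod s) = cbim (tgt s)"
 "fn (csq_bimod s) = fn s" "lmor (csq_bimod s) = rid (lbase (src s))"
 "rmor (csq_bimod s) = rid (rbase (src s))"
 by (simp_all add: csq_bimod_def)

lemma csq_bimod_in [simp]:
 assumes "s:csquares"
 shows "csq_bimod s:squares"
proof (rule squaresI)
 note sD = central_squaresD[OF assms] and sh = central_square_hom[OF assms]
 show "fn (csq_bimod s):hom (bgrp (src (csq_bimod s))) (bgrp (tgt (csq_bimod s)))"
  using central_square_add_hom[OF assms] by simp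
 fix q a r
 show "q:car (lring (src (csq_bimod s))) ==> a:bcar (src (csq_bimod s)) ==>
  fn (csq_bimod s) (lact (src (csq_bimod s)) q a) =
   lact (tgt (csq_bimod s)) (fn (lmor (csq_bimod s)) q) (fn (csq_bimod s) a)"
  using centralsD(8)[OF sD(1)] by (simp add: sh sD)
 show "a:bcar (src (csq_bimod s)) ==> r:car (rring (src (csq_bimod s))) ==>
  fn (csq_bimod s) (ract (src (csq_bimod s)) a r) =
   ract (tgt (csq_bimod s)) (fn (csq_bimod s) a) (fn (rmor (csq_bimod s)) r)"
  using centralsD(9)[OF sD(1)] by (simp add: sh sD)
qed (use assms central_ring[OF central_squaresD(1)[OF assms]] in \<open>simp_all add: central_squaresD\<close>)

lemma CENTRAL_sel [simp]:
 "Vert CENTRAL = discrete_cat {A. cring A}" "Obj (Horz CENTRAL) = centrals" "Arr (Horz CENTRAL) = csquares"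
 "Dom (Horz CENTRAL) = src" "Cod (Horz CENTRAL) = tgt" "Ident (Horz CENTRAL) = central_square_id"
 "OMap (Delta CENTRAL) = cunit" "AMap (Delta CENTRAL) A = central_square_id (cunit A)"
 "OMap (Lft CENTRAL) = lbase" "AMap (Lft CENTRAL) s = lbase (src s)"
 "OMap (Rgt CENTRAL) = rbase" "AMap (Rgt CENTRAL) s = rbase (src s)"
 "X \<star>\<^bsub>CENTRAL\<^esub> Y = ccomp X Y"
 by (simp_all add: CENTRAL_def)

lemma CENTRAL_Comp [simp]:
 "src (t \<circ>\<^sub>c s) = src s" "tgt (t \<circ>\<^sub>c s) = tgt t"
 "e:car (mid (src s)) ==> fn (t \<circ>\<^sub>c s) e = fn t (fn s e)"
 by (simp_all add: CENTRAL_def compose_eq)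

lemma CENTRAL_HComp [simp]:
 "src (s \<diamondop>\<^sub>c t) = ccomp (src s) (src t)" "tgt (s \<diamondop>\<^sub>c t) = ccomp (tgt s) (tgt t)"
 by (simp_all add: CENTRAL_def)

lemma CENTRAL_coherence [simp]:
 "src (Assoc CENTRAL X Y Z) = ccomp (ccomp X Y) Z"
 "tgt (Assoc CENTRAL X Y Z) = ccomp X (ccomp Y Z)"
 "src (LUnit CENTRAL X) = ccomp (cunit (lbase X)) X" "tgt (LUnit CENTRAL X) = X"
 "src (RUnit CENTRAL X) = ccomp X (cunit (rbase X))" "tgt (RUnit CENTRAL X) = X"
 by (simp_all add: CENTRAL_def)

lemma central_square_id_sel [simp]:
 "src (central_square_id X) = X" "tgt (central_square_id X) = X"
 "e:car (mid X) ==> fn (central_square_id X) e = e"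
 by (simp_all add: central_square_id_def)

lemma central_square_id_in [simp]: "X:centrals ==> central_square_id X:csquares"
proof -
 assume X: "X:centrals"
 then interpret ring "mid X" by (rule centralsD(3))
 have "(\<lambda>e\<in>car (mid X). e):ring_hom (mid X) (mid X)" by (rule ring_hom_memI) simp_all
 then show ?thesis
  using X centralsD(8,9)[OF X] by (simp add: central_squares_def central_square_id_def)
qed

lemma central_square_Comp [simp]:
 assumes "s:csquares" "t:csquares" "src t = tgt s"
 shows "t \<circ>\<^sub>c s:csquares"
proof -
 interpret E: ring "mid (src s)" by (rule centralsD(3)[OF central_squaresD(1)[OF assms(1)]])
 have "fn (t \<circ>\<^sub>c s):ring_hom (mid (src s)) (mid (tgt t))"
  using central_square_hom[OF assms(1)] central_square_hom[OF assms(2)] assms(3)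
  by (intro ring_hom_memI) simp_all
 moreover have "fn (t \<circ>\<^sub>c s):extensional (car (mid (src s)))" by (simp add: CENTRAL_def)
 ultimately show ?thesis
  using assms central_squaresD[OF assms(1)] central_squaresD[OF assms(2)] centralsD(8,9)[OF central_squaresD(1)[OF assms(1)]]
  by (simp add: central_squares_def)
qed

lemma category_Horz_CENTRAL: "category (Horz (CENTRAL :: ('u::infinite ring, 'u ring, 'u central, 'u central_square) double_cat))"
proof
 fix h g f :: "'u central_square"
 assume "h:Arr (Horz CENTRAL)" "g:Arr (Horz CENTRAL)" "f:Arr (Horz CENTRAL)"
  "Dom (Horz CENTRAL) h = Cod (Horz CENTRAL) g" "Dom (Horz CENTRAL) g = Cod (Horz CENTRAL) f"
 then show "h \<circ>\<^sub>c g \<circ>\<^sub>c f = h \<circ>\<^sub>c (g \<circ>\<^sub>c f)"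
  by (intro central_square_eqI[OF _ _ _ _ spans_carrier]) simp_all
next
 fix f :: "'u central_square" assume "f:Arr (Horz CENTRAL)"
 then have f: "f:csquares" by simp
 then show "Ident (Horz CENTRAL) (Cod (Horz CENTRAL) f) \<circ>\<^sub>c f = f"
  "f \<circ>\<^sub>c Ident (Horz CENTRAL) (Dom (Horz CENTRAL) f) = f"
  by (intro central_square_eqI[OF _ _ _ _ spans_carrier]; simp add: central_squaresD)+
qed (auto simp: central_squaresD)

text \<open>A set-theoretic inverse suffices: applying \<open>k\<close> to the identities satisfied
  by \<open>s\<close> shows that \<open>k\<close> is a ring map compatible with both bases. Such an
  inverse is available for the underlying bimodule squares.\<close>

lemma central_isoI:
 fixes s :: "'u::infinite central_square"
 assumes s: "s:csquares"
  and ks: "\<And>e. e:car (mid (src s)) ==> k (fn s e) = e"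
  and sk: "\<And>f. f:car (mid (tgt s)) ==> k f:car (mid (src s)) \<and> fn s (k f) = f"
 shows "is_iso (Horz CENTRAL) s"
proof -
 interpret E: ring "mid (src s)" by (rule centralsD(3)[OF central_squaresD(1)[OF s]])
 interpret F: ring "mid (tgt s)" by (rule centralsD(3)[OF central_squaresD(2)[OF s]])
 note sD = central_squaresD[OF s] and sh = central_square_hom[OF s]
 define g where "g = \<lparr>src = tgt s, fn = (\<lambda>f\<in>car (mid (tgt s)). k f), tgt = src s\<rparr>"
 have km: "k (f \<otimes>\<^bsub>mid (tgt s)\<^esub> f') = k f \<otimes>\<^bsub>mid (src s)\<^esub> k f'"
  and ka: "k (f \<oplus>\<^bsub>mid (tgt s)\<^esub> f') = k f \<oplus>\<^bsub>mid (src s)\<^esub> k f'"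
  if "f:car (mid (tgt s))" "f':car (mid (tgt s))" for f f'
  using ks[of "k f \<otimes>\<^bsub>mid (src s)\<^esub> k f'"] ks[of "k f \<oplus>\<^bsub>mid (src s)\<^esub> k f'"] sh sk that by simp_all
 have k1: "k \<one>\<^bsub>mid (tgt s)\<^esub> = \<one>\<^bsub>mid (src s)\<^esub>" using ks[of "\<one>\<^bsub>mid (src s)\<^esub>"] sh by simp
 have "(\<lambda>f\<in>car (mid (tgt s)). k f):ring_hom (mid (tgt s)) (mid (src s))"
  by (rule ring_hom_memI) (simp_all add: sk km ka k1)
 moreover have "k (lmap (tgt s) a) = lmap (src s) a" if "a:car (lbase (src s))" for a
  using ks[of "lmap (src s) a"] sD(7) that centralsD(8)[OF sD(1)] by simp
 moreover have "k (rmap (tgt s) b) = rmap (src s) b" if "b:car (rbase (src s))" for b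
  using ks[of "rmap (src s) b"] sD(8) that centralsD(9)[OF sD(1)] by simp
 ultimately have g: "g:csquares"
  using sD centralsD(8,9)[OF sD(2)] by (simp add: central_squares_def g_def)
 have "g \<circ>\<^sub>c s = central_square_id (src s)"
  by (rule central_square_eqI[OF _ _ _ _ spans_carrier]) (use s g in \<open>simp_all add: sD, simp_all add: g_def sh ks s sD\<close>)
 moreover have "s \<circ>\<^sub>c g = central_square_id (tgt s)"
 proof (rule central_square_eqI[OF _ _ _ _ spans_carrier])
  show "s \<circ>\<^sub>c g:csquares" by (rule central_square_Comp[OF g s]) (simp add: g_def)
  fix x assume "x:car (amon (mid (src (s \<circ>\<^sub>c g))))"
  then have "x:car (mid (tgt s))" "x:car (mid (src g))" by (simp_all add: g_def)
  then show "fn (s \<circ>\<^sub>c g) x = fn (central_square_id (tgt s)) x"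
   by simp (simp add: g_def sk)
 qed (simp_all add: sD, simp_all add: g_def)
 moreover have "src g = tgt s" "tgt g = src s" by (simp_all add: g_def)
 ultimately show ?thesis
  unfolding is_iso_def using s g by (auto simp: hom_arr_def)
qed

lemma square_iso_inverse:
 fixes s :: "'u::infinite square"
 assumes s: "s:squares" and "is_iso (Horz BIMOD) s"
 obtains k where "\<And>a. a:bcar (src s) ==> k (fn s a) = a"
  "\<And>b. b:bcar (tgt s) ==> k b:bcar (src s) \<and> fn s (k b) = b"
proof -
 obtain g where g: "g:squares" "src g = tgt s" "tgt g = src s"
  "g \<bullet> s = Ident (Horz BIMOD) (src s)" "s \<bullet> g = Ident (Horz BIMOD) (tgt s)"
  using assms(2) by (auto simp: is_iso_def hom_arr_def)
 have "fn g (fn s a) = a" if "a:bcar (src s)" for a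
  using arg_cong[OF g(4), of "\<lambda>x. fn x a"] that by simp
 moreover have "fn g b:bcar (src s) \<and> fn s (fn g b) = b" if "b:bcar (tgt s)" for b
  using arg_cong[OF g(5), of "\<lambda>x. fn x b"] that g(1-3) by simp
 ultimately show ?thesis by (rule that)
qed

lemma spans_central2:
 fixes X Y :: "'u::infinite central"
 assumes "X:centrals" "Y:centrals" "rbase X = lbase Y"
  "spans (amon (mid X)) S" "spans (amon (mid Y)) S'"
 shows "spans (amon (mid (ccomp X Y))) (case_prod (tens (cbim X) (cbim Y)) ` (S \<times> S'))"
proof -
 interpret ubimodule_pair "cbim X" "cbim Y" using assms by (intro ubimodule_pairI) simp_all
 show ?thesis using spans_tens[of S S'] assms by simp
qed

lemma central_eqI2:
 assumes "s:csquares" "s':csquares" "src s = ccomp X Y" "src s' = ccomp X Y" "tgt s = tgt s'"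
  "X:centrals" "Y:centrals" "rbase X = lbase Y"
  "\<And>e f. e:car (mid X) ==> f:car (mid Y) ==>
   fn s (tens (cbim X) (cbim Y) e f) = fn s' (tens (cbim X) (cbim Y) e f)"
 shows "s = (s' :: 'u::infinite central_square)"
proof (rule central_square_eqI)
 show "spans (amon (mid (src s))) (case_prod (tens (cbim X) (cbim Y)) `
   (car (amon (mid X)) \<times> car (amon (mid Y))))"
  unfolding assms(3) using assms(6-8) by (intro spans_central2 spans_carrier)
qed (use assms in auto)

lemma central_eqI3:
 assumes "s:csquares" "s':csquares" "src s = ccomp (ccomp X Y) Z"
  "src s' = ccomp (ccomp X Y) Z" "tgt s = tgt s'"
  "X:centrals" "Y:centrals" "Z:centrals" "rbase X = lbase Y" "rbase Y = lbase Z"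
  "\<And>e f g. e:car (mid X) ==> f:car (mid Y) ==> g:car (mid Z) ==>
   fn s (tens (cbim (ccomp X Y)) (cbim Z) (tens (cbim X) (cbim Y) e f) g)
   = fn s' (tens (cbim (ccomp X Y)) (cbim Z) (tens (cbim X) (cbim Y) e f) g)"
 shows "s = (s' :: 'u::infinite central_square)"
proof (rule central_square_eqI)
 show "spans (amon (mid (src s))) (case_prod (tens (cbim (ccomp X Y)) (cbim Z)) `
  (case_prod (tens (cbim X) (cbim Y)) `
   (car (amon (mid X)) \<times> car (amon (mid Y))) \<times> car (amon (mid Z))))"
  unfolding assms(3) by (intro spans_central2 spans_carrier) (use assms(6-10) in simp_all)
qed (use assms in auto)

lemma central_eqI4:
 assumes "s:csquares" "s':csquares" "src s = ccomp (ccomp (ccomp W X) Y) Z"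
  "src s' = ccomp (ccomp (ccomp W X) Y) Z" "tgt s = tgt s'"
  "W:centrals" "X:centrals" "Y:centrals" "Z:centrals" "rbase W = lbase X" "rbase X = lbase Y" "rbase Y = lbase Z"
  "\<And>d e f g. d:car (mid W) ==> e:car (mid X) ==> f:car (mid Y) ==> g:car (mid Z) ==>
   fn s (tens (cbim (ccomp (ccomp W X) Y)) (cbim Z)
    (tens (cbim (ccomp W X)) (cbim Y) (tens (cbim W) (cbim X) d e) f) g)
   = fn s' (tens (cbim (ccomp (ccomp W X) Y)) (cbim Z)
    (tens (cbim (ccomp W X)) (cbim Y) (tens (cbim W) (cbim X) d e) f) g)"
 shows "s = (s' :: 'u::infinite central_square)"
proof (rule central_square_eqI)
 show "spans (amon (mid (src s))) (case_prod (tens (cbim (ccomp (ccomp W X) Y)) (cbim Z)) `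
  (case_prod (tens (cbim (ccomp W X)) (cbim Y)) `
  (case_prod (tens (cbim W) (cbim X)) `
   (car (amon (mid W)) \<times> car (amon (mid X))) \<times> car (amon (mid Y)))
   \<times> car (amon (mid Z))))"
  unfolding assms(3) by (intro spans_central2 spans_carrier) (use assms(6-12) in simp_all)
qed (use assms in auto)

lemma fn_central_HComp [simp]:
 fixes s t :: "'u::infinite central_square"
 assumes "s:csquares" "t:csquares" "rbase (src s) = lbase (src t)" "src s = X" "src t = Y"
  "e:car (mid X)" "f:car (mid Y)"
 shows "fn (s \<diamondop>\<^sub>c t) (tens (cbim X) (cbim Y) e f)
  = tens (cbim (tgt s)) (cbim (tgt t)) (fn s e) (fn t f)"
 using fn_HComp[of "csq_bimod s" "csq_bimod t" "cbim X" "cbim Y" e f] assms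
 by (simp add: CENTRAL_def BIMOD_HComp(6))

text \<open>The function is that of the horizontal composite of the underlying bimodule squares,
  which gives additivity and normalisation. What remains is multiplicativity, tested on products of
  pure tensors, and compatibility with the bases.\<close>

lemma central_square_HComp [simp]:
 fixes s t :: "'u::infinite central_square"
 assumes s: "s:csquares" and t: "t:csquares" and st: "rbase (src s) = lbase (src t)"
 shows "s \<diamondop>\<^sub>c t:csquares"
proof -
 note sD = central_squaresD[OF s] and tD = central_squaresD[OF t]
 have c: "ccomp (src s) (src t):centrals" "ccomp (tgt s) (tgt t):centrals"
  using sD(1-4) tD(1-4) st by simp_all
 have sq: "csq_bimod s \<diamondop> csq_bimod t:squares" using s t st by simp
 have f: "fn (s \<diamondop>\<^sub>c t) = fn (csq_bimod s \<diamondop> csq_bimod t)"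
  by (simp add: CENTRAL_def BIMOD_HComp(6))
 have "fn (s \<diamondop>\<^sub>c t):ring_hom (mid (ccomp (src s) (src t))) (mid (ccomp (tgt s) (tgt t)))"
 proof (rule ring_hom_spansI)
  show "spans (amon (mid (ccomp (src s) (src t)))) (case_prod (tens (cbim (src s)) (cbim (src t))) `
   (car (amon (mid (src s))) \<times> car (amon (mid (src t)))))"
   using sD tD st by (intro spans_central2 spans_carrier)
  show "fn (s \<diamondop>\<^sub>c t):hom (amon (mid (ccomp (src s) (src t)))) (amon (mid (ccomp (tgt s) (tgt t))))"
   unfolding f using squaresD(9)[OF sq] by simp
 qed (use c[THEN centralsD(3)] s t st sD(1-4) tD(1-4) in \<open>auto simp: central_square_hom\<close>)
 moreover have "fn (s \<diamondop>\<^sub>c t):extensional (car (mid (ccomp (src s) (src t))))"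
  unfolding f using squaresD(10)[OF sq] by simp
 ultimately show ?thesis
  using c s t st sD(3,4,7) tD(3,4,8) sD(1,2) tD(1,2) centralsD(8)[OF sD(1)] centralsD(9)[OF tD(1)]
  by (simp add: central_squares_def[of] central_square_hom)
qed

section \<open>Associators and unitors of central maps\<close>

context
 fixes X Y Z :: "'u::infinite central"
 assumes X: "X:centrals" and Y: "Y:centrals" and Z: "Z:centrals"
  and XY: "rbase X = lbase Y" and YZ: "rbase Y = lbase Z"
begin

interpretation T: ubimodule_triple "cbim X" "cbim Y" "cbim Z"
 by (intro ubimodule_tripleI) (simp_all add: X Y Z XY YZ)

lemma agree_left:
 "uten (cbim (ccomp X Y)) (cbim Z) = uten (btens (cbim X) (cbim Y)) (cbim Z)"
 "tens (cbim (ccomp X Y)) (cbim Z) = tens (btens (cbim X) (cbim Y)) (cbim Z)"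
 using agree_tensor[OF central_agree_comp[OF X Y XY] agree_refl] YZ by simp_all

lemma agree_right:
 "uten (cbim X) (cbim (ccomp Y Z)) = uten (cbim X) (btens (cbim Y) (cbim Z))"
 "tens (cbim X) (cbim (ccomp Y Z)) = tens (cbim X) (btens (cbim Y) (cbim Z))"
 using agree_tensor[OF agree_refl central_agree_comp[OF Y Z YZ]] XY by simp_all

text \<open>Once the coded tensor products are known to be equal, the two \<open>THE\<close>
  descriptions are the same term, and no uniqueness argument has to be repeated.\<close>

lemma fn_central_assoc: "fn (Assoc CENTRAL X Y Z) = assoc_fun (cbim X) (cbim Y) (cbim Z)"
 by (simp add: CENTRAL_def central_assoc_def assoc_fun_def Let_def agree_left agree_right)

lemma fn_central_assoc_tens [simp]:
 "e:car (mid X) ==> f:car (mid Y) ==> g:car (mid Z) ==>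
  fn (Assoc CENTRAL X Y Z) (tens (cbim (ccomp X Y)) (cbim Z) (tens (cbim X) (cbim Y) e f) g)
  = tens (cbim X) (cbim (ccomp Y Z)) e (tens (cbim Y) (cbim Z) f g)"
 unfolding fn_central_assoc agree_left(2) agree_right(2) using X Y Z XY YZ by simp

lemma central_square_Assoc [simp]: "Assoc CENTRAL X Y Z:csquares"
proof -
 have c: "ccomp (ccomp X Y) Z:centrals" "ccomp X (ccomp Y Z):centrals"
  using X Y Z XY YZ by simp_all
 have "fn (Assoc CENTRAL X Y Z):ring_hom (mid (ccomp (ccomp X Y) Z)) (mid (ccomp X (ccomp Y Z)))"
 proof (rule ring_hom_spansI)
  show "spans (amon (mid (ccomp (ccomp X Y) Z))) (case_prod (tens (cbim (ccomp X Y)) (cbim Z)) `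
  (case_prod (tens (cbim X) (cbim Y)) `
   (car (amon (mid X)) \<times> car (amon (mid Y))) \<times> car (amon (mid Z))))"
   by (intro spans_central2 spans_carrier) (use X Y Z XY YZ in simp_all)
  show "fn (Assoc CENTRAL X Y Z):hom (amon (mid (ccomp (ccomp X Y) Z))) (amon (mid (ccomp X (ccomp Y Z))))"
   using T.assoc_fun_hom by (simp add: fn_central_assoc agree_left agree_right)
 qed (use c[THEN centralsD(3)] X Y Z XY YZ in auto)
 moreover have "fn (Assoc CENTRAL X Y Z):extensional (car (mid (ccomp (ccomp X Y) Z)))"
  using T.assoc_fun_ext by (simp add: fn_central_assoc agree_left)
 ultimately show ?thesis
  using c X Y Z XY YZ centralsD(8)[OF X] centralsD(9)[OF Z] by (simp add: central_squares_def)
qed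

lemma central_iso_Assoc: "is_iso (Horz CENTRAL) (Assoc CENTRAL X Y Z)"
proof -
 have m: "bimodule (cbim X)" "bimodule (cbim Y)" "bimodule (cbim Z)"
  "rring (cbim X) = lring (cbim Y)" "rring (cbim Y) = lring (cbim Z)"
  using X Y Z XY YZ by simp_all
 obtain k where k: "\<And>a. a:bcar (src (Assoc BIMOD (cbim X) (cbim Y) (cbim Z))) ==>
   k (fn (Assoc BIMOD (cbim X) (cbim Y) (cbim Z)) a) = a"
  "\<And>b. b:bcar (tgt (Assoc BIMOD (cbim X) (cbim Y) (cbim Z))) ==>
   k b:bcar (src (Assoc BIMOD (cbim X) (cbim Y) (cbim Z))) \<and>
   fn (Assoc BIMOD (cbim X) (cbim Y) (cbim Z)) (k b) = b"
  using square_iso_inverse[OF square_Assoc[OF m] iso_Assoc[OF m]] by metis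
 show ?thesis
 proof (rule central_isoI[where k = k])
  fix e assume "e:car (mid (src (Assoc CENTRAL X Y Z)))"
  then show "k (fn (Assoc CENTRAL X Y Z) e) = e"
   using k(1)[of e] by (simp add: fn_central_assoc agree_left)
 next
  fix f assume "f:car (mid (tgt (Assoc CENTRAL X Y Z)))"
  then show "k f:car (mid (src (Assoc CENTRAL X Y Z))) \<and> fn (Assoc CENTRAL X Y Z) (k f) = f"
   using k(2)[of f] by (simp add: fn_central_assoc agree_left agree_right)
 qed simp
qed

end

context
 fixes X :: "'u::infinite central"
 assumes X: "X:centrals"
begin

lemma agree_lunit:
 "uten (cbim (cunit (lbase X))) (cbim X) = uten (regb (lbase X)) (cbim X)"
 "tens (cbim (cunit (lbase X))) (cbim X) = tens (regb (lbase X)) (cbim X)"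
 using agree_tensor[OF agree_unit[OF centralsD(1)[OF X]] agree_refl[of "cbim X"]] by simp_all

lemma agree_runit:
 "uten (cbim X) (cbim (cunit (rbase X))) = uten (cbim X) (regb (rbase X))"
 "tens (cbim X) (cbim (cunit (rbase X))) = tens (cbim X) (regb (rbase X))"
 using agree_tensor[OF agree_refl[of "cbim X"] agree_unit[OF centralsD(2)[OF X]]] by simp_all

lemma fn_central_lunit: "fn (LUnit CENTRAL X) = lunit_fun (cbim X)"
 by (simp add: CENTRAL_def central_lunit_def lunit_fun_def agree_lunit)

lemma fn_central_runit: "fn (RUnit CENTRAL X) = runit_fun (cbim X)"
 by (simp add: CENTRAL_def central_runit_def runit_fun_def agree_runit)

lemma fn_central_lunit_tens [simp]: "a:car (lbase X) ==> e:car (mid X) ==>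
  fn (LUnit CENTRAL X) (tens (cbim (cunit (lbase X))) (cbim X) a e) = lmap X a \<otimes>\<^bsub>mid X\<^esub> e"
 using lunit_fun_tens[OF bimodule_central[OF X]] by (simp add: fn_central_lunit agree_lunit)

lemma fn_central_runit_tens [simp]: "e:car (mid X) ==> b:car (rbase X) ==>
  fn (RUnit CENTRAL X) (tens (cbim X) (cbim (cunit (rbase X))) e b) = e \<otimes>\<^bsub>mid X\<^esub> rmap X b"
 using runit_fun_tens[OF bimodule_central[OF X]] by (simp add: fn_central_runit agree_runit)

interpretation E: ring "mid X" by (rule centralsD(3)[OF X])
interpretation A: ring "lbase X" by (rule central_ring(1)[OF X])
interpretation B: ring "rbase X" by (rule central_ring(2)[OF X])

text \<open>The scalar commutes with \<open>e'\<close> by centrality. These exchanges make the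
  unitors multiplicative, as they compare a product of actions with the action on a product.\<close>

lemma central_interchange:
 "x:car (lbase X) ==> e:car (mid X) ==> e':car (mid X) ==> f:car (mid X) ==>
  e \<otimes>\<^bsub>mid X\<^esub> lmap X x \<otimes>\<^bsub>mid X\<^esub> (e' \<otimes>\<^bsub>mid X\<^esub> f) = e \<otimes>\<^bsub>mid X\<^esub> e' \<otimes>\<^bsub>mid X\<^esub> (lmap X x \<otimes>\<^bsub>mid X\<^esub> f)"
 "y:car (rbase X) ==> e:car (mid X) ==> e':car (mid X) ==> f:car (mid X) ==>
  e \<otimes>\<^bsub>mid X\<^esub> e' \<otimes>\<^bsub>mid X\<^esub> (rmap X y \<otimes>\<^bsub>mid X\<^esub> f) = e \<otimes>\<^bsub>mid X\<^esub> rmap X y \<otimes>\<^bsub>mid X\<^esub> (e' \<otimes>\<^bsub>mid X\<^esub> f)"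
proof -
 assume *: "x:car (lbase X)" "e:car (mid X)" "e':car (mid X)" "f:car (mid X)"
 have "lmap X x \<otimes>\<^bsub>mid X\<^esub> (e' \<otimes>\<^bsub>mid X\<^esub> f) = e' \<otimes>\<^bsub>mid X\<^esub> (lmap X x \<otimes>\<^bsub>mid X\<^esub> f)"
  using * centralsD(8)[OF X] centralsD(10)[OF X, of x e'] by (metis E.m_assoc)
 then show "e \<otimes>\<^bsub>mid X\<^esub> lmap X x \<otimes>\<^bsub>mid X\<^esub> (e' \<otimes>\<^bsub>mid X\<^esub> f) = e \<otimes>\<^bsub>mid X\<^esub> e' \<otimes>\<^bsub>mid X\<^esub> (lmap X x \<otimes>\<^bsub>mid X\<^esub> f)"
  using * centralsD(8)[OF X] by (simp add: E.m_assoc)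
next
 assume *: "y:car (rbase X)" "e:car (mid X)" "e':car (mid X)" "f:car (mid X)"
 have "e' \<otimes>\<^bsub>mid X\<^esub> (rmap X y \<otimes>\<^bsub>mid X\<^esub> f) = rmap X y \<otimes>\<^bsub>mid X\<^esub> (e' \<otimes>\<^bsub>mid X\<^esub> f)"
  using * centralsD(9)[OF X] centralsD(11)[OF X, of y e'] by (metis E.m_assoc)
 then show "e \<otimes>\<^bsub>mid X\<^esub> e' \<otimes>\<^bsub>mid X\<^esub> (rmap X y \<otimes>\<^bsub>mid X\<^esub> f) = e \<otimes>\<^bsub>mid X\<^esub> rmap X y \<otimes>\<^bsub>mid X\<^esub> (e' \<otimes>\<^bsub>mid X\<^esub> f)"
  using * centralsD(9)[OF X] by (simp add: E.m_assoc)
qed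

lemma central_square_LUnit [simp]: "LUnit CENTRAL X:csquares"
proof -
 note cr = centralsD(1)[OF X]
 have c: "ccomp (cunit (lbase X)) X:centrals" using X cr by simp
 have "fn (LUnit CENTRAL X):ring_hom (mid (ccomp (cunit (lbase X)) X)) (mid X)"
 proof (rule ring_hom_spansI)
  show "spans (amon (mid (ccomp (cunit (lbase X)) X))) (case_prod (tens (cbim (cunit (lbase X))) (cbim X)) `
   (car (amon (mid (cunit (lbase X)))) \<times> car (amon (mid X))))"
   by (intro spans_central2 spans_carrier) (use X cr in simp_all)
  show "fn (LUnit CENTRAL X):hom (amon (mid (ccomp (cunit (lbase X)) X))) (amon (mid X))"
   using lunit_fun_hom[OF bimodule_central[OF X]] by (simp add: fn_central_lunit agree_lunit)
  fix x y assume "x:case_prod (tens (cbim (cunit (lbase X))) (cbim X)) `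
   (car (amon (mid (cunit (lbase X)))) \<times> car (amon (mid X)))"
   "y:case_prod (tens (cbim (cunit (lbase X))) (cbim X)) `
   (car (amon (mid (cunit (lbase X)))) \<times> car (amon (mid X)))"
  then obtain a e a' e' where "x = tens (cbim (cunit (lbase X))) (cbim X) a e"
   "y = tens (cbim (cunit (lbase X))) (cbim X) a' e'"
   "a:car (lbase X)" "a':car (lbase X)" "e:car (mid X)" "e':car (mid X)" by auto
  then show "fn (LUnit CENTRAL X) (x \<otimes>\<^bsub>mid (ccomp (cunit (lbase X)) X)\<^esub> y) =
    fn (LUnit CENTRAL X) x \<otimes>\<^bsub>mid X\<^esub> fn (LUnit CENTRAL X) y"
   using X cr central_interchange(1)[of a' "lmap X a" e e'] centralsD(8)[OF X] centralsD(10)[OF X, of a' e]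
   by (simp add: central_maps_hom E.m_assoc)
 qed (use c[THEN centralsD(3)] X cr centralsD(3)[OF X] in \<open>auto simp: central_maps_hom\<close>)
 moreover have "fn (LUnit CENTRAL X):extensional (car (mid (ccomp (cunit (lbase X)) X)))"
  using lunit_fun_ext[OF bimodule_central[OF X]] by (simp add: fn_central_lunit agree_lunit)
 ultimately show ?thesis
  using c X cr centralsD(8,9)[OF X] by (simp add: central_squares_def central_maps_hom)
qed

lemma central_square_RUnit [simp]: "RUnit CENTRAL X:csquares"
proof -
 note cr = centralsD(2)[OF X]
 have c: "ccomp X (cunit (rbase X)):centrals" using X cr by simp
 have "fn (RUnit CENTRAL X):ring_hom (mid (ccomp X (cunit (rbase X)))) (mid X)"
 proof (rule ring_hom_spansI)
  show "spans (amon (mid (ccomp X (cunit (rbase X))))) (case_prod (tens (cbim X) (cbim (cunit (rbase X)))) `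
   (car (amon (mid X)) \<times> car (amon (mid (cunit (rbase X))))))"
   by (intro spans_central2 spans_carrier) (use X cr in simp_all)
  show "fn (RUnit CENTRAL X):hom (amon (mid (ccomp X (cunit (rbase X))))) (amon (mid X))"
   using runit_fun_hom[OF bimodule_central[OF X]] by (simp add: fn_central_runit agree_runit)
  fix x y assume "x:case_prod (tens (cbim X) (cbim (cunit (rbase X)))) `
   (car (amon (mid X)) \<times> car (amon (mid (cunit (rbase X)))))"
   "y:case_prod (tens (cbim X) (cbim (cunit (rbase X)))) `
   (car (amon (mid X)) \<times> car (amon (mid (cunit (rbase X)))))"
  then obtain a e a' e' where "x = tens (cbim X) (cbim (cunit (rbase X))) e a"
   "y = tens (cbim X) (cbim (cunit (rbase X))) e' a'"
   "a:car (rbase X)" "a':car (rbase X)" "e:car (mid X)" "e':car (mid X)" by auto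
  then show "fn (RUnit CENTRAL X) (x \<otimes>\<^bsub>mid (ccomp X (cunit (rbase X)))\<^esub> y) =
    fn (RUnit CENTRAL X) x \<otimes>\<^bsub>mid X\<^esub> fn (RUnit CENTRAL X) y"
   using X cr central_interchange(2)[of a e e' "rmap X a'"] centralsD(9)[OF X]
   by (simp add: central_maps_hom E.m_assoc)
 qed (use c[THEN centralsD(3)] X cr centralsD(3)[OF X] in \<open>auto simp: central_maps_hom\<close>)
 moreover have "fn (RUnit CENTRAL X):extensional (car (mid (ccomp X (cunit (rbase X)))))"
  using runit_fun_ext[OF bimodule_central[OF X]] by (simp add: fn_central_runit agree_runit)
 ultimately show ?thesis
  using c X cr centralsD(8,9)[OF X] by (simp add: central_squares_def central_maps_hom)
qed

lemma central_iso_LUnit: "is_iso (Horz CENTRAL) (LUnit CENTRAL X)"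
proof -
 have m: "bimodule (cbim X)" using X by simp
 obtain k where k: "\<And>a. a:bcar (src (LUnit BIMOD (cbim X))) ==> k (fn (LUnit BIMOD (cbim X)) a) = a"
  "\<And>b. b:bcar (tgt (LUnit BIMOD (cbim X))) ==>
   k b:bcar (src (LUnit BIMOD (cbim X))) \<and> fn (LUnit BIMOD (cbim X)) (k b) = b"
  using square_iso_inverse[OF square_LUnit[OF m] iso_LUnit[OF m]] by metis
 show ?thesis
  by (rule central_isoI[where k = k]) (use k in \<open>simp_all add: fn_central_lunit agree_lunit\<close>)
qed

lemma central_iso_RUnit: "is_iso (Horz CENTRAL) (RUnit CENTRAL X)"
proof -
 have m: "bimodule (cbim X)" using X by simp
 obtain k where k: "\<And>a. a:bcar (src (RUnit BIMOD (cbim X))) ==> k (fn (RUnit BIMOD (cbim X)) a) = a"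
  "\<And>b. b:bcar (tgt (RUnit BIMOD (cbim X))) ==>
   k b:bcar (src (RUnit BIMOD (cbim X))) \<and> fn (RUnit BIMOD (cbim X)) (k b) = b"
  using square_iso_inverse[OF square_RUnit[OF m] iso_RUnit[OF m]] by metis
 show ?thesis
  by (rule central_isoI[where k = k]) (use k in \<open>simp_all add: fn_central_runit agree_runit\<close>)
qed

end

section \<open>Axioms of the double category of central maps\<close>

lemma functor_Lft_CENTRAL: "cat_functor (Horz CENTRAL) (Vert CENTRAL) (Lft CENTRAL)"
 and functor_Rgt_CENTRAL: "cat_functor (Horz CENTRAL) (Vert CENTRAL) (Rgt CENTRAL)"
 unfolding cat_functor_def cat_functor_axioms_def
 by (auto simp: category_discrete_cat category_Horz_CENTRAL central_squaresD centralsD(1,2) central_squaresD(1,2)[THEN centralsD(1)]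
  central_squaresD(1,2)[THEN centralsD(2)])

lemma functor_Delta_CENTRAL: "cat_functor (Vert CENTRAL) (Horz CENTRAL) (Delta CENTRAL)"
proof -
 have "central_square_id X \<circ>\<^sub>c central_square_id X = central_square_id X" if "X:centrals" for X :: "'a central"
  using category.Comp_Ident_left[OF category_Horz_CENTRAL, of "central_square_id X"] that by simp
 then show ?thesis
  unfolding cat_functor_def cat_functor_axioms_def by (auto simp: category_discrete_cat category_Horz_CENTRAL)
qed

lemma functor_HComp_CENTRAL: "cat_functor (hcomposable CENTRAL) (Horz CENTRAL) (HComp CENTRAL)"
proof -
 have c: "(s' \<circ>\<^sub>c s) \<diamondop>\<^sub>c (t' \<circ>\<^sub>c t) = (s' \<diamondop>\<^sub>c t') \<circ>\<^sub>c (s \<diamondop>\<^sub>c t)"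
  if "s':csquares" "t':csquares" "s:csquares" "t:csquares"
   "rbase (src s) = lbase (src t)" "src s' = tgt s" "src t' = tgt t" for s s' t t' :: "'a central_square"
  by (rule central_eqI2[where X = "src s" and Y = "src t"]) (use that in \<open>simp_all add: central_squaresD\<close>)
 have i: "central_square_id X \<diamondop>\<^sub>c central_square_id Y = central_square_id (ccomp X Y)"
  if "X:centrals" "Y:centrals" "rbase X = lbase Y" for X Y :: "'a central"
  by (rule central_eqI2[where X = X and Y = Y]) (use that in simp_all)
 show ?thesis
  unfolding cat_functor_def cat_functor_axioms_def
  by (auto simp: category_Horz_CENTRAL category_pullback_cat[OF functor_Rgt_CENTRAL functor_Lft_CENTRAL]
    pullback_cat_sel central_squaresD c i)
qed

theorem double_category_CENTRAL:
 "double_category (CENTRAL :: ('u::infinite ring, 'u ring, 'u central, 'u central_square) double_cat)"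
proof (intro double_category.intro functor_Delta_CENTRAL functor_Lft_CENTRAL functor_Rgt_CENTRAL functor_HComp_CENTRAL
  double_category_axioms.intro)
 fix \<gamma> \<delta> \<epsilon> :: "'u central_square"
 assume "(\<gamma>, \<delta>):Arr (hcomposable CENTRAL)" "(\<delta>, \<epsilon>):Arr (hcomposable CENTRAL)"
 then have s: "\<gamma>:csquares" "\<delta>:csquares" "\<epsilon>:csquares"
  "rbase (src \<gamma>) = lbase (src \<delta>)" "rbase (src \<delta>) = lbase (src \<epsilon>)"
  by (simp_all add: pullback_cat_sel)
 show "Assoc CENTRAL (Cod (Horz CENTRAL) \<gamma>) (Cod (Horz CENTRAL) \<delta>) (Cod (Horz CENTRAL) \<epsilon>) \<circ>\<^sub>c
   ((\<gamma> \<diamondop>\<^sub>c \<delta>) \<diamondop>\<^sub>c \<epsilon>) =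
  (\<gamma> \<diamondop>\<^sub>c (\<delta> \<diamondop>\<^sub>c \<epsilon>)) \<circ>\<^sub>c
   Assoc CENTRAL (Dom (Horz CENTRAL) \<gamma>) (Dom (Horz CENTRAL) \<delta>) (Dom (Horz CENTRAL) \<epsilon>)"
  by (rule central_eqI3[where X = "src \<gamma>" and Y = "src \<delta>" and Z = "src \<epsilon>"])
   (use s in \<open>simp_all add: central_squaresD\<close>)
next
 fix \<epsilon> :: "'u central_square"
 assume "\<epsilon>:Arr (Horz CENTRAL)"
 then have s: "\<epsilon>:csquares" by simp
 note sD = central_squaresD[OF s]
 show "LUnit CENTRAL (Cod (Horz CENTRAL) \<epsilon>) \<circ>\<^sub>c (AMap (Delta CENTRAL) (AMap (Lft CENTRAL) \<epsilon>) \<diamondop>\<^sub>c \<epsilon>) =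
  \<epsilon> \<circ>\<^sub>c LUnit CENTRAL (Dom (Horz CENTRAL) \<epsilon>)"
  by (rule central_eqI2[where X = "cunit (lbase (src \<epsilon>))" and Y = "src \<epsilon>"])
   (use s sD centralsD(1)[OF sD(1)] centralsD(8)[OF sD(1)] fn_central_lunit_tens[OF sD(2)] in
    \<open>simp_all add: central_square_hom\<close>)
 show "RUnit CENTRAL (Cod (Horz CENTRAL) \<epsilon>) \<circ>\<^sub>c (\<epsilon> \<diamondop>\<^sub>c AMap (Delta CENTRAL) (AMap (Rgt CENTRAL) \<epsilon>)) =
  \<epsilon> \<circ>\<^sub>c RUnit CENTRAL (Dom (Horz CENTRAL) \<epsilon>)"
  by (rule central_eqI2[where X = "src \<epsilon>" and Y = "cunit (rbase (src \<epsilon>))"])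
   (use s sD centralsD(2)[OF sD(1)] centralsD(9)[OF sD(1)] fn_central_runit_tens[OF sD(2)] in
    \<open>simp_all add: central_square_hom\<close>)
next
 fix K H G F :: "'u central"
 assume "(K, H):Obj (hcomposable CENTRAL)" "(H, G):Obj (hcomposable CENTRAL)" "(G, F):Obj (hcomposable CENTRAL)"
 then have m: "K:centrals" "H:centrals" "G:centrals" "F:centrals" "rbase K = lbase H" "rbase H = lbase G" "rbase G = lbase F"
  by (simp_all add: pullback_cat_sel)
 show "Assoc CENTRAL K H (G \<star>\<^bsub>CENTRAL\<^esub> F) \<circ>\<^sub>c Assoc CENTRAL (K \<star>\<^bsub>CENTRAL\<^esub> H) G F =
  (Ident (Horz CENTRAL) K \<diamondop>\<^sub>c Assoc CENTRAL H G F) \<circ>\<^sub>c Assoc CENTRAL K (H \<star>\<^bsub>CENTRAL\<^esub> G) F \<circ>\<^sub>c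
   (Assoc CENTRAL K H G \<diamondop>\<^sub>c Ident (Horz CENTRAL) F)"
  by (rule central_eqI4[where W = K and X = H and Y = G and Z = F]) (use m in simp_all)
next
 fix G F :: "'u central"
 assume "(G, F):Obj (hcomposable CENTRAL)"
 then have m: "G:centrals" "F:centrals" "rbase G = lbase F" by (simp_all add: pullback_cat_sel)
 have b: "tens (cbim G) (cbim F) (e \<otimes>\<^bsub>mid G\<^esub> rmap G r) f
   = tens (cbim G) (cbim F) e (lmap F r \<otimes>\<^bsub>mid F\<^esub> f)"
  if "e:car (mid G)" "r:car (lbase F)" "f:car (mid F)" for e r f
  using central_pair.tens_middle[OF central_pair.intro[OF m]] that m by simp
 show "(Ident (Horz CENTRAL) G \<diamondop>\<^sub>c LUnit CENTRAL F) \<circ>\<^sub>c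
   Assoc CENTRAL G (OMap (Delta CENTRAL) (OMap (Rgt CENTRAL) G)) F = RUnit CENTRAL G \<diamondop>\<^sub>c Ident (Horz CENTRAL) F"
  by (rule central_eqI3[where X = G and Y = "cunit (rbase G)" and Z = F])
   (use m centralsD(1)[OF m(2)] fn_central_lunit_tens[OF m(2)] fn_central_runit_tens[OF m(1)] in \<open>simp_all add: b\<close>)
qed (auto simp: pullback_cat_sel hom_arr_def central_iso_Assoc central_iso_LUnit central_iso_RUnit centralsD(1,2))

section \<open>The double functor from central maps to bimodules\<close>

text \<open>The comparison maps of \<Omega> do not move elements, but their source and target may
  differ as records outside the carriers, so identity squares would have the wrong boundary.\<close>

definition agree_square :: "('u, 'u) bimod \<Rightarrow> ('u, 'u) bimod \<Rightarrow> 'u::infinite square" where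
 "agree_square A B = \<lparr>src = A, fn = (\<lambda>a\<in>bcar A. a), tgt = B, lmor = rid (lring A), rmor = rid (rring A)\<rparr>"

lemma agree_square_sel [simp]:
 "src (agree_square A B) = A" "tgt (agree_square A B) = B" "lmor (agree_square A B) = rid (lring A)"
 "rmor (agree_square A B) = rid (rring A)" "a:bcar A ==> fn (agree_square A B) a = a"
 by (simp_all add: agree_square_def)

lemma agree_square_in [simp]:
 assumes "bimodule A" "bimodule B" "agree A B"
 shows "agree_square A B:squares"
proof (rule squaresI)
 interpret A: bimodule A by fact
 have "(\<lambda>a\<in>bcar A. a):hom (bgrp A) (bgrp A)"
  using hom_ident by (simp add: hom_restrict_iff bimodule_group assms)
 then show "fn (agree_square A B):hom (bgrp (src (agree_square A B))) (bgrp (tgt (agree_square A B)))"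
  using assms(3) by (simp add: agree_square_def agree_def)
 fix q a r
 show "q:car (lring (src (agree_square A B))) ==> a:bcar (src (agree_square A B)) ==>
  fn (agree_square A B) (lact (src (agree_square A B)) q a)
   = lact (tgt (agree_square A B)) (fn (lmor (agree_square A B)) q) (fn (agree_square A B) a)"
  using assms(3) A.lact_closed by (simp add: agree_def)
 show "a:bcar (src (agree_square A B)) ==> r:car (rring (src (agree_square A B))) ==>
  fn (agree_square A B) (ract (src (agree_square A B)) a r)
   = ract (tgt (agree_square A B)) (fn (agree_square A B) a) (fn (rmor (agree_square A B)) r)"
  using assms(3) A.ract_closed by (simp add: agree_def)
qed (use assms in \<open>auto simp: bimodule.ring_left bimodule.ring_right agree_def\<close>, simp add: agree_square_def)

definition Omega_fct :: "('u::infinite ring, 'u ring, 'u central, 'u central_square,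
  'u ring, 'u ring_map, ('u, 'u) bimod, 'u square) double_fctr" where
 "Omega_fct =
  \<lparr>Fun0 = \<lparr>OMap = (\<lambda>A\<in>{A. cring A}. A), AMap = (\<lambda>A\<in>{A. cring A}. rid A)\<rparr>,
  Fun1 = \<lparr>OMap = (\<lambda>X\<in>centrals. cbim X), AMap = (\<lambda>s\<in>central_squares. csq_bimod s)\<rparr>,
  FComp = (\<lambda>(X, Y)\<in>Obj (hcomposable CENTRAL).
   agree_square (btens (cbim X) (cbim Y)) (cbim (ccomp X Y))),
  FUnit = (\<lambda>A\<in>{A. cring A}. agree_square (regb A) (cbim (cunit A)))\<rparr>"

lemma Omega_fct_sel [simp]:
 "cring A ==> OMap (Fun0 Omega_fct) A = A" "cring A ==> AMap (Fun0 Omega_fct) A = rid A"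
 "X:centrals ==> OMap (Fun1 Omega_fct) X = cbim X"
 "s:csquares ==> AMap (Fun1 Omega_fct) s = csq_bimod s"
 "X:centrals ==> Y:centrals ==> rbase X = lbase Y ==> FComp Omega_fct (X, Y) =
  agree_square (btens (cbim X) (cbim Y)) (cbim (ccomp X Y))"
 "cring A ==> FUnit Omega_fct A = agree_square (regb A) (cbim (cunit A))"
 by (simp_all add: Omega_fct_def pullback_cat_sel)

lemma cring_is_ring [simp]: "cring A ==> ring A"
 by (simp add: cring_def)

lemmas agree_syms [simp] = agree_sym[OF central_agree_comp] agree_sym[OF agree_unit]

text \<open>As the comparison squares fix every element, each law says that a coherence map of
  \<open>CENTRAL\<close> and the one of \<open>BIMOD\<close> have the same values on pure
  tensors.\<close>

theorem double_functor_central_bimod: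
 "double_functor CENTRAL BIMOD (Omega_fct :: ('u::infinite ring, 'u ring, 'u central, 'u central_square,
  'u ring, 'u ring_map, ('u, 'u) bimod, 'u square) double_fctr)"
proof (intro double_functor.intro double_category_CENTRAL double_category_BIMOD double_functor_axioms.intro)
 show "cat_functor (Vert CENTRAL) (Vert BIMOD) (Fun0 (Omega_fct ::
  ('u ring, 'u ring, 'u central, 'u central_square, 'u ring, 'u ring_map, ('u, 'u) bimod, 'u square) double_fctr))"
  unfolding cat_functor_def cat_functor_axioms_def
  by (auto simp: category_Vert_BIMOD category_discrete_cat)
 have c: "csq_bimod (t \<circ>\<^sub>c s) = csq_bimod t \<bullet> csq_bimod s"
  if "s:csquares" "t:csquares" "src t = tgt s" for s t :: "'u central_square"
  by (rule square_eqI) (use that in \<open>simp_all add: central_squaresD\<close>)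
 have i: "csq_bimod (central_square_id X) = Ident (Horz BIMOD) (cbim X)"
  if "X:centrals" for X :: "'u central"
  by (rule square_eqI) (use that in simp_all)
 show "cat_functor (Horz CENTRAL) (Horz BIMOD) (Fun1 (Omega_fct ::
  ('u ring, 'u ring, 'u central, 'u central_square, 'u ring, 'u ring_map, ('u, 'u) bimod, 'u square) double_fctr))"
  unfolding cat_functor_def cat_functor_axioms_def
  by (auto simp: category_Horz_BIMOD category_Horz_CENTRAL central_squaresD c i)
 fix \<theta> :: "'u ring" assume "\<theta>:Arr (Vert CENTRAL)"
 then have r: "cring \<theta>" by simp
 have "AMap (Delta BIMOD) (rid \<theta>) = Ident (Horz BIMOD) (regb \<theta>)"
  using cat_functor.AMap_Ident[OF functor_Delta_BIMOD, of \<theta>] r by simp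
 with r show "FUnit Omega_fct (Cod (Vert CENTRAL) \<theta>) \<bullet> AMap (Delta BIMOD) (AMap (Fun0 Omega_fct) \<theta>) =
  AMap (Fun1 Omega_fct) (AMap (Delta CENTRAL) \<theta>) \<bullet> FUnit Omega_fct (Dom (Vert CENTRAL) \<theta>)"
  by (simp add: i)
next
 fix \<delta> \<epsilon> :: "'u central_square" assume "(\<delta>, \<epsilon>):Arr (hcomposable CENTRAL)"
 then have s: "\<delta>:csquares" "\<epsilon>:csquares" "rbase (src \<delta>) = lbase (src \<epsilon>)"
  by (simp_all add: pullback_cat_sel)
 show "FComp Omega_fct (Cod (Horz CENTRAL) \<delta>, Cod (Horz CENTRAL) \<epsilon>) \<bullet>
   (AMap (Fun1 Omega_fct) \<delta> \<diamondop> AMap (Fun1 Omega_fct) \<epsilon>) =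
  AMap (Fun1 Omega_fct) (\<delta> \<diamondop>\<^sub>c \<epsilon>) \<bullet>
   FComp Omega_fct (Dom (Horz CENTRAL) \<delta>, Dom (Horz CENTRAL) \<epsilon>)"
  by (rule square_eqI_tens[where A = "cbim (src \<delta>)" and B = "cbim (src \<epsilon>)"])
   (use s in \<open>simp_all add: central_squaresD\<close>)
next
 fix X Y Z :: "'u central"
 assume "(X, Y):Obj (hcomposable CENTRAL)" "(Y, Z):Obj (hcomposable CENTRAL)"
 then have m: "X:centrals" "Y:centrals" "Z:centrals" "rbase X = lbase Y" "rbase Y = lbase Z"
  by (simp_all add: pullback_cat_sel)
 show "AMap (Fun1 Omega_fct) (Assoc CENTRAL X Y Z) \<bullet> FComp Omega_fct (X \<star>\<^bsub>CENTRAL\<^esub> Y, Z) \<bullet>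
   (FComp Omega_fct (X, Y) \<diamondop> Ident (Horz BIMOD) (OMap (Fun1 Omega_fct) Z)) =
  FComp Omega_fct (X, Y \<star>\<^bsub>CENTRAL\<^esub> Z) \<bullet>
   (Ident (Horz BIMOD) (OMap (Fun1 Omega_fct) X) \<diamondop> FComp Omega_fct (Y, Z)) \<bullet>
   Assoc BIMOD (OMap (Fun1 Omega_fct) X) (OMap (Fun1 Omega_fct) Y) (OMap (Fun1 Omega_fct) Z)"
  by (rule square_eqI_tens3[where A = "cbim X" and B = "cbim Y" and C = "cbim Z"])
   (use m in \<open>simp_all add: central_ring\<close>)
next
 fix X :: "'u central" and x assume "X:Obj (Horz CENTRAL)" and x: "x = OMap (Lft CENTRAL) X"
 then have m: "X:centrals" "cring (lbase X)" "ring (rbase X)" using centralsD central_ring by auto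
 show "AMap (Fun1 Omega_fct) (LUnit CENTRAL X) \<bullet> FComp Omega_fct (OMap (Delta CENTRAL) x, X) \<bullet>
   (FUnit Omega_fct x \<diamondop> Ident (Horz BIMOD) (OMap (Fun1 Omega_fct) X)) =
  LUnit BIMOD (OMap (Fun1 Omega_fct) X)"
  by (rule square_eqI_tens[where A = "regb (lbase X)" and B = "cbim X"])
   (use m x lunit_fun_tens[OF bimodule_central[OF m(1)]] in simp_all)
next
 fix X :: "'u central" and x assume "X:Obj (Horz CENTRAL)" and x: "x = OMap (Rgt CENTRAL) X"
 then have m: "X:centrals" "cring (rbase X)" "ring (lbase X)" using centralsD central_ring by auto
 show "AMap (Fun1 Omega_fct) (RUnit CENTRAL X) \<bullet> FComp Omega_fct (X, OMap (Delta CENTRAL) x) \<bullet>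
   (Ident (Horz BIMOD) (OMap (Fun1 Omega_fct) X) \<diamondop> FUnit Omega_fct x) =
  RUnit BIMOD (OMap (Fun1 Omega_fct) X)"
  by (rule square_eqI_tens[where A = "cbim X" and B = "regb (rbase X)"])
   (use m x runit_fun_tens[OF bimodule_central[OF m(1)]] in simp_all)
qed (auto simp: pullback_cat_sel hom_arr_def centralsD(1,2) central_ring central_squaresD(1)[THEN centralsD(1)]
 central_squaresD(1)[THEN centralsD(2)], auto simp: Omega_fct_def)

section \<open>The double functor from rings to central maps\<close>

lemma centre_ring_sel [simp]:
 "car (centre_ring R) = centre R" "mult (centre_ring R) = mult R" "add (centre_ring R) = add R"
 "\<one>\<^bsub>centre_ring R\<^esub> = \<one>\<^bsub>R\<^esub>" "\<zero>\<^bsub>centre_ring R\<^esub> = \<zero>\<^bsub>R\<^esub>"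
 by (simp_all add: centre_ring_def)

lemma centralizer_ring_sel [simp]:
 "mult (zring \<sigma>) = mult (tgt \<sigma>)" "add (zring \<sigma>) = add (tgt \<sigma>)"
 "\<one>\<^bsub>zring \<sigma>\<^esub> = \<one>\<^bsub>tgt \<sigma>\<^esub>" "\<zero>\<^bsub>zring \<sigma>\<^esub> = \<zero>\<^bsub>tgt \<sigma>\<^esub>"
 by (simp_all add: centralizer_ring_def)

lemma centre_iff: "z:centre R \<longleftrightarrow> z:car R \<and> (\<forall>x\<in>car R. z \<otimes>\<^bsub>R\<^esub> x = x \<otimes>\<^bsub>R\<^esub> z)"
 by (simp add: centre_def)

lemma centralizer_iff: "s:car (zring \<sigma>) \<longleftrightarrow>
  s:car (tgt \<sigma>) \<and> (\<forall>r\<in>car (src \<sigma>). s \<otimes>\<^bsub>tgt \<sigma>\<^esub> fn \<sigma> r = fn \<sigma> r \<otimes>\<^bsub>tgt \<sigma>\<^esub> s)"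
 by (simp add: centralizer_ring_def)

text \<open>One closure argument for two cases: the centre, with \<open>C\<close> the whole ring,
  and the centralizer of \<sigma>, with \<open>C\<close> its image.\<close>

lemma (in ring) ring_commutant:
 assumes "C \<subseteq> car R"
 shows "ring (R\<lparr>carrier := {z:car R. \<forall>x\<in>C. z \<otimes> x = x \<otimes> z}\<rparr>)"
proof (rule subring_is_ring, rule subringI)
 fix h1 h2 assume h: "h1:{z:car R. \<forall>x\<in>C. z \<otimes> x = x \<otimes> z}" "h2:{z:car R. \<forall>x\<in>C. z \<otimes> x = x \<otimes> z}"
 have "h1 \<otimes> h2 \<otimes> x = x \<otimes> (h1 \<otimes> h2)" if "x:C" for x
 proof -
  have x: "x:car R" "h1 \<otimes> x = x \<otimes> h1" "h2 \<otimes> x = x \<otimes> h2" using that assms h by auto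
  have "h1 \<otimes> h2 \<otimes> x = h1 \<otimes> (x \<otimes> h2)" using h x by (simp add: m_assoc)
  also have "\<dots> = x \<otimes> (h1 \<otimes> h2)" using h x(1) x(2)[symmetric] by (simp flip: m_assoc)
  finally show ?thesis .
 qed
 with h show "h1 \<otimes> h2:{z:car R. \<forall>x\<in>C. z \<otimes> x = x \<otimes> z}" by simp
 show "h1 \<oplus> h2:{z:car R. \<forall>x\<in>C. z \<otimes> x = x \<otimes> z}"
  using h assms by (auto simp: l_distr r_distr subset_iff)
next
 fix h assume "h:{z:car R. \<forall>x\<in>C. z \<otimes> x = x \<otimes> z}"
 then show "\<ominus> h:{z:car R. \<forall>x\<in>C. z \<otimes> x = x \<otimes> z}"
  using assms by (auto simp: l_minus r_minus subset_iff)
qed (use assms in auto)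

lemma cring_centre_ring [simp]: "ring R ==> cring (centre_ring R)"
proof -
 assume "ring R"
 then interpret ring R .
 have "ring (centre_ring R)"
  using ring_commutant[of "car R"] by (simp add: centre_ring_def centre_def)
 then interpret Z: ring "centre_ring R" .
 show ?thesis
 proof unfold_locales
  fix x y assume "x:car (centre_ring R)" "y:car (centre_ring R)"
  then have "x:centre R" "y:car R" by (simp_all add: centre_def)
  then have "x \<otimes>\<^bsub>R\<^esub> y = y \<otimes>\<^bsub>R\<^esub> x" unfolding centre_def by blast
  then show "x \<otimes>\<^bsub>centre_ring R\<^esub> y = y \<otimes>\<^bsub>centre_ring R\<^esub> x" by simp
 qed
qed

lemma ring_centralizer_ring: "\<sigma>:ring_maps ==> ring (zring \<sigma>)"
proof -
 assume s: "\<sigma>:ring_maps"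
 then interpret S: ring "tgt \<sigma>" by (rule ring_mapsD)
 show ?thesis
  using S.ring_commutant[of "fn \<sigma> ` car (src \<sigma>)"] s
  by (simp add: centralizer_ring_def image_subset_iff)
qed

lemma centralizer_central_sel [simp]:
 "lbase (zcentral \<sigma>) = centre_ring (tgt \<sigma>)" "rbase (zcentral \<sigma>) = centre_ring (src \<sigma>)"
 "mid (zcentral \<sigma>) = zring \<sigma>"
 "s:centre (tgt \<sigma>) ==> lmap (zcentral \<sigma>) s = s"
 "r:centre (src \<sigma>) ==> rmap (zcentral \<sigma>) r = fn \<sigma> r"
 by (simp_all add: centralizer_central_def)

text \<open>A central element of the target commutes with everything, in particular with the image
  of \<sigma>. The image of a central \<open>r\<close> commutes with the image of \<sigma> by
  multiplicativity, so it lies in the centralizer; it is central there because members of the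
  centralizer commute with the image by definition.\<close>

lemma centralizer_central_in [simp]:
 assumes s: "\<sigma>:ring_maps"
 shows "zcentral \<sigma>:centrals"
proof -
 interpret R: ring "src \<sigma>" by (rule ring_mapsD(1)[OF s])
 interpret S: ring "tgt \<sigma>" by (rule ring_mapsD(2)[OF s])
 interpret ZR: cring "centre_ring (src \<sigma>)" by (rule cring_centre_ring[OF R.ring_axioms])
 interpret ZS: cring "centre_ring (tgt \<sigma>)" by (rule cring_centre_ring[OF S.ring_axioms])
 have l: "s:centre (zring \<sigma>)" if "s:centre (tgt \<sigma>)" for s
 proof -
  have s': "s:car (tgt \<sigma>)" "\<And>x. x:car (tgt \<sigma>) ==> s \<otimes>\<^bsub>tgt \<sigma>\<^esub> x = x \<otimes>\<^bsub>tgt \<sigma>\<^esub> s"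
   using that by (auto simp only: centre_iff)
  then have "s:car (zring \<sigma>)"
   unfolding centralizer_iff using ring_map_closed[OF s] by blast
  moreover have "s \<otimes>\<^bsub>tgt \<sigma>\<^esub> x = x \<otimes>\<^bsub>tgt \<sigma>\<^esub> s" if "x:car (zring \<sigma>)" for x
   using s'(2) that by (simp only: centralizer_iff)
  ultimately show ?thesis by (simp only: centre_iff centralizer_ring_sel ball_simps) blast
 qed
 have r: "fn \<sigma> r:centre (zring \<sigma>)" if "r:centre (src \<sigma>)" for r
 proof -
  have "fn \<sigma> r \<otimes>\<^bsub>tgt \<sigma>\<^esub> fn \<sigma> x = fn \<sigma> x \<otimes>\<^bsub>tgt \<sigma>\<^esub> fn \<sigma> r" if "x:car (src \<sigma>)" for x
  proof -
   have "r:car (src \<sigma>)" "r \<otimes>\<^bsub>src \<sigma>\<^esub> x = x \<otimes>\<^bsub>src \<sigma>\<^esub> r"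
    using \<open>r:centre (src \<sigma>)\<close> that unfolding centre_iff by blast+
   then show ?thesis using ring_map_hom(2)[OF s, of r x] ring_map_hom(2)[OF s, of x r] that by simp
  qed
  moreover have "fn \<sigma> r:car (tgt \<sigma>)" using that s by (simp add: centre_iff)
  ultimately have "fn \<sigma> r:car (zring \<sigma>)" unfolding centralizer_iff by blast
  moreover have "fn \<sigma> r \<otimes>\<^bsub>tgt \<sigma>\<^esub> x = x \<otimes>\<^bsub>tgt \<sigma>\<^esub> fn \<sigma> r" if "x:car (zring \<sigma>)" for x
   using that \<open>r:centre (src \<sigma>)\<close> by (simp add: centralizer_iff centre_iff)
  ultimately show ?thesis by (simp only: centre_iff centralizer_ring_sel) blast
 qed
 have c: "z:car R" if "z:centre R" for z and R :: "'a ring" using that by (simp add: centre_iff)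
 have cc: "z:car (zring \<sigma>)" if "z:centre (zring \<sigma>)" for z
  using c[OF that] .
 have "(\<lambda>s\<in>centre (tgt \<sigma>). s):ring_hom (centre_ring (tgt \<sigma>)) (zring \<sigma>)"
  using ZS.m_closed ZS.a_closed ZS.one_closed by (intro ring_hom_memI) (simp_all add: l cc)
 moreover have "(\<lambda>r\<in>centre (src \<sigma>). fn \<sigma> r):ring_hom (centre_ring (src \<sigma>)) (zring \<sigma>)"
  using ZR.m_closed ZR.a_closed ZR.one_closed
  by (intro ring_hom_memI) (simp_all add: r cc c s ring_map_hom)
 ultimately show ?thesis
  using l r R.ring_axioms S.ring_axioms ring_centralizer_ring[OF s]
  by (simp add: centrals_def centralizer_central_def image_subset_iff)
qed

text \<open>The map \<open>Z(\<tau>) \<otimes> Z(\<sigma>) \<rightarrow> Z(\<tau>\<sigma>)\<close>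
  sending \<open>z \<otimes> s\<close> to \<open>z \<tau>(s)\<close>. In general it is not
  invertible, so \<Psi> is properly lax.\<close>

definition centralizer_comp :: "'u::infinite ring_map \<Rightarrow> 'u ring_map \<Rightarrow> 'u central_square" where
 "centralizer_comp \<tau> \<sigma> =
  (let X = zcentral \<tau>; Y = zcentral \<sigma>; C = zcentral (ring_map_comp \<tau> \<sigma>)
  in \<lparr>src = ccomp X Y,
   fn = the_hom (uten (cbim X) (cbim Y)) (amon (mid C))
    (\<lambda>h. \<forall>e\<in>bcar (cbim X). \<forall>f\<in>bcar (cbim Y).
     h (tens (cbim X) (cbim Y) e f) = e \<otimes>\<^bsub>tgt \<tau>\<^esub> fn \<tau> f),
   tgt = C\<rparr>)"

lemma centralizer_comp_sel [simp]:
 "src (centralizer_comp \<tau> \<sigma>) = ccomp (zcentral \<tau>) (zcentral \<sigma>)"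
 "tgt (centralizer_comp \<tau> \<sigma>) = zcentral (ring_map_comp \<tau> \<sigma>)"
 by (simp_all add: centralizer_comp_def Let_def)

context
 fixes \<tau> \<sigma> :: "'u::infinite ring_map"
 assumes m: "\<tau>:ring_maps" "\<sigma>:ring_maps" "src \<tau> = tgt \<sigma>"
begin

interpretation S: ring "tgt \<sigma>" by (rule ring_mapsD(2)[OF m(2)])
interpretation T: ring "tgt \<tau>" by (rule ring_mapsD(2)[OF m(1)])
interpretation P: central_pair "zcentral \<tau>" "zcentral \<sigma>"
 by unfold_locales (simp_all add: m)

lemma tau_hom:
 "x:car (tgt \<sigma>) ==> fn \<tau> x:car (tgt \<tau>)"
 "x:car (tgt \<sigma>) ==> y:car (tgt \<sigma>) ==> fn \<tau> (x \<otimes>\<^bsub>tgt \<sigma>\<^esub> y) = fn \<tau> x \<otimes>\<^bsub>tgt \<tau>\<^esub> fn \<tau> y"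
 "x:car (tgt \<sigma>) ==> y:car (tgt \<sigma>) ==> fn \<tau> (x \<oplus>\<^bsub>tgt \<sigma>\<^esub> y) = fn \<tau> x \<oplus>\<^bsub>tgt \<tau>\<^esub> fn \<tau> y"
 "fn \<tau> \<one>\<^bsub>tgt \<sigma>\<^esub> = \<one>\<^bsub>tgt \<tau>\<^esub>"
 using ring_map_closed[OF m(1)] ring_map_hom[OF m(1)] m(3) by simp_all

lemma centralizerD:
 "z:car (zring \<tau>) ==> z:car (tgt \<tau>)"
 "z:car (zring \<tau>) ==> x:car (tgt \<sigma>) ==> z \<otimes>\<^bsub>tgt \<tau>\<^esub> fn \<tau> x = fn \<tau> x \<otimes>\<^bsub>tgt \<tau>\<^esub> z"
 "s:car (zring \<sigma>) ==> s:car (tgt \<sigma>)"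
 using m(3) by (simp_all add: centralizer_iff)

text \<open>Two commutations are chained: \<open>s\<close> commutes with \<sigma>(r) in the middle
  ring, hence their images under \<tau> commute, and \<open>z\<close> commutes with the whole image
  of \<tau>.\<close>

lemma centralizer_mult_closed:
 assumes z: "z:car (zring \<tau>)" and s: "s:car (zring \<sigma>)"
 shows "z \<otimes>\<^bsub>tgt \<tau>\<^esub> fn \<tau> s:car (zring (ring_map_comp \<tau> \<sigma>))"
proof -
 have "z \<otimes>\<^bsub>tgt \<tau>\<^esub> fn \<tau> s \<otimes>\<^bsub>tgt \<tau>\<^esub> fn \<tau> (fn \<sigma> r) = fn \<tau> (fn \<sigma> r) \<otimes>\<^bsub>tgt \<tau>\<^esub> (z \<otimes>\<^bsub>tgt \<tau>\<^esub> fn \<tau> s)"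
  if r: "r:car (src \<sigma>)" for r
 proof -
  have c: "fn \<sigma> r:car (tgt \<sigma>)" using r m by simp
  have "fn \<tau> s \<otimes>\<^bsub>tgt \<tau>\<^esub> fn \<tau> (fn \<sigma> r) = fn \<tau> (fn \<sigma> r) \<otimes>\<^bsub>tgt \<tau>\<^esub> fn \<tau> s"
   using s r c centralizerD(3)[OF s] by (simp add: centralizer_iff flip: tau_hom(2))
  then have "z \<otimes>\<^bsub>tgt \<tau>\<^esub> fn \<tau> s \<otimes>\<^bsub>tgt \<tau>\<^esub> fn \<tau> (fn \<sigma> r) = z \<otimes>\<^bsub>tgt \<tau>\<^esub> (fn \<tau> (fn \<sigma> r) \<otimes>\<^bsub>tgt \<tau>\<^esub> fn \<tau> s)"
   using T.m_assoc[of z "fn \<tau> s" "fn \<tau> (fn \<sigma> r)"] tau_hom(1)[OF c] tau_hom(1)[OF centralizerD(3)[OF s]] centralizerD(1)[OF z] by simp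
  also have "\<dots> = z \<otimes>\<^bsub>tgt \<tau>\<^esub> fn \<tau> (fn \<sigma> r) \<otimes>\<^bsub>tgt \<tau>\<^esub> fn \<tau> s"
   using T.m_assoc[of z "fn \<tau> (fn \<sigma> r)" "fn \<tau> s"] tau_hom(1)[OF c] tau_hom(1)[OF centralizerD(3)[OF s]] centralizerD(1)[OF z] by simp
  also have "\<dots> = fn \<tau> (fn \<sigma> r) \<otimes>\<^bsub>tgt \<tau>\<^esub> (z \<otimes>\<^bsub>tgt \<tau>\<^esub> fn \<tau> s)"
   unfolding centralizerD(2)[OF z c]
   using T.m_assoc[of "fn \<tau> (fn \<sigma> r)" z "fn \<tau> s"] tau_hom(1)[OF c] tau_hom(1)[OF centralizerD(3)[OF s]] centralizerD(1)[OF z] by simp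
  finally show ?thesis .
 qed
 then show ?thesis using z s by (simp add: centralizer_iff[of _ "ring_map_comp \<tau> \<sigma>"] centralizerD(1,3) tau_hom)
qed

lemma balanced_centralizer:
 "balanced (cbim (zcentral \<tau>)) (cbim (zcentral \<sigma>))
  (amon (mid (zcentral (ring_map_comp \<tau> \<sigma>)))) (\<lambda>e f. e \<otimes>\<^bsub>tgt \<tau>\<^esub> fn \<tau> f)"
proof (rule balancedI)
 fix e b f assume "e:bcar (cbim (zcentral \<tau>))"
  "b:car (rring (cbim (zcentral \<tau>)))" "f:bcar (cbim (zcentral \<sigma>))"
 then have *: "e:car (zring \<tau>)" "b:centre (tgt \<sigma>)" "b:car (tgt \<sigma>)" "f:car (zring \<sigma>)"
  using m(3) by (simp_all add: centre_iff)
 then show "ract (cbim (zcentral \<tau>)) e b \<otimes>\<^bsub>tgt \<tau>\<^esub> fn \<tau> f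
  = e \<otimes>\<^bsub>tgt \<tau>\<^esub> fn \<tau> (lact (cbim (zcentral \<sigma>)) b f)"
  using m(3) by (simp add: tau_hom centralizerD(1,3) T.m_assoc)
qed (simp_all add: centralizer_mult_closed tau_hom centralizerD(1,3) T.l_distr T.r_distr)

lemma comm_group_centralizer: "comm_group (amon (mid (zcentral (ring_map_comp \<tau> \<sigma>))))"
proof -
 interpret ring "zring (ring_map_comp \<tau> \<sigma>)" using m by (intro ring_centralizer_ring) simp
 show ?thesis unfolding centralizer_central_sel by (rule a_comm_group)
qed

lemma fn_centralizer_comp [simp]:
 "e:car (zring \<tau>) ==> f:car (zring \<sigma>) ==>
  fn (centralizer_comp \<tau> \<sigma>) (tens (cbim (zcentral \<tau>)) (cbim (zcentral \<sigma>)) e f)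
   = e \<otimes>\<^bsub>tgt \<tau>\<^esub> fn \<tau> f"
 using P.P.utensor_the_hom_tens[OF comm_group_centralizer balanced_centralizer]
 by (simp add: centralizer_comp_def Let_def)

lemma centralizer_comp_in [simp]: "centralizer_comp \<tau> \<sigma>:csquares"
proof -
 let ?X = "zcentral \<tau>" and ?Y = "zcentral \<sigma>" and ?C = "zcentral (ring_map_comp \<tau> \<sigma>)"
 have c: "ccomp ?X ?Y:centrals" "?C:centrals" using m by simp_all
 have "fn (centralizer_comp \<tau> \<sigma>):ring_hom (mid (ccomp ?X ?Y)) (mid ?C)"
 proof (rule ring_hom_spansI)
  show "ring (mid (ccomp ?X ?Y))" "ring (mid ?C)" using c[THEN centralsD(3)] by simp_all
  show "spans (amon (mid (ccomp ?X ?Y))) (case_prod (tens (cbim ?X) (cbim ?Y)) `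
   (car (amon (mid ?X)) \<times> car (amon (mid ?Y))))"
   by (intro spans_central2 spans_carrier) (use m in simp_all)
  show "fn (centralizer_comp \<tau> \<sigma>):hom (amon (mid (ccomp ?X ?Y))) (amon (mid ?C))"
   using P.P.utensor_the_hom[OF comm_group_centralizer balanced_centralizer]
   by (simp add: centralizer_comp_def Let_def)
  show "fn (centralizer_comp \<tau> \<sigma>) \<one>\<^bsub>mid (ccomp ?X ?Y)\<^esub> = \<one>\<^bsub>mid ?C\<^esub>"
   using P.E.one_closed P.F.one_closed by (simp add: tau_hom)
  fix x y assume "x:case_prod (tens (cbim ?X) (cbim ?Y)) `
   (car (amon (mid ?X)) \<times> car (amon (mid ?Y)))"
   "y:case_prod (tens (cbim ?X) (cbim ?Y)) `
   (car (amon (mid ?X)) \<times> car (amon (mid ?Y)))"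
  then obtain e f e' f' where *: "x = tens (cbim ?X) (cbim ?Y) e f" "y = tens (cbim ?X) (cbim ?Y) e' f'"
   "e:car (zring \<tau>)" "f:car (zring \<sigma>)" "e':car (zring \<tau>)" "f':car (zring \<sigma>)"
   by auto
  have cl: "e \<otimes>\<^bsub>tgt \<tau>\<^esub> e':car (zring \<tau>)" "f \<otimes>\<^bsub>tgt \<sigma>\<^esub> f':car (zring \<sigma>)"
   using P.E.m_closed[of e e'] P.F.m_closed[of f f'] * by simp_all
  \<comment> \<open>Since \<open>e'\<close> centralizes the image of \<tau>, it can be exchanged
    with the image of \<open>f\<close>; this turns \<open>e e' \<tau>(f f')\<close> into
    \<open>e \<tau>(f) e' \<tau>(f')\<close>, which is multiplicativity on pure tensors.\<close>
  have "e' \<otimes>\<^bsub>tgt \<tau>\<^esub> (fn \<tau> f \<otimes>\<^bsub>tgt \<tau>\<^esub> fn \<tau> f') = fn \<tau> f \<otimes>\<^bsub>tgt \<tau>\<^esub> (e' \<otimes>\<^bsub>tgt \<tau>\<^esub> fn \<tau> f')"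
   using * centralizerD(2)[OF *(5) centralizerD(3)[OF *(4)]] by (simp add: centralizerD(1,3) tau_hom flip: T.m_assoc)
  then show "fn (centralizer_comp \<tau> \<sigma>) (x \<otimes>\<^bsub>mid (ccomp ?X ?Y)\<^esub> y)
   = fn (centralizer_comp \<tau> \<sigma>) x \<otimes>\<^bsub>mid ?C\<^esub> fn (centralizer_comp \<tau> \<sigma>) y"
   using * cl m P.tensor_mult[of e f e' f'] by (simp add: centralizerD(1,3) tau_hom T.m_assoc)
 qed
 moreover have "fn (centralizer_comp \<tau> \<sigma>):extensional (car (mid (ccomp ?X ?Y)))"
  using P.P.utensor_the_hom_ext[OF comm_group_centralizer balanced_centralizer]
  by (simp add: centralizer_comp_def Let_def)
 moreover have "a:car (tgt \<tau>)" "a:car (zring \<tau>)" if "a:centre (tgt \<tau>)" for a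
  using that centralsD(8)[OF P.X, of a] by (simp_all add: centre_iff)
 moreover have "b:car (src \<sigma>)" "fn \<sigma> b:car (zring \<sigma>)" if "b:centre (src \<sigma>)" for b
  using that centralsD(9)[OF P.Y, of b] by (simp_all add: centre_iff)
 ultimately show ?thesis
  using c m P.E.one_closed P.F.one_closed by (simp add: central_squares_def tau_hom centralizerD(1,3))
qed

end

text \<open>The centralizer of an identity map is the centre, so the unit comparison is the identity
  on elements.\<close>

definition centralizer_unit :: "'u::infinite ring \<Rightarrow> 'u central_square" where
 "centralizer_unit R = \<lparr>src = cunit (centre_ring R), fn = (\<lambda>x\<in>centre R. x), tgt = zcentral (rid R)\<rparr>"

lemma centralizer_unit_sel [simp]:
 "src (centralizer_unit R) = cunit (centre_ring R)" "tgt (centralizer_unit R) = zcentral (rid R)"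
 "x:centre R ==> fn (centralizer_unit R) x = x"
 by (simp_all add: centralizer_unit_def)

lemma carrier_centralizer_id: "car (zring (rid R)) = centre R"
 by (auto simp: centralizer_iff centre_iff)

lemma centralizer_unit_in [simp]: "ring R ==> centralizer_unit R:csquares"
proof -
 assume R: "ring R"
 then interpret Z: cring "centre_ring R" by simp
 have "(\<lambda>x\<in>centre R. x):ring_hom (centre_ring R) (zring (rid R))"
  using Z.m_closed Z.a_closed Z.one_closed by (intro ring_hom_memI) (simp_all add: carrier_centralizer_id)
 then show ?thesis
  using R by (simp add: central_squares_def) (simp add: centralizer_unit_def centre_iff)
qed

definition Psi_fct :: "('u::infinite ring, 'u ring, 'u ring_map, 'u ring_map,
  'u ring, 'u ring, 'u central, 'u central_square) double_fctr" where
 "Psi_fct =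
  \<lparr>Fun0 = \<lparr>OMap = (\<lambda>R\<in>{R. ring R}. centre_ring R), AMap = (\<lambda>R\<in>{R. ring R}. centre_ring R)\<rparr>,
  Fun1 = \<lparr>OMap = (\<lambda>\<sigma>\<in>ring_maps. zcentral \<sigma>), AMap = (\<lambda>\<sigma>\<in>ring_maps. central_square_id (zcentral \<sigma>))\<rparr>,
  FComp = (\<lambda>(\<tau>, \<sigma>)\<in>Obj (hcomposable RING). centralizer_comp \<tau> \<sigma>),
  FUnit = (\<lambda>R\<in>{R. ring R}. centralizer_unit R)\<rparr>"

lemma Psi_fct_sel [simp]:
 "ring R ==> OMap (Fun0 Psi_fct) R = centre_ring R" "ring R ==> AMap (Fun0 Psi_fct) R = centre_ring R"
 "\<sigma>:ring_maps ==> OMap (Fun1 Psi_fct) \<sigma> = zcentral \<sigma>"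
 "\<sigma>:ring_maps ==> AMap (Fun1 Psi_fct) \<sigma> = central_square_id (zcentral \<sigma>)"
 "\<tau>:ring_maps ==> \<sigma>:ring_maps ==> src \<tau> = tgt \<sigma> ==> FComp Psi_fct (\<tau>, \<sigma>) = centralizer_comp \<tau> \<sigma>"
 "ring R ==> FUnit Psi_fct R = centralizer_unit R"
 by (simp_all add: Psi_fct_def pullback_cat_sel)

lemma Ident_Comp_CENTRAL [simp]:
 fixes s :: "'u::infinite central_square"
 shows "s:csquares ==> tgt s = M ==> central_square_id M \<circ>\<^sub>c s = s"
  and "s:csquares ==> src s = M ==> s \<circ>\<^sub>c central_square_id M = s"
 using category.Comp_Ident_left[OF category_Horz_CENTRAL, of s]
  category.Comp_Ident_right[OF category_Horz_CENTRAL, of s] by auto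

lemma Ident_HComp_Ident_CENTRAL [simp]:
 fixes A B :: "'u::infinite central"
 shows "A:centrals ==> B:centrals ==> rbase A = lbase B ==>
  central_square_id A \<diamondop>\<^sub>c central_square_id B = central_square_id (ccomp A B)"
 using cat_functor.AMap_Ident[OF functor_HComp_CENTRAL, of "(A, B)"] by (simp add: pullback_cat_sel)

theorem double_functor_ring_central:
 "double_functor RING CENTRAL (Psi_fct :: ('u::infinite ring, 'u ring, 'u ring_map, 'u ring_map,
  'u ring, 'u ring, 'u central, 'u central_square) double_fctr)"
proof (intro double_functor.intro double_category_RING double_category_CENTRAL double_functor_axioms.intro)
 show "cat_functor (Vert RING) (Vert CENTRAL) (Fun0 (Psi_fct ::
  ('u ring, 'u ring, 'u ring_map, 'u ring_map, 'u ring, 'u ring, 'u central, 'u central_square) double_fctr))"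
  unfolding cat_functor_def cat_functor_axioms_def
  by (auto simp: category_discrete_cat)
 show "cat_functor (Horz RING) (Horz CENTRAL) (Fun1 (Psi_fct ::
  ('u ring, 'u ring, 'u ring_map, 'u ring_map, 'u ring, 'u ring, 'u central, 'u central_square) double_fctr))"
  unfolding cat_functor_def cat_functor_axioms_def
  by (auto simp: category_Horz_CENTRAL category_discrete_cat)
next
 fix \<upsilon> \<tau> \<sigma> :: "'u ring_map"
 assume "(\<upsilon>, \<tau>):Obj (hcomposable RING)" "(\<tau>, \<sigma>):Obj (hcomposable RING)"
 then have m: "\<upsilon>:ring_maps" "\<tau>:ring_maps" "\<sigma>:ring_maps" "src \<upsilon> = tgt \<tau>" "src \<tau> = tgt \<sigma>"
  by (simp_all add: pullback_cat_sel)
 interpret U: ring "tgt \<upsilon>" by (rule ring_mapsD(2)[OF m(1)])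
 note c = centralizer_mult_closed[OF m(1,2,4)] centralizer_mult_closed[OF m(2,3,5)]
  centralizerD(1)[OF m(1,2,4)] centralizerD(1)[OF m(2,3,5)] centralizerD(3)[OF m(2,3,5)]
  tau_hom[OF m(1,2,4)] tau_hom[OF m(2,3,5)]
 show "AMap (Fun1 Psi_fct) (Assoc RING \<upsilon> \<tau> \<sigma>) \<circ>\<^sub>c FComp Psi_fct (\<upsilon> \<star>\<^bsub>RING\<^esub> \<tau>, \<sigma>) \<circ>\<^sub>c
   (FComp Psi_fct (\<upsilon>, \<tau>) \<diamondop>\<^sub>c Ident (Horz CENTRAL) (OMap (Fun1 Psi_fct) \<sigma>)) =
  FComp Psi_fct (\<upsilon>, \<tau> \<star>\<^bsub>RING\<^esub> \<sigma>) \<circ>\<^sub>c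
   (Ident (Horz CENTRAL) (OMap (Fun1 Psi_fct) \<upsilon>) \<diamondop>\<^sub>c FComp Psi_fct (\<tau>, \<sigma>)) \<circ>\<^sub>c
   Assoc CENTRAL (OMap (Fun1 Psi_fct) \<upsilon>) (OMap (Fun1 Psi_fct) \<tau>) (OMap (Fun1 Psi_fct) \<sigma>)"
  by (rule central_eqI3[where X = "zcentral \<upsilon>" and Y = "zcentral \<tau>" and Z = "zcentral \<sigma>"])
   (use m in \<open>simp_all add: ring_map_comp_assoc c U.m_assoc\<close>)
next
 fix \<sigma> :: "'u ring_map" and x assume "\<sigma>:Obj (Horz RING)" and x: "x = OMap (Lft RING) \<sigma>"
 then have m: "\<sigma>:ring_maps" by simp
 have c: "a:car (tgt \<sigma>)" if "a:centre (tgt \<sigma>)" for a using that by (simp add: centre_iff)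
 show "AMap (Fun1 Psi_fct) (LUnit RING \<sigma>) \<circ>\<^sub>c FComp Psi_fct (OMap (Delta RING) x, \<sigma>) \<circ>\<^sub>c
   (FUnit Psi_fct x \<diamondop>\<^sub>c Ident (Horz CENTRAL) (OMap (Fun1 Psi_fct) \<sigma>)) =
  LUnit CENTRAL (OMap (Fun1 Psi_fct) \<sigma>)"
  by (rule central_eqI2[where X = "cunit (centre_ring (tgt \<sigma>))" and Y = "zcentral \<sigma>"])
   (use m x fn_central_lunit_tens[OF centralizer_central_in[OF m]] in
    \<open>simp_all add: ring_mapsD carrier_centralizer_id centralizer_iff[of _ \<sigma>]\<close>)
next
 fix \<sigma> :: "'u ring_map" and x assume "\<sigma>:Obj (Horz RING)" and x: "x = OMap (Rgt RING) \<sigma>"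
 then have m: "\<sigma>:ring_maps" by simp
 show "AMap (Fun1 Psi_fct) (RUnit RING \<sigma>) \<circ>\<^sub>c FComp Psi_fct (\<sigma>, OMap (Delta RING) x) \<circ>\<^sub>c
   (Ident (Horz CENTRAL) (OMap (Fun1 Psi_fct) \<sigma>) \<diamondop>\<^sub>c FUnit Psi_fct x) =
  RUnit CENTRAL (OMap (Fun1 Psi_fct) \<sigma>)"
  by (rule central_eqI2[where X = "zcentral \<sigma>" and Y = "cunit (centre_ring (src \<sigma>))"])
   (use m x fn_central_runit_tens[OF centralizer_central_in[OF m]] in
    \<open>simp_all add: ring_mapsD carrier_centralizer_id\<close>)
qed (auto simp: pullback_cat_sel hom_arr_def ring_mapsD, auto simp: Psi_fct_def)

section \<open>Tensor categories of species\<close>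

lemma nth_path_append:
 assumes "last ys = hd xs" "ys \<noteq> []" "xs \<noteq> []"
 shows "i < length ys ==> (ys @ tl xs) ! i = ys ! i"
  and "j < length xs ==> Suc k = length ys ==> (ys @ tl xs) ! (k + j) = xs ! j"
proof -
 show "i < length ys ==> (ys @ tl xs) ! i = ys ! i" by (simp add: nth_append)
 assume *: "j < length xs" "Suc k = length ys"
 show "(ys @ tl xs) ! (k + j) = xs ! j"
 proof (cases j)
  case 0
  have "ys ! k = last ys" using assms(2) *(2) by (metis last_conv_nth diff_Suc_1)
  then show ?thesis using assms * 0 by (simp add: nth_append hd_conv_nth)
 next
  case (Suc i)
  have "k + j = length ys + i" using Suc *(2) by simp
  then have "(ys @ tl xs) ! (k + j) = tl xs ! i" by (simp only: nth_append_length_plus)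
  then show ?thesis using *(1) Suc by (simp add: nth_tl)
 qed
qed

lemma pathsD:
 assumes "xs:paths X t h"
 shows "xs \<noteq> []" "set xs \<subseteq> X" "hd xs = h" "last xs = t" "i < length xs ==> xs ! i:X"
 using assms by (auto simp: paths_def)

lemma paths_append:
 assumes "ys:paths X u h" "xs:paths X t u"
 shows "ys @ tl xs:paths X t h"
 using assms by (cases xs; cases "tl xs = []") (auto simp: paths_def)

text \<open>The functions on words whose additive extensions kill \<open>path_relations\<close>:
  additive in each letter, balanced at each interior vertex. The list updates are the ones occurring
  in the relations, so words need not be split.\<close>

definition slotwise :: "('o, 'r, 'a) species \<Rightarrow> 'o list \<Rightarrow> 'k monoid \<Rightarrow> ('a list \<Rightarrow> 'k) \<Rightarrow> bool" where
 "slotwise Sp xs K f \<longleftrightarrow>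
  (\<forall>as\<in>words Sp xs. f as:car K) \<and>
  (\<forall>as\<in>words Sp xs. \<forall>i<length as. \<forall>a\<in>bcar (sp_mod Sp (xs ! i) (xs ! Suc i)).
   \<forall>b\<in>bcar (sp_mod Sp (xs ! i) (xs ! Suc i)).
    f (as[i := a \<otimes>\<^bsub>bgrp (sp_mod Sp (xs ! i) (xs ! Suc i))\<^esub> b]) = f (as[i := a]) \<otimes>\<^bsub>K\<^esub> f (as[i := b])) \<and>
  (\<forall>as\<in>words Sp xs. \<forall>i. Suc i < length as \<longrightarrow> (\<forall>r\<in>car (sp_ring Sp (xs ! Suc i)).
    f (as[i := ract (sp_mod Sp (xs ! i) (xs ! Suc i)) (as ! i) r])
     = f (as[Suc i := lact (sp_mod Sp (xs ! Suc i) (xs ! Suc (Suc i))) r (as ! Suc i)])))"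

lemma slotwiseI:
 assumes "\<And>as. as:words Sp xs ==> f as:car K"
  and "\<And>as i a b. as:words Sp xs ==> i < length as ==> a:bcar (sp_mod Sp (xs ! i) (xs ! Suc i)) ==>
   b:bcar (sp_mod Sp (xs ! i) (xs ! Suc i)) ==>
   f (as[i := a \<otimes>\<^bsub>bgrp (sp_mod Sp (xs ! i) (xs ! Suc i))\<^esub> b]) = f (as[i := a]) \<otimes>\<^bsub>K\<^esub> f (as[i := b])"
  and "\<And>as i r. as:words Sp xs ==> Suc i < length as ==> r:car (sp_ring Sp (xs ! Suc i)) ==>
   f (as[i := ract (sp_mod Sp (xs ! i) (xs ! Suc i)) (as ! i) r])
     = f (as[Suc i := lact (sp_mod Sp (xs ! Suc i) (xs ! Suc (Suc i))) r (as ! Suc i)])"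
 shows "slotwise Sp xs K f"
 using assms by (auto simp: slotwise_def)

lemma slotwiseD:
 assumes "slotwise Sp xs K f" "as:words Sp xs"
 shows "f as:car K"
  and "i < length as ==> a:bcar (sp_mod Sp (xs ! i) (xs ! Suc i)) ==>
   b:bcar (sp_mod Sp (xs ! i) (xs ! Suc i)) ==>
   f (as[i := a \<otimes>\<^bsub>bgrp (sp_mod Sp (xs ! i) (xs ! Suc i))\<^esub> b]) = f (as[i := a]) \<otimes>\<^bsub>K\<^esub> f (as[i := b])"
  and "Suc i < length as ==> r:car (sp_ring Sp (xs ! Suc i)) ==>
   f (as[i := ract (sp_mod Sp (xs ! i) (xs ! Suc i)) (as ! i) r])
     = f (as[Suc i := lact (sp_mod Sp (xs ! Suc i) (xs ! Suc (Suc i))) r (as ! Suc i)])"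
 using assms by (auto simp: slotwise_def)

lemma path_wordsD:
 assumes "as:words Sp xs"
 shows "length xs = Suc (length as)" "i < length as ==> as ! i:bcar (sp_mod Sp (xs ! i) (xs ! Suc i))"
 using assms by (auto simp: path_words_def)

lemma path_words_update:
 assumes "as:words Sp xs" "i < length as ==> a:bcar (sp_mod Sp (xs ! i) (xs ! Suc i))"
 shows "as[i := a]:words Sp xs"
 using assms by (cases "i < length as") (auto simp: path_words_def nth_list_update)

lemma path_words_append:
 assumes "last ys = hd xs" "bs:words Sp ys" "as:words Sp xs"
 shows "bs @ as:words Sp (ys @ tl xs)"
proof -
 have ne: "ys \<noteq> []" "xs \<noteq> []" using path_wordsD(1)[OF assms(2)] path_wordsD(1)[OF assms(3)] by auto
 note nth = nth_path_append[OF assms(1) ne]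
 have "(bs @ as) ! i:bcar (sp_mod Sp ((ys @ tl xs) ! i) ((ys @ tl xs) ! Suc i))" if "i < length (bs @ as)" for i
 proof (cases "i < length bs")
  case True
  then show ?thesis using path_wordsD[OF assms(2)] by (simp add: nth nth_append[of bs])
 next
  case False
  define j where "j = i - length bs"
  have j: "i = length bs + j" "j < length as" using that False by (auto simp: j_def)
  show ?thesis unfolding j(1)
   using path_wordsD[OF assms(3)] nth(2)[of j "length bs"] nth(2)[of "Suc j" "length bs"] path_wordsD(1)[OF assms(2)] j(2)
   by simp
 qed
 then show ?thesis
  using path_wordsD(1)[OF assms(2)] path_wordsD(1)[OF assms(3)] by (simp add: path_words_def)
qed

text \<open>A family over all paths at once, because a morphism is a finite sum over paths. Paths of
  length zero carry scalars and ask for plain additivity, the others for the slotwise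
  condition.\<close>

definition multiadditive :: "('o, 'r, 'a) species \<Rightarrow> 'o \<Rightarrow> 'o \<Rightarrow> 'k monoid \<Rightarrow>
  ('o list \<Rightarrow> ('r, 'a) generator \<Rightarrow> 'k) \<Rightarrow> bool" where
 "multiadditive Sp t h K f \<longleftrightarrow> (\<forall>xs\<in>paths (sp_obj Sp) t h.
  if length xs = 1 then (\<lambda>r. f xs (Scalar r)):hom (amon (sp_ring Sp (hd xs)) :: 'r monoid) K
  else slotwise Sp xs K (\<lambda>as. f xs (Word as)))"

lemma multiadditiveD:
 assumes "multiadditive Sp t h K f" "xs:paths (sp_obj Sp) t h"
 shows "length xs = 1 ==> (\<lambda>r. f xs (Scalar r)):hom (amon (sp_ring Sp (hd xs)) :: 'b monoid) K"
  and "length xs \<noteq> 1 ==> slotwise Sp xs K (\<lambda>as. f xs (Word as))"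
  and "v:gens Sp xs ==> f xs v:car K"
proof -
 show 1: "length xs = 1 ==> (\<lambda>r. f xs (Scalar r)):hom (amon (sp_ring Sp (hd xs)) :: 'b monoid) K"
  and 2: "length xs \<noteq> 1 ==> slotwise Sp xs K (\<lambda>as. f xs (Word as))"
  using assms by (auto simp: multiadditive_def)
 show "v:gens Sp xs ==> f xs v:car K"
  using hom_in_carrier[OF 1] slotwiseD(1)[OF 2] by (auto simp: generators_def split: if_splits)
qed

lemma multiadditiveI:
 assumes "\<And>xs. xs:paths (sp_obj Sp) t h ==> length xs = 1 ==>
   (\<lambda>r. f xs (Scalar r)):hom (amon (sp_ring Sp (hd xs)) :: 'b monoid) K"
  and "\<And>xs. xs:paths (sp_obj Sp) t h ==> length xs \<noteq> 1 ==> slotwise Sp xs K (\<lambda>as. f xs (Word as))"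
 shows "multiadditive Sp t h K f"
 using assms by (auto simp: multiadditive_def)

section \<open>Path groups of a species and their universal properties\<close>

locale species =
 fixes Sp :: "('o, 'r, 'a) species"
 assumes sp_ring: "x:sp_obj Sp ==> ring (sp_ring Sp x)"
  and sp_mod: "y:sp_obj Sp ==> x:sp_obj Sp ==> bimodule (sp_mod Sp y x)"
  and lring_sp_mod: "y:sp_obj Sp ==> x:sp_obj Sp ==> lring (sp_mod Sp y x) = sp_ring Sp y"
  and rring_sp_mod: "y:sp_obj Sp ==> x:sp_obj Sp ==> rring (sp_mod Sp y x) = sp_ring Sp x"
begin

abbreviation "\<R> \<equiv> sp_ring Sp"
abbreviation "\<M> \<equiv> sp_mod Sp"
abbreviation "P t h \<equiv> paths (sp_obj Sp) t h"
abbreviation "\<T> t h \<equiv> tensor_hom Sp t h"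
text \<open>A generator as a morphism of the tensor category. These elements span the morphism
  groups, and identities there are tested on them.\<close>

abbreviation "E xs v \<equiv> in_path Sp xs (pure Sp xs v)"

lemma mod_closed:
 assumes "y:sp_obj Sp" "x:sp_obj Sp"
 shows "a:bcar (\<M> y x) ==> b:bcar (\<M> y x) ==> a \<otimes>\<^bsub>bgrp (\<M> y x)\<^esub> b:bcar (\<M> y x)"
  and "a:bcar (\<M> y x) ==> r:car (\<R> x) ==> ract (\<M> y x) a r:bcar (\<M> y x)"
  and "r:car (\<R> y) ==> a:bcar (\<M> y x) ==> lact (\<M> y x) r a:bcar (\<M> y x)"
proof -
 interpret M: bimodule "\<M> y x" by (rule sp_mod[OF assms])
 interpret G: comm_group "bgrp (\<M> y x)" by (rule M.comm_group)
 show "a:bcar (\<M> y x) ==> b:bcar (\<M> y x) ==> a \<otimes>\<^bsub>bgrp (\<M> y x)\<^esub> b:bcar (\<M> y x)" by simp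
 show "a:bcar (\<M> y x) ==> r:car (\<R> x) ==> ract (\<M> y x) a r:bcar (\<M> y x)"
  using M.ract_closed rring_sp_mod[OF assms] by simp
 show "r:car (\<R> y) ==> a:bcar (\<M> y x) ==> lact (\<M> y x) r a:bcar (\<M> y x)"
  using M.lact_closed lring_sp_mod[OF assms] by simp
qed

lemma path_relations_closed:
 assumes "xs:P t h"
 shows "path_relations Sp xs \<subseteq> car (FA (words Sp xs))"
 unfolding path_relations_def
 by (auto simp del: carrier_free_Abelian_group_iff intro!: frag_diff_closed path_words_update mod_closed
   dest: path_wordsD simp: pathsD(5)[OF assms] path_wordsD)

lemma comm_group_words:
 assumes "xs:P t h"
 shows "comm_group (FA (words Sp xs) Mod path_kernel Sp xs)"
 unfolding path_kernel_def
 using comm_group.abelian_FactGroup[OF abelian_free_Abelian_group]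
  group.generate_is_subgroup[OF group_free_Abelian_group path_relations_closed[OF assms]] by blast

lemma comm_group_add: "x:sp_obj Sp ==> comm_group (amon (\<R> x))"
 by (rule abelian_group.a_comm_group[OF ring.is_abelian_group[OF sp_ring]])

lemma comm_group_path_group:
 assumes "xs:P t h"
 shows "comm_group (path_group Sp xs)"
proof -
 have "hd xs:sp_obj Sp" using pathsD(1,2)[OF assms] by (cases xs) auto
 then have "comm_group (image_group Inl (amon (\<R> (hd xs))) :: ('r, 'a) path_elem monoid)"
  by (intro image_group_comm_group comm_group_add) simp_all
 moreover have "comm_group (image_group Inr (FA (words Sp xs) Mod path_kernel Sp xs) :: ('r, 'a) path_elem monoid)"
  by (intro image_group_comm_group comm_group_words[OF assms]) simp
 ultimately show ?thesis by (simp only: path_group_def split: if_split) simp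
qed

lemma spans_path_group:
 assumes xs: "xs:P t h"
 shows "spans (path_group Sp xs) (pure Sp xs ` gens Sp xs)"
proof (cases "length xs = 1")
 case True
 have "hd xs:sp_obj Sp" using pathsD(1,2)[OF assms] by (cases xs) auto
 from comm_group_add[OF this] have "comm_group (amon (\<R> (hd xs)))" .
 moreover have "spans (amon (\<R> (hd xs))) (car (\<R> (hd xs)))"
  by (auto simp: spans_def intro: generate.incl)
 ultimately have "spans (image_group Inl (amon (\<R> (hd xs)))) (Inl ` car (\<R> (hd xs)))"
  by (intro spans_image_group) auto
 moreover have "pure Sp xs ` gens Sp xs = Inl ` car (\<R> (hd xs))"
  using True by (auto simp: generators_def image_image)
 ultimately show ?thesis using True by (simp add: path_group_def)
next
 case False
 have "spans (image_group Inr (FA (words Sp xs) Mod path_kernel Sp xs))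
   (Inr ` (\<lambda>as. path_kernel Sp xs #>\<^bsub>FA (words Sp xs)\<^esub> frag_of as) ` words Sp xs)"
  using spans_presented[OF path_relations_closed[OF xs]] comm_group_words[OF xs]
  by (intro spans_image_group) (auto simp: path_kernel_def)
 moreover have "pure Sp xs ` gens Sp xs
   = Inr ` (\<lambda>as. path_kernel Sp xs #>\<^bsub>FA (words Sp xs)\<^esub> frag_of as) ` words Sp xs"
  using False by (simp add: generators_def image_image)
 ultimately show ?thesis using False by (simp add: path_group_def)
qed

lemma pure_closed: "xs:P t h ==> v:gens Sp xs ==> pure Sp xs v:car (path_group Sp xs)"
 using spans_subset[OF spans_path_group] by blast

lemma scalar_pure_hom:
 assumes "xs:P t h" "length xs = 1"
 shows "(\<lambda>r. pure Sp xs (Scalar r)):hom (amon (\<R> (hd xs))) (path_group Sp xs)"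
proof -
 have "hd xs:sp_obj Sp" using pathsD(1,2)[OF assms(1)] by (cases xs) auto
 then show ?thesis
  using image_group_hom[of Inl "amon (\<R> (hd xs))"] comm_group_add[of "hd xs"] assms(2)
  by (simp add: path_group_def comm_group_def)
qed

text \<open>Each defining relation of the path group, read modulo the kernel, is one instance of a
  slotwise condition.\<close>

lemma slotwise_pure:
 assumes xs: "xs:P t h" and len: "length xs \<noteq> 1"
 shows "slotwise Sp xs (path_group Sp xs) (\<lambda>as. pure Sp xs (Word as))"
proof -
 let ?F = "FA (words Sp xs)"
 let ?N = "path_kernel Sp xs"
 interpret N: normal ?N ?F
  unfolding path_kernel_def by (rule generate_normal_free[OF path_relations_closed[OF xs]])
 have eq: "?N #>\<^bsub>?F\<^esub> c = ?N #>\<^bsub>?F\<^esub> d"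
  if "c - d:path_relations Sp xs" "c:car ?F" "d:car ?F" for c d
  using frag_class_eq[OF path_relations_closed[OF xs] that] by (simp add: path_kernel_def)
 have Inr: "Inr A \<otimes>\<^bsub>path_group Sp xs\<^esub> Inr B = Inr (A \<otimes>\<^bsub>?F Mod ?N\<^esub> B)"
  if "A:car (?F Mod ?N)" "B:car (?F Mod ?N)" for A B
  using that len by (simp add: path_group_def image_group_def)
 have cl: "?N #>\<^bsub>?F\<^esub> frag_of x:car (?F Mod ?N)" if "x:words Sp xs" for x
  using that by (auto simp: carrier_FactGroup)
 show ?thesis
 proof (rule slotwiseI)
  fix as i a b assume *: "as:words Sp xs" "i < length as" "a:bcar (\<M> (xs ! i) (xs ! Suc i))"
   "b:bcar (\<M> (xs ! i) (xs ! Suc i))"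
  then have w: "as[i := a]:words Sp xs" "as[i := b]:words Sp xs"
   "as[i := a \<otimes>\<^bsub>bgrp (\<M> (xs ! i) (xs ! Suc i))\<^esub> b]:words Sp xs"
   using pathsD(5)[OF xs] path_wordsD(1)[OF *(1)] by (auto intro!: path_words_update mod_closed)
  have pl: "frag_of (as[i := a]) + frag_of (as[i := b]):car ?F"
   using N.m_closed[of "frag_of (as[i := a])" "frag_of (as[i := b])"] w by simp
  have "?N #>\<^bsub>?F\<^esub> frag_of (as[i := a \<otimes>\<^bsub>bgrp (\<M> (xs ! i) (xs ! Suc i))\<^esub> b])
   = ?N #>\<^bsub>?F\<^esub> (frag_of (as[i := a]) + frag_of (as[i := b]))"
  proof (rule eq)
   show "frag_of (as[i := a \<otimes>\<^bsub>bgrp (\<M> (xs ! i) (xs ! Suc i))\<^esub> b]) - (frag_of (as[i := a]) + frag_of (as[i := b]))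
    :path_relations Sp xs"
    unfolding path_relations_def diff_diff_eq[symmetric] using * by blast
  qed (use w pl in auto)
  then show "pure Sp xs (Word (as[i := a \<otimes>\<^bsub>bgrp (\<M> (xs ! i) (xs ! Suc i))\<^esub> b]))
    = pure Sp xs (Word (as[i := a])) \<otimes>\<^bsub>path_group Sp xs\<^esub> pure Sp xs (Word (as[i := b]))"
   using N.rcos_sum[of "frag_of (as[i := a])" "frag_of (as[i := b])"] w cl by (simp add: Inr)
 next
  fix as i r assume *: "as:words Sp xs" "Suc i < length as" "r:car (\<R> (xs ! Suc i))"
  have "as[i := ract (\<M> (xs ! i) (xs ! Suc i)) (as ! i) r]:words Sp xs"
   "as[Suc i := lact (\<M> (xs ! Suc i) (xs ! Suc (Suc i))) r (as ! Suc i)]:words Sp xs"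
   using * pathsD(5)[OF xs] path_wordsD[OF *(1)] by (auto intro!: path_words_update mod_closed)
  moreover have "frag_of (as[i := ract (\<M> (xs ! i) (xs ! Suc i)) (as ! i) r])
    - frag_of (as[Suc i := lact (\<M> (xs ! Suc i) (xs ! Suc (Suc i))) r (as ! Suc i)]):path_relations Sp xs"
   unfolding path_relations_def using * by blast
  ultimately show "pure Sp xs (Word (as[i := ract (\<M> (xs ! i) (xs ! Suc i)) (as ! i) r])) =
    pure Sp xs (Word (as[Suc i := lact (\<M> (xs ! Suc i) (xs ! Suc (Suc i))) r (as ! Suc i)]))"
   using eq by simp
 next
  fix as assume "as:words Sp xs"
  then show "pure Sp xs (Word as):car (path_group Sp xs)"
   by (intro pure_closed[OF xs]) (use len in \<open>simp add: generators_def\<close>)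
 qed
qed

text \<open>A slotwise function takes equal values on the two sides of each relation, so its
  additive extension descends to the quotient; the result is then read through the tag
  \<open>Inr\<close>.\<close>

lemma words_lift:
 assumes xs: "xs:P t h" and len: "length xs \<noteq> 1" and K: "comm_group K" and f: "slotwise Sp xs K f"
 obtains k where "k:hom (path_group Sp xs) K" "\<And>as. as:words Sp xs ==> k (pure Sp xs (Word as)) = f as"
proof -
 interpret K: comm_group K by fact
 have up: "as[i := a]:words Sp xs" if "as:words Sp xs" "a:bcar (\<M> (xs ! i) (xs ! Suc i))" for as i a
  using that by (simp add: path_words_update)
 have "\<exists>g\<in>hom (FA (words Sp xs) Mod path_kernel Sp xs) K. \<forall>as\<in>words Sp xs.
   g (path_kernel Sp xs #>\<^bsub>FA (words Sp xs)\<^esub> frag_of as) = f as"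
  unfolding path_kernel_def
 proof (rule presented_lift[OF path_relations_closed[OF xs] K, of f])
  fix g r assume g: "g:hom (FA (words Sp xs)) K" "\<And>x. x:words Sp xs ==> g (frag_of x) = f x"
  assume "r:path_relations Sp xs"
  then consider
   as i a b where "r = frag_of (as[i := a \<otimes>\<^bsub>bgrp (\<M> (xs ! i) (xs ! Suc i))\<^esub> b]) - frag_of (as[i := a]) - frag_of (as[i := b])"
    "as:words Sp xs" "i < length as" "a:bcar (\<M> (xs ! i) (xs ! Suc i))" "b:bcar (\<M> (xs ! i) (xs ! Suc i))"
   | as i q where "r = frag_of (as[i := ract (\<M> (xs ! i) (xs ! Suc i)) (as ! i) q])
     - frag_of (as[Suc i := lact (\<M> (xs ! Suc i) (xs ! Suc (Suc i))) q (as ! Suc i)])"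
    "as:words Sp xs" "Suc i < length as" "q:car (\<R> (xs ! Suc i))"
   unfolding path_relations_def by blast
  then show "g r = \<one>\<^bsub>K\<^esub>"
  proof cases
   case 1
   then have w: "as[i := a]:words Sp xs" "as[i := b]:words Sp xs"
    "as[i := a \<otimes>\<^bsub>bgrp (\<M> (xs ! i) (xs ! Suc i))\<^esub> b]:words Sp xs"
    using pathsD(5)[OF xs] path_wordsD(1)[OF 1(2)] by (auto intro!: path_words_update mod_closed)
   then show ?thesis
    unfolding 1(1) by (intro hom_frag_diff2_one[OF K.is_group g(1)]) (use 1 in \<open>simp_all add: g(2) slotwiseD(2)[OF f]\<close>)
  next
   case 2
   then have w: "as[i := ract (\<M> (xs ! i) (xs ! Suc i)) (as ! i) q]:words Sp xs"
    "as[Suc i := lact (\<M> (xs ! Suc i) (xs ! Suc (Suc i))) q (as ! Suc i)]:words Sp xs"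
    using pathsD(5)[OF xs] path_wordsD[OF 2(2)] by (auto intro!: path_words_update mod_closed)
   then show ?thesis
    unfolding 2(1) by (intro hom_frag_diff_one[OF K.is_group g(1)]) (use 2 in \<open>simp_all add: g(2) slotwiseD(3)[OF f]\<close>)
  qed
 qed (auto simp: slotwiseD(1)[OF f])
 then obtain g where g: "g:hom (FA (words Sp xs) Mod path_kernel Sp xs) K"
  "\<And>as. as:words Sp xs ==> g (path_kernel Sp xs #>\<^bsub>FA (words Sp xs)\<^esub> frag_of as) = f as" by blast
 have "group (FA (words Sp xs) Mod path_kernel Sp xs)"
  using comm_group_words[OF xs] by (simp add: comm_group_def)
 from image_group_lift[OF inj_on_subset[OF inj_Inr subset_UNIV] this g(1)]
 obtain k where k: "k:hom (image_group Inr (FA (words Sp xs) Mod path_kernel Sp xs)) K"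
  "\<And>x. x:car (FA (words Sp xs) Mod path_kernel Sp xs) ==> k (Inr x :: 'r + _) = g x" by blast
 show ?thesis
 proof (rule that)
  show "k:hom (path_group Sp xs) K" using k(1) len by (simp add: path_group_def)
  show "k (pure Sp xs (Word as)) = f as" if "as:words Sp xs" for as
   using that by (simp add: k(2) carrier_FactGroup g(2))
 qed
qed

lemma path_group_lift:
 assumes xs: "xs:P t h" and K: "comm_group K" and f: "multiadditive Sp t h K f"
 obtains k where "k:hom (path_group Sp xs) K" "\<And>v. v:gens Sp xs ==> k (pure Sp xs v) = f xs v"
proof (cases "length xs = 1")
 case True
 have "hd xs:sp_obj Sp" using pathsD(1,2)[OF xs] by (cases xs) auto
 then have "group (amon (\<R> (hd xs)))" using comm_group_add by (simp add: comm_group_def)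
 from image_group_lift[OF inj_on_subset[OF inj_Inl subset_UNIV] this multiadditiveD(1)[OF f xs True]]
 obtain k where k: "k:hom (image_group Inl (amon (\<R> (hd xs)))) K"
  "\<And>r. r:car (\<R> (hd xs)) ==> k (Inl r :: _ + ('a list \<Rightarrow>\<^sub>0 int) set) = f xs (Scalar r)" by auto
 show ?thesis
  by (rule that[of k]) (use k True in \<open>auto simp: path_group_def generators_def\<close>)
next
 case False
 from words_lift[OF xs False K multiadditiveD(2)[OF f xs False]]
 obtain k where k: "k:hom (path_group Sp xs) K" "\<And>as. as:words Sp xs ==> k (pure Sp xs (Word as)) = f xs (Word as)" by blast
 show ?thesis
 proof (rule that[OF k(1)])
  show "k (pure Sp xs v) = f xs v" if "v:gens Sp xs" for v
   using that False by (auto simp: generators_def simp del: pure.simps intro: k(2))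
 qed
qed

lemma group_path_group: "xs:P t h ==> group (path_group Sp xs)"
 using comm_group_path_group by (simp add: comm_group_def)

lemma comm_group_tensor_hom: "comm_group (\<T> t h)"
 unfolding tensor_hom_def by (rule comm_group_sum_group) (rule comm_group_path_group)

lemma group_tensor_hom: "group (\<T> t h)"
 using comm_group_tensor_hom by (simp add: comm_group_def)

lemma in_path_eq: "xs:P t h ==> in_path Sp xs = summand (P t h) (path_group Sp) xs"
 by (simp add: in_path_def pathsD)

lemma in_path_hom: "xs:P t h ==> in_path Sp xs:hom (path_group Sp xs) (\<T> t h)"
 unfolding tensor_hom_def using summand_hom[of "P t h" "path_group Sp"] group_path_group by (simp add: in_path_eq)

lemma E_closed: "xs:P t h ==> v:gens Sp xs ==> E xs v:car (\<T> t h)"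
 using hom_in_carrier[OF in_path_hom pure_closed] .

lemma slotwise_hom:
 assumes "slotwise Sp xs K f" "k:hom K L" "set xs \<subseteq> sp_obj Sp"
 shows "slotwise Sp xs L (\<lambda>as. k (f as))"
proof (rule slotwiseI)
 fix as assume as: "as:words Sp xs"
 show "k (f as):car L" using hom_in_carrier[OF assms(2) slotwiseD(1)[OF assms(1) as]] .
 fix i
 show "k (f (as[i := a \<otimes>\<^bsub>bgrp (\<M> (xs ! i) (xs ! Suc i))\<^esub> b])) = k (f (as[i := a])) \<otimes>\<^bsub>L\<^esub> k (f (as[i := b]))"
  if "i < length as" "a:bcar (\<M> (xs ! i) (xs ! Suc i))" "b:bcar (\<M> (xs ! i) (xs ! Suc i))" for a b
  using slotwiseD(2)[OF assms(1) as that] hom_mult[OF assms(2)] slotwiseD(1)[OF assms(1) path_words_update[OF as]] that by simp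
 show "k (f (as[i := ract (\<M> (xs ! i) (xs ! Suc i)) (as ! i) r]))
  = k (f (as[Suc i := lact (\<M> (xs ! Suc i) (xs ! Suc (Suc i))) r (as ! Suc i)]))"
  if "Suc i < length as" "r:car (\<R> (xs ! Suc i))" for r
  using slotwiseD(3)[OF assms(1) as that] by simp
qed

lemma slotwise_E:
 assumes "xs:P t h" "length xs \<noteq> 1"
 shows "slotwise Sp xs (\<T> t h) (\<lambda>as. E xs (Word as))"
 using slotwise_hom[OF slotwise_pure[OF assms] in_path_hom[OF assms(1)] pathsD(2)[OF assms(1)]] .

lemma scalar_E:
 assumes "xs:P t h" "length xs = 1"
 shows "(\<lambda>r. E xs (Scalar r)):hom (amon (\<R> (hd xs))) (\<T> t h)"
 using hom_compose[OF scalar_pure_hom[OF assms] in_path_hom[OF assms(1)]] by (simp add: o_def)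

lemma spans_tensor_hom: "spans (\<T> t h) {E xs v | xs v. xs:P t h \<and> v:gens Sp xs}"
proof -
 have "spans (\<T> t h) (\<Union>xs\<in>P t h. summand (P t h) (path_group Sp) xs ` pure Sp xs ` gens Sp xs)"
  unfolding tensor_hom_def by (rule spans_sum_group) (use group_path_group spans_path_group in auto)
 moreover have "(\<Union>xs\<in>P t h. summand (P t h) (path_group Sp) xs ` pure Sp xs ` gens Sp xs)
   = {E xs v | xs v. xs:P t h \<and> v:gens Sp xs}"
  by (auto simp: in_path_eq) (metis in_path_eq)
 ultimately show ?thesis by simp
qed

lemma tensor_hom_lift:
 assumes K: "comm_group K" and f: "multiadditive Sp t h K f"
 obtains k where "k:hom (\<T> t h) K" "\<And>xs v. xs:P t h ==> v:gens Sp xs ==> k (E xs v) = f xs v"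
proof -
 have "\<forall>xs\<in>P t h. \<exists>k\<in>hom (path_group Sp xs) K. \<forall>v\<in>gens Sp xs. k (pure Sp xs v) = f xs v"
  by (metis path_group_lift[OF _ K f])
 then obtain k where k: "\<And>xs. xs:P t h ==> k xs:hom (path_group Sp xs) K"
  "\<And>xs v. xs:P t h ==> v:gens Sp xs ==> k xs (pure Sp xs v) = f xs v" by metis
 obtain g where g: "g:hom (\<T> t h) K"
  "\<And>xs x. xs:P t h ==> x:car (path_group Sp xs) ==> g (summand (P t h) (path_group Sp) xs x) = k xs x"
  unfolding tensor_hom_def by (rule sum_group_lift[of "P t h" "path_group Sp" K k]) (use group_path_group K k(1) in auto)
 show ?thesis
  by (rule that[OF g(1)]) (simp add: in_path_eq g(2) pure_closed k(2))
qed

lemma tensor_hom_eq: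
 assumes "group K" "k:hom (\<T> t h) K" "l:hom (\<T> t h) K"
  "\<And>xs v. xs:P t h ==> v:gens Sp xs ==> k (E xs v) = l (E xs v)" "a:car (\<T> t h)"
 shows "k a = l a"
 by (rule spans_hom_eq[OF group_tensor_hom assms(1-3) spans_tensor_hom _ assms(5)]) (use assms(4) in auto)

text \<open>Currying reduces a map in two variables to two single lifts: \<open>f1\<close> yields,
  for each first generator, a homomorphism in the second variable, and \<open>f2\<close> makes this
  dependence multiadditive with values in \<open>hom_group\<close>.\<close>

lemma bilift:
 assumes K: "comm_group K"
  and f1: "\<And>ys v. ys:P u h ==> v:gens Sp ys ==> multiadditive Sp t u K (f ys v)"
  and f2: "\<And>xs w. xs:P t u ==> w:gens Sp xs ==> multiadditive Sp u h K (\<lambda>ys v. f ys v xs w)"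
 obtains m where "biadditive (\<T> u h) (\<T> t u) K m"
  "\<And>ys v xs w. ys:P u h ==> v:gens Sp ys ==> xs:P t u ==> w:gens Sp xs ==>
   m (E ys v) (E xs w) = f ys v xs w"
proof -
 interpret K: comm_group K by fact
 let ?H = "hom_group (\<T> t u) K"
 \<comment> \<open>The membership conditions are placed under the quantifiers, so that choice
   delivers a total function \<open>l\<close> of paths and generators.\<close>
 have "\<forall>ys v. \<exists>k. ys:P u h \<longrightarrow> v:gens Sp ys \<longrightarrow> k:car ?H \<and>
   (\<forall>xs\<in>P t u. \<forall>w\<in>gens Sp xs. k (E xs w) = f ys v xs w)"
 proof (intro allI)
  fix ys v
  show "\<exists>k. ys:P u h \<longrightarrow> v:gens Sp ys \<longrightarrow> k:car ?H \<and>
   (\<forall>xs\<in>P t u. \<forall>w\<in>gens Sp xs. k (E xs w) = f ys v xs w)"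
  proof (cases "ys:P u h \<and> v:gens Sp ys")
   case True
   with tensor_hom_lift[OF K f1] obtain k where "k:hom (\<T> t u) K"
    "\<And>xs w. xs:P t u ==> w:gens Sp xs ==> k (E xs w) = f ys v xs w" by metis
   then show ?thesis
    by (intro exI[of _ "restrict k (car (\<T> t u))"])
     (auto simp: hom_group_def hom_restrict_iff[OF group_tensor_hom] E_closed)
  qed auto
 qed
 then obtain l where l: "\<And>ys v. ys:P u h ==> v:gens Sp ys ==> l ys v:car ?H"
  "\<And>ys v xs w. ys:P u h ==> v:gens Sp ys ==> xs:P t u ==> w:gens Sp xs ==>
   l ys v (E xs w) = f ys v xs w" by metis
 have H: "comm_group ?H" by (rule comm_group_hom_group[OF group_tensor_hom K])
 interpret H: comm_group ?H by (rule H)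
 have Heq: "p = q" if "p:car ?H" "q:car ?H"
  "\<And>xs w. xs:P t u ==> w:gens Sp xs ==> p (E xs w) = q (E xs w)" for p q
  by (rule extensionalityI[of _ "car (\<T> t u)"])
   (use that tensor_hom_eq[OF K.is_group, of p t u q] in \<open>auto simp: hom_group_def\<close>)
 have Hm: "(p \<otimes>\<^bsub>?H\<^esub> q) (E xs w) = p (E xs w) \<otimes>\<^bsub>K\<^esub> q (E xs w)" if "xs:P t u" "w:gens Sp xs" for p q xs w
  using that by (simp add: hom_group_def E_closed)
 have "multiadditive Sp u h ?H l"
 proof (rule multiadditiveI)
  fix ys assume ys: "ys:P u h" "length ys = 1"
  have hd: "hd ys:sp_obj Sp" using pathsD(1,2)[OF ys(1)] by (cases ys) auto
  interpret R: ring "\<R> (hd ys)" by (rule sp_ring[OF hd])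
  have g: "Scalar r:gens Sp ys" if "r:car (\<R> (hd ys))" for r using that ys(2) by (simp add: generators_def)
  show "(\<lambda>r. l ys (Scalar r)):hom (amon (\<R> (hd ys))) ?H"
  proof (rule homI)
   fix r s assume rs: "r:car (amon (\<R> (hd ys)))" "s:car (amon (\<R> (hd ys)))"
   show "l ys (Scalar (r \<otimes>\<^bsub>amon (\<R> (hd ys))\<^esub> s)) = l ys (Scalar r) \<otimes>\<^bsub>?H\<^esub> l ys (Scalar s)"
   proof (rule Heq)
    fix xs w assume "xs:P t u" "w:gens Sp xs"
    then show "l ys (Scalar (r \<otimes>\<^bsub>amon (\<R> (hd ys))\<^esub> s)) (E xs w) = (l ys (Scalar r) \<otimes>\<^bsub>?H\<^esub> l ys (Scalar s)) (E xs w)"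
     using rs ys g hom_mult[OF multiadditiveD(1)[OF f2 ys]] by (simp add: Hm l(2))
   qed (use rs ys g l(1) in auto)
  qed (use ys g l(1) in auto)
 next
  fix ys assume ys: "ys:P u h" "length ys \<noteq> 1"
  have g: "Word as:gens Sp ys" if "as:words Sp ys" for as using that ys(2) by (simp add: generators_def)
  have f2': "slotwise Sp ys K (\<lambda>as. f ys (Word as) xs w)" if "xs:P t u" "w:gens Sp xs" for xs w
   using multiadditiveD(2)[OF f2[OF that] ys] .
  show "slotwise Sp ys ?H (\<lambda>as. l ys (Word as))"
  proof (rule slotwiseI)
   fix as i a b assume *: "as:words Sp ys" "i < length as" "a:bcar (\<M> (ys ! i) (ys ! Suc i))"
    "b:bcar (\<M> (ys ! i) (ys ! Suc i))"
   then have w: "as[i := a]:words Sp ys" "as[i := b]:words Sp ys"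
    "as[i := a \<otimes>\<^bsub>bgrp (\<M> (ys ! i) (ys ! Suc i))\<^esub> b]:words Sp ys"
    using pathsD(5)[OF ys(1)] path_wordsD(1)[OF *(1)] by (auto intro!: path_words_update mod_closed)
   show "l ys (Word (as[i := a \<otimes>\<^bsub>bgrp (\<M> (ys ! i) (ys ! Suc i))\<^esub> b]))
     = l ys (Word (as[i := a])) \<otimes>\<^bsub>?H\<^esub> l ys (Word (as[i := b]))"
    by (rule Heq) (use w ys(1) g l(1) * in \<open>auto simp: Hm l(2) slotwiseD(2)[OF f2']\<close>)
  next
   fix as i r assume *: "as:words Sp ys" "Suc i < length as" "r:car (\<R> (ys ! Suc i))"
   then have w: "as[i := ract (\<M> (ys ! i) (ys ! Suc i)) (as ! i) r]:words Sp ys"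
    "as[Suc i := lact (\<M> (ys ! Suc i) (ys ! Suc (Suc i))) r (as ! Suc i)]:words Sp ys"
    using pathsD(5)[OF ys(1)] path_wordsD[OF *(1)] by (auto intro!: path_words_update mod_closed)
   show "l ys (Word (as[i := ract (\<M> (ys ! i) (ys ! Suc i)) (as ! i) r])) =
     l ys (Word (as[Suc i := lact (\<M> (ys ! Suc i) (ys ! Suc (Suc i))) r (as ! Suc i)]))"
    by (rule Heq) (use w ys(1) g l(1) * in \<open>auto simp: l(2) slotwiseD(3)[OF f2']\<close>)
  qed (use ys g l(1) in auto)
 qed
 from tensor_hom_lift[OF H this] obtain m where m: "m:hom (\<T> u h) ?H"
  "\<And>ys v. ys:P u h ==> v:gens Sp ys ==> m (E ys v) = l ys v" by blast
 show ?thesis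
  by (rule that[OF biadditive_hom_group[OF group_tensor_hom group_tensor_hom m(1)]]) (simp add: m(2) l(2))
qed

end

section \<open>Concatenation of generators\<close>

lemma conc_scalar_word:
 assumes "as \<noteq> []"
 shows "conc Sp ys xs (Scalar r) (Word as) = Word (as[0 := lact (sp_mod Sp (xs ! 0) (xs ! 1)) r (as ! 0)])"
 using assms by (cases as) simp_all

text \<open>The letter acted upon is rewritten as a list update, here at the last index and in the
  preceding lemma at index zero, because the slotwise conditions are stated for updates.\<close>

lemma conc_word_scalar:
 assumes "length ys = Suc (length bs)" "bs \<noteq> []"
 shows "conc Sp ys xs (Word bs) (Scalar s) = Word (bs[length bs - 1 :=
  ract (sp_mod Sp (ys ! (length bs - 1)) (ys ! length bs)) (bs ! (length bs - 1)) s])"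
proof -
 obtain cs c where bs: "bs = cs @ [c]" using assms(2) by (cases bs rule: rev_cases) auto
 show ?thesis using assms(1) by (simp add: bs)
qed

lemma hd_tl_paths:
 assumes "xs:paths X t u"
 shows "[u] @ tl xs = xs"
 using pathsD(1,3)[OF assms] by (cases xs) auto

lemma path_length1:
 assumes "xs:paths X t u" "length xs = 1"
 shows "xs = [u]" "t = u" "u:X"
 using assms by (auto simp: paths_def length_Suc_conv)

context species
begin

text \<open>Agreement on words is enough because the updated words in the conditions are words
  again; closure of the bimodules under their operations requires the vertices to be
  objects.\<close>

lemma slotwise_cong:
 assumes "slotwise Sp xs K f" "set xs \<subseteq> sp_obj Sp" "\<And>as. as:words Sp xs ==> g as = f as"
 shows "slotwise Sp xs K g"
proof (rule slotwiseI)
 have o: "xs ! i:sp_obj Sp" if "i < length xs" for i using assms(2) that nth_mem by blast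
 fix as assume as: "as:words Sp xs"
 show "g as:car K" using assms(3)[OF as] slotwiseD(1)[OF assms(1) as] by simp
 fix i
 show "g (as[i := a \<otimes>\<^bsub>bgrp (\<M> (xs ! i) (xs ! Suc i))\<^esub> b]) = g (as[i := a]) \<otimes>\<^bsub>K\<^esub> g (as[i := b])"
  if "i < length as" "a:bcar (\<M> (xs ! i) (xs ! Suc i))" "b:bcar (\<M> (xs ! i) (xs ! Suc i))" for a b
  using slotwiseD(2)[OF assms(1) as that] that path_wordsD(1)[OF as] o
  by (simp add: assms(3) path_words_update[OF as] mod_closed)
 show "g (as[i := ract (\<M> (xs ! i) (xs ! Suc i)) (as ! i) r])
  = g (as[Suc i := lact (\<M> (xs ! Suc i) (xs ! Suc (Suc i))) r (as ! Suc i)])"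
  if "Suc i < length as" "r:car (\<R> (xs ! Suc i))" for r
  using slotwiseD(3)[OF assms(1) as that] that path_wordsD[OF as] o
  by (simp add: assms(3) path_words_update[OF as] mod_closed)
qed

lemma mod_laws:
 assumes "y:sp_obj Sp" "x:sp_obj Sp"
 shows "q:car (\<R> y) ==> a:bcar (\<M> y x) ==> b:bcar (\<M> y x) ==>
   lact (\<M> y x) q (a \<otimes>\<^bsub>bgrp (\<M> y x)\<^esub> b) = lact (\<M> y x) q a \<otimes>\<^bsub>bgrp (\<M> y x)\<^esub> lact (\<M> y x) q b"
  and "q:car (\<R> y) ==> q':car (\<R> y) ==> a:bcar (\<M> y x) ==>
   lact (\<M> y x) (q \<oplus>\<^bsub>\<R> y\<^esub> q') a = lact (\<M> y x) q a \<otimes>\<^bsub>bgrp (\<M> y x)\<^esub> lact (\<M> y x) q' a"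
  and "q:car (\<R> y) ==> q':car (\<R> y) ==> a:bcar (\<M> y x) ==>
   lact (\<M> y x) (q \<otimes>\<^bsub>\<R> y\<^esub> q') a = lact (\<M> y x) q (lact (\<M> y x) q' a)"
  and "a:bcar (\<M> y x) ==> lact (\<M> y x) \<one>\<^bsub>\<R> y\<^esub> a = a"
  and "r:car (\<R> x) ==> a:bcar (\<M> y x) ==> b:bcar (\<M> y x) ==>
   ract (\<M> y x) (a \<otimes>\<^bsub>bgrp (\<M> y x)\<^esub> b) r = ract (\<M> y x) a r \<otimes>\<^bsub>bgrp (\<M> y x)\<^esub> ract (\<M> y x) b r"
  and "r:car (\<R> x) ==> r':car (\<R> x) ==> a:bcar (\<M> y x) ==>
   ract (\<M> y x) a (r \<oplus>\<^bsub>\<R> x\<^esub> r') = ract (\<M> y x) a r \<otimes>\<^bsub>bgrp (\<M> y x)\<^esub> ract (\<M> y x) a r'"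
  and "r:car (\<R> x) ==> r':car (\<R> x) ==> a:bcar (\<M> y x) ==>
   ract (\<M> y x) a (r \<otimes>\<^bsub>\<R> x\<^esub> r') = ract (\<M> y x) (ract (\<M> y x) a r) r'"
  and "a:bcar (\<M> y x) ==> ract (\<M> y x) a \<one>\<^bsub>\<R> x\<^esub> = a"
  and "q:car (\<R> y) ==> a:bcar (\<M> y x) ==> r:car (\<R> x) ==>
   ract (\<M> y x) (lact (\<M> y x) q a) r = lact (\<M> y x) q (ract (\<M> y x) a r)"
 using bimodule.lact_add[OF sp_mod[OF assms]] bimodule.add_lact[OF sp_mod[OF assms]]
  bimodule.mult_lact[OF sp_mod[OF assms]] bimodule.one_lact[OF sp_mod[OF assms]]
  bimodule.ract_add[OF sp_mod[OF assms]] bimodule.add_ract[OF sp_mod[OF assms]]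
  bimodule.mult_ract[OF sp_mod[OF assms]] bimodule.one_ract[OF sp_mod[OF assms]]
  bimodule.lact_ract[OF sp_mod[OF assms]]
 by (simp_all only: lring_sp_mod[OF assms] rring_sp_mod[OF assms])

lemma word_nonempty: "as:words Sp xs ==> length xs \<noteq> 1 ==> as \<noteq> []"
 using path_wordsD(1) by fastforce

context
 fixes xs t h
 assumes xs: "xs:P t h" and len: "length xs \<noteq> 1"
begin

lemma obj: "as:words Sp xs ==> i < length as ==> xs ! i:sp_obj Sp \<and> xs ! Suc i:sp_obj Sp"
 using pathsD(5)[OF xs] path_wordsD(1)[of as Sp xs] by simp

text \<open>Only the first letter changes. Additivity there is additivity of the left action, and
  balancing at the first interior vertex needs the left action on that letter to commute with the
  right one. The other slots are untouched.\<close>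

lemma slotwise_lact:
 assumes f: "slotwise Sp xs K f" and r: "r:car (\<R> (xs ! 0))"
 shows "slotwise Sp xs K (\<lambda>as. f (as[0 := lact (\<M> (xs ! 0) (xs ! 1)) r (as ! 0)]))"
proof (rule slotwiseI)
 fix as assume as: "as:words Sp xs"
 have ne: "0 < length as" using word_nonempty[OF as len] by simp
 note o = obj[OF as] and a0 = path_wordsD(2)[OF as ne]
 let ?l = "lact (\<M> (xs ! 0) (xs ! 1))"
 let ?L = "as[0 := ?l r (as ! 0)]"
 have L: "?L:words Sp xs"
  using o[OF ne] a0 r by (intro path_words_update[OF as]) (simp add: mod_closed)
 have swap: "(as[i := c])[0 := ?l r (as[i := c] ! 0)] = ?L[i := c]" if "i \<noteq> 0" for i c
  using that by (simp add: list_update_swap)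
 show "f ?L:car K" by (rule slotwiseD(1)[OF f L])
 fix i
 show "f ((as[i := a \<otimes>\<^bsub>bgrp (\<M> (xs ! i) (xs ! Suc i))\<^esub> b])[0 := ?l r (as[i := a \<otimes>\<^bsub>bgrp (\<M> (xs ! i) (xs ! Suc i))\<^esub> b] ! 0)])
   = f ((as[i := a])[0 := ?l r (as[i := a] ! 0)]) \<otimes>\<^bsub>K\<^esub> f ((as[i := b])[0 := ?l r (as[i := b] ! 0)])"
  if *: "i < length as" "a:bcar (\<M> (xs ! i) (xs ! Suc i))" "b:bcar (\<M> (xs ! i) (xs ! Suc i))" for a b
 proof (cases "i = 0")
  case True
  then show ?thesis
   using * o[OF ne] r slotwiseD(2)[OF f as ne, of "?l r a" "?l r b"] by (simp add: mod_laws mod_closed)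
 next
  case False
  then show ?thesis unfolding swap[OF False] using slotwiseD(2)[OF f L] * by simp
 qed
 show "f ((as[i := ract (\<M> (xs ! i) (xs ! Suc i)) (as ! i) q])[0 := ?l r (as[i := ract (\<M> (xs ! i) (xs ! Suc i)) (as ! i) q] ! 0)])
   = f ((as[Suc i := lact (\<M> (xs ! Suc i) (xs ! Suc (Suc i))) q (as ! Suc i)])
    [0 := ?l r (as[Suc i := lact (\<M> (xs ! Suc i) (xs ! Suc (Suc i))) q (as ! Suc i)] ! 0)])"
  if *: "Suc i < length as" "q:car (\<R> (xs ! Suc i))" for q
 proof -
  have 1: "(as[i := ract (\<M> (xs ! i) (xs ! Suc i)) (as ! i) q])[0 := ?l r (as[i := ract (\<M> (xs ! i) (xs ! Suc i)) (as ! i) q] ! 0)]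
    = ?L[i := ract (\<M> (xs ! i) (xs ! Suc i)) (?L ! i) q]"
  proof (cases "i = 0")
   case True
   then show ?thesis using * o[OF ne] a0 r ne by (simp add: mod_laws)
  next
   case False
   then show ?thesis unfolding swap[OF False] by simp
  qed
  show ?thesis
   unfolding 1 swap[OF nat.simps(3)] using slotwiseD(3)[OF f L, of i q] * by simp
 qed
qed

lemma slotwise_ract:
 assumes f: "slotwise Sp xs K f" and r: "r:car (\<R> (xs ! (length xs - 1)))"
 shows "slotwise Sp xs K (\<lambda>as. f (as[length as - 1 :=
  ract (\<M> (xs ! (length as - 1)) (xs ! length as)) (as ! (length as - 1)) r]))"
proof -
 \<comment> \<open>The last letter of every word along \<open>xs\<close> has index
   \<open>length xs - 2\<close>; this fixed index stands in for \<open>length as - 1\<close> during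
   the argument.\<close>
 define n where "n = length xs - 2"
 have n': "length as = Suc n" "n < length as" "length xs = Suc (Suc n)" if as: "as:words Sp xs" for as
  using word_nonempty[OF as len] path_wordsD(1)[OF as] by (cases as; simp add: n_def)+
 have "slotwise Sp xs K (\<lambda>as. f (as[n := ract (\<M> (xs ! n) (xs ! Suc n)) (as ! n) r]))"
 proof (rule slotwiseI)
  fix as assume as: "as:words Sp xs"
  note n = n'[OF as]
  note o = obj[OF as] and a0 = path_wordsD(2)[OF as n(2)]
  have r': "r:car (\<R> (xs ! Suc n))" using r n by simp
  let ?l = "\<lambda>a. ract (\<M> (xs ! n) (xs ! Suc n)) a r"
  let ?L = "as[n := ?l (as ! n)]"
  have L: "?L:words Sp xs"
   using o[OF n(2)] a0 r' by (intro path_words_update[OF as]) (simp add: mod_closed)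
  have swap: "(as[i := c])[n := ?l (as[i := c] ! n)] = ?L[i := c]" if "i \<noteq> n" for i c
   using that by (simp add: list_update_swap)
  show "f ?L:car K" by (rule slotwiseD(1)[OF f L])
  fix i
  show "f ((as[i := a \<otimes>\<^bsub>bgrp (\<M> (xs ! i) (xs ! Suc i))\<^esub> b])[n := ?l (as[i := a \<otimes>\<^bsub>bgrp (\<M> (xs ! i) (xs ! Suc i))\<^esub> b] ! n)])
    = f ((as[i := a])[n := ?l (as[i := a] ! n)]) \<otimes>\<^bsub>K\<^esub> f ((as[i := b])[n := ?l (as[i := b] ! n)])"
   if *: "i < length as" "a:bcar (\<M> (xs ! i) (xs ! Suc i))" "b:bcar (\<M> (xs ! i) (xs ! Suc i))" for a b
  proof (cases "i = n")
   case True
   then show ?thesis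
    using * o[OF n(2)] r' n slotwiseD(2)[OF f as n(2), of "?l a" "?l b"] by (simp add: mod_laws mod_closed)
  next
   case False
   then show ?thesis unfolding swap[OF False] using slotwiseD(2)[OF f L] * by simp
  qed
  show "f ((as[i := ract (\<M> (xs ! i) (xs ! Suc i)) (as ! i) q])[n := ?l (as[i := ract (\<M> (xs ! i) (xs ! Suc i)) (as ! i) q] ! n)])
    = f ((as[Suc i := lact (\<M> (xs ! Suc i) (xs ! Suc (Suc i))) q (as ! Suc i)])
     [n := ?l (as[Suc i := lact (\<M> (xs ! Suc i) (xs ! Suc (Suc i))) q (as ! Suc i)] ! n)])"
   if *: "Suc i < length as" "q:car (\<R> (xs ! Suc i))" for q
  proof -
   have i: "i \<noteq> n" using * n by simp
   have 1: "(as[Suc i := lact (\<M> (xs ! Suc i) (xs ! Suc (Suc i))) q (as ! Suc i)])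
     [n := ?l (as[Suc i := lact (\<M> (xs ! Suc i) (xs ! Suc (Suc i))) q (as ! Suc i)] ! n)]
     = ?L[Suc i := lact (\<M> (xs ! Suc i) (xs ! Suc (Suc i))) q (?L ! Suc i)]"
   proof (cases "Suc i = n")
    case True
    then show ?thesis using * o[OF n(2)] a0 r' n by (simp add: mod_laws)
   next
    case False
    then show ?thesis unfolding swap[OF False] by simp
   qed
   show ?thesis
    unfolding 1 swap[OF i] using slotwiseD(3)[OF f L, of i q] * i by simp
  qed
 qed
 then show ?thesis by (rule slotwise_cong[OF _ pathsD(2)[OF xs]]) (simp add: n')
qed

lemma scalar_lact_hom:
 assumes f: "slotwise Sp xs K f" and as: "as:words Sp xs"
 shows "(\<lambda>r. f (as[0 := lact (\<M> (xs ! 0) (xs ! 1)) r (as ! 0)])):hom (amon (\<R> (xs ! 0))) K"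
proof (rule homI)
 have ne: "0 < length as" using word_nonempty[OF as len] by simp
 note o = obj[OF as ne] and a0 = path_wordsD(2)[OF as ne]
 fix r s assume r: "r:car (amon (\<R> (xs ! 0)))"
 then show "f (as[0 := lact (\<M> (xs ! 0) (xs ! 1)) r (as ! 0)]):car K"
  using o a0 by (intro slotwiseD(1)[OF f] path_words_update[OF as]) (simp add: mod_closed)
 assume "s:car (amon (\<R> (xs ! 0)))"
 with r show "f (as[0 := lact (\<M> (xs ! 0) (xs ! 1)) (r \<otimes>\<^bsub>amon (\<R> (xs ! 0))\<^esub> s) (as ! 0)])
  = f (as[0 := lact (\<M> (xs ! 0) (xs ! 1)) r (as ! 0)]) \<otimes>\<^bsub>K\<^esub> f (as[0 := lact (\<M> (xs ! 0) (xs ! 1)) s (as ! 0)])"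
  using o a0 slotwiseD(2)[OF f as ne] by (simp add: mod_laws mod_closed)
qed

lemma scalar_ract_hom:
 assumes f: "slotwise Sp xs K f" and as: "as:words Sp xs"
 shows "(\<lambda>r. f (as[length as - 1 := ract (\<M> (xs ! (length as - 1)) (xs ! length as)) (as ! (length as - 1)) r]))
 :hom (amon (\<R> (xs ! length as))) K"
proof (rule homI)
 obtain n where n: "length as = Suc n" "n < length as"
  using word_nonempty[OF as len] by (cases as) auto
 note o = obj[OF as n(2)] and a0 = path_wordsD(2)[OF as n(2)]
 fix r s assume r: "r:car (amon (\<R> (xs ! length as)))"
 then show "f (as[length as - 1 := ract (\<M> (xs ! (length as - 1)) (xs ! length as)) (as ! (length as - 1)) r]):car K"
  using o a0 n by (intro slotwiseD(1)[OF f] path_words_update[OF as]) (simp add: mod_closed)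
 assume "s:car (amon (\<R> (xs ! length as)))"
 with r show "f (as[length as - 1 := ract (\<M> (xs ! (length as - 1)) (xs ! length as)) (as ! (length as - 1)) (r \<otimes>\<^bsub>amon (\<R> (xs ! length as))\<^esub> s)])
  = f (as[length as - 1 := ract (\<M> (xs ! (length as - 1)) (xs ! length as)) (as ! (length as - 1)) r])
   \<otimes>\<^bsub>K\<^esub> f (as[length as - 1 := ract (\<M> (xs ! (length as - 1)) (xs ! length as)) (as ! (length as - 1)) s])"
  using o a0 n slotwiseD(2)[OF f as n(2)] by (simp add: mod_laws mod_closed)
qed

end

text \<open>The conditions on the right-hand part are those of the long word shifted by
  \<open>length bs\<close>. The vertex at the junction is shared, which is why only the tail of
  \<open>xs\<close> is appended.\<close>

lemma slotwise_append_right: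
 assumes f: "slotwise Sp (ys @ tl xs) K f" and eq: "last ys = hd xs" and bs: "bs:words Sp ys"
 shows "slotwise Sp xs K (\<lambda>as. f (bs @ as))"
proof (rule slotwiseI)
 fix as assume as: "as:words Sp xs"
 have ne: "ys \<noteq> []" "xs \<noteq> []" using path_wordsD(1)[OF bs] path_wordsD(1)[OF as] by auto
 note w = path_words_append[OF eq bs as] and lb = path_wordsD(1)[OF bs] and la = path_wordsD(1)[OF as]
 have nth: "(ys @ tl xs) ! (length bs + j) = xs ! j" if "j < length xs" for j
  using nth_path_append(2)[OF eq ne that] lb by simp
 show "f (bs @ as):car K" by (rule slotwiseD(1)[OF f w])
 fix i
 show "f (bs @ as[i := a \<otimes>\<^bsub>bgrp (\<M> (xs ! i) (xs ! Suc i))\<^esub> b]) = f (bs @ as[i := a]) \<otimes>\<^bsub>K\<^esub> f (bs @ as[i := b])"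
  if "i < length as" "a:bcar (\<M> (xs ! i) (xs ! Suc i))" "b:bcar (\<M> (xs ! i) (xs ! Suc i))" for a b
  using slotwiseD(2)[OF f w, of "length bs + i" a b] that la nth[of i] nth[of "Suc i"] by (simp add: list_update_append)
 show "f (bs @ as[i := ract (\<M> (xs ! i) (xs ! Suc i)) (as ! i) r])
   = f (bs @ as[Suc i := lact (\<M> (xs ! Suc i) (xs ! Suc (Suc i))) r (as ! Suc i)])"
  if "Suc i < length as" "r:car (\<R> (xs ! Suc i))" for r
  using slotwiseD(3)[OF f w, of "length bs + i" r] that la nth[of i] nth[of "Suc i"] nth[of "Suc (Suc i)"]
  by (simp add: list_update_append nth_append)
qed

lemma slotwise_append_left:
 assumes f: "slotwise Sp (ys @ tl xs) K f" and eq: "last ys = hd xs" and as: "as:words Sp xs"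
 shows "slotwise Sp ys K (\<lambda>bs. f (bs @ as))"
proof (rule slotwiseI)
 fix bs assume bs: "bs:words Sp ys"
 have ne: "ys \<noteq> []" "xs \<noteq> []" using path_wordsD(1)[OF bs] path_wordsD(1)[OF as] by auto
 note w = path_words_append[OF eq bs as] and lb = path_wordsD(1)[OF bs]
 note nth = nth_path_append(1)[OF eq ne]
 show "f (bs @ as):car K" by (rule slotwiseD(1)[OF f w])
 fix i
 show "f (bs[i := a \<otimes>\<^bsub>bgrp (\<M> (ys ! i) (ys ! Suc i))\<^esub> b] @ as) = f (bs[i := a] @ as) \<otimes>\<^bsub>K\<^esub> f (bs[i := b] @ as)"
  if "i < length bs" "a:bcar (\<M> (ys ! i) (ys ! Suc i))" "b:bcar (\<M> (ys ! i) (ys ! Suc i))" for a b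
  using slotwiseD(2)[OF f w, of i a b] that lb nth[of i] nth[of "Suc i"] by (simp add: list_update_append)
 show "f (bs[i := ract (\<M> (ys ! i) (ys ! Suc i)) (bs ! i) r] @ as)
   = f (bs[Suc i := lact (\<M> (ys ! Suc i) (ys ! Suc (Suc i))) r (bs ! Suc i)] @ as)"
  if "Suc i < length bs" "r:car (\<R> (ys ! Suc i))" for r
  using slotwiseD(3)[OF f w, of i r] that lb nth[of i] nth[of "Suc i"] nth[of "Suc (Suc i)"]
  by (simp add: list_update_append nth_append)
qed

end

context species
begin

lemma generator_cases:
 assumes "v:gens Sp xs" "xs:P t h"
 obtains (Scalar) r where "xs = [h]" "t = h" "h:sp_obj Sp" "v = Scalar r" "r:car (\<R> h)"
  | (Word) as where "length xs \<noteq> 1" "v = Word as" "as:words Sp xs" "as \<noteq> []" "length xs = Suc (length as)"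
proof (cases "length xs = 1")
 case True
 then show ?thesis using assms path_length1[OF assms(2) True] that(1) by (auto simp: generators_def)
next
 case False
 then obtain as where as: "v = Word as" "as:words Sp xs" using assms(1) by (auto simp: generators_def)
 show ?thesis by (rule that(2)[OF False as word_nonempty[OF as(2) False] path_wordsD(1)[OF as(2)]])
qed

lemma length_append_path:
 assumes "ys \<noteq> []" "xs \<noteq> []"
 shows "length (ys @ tl xs) = 1 \<longleftrightarrow> length ys = 1 \<and> length xs = 1"
 using assms by (cases ys; cases xs) auto

lemma generator_Word: "xs:P t h ==> length xs \<noteq> 1 ==> as:words Sp xs ==> Word as:gens Sp xs"
 by (simp add: generators_def)

lemma generator_Scalar: "r:car (\<R> x) ==> Scalar r:gens Sp [x]"
 by (simp add: generators_def)

lemma path_ends: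
 assumes "xs:P t h" "length xs = Suc n"
 shows "xs ! 0 = h" "xs ! n = t"
 using pathsD(1,3,4)[OF assms(1)] assms(2) by (auto simp: hd_conv_nth last_conv_nth)

lemma conc_closed:
 assumes ys: "ys:P u h" and v: "v:gens Sp ys" and xs: "xs:P t u" and w: "w:gens Sp xs"
 shows "conc Sp ys xs v w:gens Sp (ys @ tl xs)"
 using v ys
proof (cases rule: generator_cases)
 case (Scalar r)
 note S = this
 from w xs show ?thesis
 proof (cases rule: generator_cases)
  case (Scalar s)
  interpret R: ring "\<R> h" by (rule sp_ring[OF S(3)])
  show ?thesis using S Scalar by (simp add: generators_def)
 next
  case (Word as)
  have eq: "ys @ tl xs = xs" using S hd_tl_paths[OF xs] by simp
  have "as[0 := lact (\<M> (xs ! 0) (xs ! 1)) r (as ! 0)]:words Sp xs"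
   using obj[OF xs Word(1,3), of 0] path_wordsD(2)[OF Word(3), of 0] Word(4,5) S path_ends(1)[OF xs Word(5)]
   by (intro path_words_update[OF Word(3)]) (simp add: mod_closed)
  then show ?thesis unfolding eq Word(2) S(4) conc_scalar_word[OF Word(4)] by (rule generator_Word[OF xs Word(1)])
 qed
next
 case (Word bs)
 note W = this
 from w xs show ?thesis
 proof (cases rule: generator_cases)
  case (Scalar s)
  obtain n where n: "length bs = Suc n" using W(4) by (cases bs) auto
  have "bs[length bs - 1 := ract (\<M> (ys ! (length bs - 1)) (ys ! length bs)) (bs ! (length bs - 1)) s]:words Sp ys"
   using obj[OF ys W(1,3), of n] path_wordsD(2)[OF W(3), of n] n Scalar path_ends(2)[OF ys W(5)]
   by (intro path_words_update[OF W(3)]) (simp add: mod_closed)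
  then show ?thesis
   using Scalar generator_Word[OF ys W(1)] unfolding W(2) Scalar(4) conc_word_scalar[OF W(5,4)] by simp
 next
  case (Word as)
  have "bs @ as:words Sp (ys @ tl xs)"
   by (rule path_words_append) (use W Word pathsD[OF xs] pathsD[OF ys] in auto)
  then show ?thesis
   using generator_Word[OF paths_append[OF ys xs]] W Word length_append_path[of ys xs] pathsD(1)[OF xs] pathsD(1)[OF ys] by simp
 qed
qed

text \<open>The combinations of scalars and words reduce to distributivity in a ring, to additivity
  of an action at one end of a word, and to relations inside a longer word.\<close>

lemma multiadditive_conc_right:
 assumes ys: "ys:P u h" and v: "v:gens Sp ys"
 shows "multiadditive Sp t u (\<T> t h) (\<lambda>xs w. E (ys @ tl xs) (conc Sp ys xs v w))"
proof (rule multiadditiveI)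
 fix xs assume xs: "xs:P t u" and len: "length xs = 1"
 note x = path_length1[OF xs len]
 from v ys show "(\<lambda>r. E (ys @ tl xs) (conc Sp ys xs v (Scalar r))):hom (amon (\<R> (hd xs))) (\<T> t h)"
 proof (cases rule: generator_cases)
  case (Scalar r)
  interpret R: ring "\<R> h" by (rule sp_ring[OF Scalar(3)])
  have "(\<lambda>s. E [h] (Scalar (r \<otimes>\<^bsub>\<R> h\<^esub> s))):hom (amon (\<R> h)) (\<T> h h)"
   using hom_mult[OF scalar_E[of "[h]" h h]] hom_in_carrier[OF scalar_E[of "[h]" h h]] x Scalar xs
   by (intro homI) (simp_all add: R.r_distr)
  then show ?thesis using x Scalar by simp
 next
  case (Word bs)
  have e: "conc Sp ys xs v (Scalar s) = Word (bs[length bs - 1 := ract (\<M> (ys ! (length bs - 1)) (ys ! length bs)) (bs ! (length bs - 1)) s])" for s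
   unfolding Word(2) by (rule conc_word_scalar[OF Word(5,4)])
  show ?thesis
   using scalar_ract_hom[OF ys Word(1) slotwise_E[OF ys Word(1)] Word(3)] x path_ends(2)[OF ys Word(5)] unfolding e by simp
 qed
next
 fix xs assume xs: "xs:P t u" and len: "length xs \<noteq> 1"
 from v ys show "slotwise Sp xs (\<T> t h) (\<lambda>as. E (ys @ tl xs) (conc Sp ys xs v (Word as)))"
 proof (cases rule: generator_cases)
  case (Scalar r)
  have eq: "ys @ tl xs = xs" using Scalar hd_tl_paths[OF xs] by simp
  have "r:car (\<R> (xs ! 0))" using Scalar pathsD(1,3)[OF xs] by (simp add: hd_conv_nth)
  from slotwise_lact[OF xs len slotwise_E[OF xs len] this]
  have *: "slotwise Sp xs (\<T> t h) (\<lambda>as. E xs (Word (as[0 := lact (\<M> (xs ! 0) (xs ! 1)) r (as ! 0)])))"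
   unfolding Scalar(2) .
  show ?thesis unfolding eq Scalar(4)
  proof (rule slotwise_cong[OF * pathsD(2)[OF xs]])
   fix as assume as: "as:words Sp xs"
   show "E xs (conc Sp ys xs (Scalar r) (Word as)) = E xs (Word (as[0 := lact (\<M> (xs ! 0) (xs ! 1)) r (as ! 0)]))"
    by (simp only: conc_scalar_word[OF word_nonempty[OF as len]])
  qed
 next
  case (Word bs)
  show ?thesis unfolding Word(2) conc.simps
   by (rule slotwise_append_right[OF slotwise_E[OF paths_append[OF ys xs]] _ Word(3)])
    (use Word(1) length_append_path[of ys xs] pathsD[OF xs] pathsD[OF ys] in auto)
 qed
qed

lemma multiadditive_conc_left:
 assumes xs: "xs:P t u" and w: "w:gens Sp xs"
 shows "multiadditive Sp u h (\<T> t h) (\<lambda>ys v. E (ys @ tl xs) (conc Sp ys xs v w))"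
proof (rule multiadditiveI)
 fix ys assume ys: "ys:P u h" and len: "length ys = 1"
 note y = path_length1[OF ys len]
 from w xs show "(\<lambda>r. E (ys @ tl xs) (conc Sp ys xs (Scalar r) w)):hom (amon (\<R> (hd ys))) (\<T> t h)"
 proof (cases rule: generator_cases)
  case (Scalar s)
  interpret R: ring "\<R> h" using sp_ring y by simp
  have "(\<lambda>r. E [u] (Scalar (r \<otimes>\<^bsub>\<R> u\<^esub> s))):hom (amon (\<R> u)) (\<T> u u)"
   using hom_mult[OF scalar_E[of "[u]" u u]] hom_in_carrier[OF scalar_E[of "[u]" u u]] y Scalar xs
   by (intro homI) (simp_all add: R.l_distr)
  then show ?thesis using y Scalar by simp
 next
  case (Word as)
  have eq: "ys @ tl xs = xs" using y hd_tl_paths[OF xs] by simp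
  have e: "conc Sp ys xs (Scalar r) w = Word (as[0 := lact (\<M> (xs ! 0) (xs ! 1)) r (as ! 0)])" for r
   unfolding Word(2) by (rule conc_scalar_word[OF Word(4)])
  show ?thesis
   using scalar_lact_hom[OF xs Word(1) slotwise_E[OF xs Word(1)] Word(3)] y path_ends(1)[OF xs Word(5)] unfolding e eq by simp
 qed
next
 fix ys assume ys: "ys:P u h" and len: "length ys \<noteq> 1"
 from w xs show "slotwise Sp ys (\<T> t h) (\<lambda>bs. E (ys @ tl xs) (conc Sp ys xs (Word bs) w))"
 proof (cases rule: generator_cases)
  case (Scalar r)
  have "r:car (\<R> (ys ! (length ys - 1)))" using Scalar pathsD(1,4)[OF ys] by (simp add: last_conv_nth)
  from slotwise_ract[OF ys len slotwise_E[OF ys len] this]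
  have *: "slotwise Sp ys (\<T> t h) (\<lambda>as. E ys (Word (as[length as - 1 :=
   ract (\<M> (ys ! (length as - 1)) (ys ! length as)) (as ! (length as - 1)) r])))" using Scalar by simp
  have eq: "ys @ tl xs = ys" using Scalar by simp
  show ?thesis unfolding eq Scalar(4)
  proof (rule slotwise_cong[OF * pathsD(2)[OF ys]])
   fix bs assume bs: "bs:words Sp ys"
   show "E ys (conc Sp ys xs (Word bs) (Scalar r)) = E ys (Word (bs[length bs - 1 :=
    ract (\<M> (ys ! (length bs - 1)) (ys ! length bs)) (bs ! (length bs - 1)) r]))"
    by (simp only: conc_word_scalar[OF path_wordsD(1)[OF bs] word_nonempty[OF bs len]])
  qed
 next
  case (Word as)
  show ?thesis unfolding Word(2) conc.simps
   by (rule slotwise_append_left[OF slotwise_E[OF paths_append[OF ys xs]] _ Word(3)])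
    (use Word(1) length_append_path[of ys xs] pathsD[OF xs] pathsD[OF ys] in auto)
 qed
qed

section \<open>Composition in the tensor category\<close>

abbreviation "\<C> \<equiv> tensor_category Sp"

lemma tensor_category_sel [simp]:
 "PObj \<C> = sp_obj Sp" "PHom \<C> = tensor_hom Sp" "PIdent \<C> x = E [x] (Scalar \<one>\<^bsub>\<R> x\<^esub>)"
 by (simp_all add: tensor_category_def)

text \<open>Resolves the \<open>THE\<close> in \<open>tensor_category\<close>; composition is used
  afterwards through biadditivity and its values on generators.\<close>

lemma biadditive_PComp: "biadditive (\<T> u h) (\<T> t u) (\<T> t h) (PComp \<C> t u h)" (is ?A)
 and PComp_E: "\<And>ys v xs w. ys:P u h ==> v:gens Sp ys ==> xs:P t u ==> w:gens Sp xs ==>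
   PComp \<C> t u h (E ys v) (E xs w) = E (ys @ tl xs) (conc Sp ys xs v w)"
proof -
 obtain m where m: "biadditive (\<T> u h) (\<T> t u) (\<T> t h) m"
  "\<And>ys v xs w. ys:P u h ==> v:gens Sp ys ==> xs:P t u ==> w:gens Sp xs ==>
   m (E ys v) (E xs w) = E (ys @ tl xs) (conc Sp ys xs v w)"
  using bilift[OF comm_group_tensor_hom multiadditive_conc_right multiadditive_conc_left] by blast
 have eq: "PComp \<C> t u h b a = m b a" if "b:car (\<T> u h)" "a:car (\<T> t u)" for a b
  unfolding tensor_category_def preadd.simps
  by (rule the_biadditive_eq[OF group_tensor_hom group_tensor_hom group_tensor_hom m(1) spans_tensor_hom spans_tensor_hom _ _ that])
   (auto simp: m(2) E_closed)
 show ?A by (rule biadditiveI) (use comm_group_tensor_hom in \<open>simp_all add: eq biadditiveD[OF m(1)] comm_group_def group.is_monoid monoid.m_closed\<close>)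
 show "PComp \<C> t u h (E ys v) (E xs w) = E (ys @ tl xs) (conc Sp ys xs v w)"
  if "ys:P u h" "v:gens Sp ys" "xs:P t u" "w:gens Sp xs" for ys v xs w
  using that by (simp add: eq E_closed m(2))
qed

text \<open>The concatenated generators themselves coincide in all cases but one. For a scalar
  between two words, one bracketing acts on the last letter of the left word and the other on the
  first letter of the right word; these words are identified only by the balancing relation at the
  junction. Hence the comparison is made after applying \<open>E\<close>.\<close>

lemma conc_assoc:
 assumes zs: "zs:P v h" and c: "c:gens Sp zs" and ys: "ys:P u v" and b: "b:gens Sp ys"
  and xs: "xs:P t u" and a: "a:gens Sp xs"
 shows "E ((zs @ tl ys) @ tl xs) (conc Sp (zs @ tl ys) xs (conc Sp zs ys c b) a)
  = E (zs @ tl (ys @ tl xs)) (conc Sp zs (ys @ tl xs) c (conc Sp ys xs b a))"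
proof -
 have path: "zs @ tl (ys @ tl xs) = (zs @ tl ys) @ tl xs" using pathsD(1)[OF ys] by simp
 have yx: "ys @ tl xs:P t v" and zy: "zs @ tl ys:P u h" using paths_append[OF ys xs] paths_append[OF zs ys] .
 have yx0: "(ys @ tl xs) ! i = ys ! i" if "i < length ys" for i
  using nth_path_append(1)[of ys xs i] pathsD[OF ys] pathsD[OF xs] that by auto
 have zy1: "(zs @ tl ys) ! (k + i) = ys ! i" if "i < length ys" "Suc k = length zs" for i k
  using nth_path_append(2)[of zs ys i k] pathsD[OF ys] pathsD[OF zs] that by auto
 from c zs show ?thesis
 proof (cases rule: generator_cases)
  case (Scalar r)
  note C = this
  have zy': "zs @ tl ys = ys" using C hd_tl_paths[OF ys] by simp
  from b ys show ?thesis
  proof (cases rule: generator_cases)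
   case (Scalar s)
   note B = this
   interpret R: ring "\<R> h" using C sp_ring by simp
   have yx': "ys @ tl xs = xs" using B hd_tl_paths[OF xs] by simp
   from a xs show ?thesis
   proof (cases rule: generator_cases)
    case (Scalar q)
    then show ?thesis using B C by (simp add: R.m_assoc)
   next
    case (Word as)
    note o = obj[OF xs Word(1,3), of 0] path_wordsD(2)[OF Word(3), of 0] path_ends(1)[OF xs Word(5)]
    have "conc Sp (zs @ tl ys) xs (conc Sp zs ys c b) a = conc Sp zs (ys @ tl xs) c (conc Sp ys xs b a)"
     unfolding yx' C(4) B(2) B(4) Word(2) conc.simps(1) conc_scalar_word[OF Word(4)]
     using o Word(4) B C by (subst conc_scalar_word) (simp_all add: mod_laws)
    then show ?thesis by (simp only: path)
   qed
  next
   case (Word bs)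
   note B = this
   note o = obj[OF ys B(1,3), of 0] path_wordsD(2)[OF B(3), of 0] path_ends(1)[OF ys B(5)]
   from a xs show ?thesis
   proof (cases rule: generator_cases)
    case (Scalar q)
    obtain n where n: "length bs = Suc n" using B(4) by (cases bs) auto
    note o' = obj[OF ys B(1,3), of n] path_wordsD(2)[OF B(3), of n] path_ends(2)[OF ys B(5)]
    have yx': "ys @ tl xs = ys" using Scalar by simp
    \<comment> \<open>In a word of one letter both scalars act on the same letter, and the two
      actions commute; in a longer word the two updates have different indices.\<close>
    have "conc Sp (zs @ tl ys) xs (conc Sp zs ys c b) a = conc Sp zs (ys @ tl xs) c (conc Sp ys xs b a)"
     unfolding zy' yx' C(4) B(2) Scalar(4) conc_scalar_word[OF B(4)] conc_word_scalar[OF B(5,4)]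
     using B(4,5) n o o' C Scalar
     by (subst conc_word_scalar, simp, simp, subst conc_scalar_word, simp, cases "n = 0") (simp_all add: mod_laws list_update_swap)
    then show ?thesis by (simp only: path)
   next
    case (Word as)
    have "conc Sp (zs @ tl ys) xs (conc Sp zs ys c b) a = conc Sp zs (ys @ tl xs) c (conc Sp ys xs b a)"
     unfolding zy' C(4) B(2) Word(2) conc_scalar_word[OF B(4)] conc.simps(4)
     using B(4,5) yx0[of 0] yx0[of 1] by (subst conc_scalar_word) (simp_all add: list_update_append nth_append)
    then show ?thesis by (simp only: path)
   qed
  qed
 next
  case (Word cs)
  note C = this
  obtain n where n: "length cs = Suc n" using C(4) by (cases cs) auto
  note o = obj[OF zs C(1,3), of n] path_wordsD(2)[OF C(3), of n] path_ends(2)[OF zs C(5)]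
  from b ys show ?thesis
  proof (cases rule: generator_cases)
   case (Scalar s)
   note B = this
   have yx': "ys @ tl xs = xs" using B hd_tl_paths[OF xs] by simp
   have zy': "zs @ tl ys = zs" using B by simp
   from a xs show ?thesis
   proof (cases rule: generator_cases)
    case (Scalar q)
    have "conc Sp (zs @ tl ys) xs (conc Sp zs ys c b) a = conc Sp zs (ys @ tl xs) c (conc Sp ys xs b a)"
     unfolding zy' yx' C(2) B(4) Scalar(4) conc.simps(1) conc_word_scalar[OF C(5,4)]
     using C(4,5) n o B Scalar by (subst conc_word_scalar) (simp_all add: mod_laws)
    then show ?thesis by (simp only: path)
   next
    case (Word as)
    have cx: "last zs = hd xs" using pathsD(4)[OF zs] pathsD(3)[OF xs] B by simp
    have w: "cs @ as:words Sp (zs @ tl xs)" by (rule path_words_append[OF cx C(3) Word(3)])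
    have zx: "zs @ tl xs:P t h" using zy xs zy' paths_append by metis
    have len: "length (zs @ tl xs) \<noteq> 1" using C(1) length_append_path[of zs xs] pathsD(1)[OF xs] pathsD(1)[OF zs] by simp
    have nz: "(zs @ tl xs) ! n = zs ! n" "(zs @ tl xs) ! Suc n = xs ! 0" "(zs @ tl xs) ! Suc (Suc n) = xs ! 1"
     using nth_path_append(1)[OF cx pathsD(1)[OF zs] pathsD(1)[OF xs], of n]
      nth_path_append(2)[OF cx pathsD(1)[OF zs] pathsD(1)[OF xs], of 0 "Suc n"]
      nth_path_append(2)[OF cx pathsD(1)[OF zs] pathsD(1)[OF xs], of 1 "Suc n"] n C(5) Word(4,5) by auto
    have n0: "zs ! Suc n = xs ! 0" "xs ! 0 = u" using o n path_ends(1)[OF xs Word(5)] B by simp_all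
    \<comment> \<open>The balancing relation of the word \<open>cs @ as\<close> at the junction:
      \<open>n\<close> is the last index of \<open>cs\<close>, and \<open>Suc n\<close> the first
      letter of \<open>as\<close>.\<close>
    have "E (zs @ tl xs) (Word ((cs @ as)[n := ract (\<M> ((zs @ tl xs) ! n) ((zs @ tl xs) ! Suc n)) ((cs @ as) ! n) s]))
     = E (zs @ tl xs) (Word ((cs @ as)[Suc n := lact (\<M> ((zs @ tl xs) ! Suc n) ((zs @ tl xs) ! Suc (Suc n))) s ((cs @ as) ! Suc n)]))"
     by (rule slotwiseD(3)[OF slotwise_E[OF zx len] w]) (use n Word(4) nz n0 B in auto)
    moreover have "conc Sp (zs @ tl ys) xs (conc Sp zs ys c b) a
     = Word ((cs @ as)[n := ract (\<M> ((zs @ tl xs) ! n) ((zs @ tl xs) ! Suc n)) ((cs @ as) ! n) s])"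
     unfolding zy' C(2) B(4) Word(2) conc_word_scalar[OF C(5,4)] using n nz n0 by (simp add: list_update_append nth_append)
    moreover have "conc Sp zs (ys @ tl xs) c (conc Sp ys xs b a)
     = Word ((cs @ as)[Suc n := lact (\<M> ((zs @ tl xs) ! Suc n) ((zs @ tl xs) ! Suc (Suc n))) s ((cs @ as) ! Suc n)])"
     unfolding yx' C(2) B(4) Word(2) conc_scalar_word[OF Word(4)] using n nz by (simp add: list_update_append nth_append)
    ultimately show ?thesis by (simp only: path zy')
   qed
  next
   case (Word bs)
   note B = this
   from a xs show ?thesis
   proof (cases rule: generator_cases)
    case (Scalar q)
    obtain k where k: "length bs = Suc k" using B(4) by (cases bs) auto
    have l: "length (zs @ tl ys) = Suc (length (cs @ bs))" "cs @ bs \<noteq> []" using B(4,5) C(5) by auto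
    have z: "(zs @ tl ys) ! (length cs + i) = ys ! i" if "i < length ys" for i using zy1[OF that] C(5) by simp
    have "conc Sp (zs @ tl ys) xs (conc Sp zs ys c b) a = conc Sp zs (ys @ tl xs) c (conc Sp ys xs b a)"
     unfolding C(2) B(2) Scalar(4) conc.simps(4) conc_word_scalar[OF l] conc_word_scalar[OF B(5,4)]
     using k B(5) z[of k] z[of "Suc k"] by (simp add: list_update_append nth_append)
    then show ?thesis by (simp only: path)
   next
    case (Word as)
    then show ?thesis using B C path by simp
   qed
  qed
 qed
qed

lemma PComp_PIdent:
 assumes a: "a:car (\<T> t h)"
 shows "h:sp_obj Sp ==> PComp \<C> t h h (PIdent \<C> h) a = a"
  and "t:sp_obj Sp ==> PComp \<C> t t h a (PIdent \<C> t) = a"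
proof -
 assume h: "h:sp_obj Sp"
 interpret R: ring "\<R> h" by (rule sp_ring[OF h])
 have g: "[h]:P h h" "Scalar \<one>\<^bsub>\<R> h\<^esub>:gens Sp [h]" using h by (auto simp: paths_def generators_def)
 show "PComp \<C> t h h (PIdent \<C> h) a = a"
 proof (rule tensor_hom_eq[OF group_tensor_hom biadditiveD(1)[OF biadditive_PComp] _ _ a])
  show "PIdent \<C> h:car (\<T> h h)" using E_closed[OF g] by simp
  show "(\<lambda>a. a):hom (\<T> t h) (\<T> t h)" by (simp add: hom_def)
  fix xs v assume xs: "xs:P t h" and v: "v:gens Sp xs"
  have "conc Sp [h] xs (Scalar \<one>\<^bsub>\<R> h\<^esub>) v = v"
   using v xs
  proof (cases rule: generator_cases)
   case (Word as)
   then show ?thesis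
    using obj[OF xs Word(1,3), of 0] path_wordsD(2)[OF Word(3), of 0] path_ends(1)[OF xs Word(5)]
    unfolding Word(2) conc_scalar_word[OF Word(4)] by (simp add: mod_laws)
  qed (simp add: R.one_closed)
  then show "PComp \<C> t h h (PIdent \<C> h) (E xs v) = E xs v"
   using PComp_E[OF g xs v] hd_tl_paths[OF xs] by simp
 qed
next
 assume t: "t:sp_obj Sp"
 interpret R: ring "\<R> t" by (rule sp_ring[OF t])
 have g: "[t]:P t t" "Scalar \<one>\<^bsub>\<R> t\<^esub>:gens Sp [t]" using t by (auto simp: paths_def generators_def)
 show "PComp \<C> t t h a (PIdent \<C> t) = a"
 proof (rule tensor_hom_eq[OF group_tensor_hom biadditiveD(2)[OF biadditive_PComp] _ _ a])
  show "PIdent \<C> t:car (\<T> t t)" using E_closed[OF g] by simp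
  show "(\<lambda>a. a):hom (\<T> t h) (\<T> t h)" by (simp add: hom_def)
  fix xs v assume xs: "xs:P t h" and v: "v:gens Sp xs"
  have "conc Sp xs [t] v (Scalar \<one>\<^bsub>\<R> t\<^esub>) = v"
   using v xs
  proof (cases rule: generator_cases)
   case (Word as)
   obtain n where n: "length as = Suc n" using Word(4) by (cases as) auto
   then show ?thesis
    using obj[OF xs Word(1,3), of n] path_wordsD(2)[OF Word(3), of n] path_ends(2)[OF xs Word(5)]
    unfolding Word(2) conc_word_scalar[OF Word(5,4)] by (simp add: mod_laws)
  qed (use R.r_one in auto)
  then show "PComp \<C> t t h (E xs v) (PIdent \<C> t) = E xs v"
   using PComp_E[OF xs v g] by simp
 qed
qed

text \<open>Both sides are additive in each of the three morphisms. Starting from generators,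
  \<open>a\<close> is made arbitrary, then \<open>b\<close>, then \<open>c\<close>.\<close>

lemma PComp_assoc:
 assumes c: "c:car (\<T> v h)" and b: "b:car (\<T> u v)" and a: "a:car (\<T> t u)"
 shows "PComp \<C> t u h (PComp \<C> u v h c b) a = PComp \<C> t v h c (PComp \<C> t u v b a)"
proof -
 note h1 = biadditiveD(1)[OF biadditive_PComp] and h2 = biadditiveD(2)[OF biadditive_PComp]
  and cl = biadditiveD(3)[OF biadditive_PComp]
 note eq = tensor_hom_eq[OF group_tensor_hom]
 have hc: "(\<lambda>x. k (l x)):hom G K" if "l:hom G H" "k:hom H K" for G :: "('o list \<Rightarrow> ('r, 'a) path_elem) monoid"
  and H :: "('o list \<Rightarrow> ('r, 'a) path_elem) monoid" and K :: "('o list \<Rightarrow> ('r, 'a) path_elem) monoid" and k l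
  using hom_compose[OF that] by (simp add: o_def)
 have 1: "PComp \<C> t u h (PComp \<C> u v h (E zs p) (E ys q)) (E xs r) = PComp \<C> t v h (E zs p) (PComp \<C> t u v (E ys q) (E xs r))"
  if "zs:P v h" "p:gens Sp zs" "ys:P u v" "q:gens Sp ys" "xs:P t u" "r:gens Sp xs" for zs p ys q xs r
  using conc_assoc[OF that] that by (simp only: PComp_E conc_closed paths_append)
 have 2: "PComp \<C> t u h (PComp \<C> u v h (E zs p) (E ys q)) a = PComp \<C> t v h (E zs p) (PComp \<C> t u v (E ys q) a)"
  if "zs:P v h" "p:gens Sp zs" "ys:P u v" "q:gens Sp ys" for zs p ys q
  using that by (intro eq[OF h1 hc[OF h1 h1] 1 a] cl E_closed)
 have 3: "PComp \<C> t u h (PComp \<C> u v h (E zs p) b) a = PComp \<C> t v h (E zs p) (PComp \<C> t u v b a)"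
  if "zs:P v h" "p:gens Sp zs" for zs p
  using that a by (intro eq[OF hc[OF h1 h2] hc[OF h2 h1] 2 b] E_closed)
 show ?thesis
  using a b by (intro eq[OF hc[OF h2 h2] h2 3 c] cl)
qed

theorem preadditive_tensor_category: "preadditive_category \<C>"
proof (rule preadditive_category.intro)
 show "PIdent \<C> x:car (PHom \<C> x x)" if "x:PObj \<C>" for x
 proof -
  interpret R: ring "\<R> x" using that sp_ring by simp
  show ?thesis using that E_closed[of "[x]" x x "Scalar \<one>\<^bsub>\<R> x\<^esub>"] by (simp add: paths_def generators_def)
 qed
qed (simp_all only: tensor_category_sel comm_group_tensor_hom biadditive_PComp PComp_assoc PComp_PIdent[unfolded tensor_category_sel])

end

section \<open>Ideals and quotients of preadditive categories\<close>

text \<open>The counterpart of \<open>hom_spans_into\<close> for an element of a generated subgroup,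
  such as an ideal, instead of an element of a group with a spanning set.\<close>

lemma hom_generate_into:
 assumes "group G" "group K" "h:hom G K" "X \<subseteq> car G" "subgroup H K" "h ` X \<subseteq> H" "a:generate G X"
 shows "h a:H"
proof -
 interpret h: group_hom G K h using assms by (simp add: group_hom_def group_hom_axioms_def)
 have "h a:generate K (h ` X)" using h.generate_img[OF assms(4)] assms(7) by auto
 then show ?thesis using h.H.generate_subgroup_incl[OF assms(6,5)] by auto
qed

locale preadditive_ideal = preadditive_category C
 for C :: "('o, 'm) preadd" +
 fixes I :: "'o \<Rightarrow> 'o \<Rightarrow> 'm set"
 assumes subgroup: "t:PObj C ==> h:PObj C ==> subgroup (I t h) (PHom C t h)"
  and left: "t:PObj C ==> u:PObj C ==> h:PObj C ==> b:car (PHom C u h) ==> a:I t u ==>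
   PComp C t u h b a:I t h"
  and right: "t:PObj C ==> u:PObj C ==> h:PObj C ==> b:I u h ==> a:car (PHom C t u) ==>
   PComp C t u h b a:I t h"
begin

abbreviation "\<Q> \<equiv> quotient_preadd C I"
abbreviation "coset t h a \<equiv> I t h #>\<^bsub>PHom C t h\<^esub> a"

lemma quotient_sel [simp]:
 "PObj \<Q> = PObj C" "PHom \<Q> t h = PHom C t h Mod I t h" "PIdent \<Q> x = coset x x (PIdent C x)"
 by (simp_all add: quotient_preadd_def)

lemma normal: "t:PObj C ==> h:PObj C ==> I t h \<lhd> PHom C t h"
 using comm_group.subgroup_imp_normal[OF comm_group subgroup] .

lemma group_PHom: "t:PObj C ==> h:PObj C ==> group (PHom C t h)"
 using comm_group by (simp add: comm_group_def)

lemma PComp_closed: "t:PObj C ==> u:PObj C ==> h:PObj C ==> b:car (PHom C u h) ==>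
  a:car (PHom C t u) ==> PComp C t u h b a:car (PHom C t h)"
 using biadditiveD(3)[OF biadditive] .

lemma carrier_quotient: "car (PHom C t h Mod I t h) = coset t h ` car (PHom C t h)"
 by (rule carrier_FactGroup)

lemma coset_mult: "t:PObj C ==> h:PObj C ==> a:car (PHom C t h) ==> b:car (PHom C t h) ==>
  coset t h a \<otimes>\<^bsub>PHom C t h Mod I t h\<^esub> coset t h b = coset t h (a \<otimes>\<^bsub>PHom C t h\<^esub> b)"
 using normal.rcos_sum[OF normal] by simp

lemma coset_eq:
 assumes "t:PObj C" "h:PObj C" "i:I t h" "a:car (PHom C t h)"
 shows "coset t h (i \<otimes>\<^bsub>PHom C t h\<^esub> a) = coset t h a"
proof -
 interpret group "PHom C t h" by (rule group_PHom[OF assms(1,2)])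
 interpret subgroup "I t h" "PHom C t h" by (rule subgroup[OF assms(1,2)])
 have "i \<otimes>\<^bsub>PHom C t h\<^esub> a:coset t h a" using assms(3) by (auto simp: r_coset_def)
 then show ?thesis using repr_independence[OF _ assms(4) subgroup_axioms] by simp
qed

text \<open>A composite in the quotient is defined as the union of the cosets of all composites of
  representatives. A change of representatives adds elements of the ideal, so these cosets coincide
  and their union is a single coset.\<close>

lemma PComp_quotient:
 assumes o: "t:PObj C" "u:PObj C" "h:PObj C" and b: "b:car (PHom C u h)" and a: "a:car (PHom C t u)"
 shows "PComp \<Q> t u h (coset u h b) (coset t u a) = coset t h (PComp C t u h b a)"
proof -
 interpret U: group "PHom C u h" by (rule group_PHom[OF o(2,3)])
 interpret T: group "PHom C t u" by (rule group_PHom[OF o(1,2)])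
 interpret H: comm_group "PHom C t h" by (rule comm_group[OF o(1,3)])
 interpret IU: subgroup "I u h" "PHom C u h" by (rule subgroup[OF o(2,3)])
 interpret IT: subgroup "I t u" "PHom C t u" by (rule subgroup[OF o(1,2)])
 interpret IH: subgroup "I t h" "PHom C t h" by (rule subgroup[OF o(1,3)])
 note bi = biadditiveD[OF biadditive[OF o]]
 have "coset t h (PComp C t u h b' a') = coset t h (PComp C t u h b a)" if b': "b':coset u h b" and a': "a':coset t u a" for b' a'
 proof -
  obtain i where i: "i:I u h" "b' = i \<otimes>\<^bsub>PHom C u h\<^esub> b" using b' by (auto simp: r_coset_def)
  obtain k where k: "k:I t u" "a' = k \<otimes>\<^bsub>PHom C t u\<^esub> a" using a' by (auto simp: r_coset_def)
  have c: "i:car (PHom C u h)" "k:car (PHom C t u)" "a':car (PHom C t u)" using i k a by auto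
  have "PComp C t u h b' a' = PComp C t u h i a' \<otimes>\<^bsub>PHom C t h\<^esub> (PComp C t u h b k \<otimes>\<^bsub>PHom C t h\<^esub> PComp C t u h b a)"
   using c a b by (simp add: i(2) bi(4)) (simp add: k(2) bi(5))
  also have "coset t h \<dots> = coset t h (PComp C t u h b a)"
   using right[OF o i(1) c(3)] left[OF o b k(1)] a b c by (simp add: coset_eq[OF o(1,3)] bi(3))
  finally show ?thesis .
 qed
 moreover have "b:coset u h b" "a:coset t u a"
  using U.rcos_self[OF b IU.subgroup_axioms] T.rcos_self[OF a IT.subgroup_axioms] .
 ultimately show ?thesis unfolding quotient_preadd_def preadd.simps by blast
qed

theorem preadditive_quotient: "preadditive_category \<Q>"
proof (rule preadditive_category.intro)
 fix t h assume "t:PObj \<Q>" "h:PObj \<Q>"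
 then show "comm_group (PHom \<Q> t h)"
  using comm_group.abelian_FactGroup[OF comm_group subgroup] by simp
next
 fix t u h assume "t:PObj \<Q>" "u:PObj \<Q>" "h:PObj \<Q>"
 then have o: "t:PObj C" "u:PObj C" "h:PObj C" by simp_all
 note bi = biadditiveD[OF biadditive[OF o]]
 have m: "a \<otimes>\<^bsub>PHom C x y\<^esub> b:car (PHom C x y)"
  if "x:PObj C" "y:PObj C" "a:car (PHom C x y)" "b:car (PHom C x y)" for x y a b
  using group.is_monoid[OF group_PHom[OF that(1,2)]] that(3,4) by (rule monoid.m_closed)
 have ex: "\<exists>a'\<in>car (PHom C x y). a = coset x y a'" if "a:car (PHom \<Q> x y)" for x y a
  using that unfolding quotient_sel carrier_quotient by auto
 show "biadditive (PHom \<Q> u h) (PHom \<Q> t u) (PHom \<Q> t h) (PComp \<Q> t u h)"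
 proof (rule biadditiveI)
  fix b b' a assume "b:car (PHom \<Q> u h)" "b':car (PHom \<Q> u h)" "a:car (PHom \<Q> t u)"
  then obtain x x' y where *: "x:car (PHom C u h)" "b = coset u h x" "x':car (PHom C u h)" "b' = coset u h x'"
   "y:car (PHom C t u)" "a = coset t u y" using ex[of b] ex[of b'] ex[of a] by metis
  show "PComp \<Q> t u h (b \<otimes>\<^bsub>PHom \<Q> u h\<^esub> b') a = PComp \<Q> t u h b a \<otimes>\<^bsub>PHom \<Q> t h\<^esub> PComp \<Q> t u h b' a"
   unfolding *(2,4,6) quotient_sel using o *(1,3,5) by (simp only: PComp_quotient coset_mult m bi)
 next
  fix b a a' assume "b:car (PHom \<Q> u h)" "a:car (PHom \<Q> t u)" "a':car (PHom \<Q> t u)"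
  then obtain x y y' where *: "x:car (PHom C u h)" "b = coset u h x" "y:car (PHom C t u)" "a = coset t u y"
   "y':car (PHom C t u)" "a' = coset t u y'" using ex[of b] ex[of a] ex[of a'] by metis
  show "PComp \<Q> t u h b (a \<otimes>\<^bsub>PHom \<Q> t u\<^esub> a') = PComp \<Q> t u h b a \<otimes>\<^bsub>PHom \<Q> t h\<^esub> PComp \<Q> t u h b a'"
   unfolding *(2,4,6) quotient_sel using o *(1,3,5) by (simp only: PComp_quotient coset_mult m bi)
 next
  fix b a assume "b:car (PHom \<Q> u h)" "a:car (PHom \<Q> t u)"
  then obtain x y where *: "x:car (PHom C u h)" "b = coset u h x" "y:car (PHom C t u)" "a = coset t u y"
   using ex[of b] ex[of a] by metis
  show "PComp \<Q> t u h b a:car (PHom \<Q> t h)"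
   unfolding *(2,4) quotient_sel carrier_quotient using o *(1,3) by (simp only: PComp_quotient) (rule imageI, rule bi(3))
 qed
next
 fix t u v h c b a assume o: "t:PObj \<Q>" "u:PObj \<Q>" "v:PObj \<Q>" "h:PObj \<Q>"
  and "c:car (PHom \<Q> v h)" "b:car (PHom \<Q> u v)" "a:car (PHom \<Q> t u)"
 then obtain c' b' a' where "c = coset v h c'" "c':car (PHom C v h)" "b = coset u v b'" "b':car (PHom C u v)"
  "a = coset t u a'" "a':car (PHom C t u)" unfolding quotient_sel carrier_quotient by blast
 with o show "PComp \<Q> t u h (PComp \<Q> u v h c b) a = PComp \<Q> t v h c (PComp \<Q> t u v b a)"
  by (simp add: PComp_quotient PComp_closed PComp_assoc)
next
 show "x:PObj \<Q> ==> PIdent \<Q> x:car (PHom \<Q> x x)" for x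
  using PIdent_closed by (auto simp: carrier_quotient)
next
 fix t h a assume o: "t:PObj \<Q>" "h:PObj \<Q>" and "a:car (PHom \<Q> t h)"
 then obtain a' where "a = coset t h a'" "a':car (PHom C t h)" unfolding quotient_sel carrier_quotient by blast
 with o show "PComp \<Q> t h h (PIdent \<Q> h) a = a" "PComp \<Q> t t h a (PIdent \<Q> t) = a"
  by (simp_all add: PComp_quotient PIdent_closed PComp_PIdent_left PComp_PIdent_right)
qed

end

section \<open>The ideal of a composition family\<close>

lemma nth_contract_path:
 assumes "Suc (Suc j) < length xs"
 shows "i \<le> j ==> cpath j xs ! i = xs ! i"
  and "j < i ==> Suc i < length xs ==> cpath j xs ! i = xs ! Suc i"
  and "length (cpath j xs) = length xs - 1"
 using assms by (auto simp: contract_path_def nth_append)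

lemma contract_path_in:
 assumes "xs:paths X t h" "Suc (Suc j) < length xs"
 shows "cpath j xs:paths X t h"
proof -
 have "set (cpath j xs) \<subseteq> set xs"
  by (auto simp: contract_path_def dest: in_set_takeD in_set_dropD)
 then show ?thesis using assms by (cases xs) (auto simp: paths_def contract_path_def)
qed

text \<open>Formulated for a plain binary operation \<open>m\<close>, so that the index
  combinatorics is independent of the species and of the composition maps.\<close>

definition contract_word :: "('a \<Rightarrow> 'a \<Rightarrow> 'a) \<Rightarrow> nat \<Rightarrow> 'a list \<Rightarrow> 'a list" where
 "contract_word m j as = take j as @ [m (as ! j) (as ! Suc j)] @ drop (j + 2) as"

lemma nth_contract_word:
 assumes "Suc j < length as"
 shows "i < j ==> contract_word m j as ! i = as ! i"
  and "contract_word m j as ! j = m (as ! j) (as ! Suc j)"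
  and "j < i ==> Suc i < length as ==> contract_word m j as ! i = as ! Suc i"
  and "length (contract_word m j as) = length as - 1"
 using assms by (auto simp: contract_word_def nth_append nth_Cons')

lemma contract_word_update:
 assumes j: "Suc j < length as"
 shows "i < j ==> contract_word m j (as[i := c]) = (contract_word m j as)[i := c]"
  and "contract_word m j (as[j := c]) = (contract_word m j as)[j := m c (as ! Suc j)]"
  and "contract_word m j (as[Suc j := c]) = (contract_word m j as)[j := m (as ! j) c]"
  and "j < i ==> contract_word m j (as[Suc i := c]) = (contract_word m j as)[i := c]"
proof -
 have n: "contract_word m j bs ! k = (if k < j then bs ! k else if k = j then m (bs ! j) (bs ! Suc j) else bs ! Suc k)"
  if "length bs = length as" "k < length as - 1" for bs k
  using nth_contract_word[where j = j and as = bs and m = m] j that by auto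
 have l: "length (contract_word m j bs) = length as - 1" if "length bs = length as" for bs
  using nth_contract_word(4)[where j = j and as = bs and m = m] j that by simp
 have u: "(bs[k := c]) ! i = (if k = i then c else bs ! i)" if "i < length bs" for bs :: "'a list" and k i
  using that by simp
 show "i < j ==> contract_word m j (as[i := c]) = (contract_word m j as)[i := c]"
  "contract_word m j (as[j := c]) = (contract_word m j as)[j := m c (as ! Suc j)]"
  "contract_word m j (as[Suc j := c]) = (contract_word m j as)[j := m (as ! j) c]"
  "j < i ==> contract_word m j (as[Suc i := c]) = (contract_word m j as)[i := c]"
  using j by (auto intro!: nth_equalityI simp: l n u)
qed

text \<open>Linearity is demanded over the two outer rings and on pure tensors only. Balancedness
  over the middle ring is automatic, since \<open>c\<close> starts from the tensor product over that
  ring.\<close>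

locale species_composition = species Sp
 for Sp :: "('o, 'r, 'a) species" +
 fixes c :: "('o, 'a) composition_family"
 assumes c_hom: "z:sp_obj Sp ==> y:sp_obj Sp ==> x:sp_obj Sp ==>
   c z y x:hom (tensor_group (sp_mod Sp z y) (sp_mod Sp y x)) (bgrp (sp_mod Sp z x))"
  and c_lact: "z:sp_obj Sp ==> y:sp_obj Sp ==> x:sp_obj Sp ==> q:car (sp_ring Sp z) ==>
   b:bcar (sp_mod Sp z y) ==> a:bcar (sp_mod Sp y x) ==>
   c z y x (tensor_elem (sp_mod Sp z y) (sp_mod Sp y x) (lact (sp_mod Sp z y) q b) a)
    = lact (sp_mod Sp z x) q (c z y x (tensor_elem (sp_mod Sp z y) (sp_mod Sp y x) b a))"
  and c_ract: "z:sp_obj Sp ==> y:sp_obj Sp ==> x:sp_obj Sp ==> r:car (sp_ring Sp x) ==>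
   b:bcar (sp_mod Sp z y) ==> a:bcar (sp_mod Sp y x) ==>
   c z y x (tensor_elem (sp_mod Sp z y) (sp_mod Sp y x) b (ract (sp_mod Sp y x) a r))
    = ract (sp_mod Sp z x) (c z y x (tensor_elem (sp_mod Sp z y) (sp_mod Sp y x) b a)) r"
begin

abbreviation "\<mu> z y x b a \<equiv> c z y x (tensor_elem (\<M> z y) (\<M> y x) b a)"

lemma balanced_\<mu>:
 assumes "z:sp_obj Sp" "y:sp_obj Sp" "x:sp_obj Sp"
 shows "balanced (\<M> z y) (\<M> y x) (bgrp (\<M> z x)) (\<mu> z y x)"
proof -
 interpret bimodule_pair "\<M> z y" "\<M> y x"
  by (intro bimodule_pair.intro bimodule_pair_axioms.intro sp_mod) (use assms in \<open>simp_all add: lring_sp_mod rring_sp_mod\<close>)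
 show ?thesis by (rule balanced_hom[OF balanced_tensor_elem c_hom[OF assms]])
qed

context
 fixes xs t h j
 assumes xs: "xs:P t h" and j: "Suc (Suc j) < length xs"
begin

abbreviation (input) ctr where "ctr \<equiv> contract_word (\<mu> (xs ! j) (xs ! Suc j) (xs ! Suc (Suc j))) j"

lemma contract_objs: "xs ! j:sp_obj Sp" "xs ! Suc j:sp_obj Sp" "xs ! Suc (Suc j):sp_obj Sp"
 using pathsD(5)[OF xs] j by simp_all

lemmas bal = balancedD[OF balanced_\<mu>[OF contract_objs]]

lemma contract_word_in:
 assumes as: "as:words Sp xs"
 shows "ctr as:words Sp (cpath j xs)"
proof -
 have l: "Suc j < length as" "length xs = Suc (length as)" using path_wordsD(1)[OF as] j by simp_all
 have "ctr as ! i:bcar (\<M> (cpath j xs ! i) (cpath j xs ! Suc i))" if "i < length as - 1" for i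
 proof -
  consider "i < j" | "i = j" | "j < i" by linarith
  then show ?thesis
  proof cases
   case 1
   then show ?thesis using path_wordsD(2)[OF as, of i] l that j by (simp add: nth_contract_word nth_contract_path)
  next
   case 2
   then show ?thesis using bal(1) path_wordsD(2)[OF as, of j] path_wordsD(2)[OF as, of "Suc j"] l j
    by (simp add: nth_contract_word nth_contract_path)
  next
   case 3
   then show ?thesis using path_wordsD(2)[OF as, of "Suc i"] l that j by (simp add: nth_contract_word nth_contract_path)
  qed
 qed
 then show ?thesis using l j by (simp add: path_words_def nth_contract_word nth_contract_path)
qed

text \<open>Away from the contracted pair the conditions are inherited, with the index lowered by
  one to its right. Additivity in either letter of the pair is biadditivity of \<mu>. Balancing at
  an end of the pair is linearity of \<open>c\<close> over an outer ring, and balancing at the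
  removed vertex is the tensor relation.\<close>

lemma slotwise_contract:
 assumes f: "slotwise Sp (cpath j xs) K f"
 shows "slotwise Sp xs K (\<lambda>as. f (ctr as))"
proof (rule slotwiseI)
 fix as assume as: "as:words Sp xs"
 note C = contract_word_in[OF as]
 have l: "Suc j < length as" "length xs = Suc (length as)" using path_wordsD(1)[OF as] j by simp_all
 have cj: "j < length (ctr as)" using l by (simp add: nth_contract_word)
 have aj: "as ! j:bcar (\<M> (xs ! j) (xs ! Suc j))" "as ! Suc j:bcar (\<M> (xs ! Suc j) (xs ! Suc (Suc j)))"
  using path_wordsD(2)[OF as, of j] path_wordsD(2)[OF as, of "Suc j"] l by simp_all
 have pj: "cpath j xs ! j = xs ! j" "cpath j xs ! Suc j = xs ! Suc (Suc j)"
  using j by (simp_all add: nth_contract_path)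
 note add = slotwiseD(2)[OF f C] and blc = slotwiseD(3)[OF f C]
 note upd = contract_word_update[OF l(1)] and nth = nth_contract_word[OF l(1)]
 show "f (ctr as):car K" by (rule slotwiseD(1)[OF f C])
 fix i
 show "f (ctr (as[i := a \<otimes>\<^bsub>bgrp (\<M> (xs ! i) (xs ! Suc i))\<^esub> b])) = f (ctr (as[i := a])) \<otimes>\<^bsub>K\<^esub> f (ctr (as[i := b]))"
  if i: "i < length as" and ab: "a:bcar (\<M> (xs ! i) (xs ! Suc i))" "b:bcar (\<M> (xs ! i) (xs ! Suc i))" for a b
 proof -
  have "i < j \<or> i = j \<or> i = Suc j \<or> i = Suc (i - 1) \<and> j < i - 1" by arith
  then consider "i < j" | "i = j" | "i = Suc j" | k where "i = Suc k" "j < k" by blast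
  then show ?thesis
  proof cases
   case 1
   then show ?thesis using add[of i a b] ab l j by (simp add: upd nth_contract_path nth(4))
  next
   case 2
   then show ?thesis using add[OF cj] ab aj by (simp add: upd pj bal)
  next
   case 3
   then show ?thesis using add[OF cj] ab aj by (simp add: upd pj bal)
  next
   case 4
   then show ?thesis using add[of k a b] ab l i j by (simp add: upd nth_contract_path nth(4))
  qed
 qed
 show "f (ctr (as[i := ract (\<M> (xs ! i) (xs ! Suc i)) (as ! i) r]))
   = f (ctr (as[Suc i := lact (\<M> (xs ! Suc i) (xs ! Suc (Suc i))) r (as ! Suc i)]))"
  if i: "Suc i < length as" and r: "r:car (\<R> (xs ! Suc i))" for r
 proof -
  \<comment> \<open>Balancing takes place at vertex \<open>Suc i\<close>, and the contracted pair
    spans the vertices \<open>j\<close> to \<open>j + 2\<close>. The cases place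
    \<open>Suc i\<close> before the pair, at its left end, at the removed vertex, at its right end,
    or beyond it.\<close>
  have "Suc i < j \<or> Suc i = j \<or> i = j \<or> i = Suc j \<or> i = Suc (i - 1) \<and> j < i - 1" by arith
  then consider "Suc i < j" | "Suc i = j" | "i = j" | "i = Suc j" | k where "i = Suc k" "j < k" by blast
  then show ?thesis
  proof cases
   case 1
   then show ?thesis using blc[of i r] r l j by (simp add: upd nth_contract_path nth)
  next
   case 2
   have "f ((ctr as)[i := ract (\<M> (xs ! i) (xs ! Suc i)) (as ! i) r])
     = f ((ctr as)[j := lact (\<M> (xs ! j) (xs ! Suc (Suc j))) r (\<mu> (xs ! j) (xs ! Suc j) (xs ! Suc (Suc j)) (as ! j) (as ! Suc j))])"
    using blc[of i r] r l j 2 pj cj by (simp add: nth_contract_path nth)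
   then show ?thesis
    using 2 r c_lact[OF contract_objs _ aj] by (simp add: upd)
  next
   case 3
   then show ?thesis using r aj bal(4) rring_sp_mod[OF contract_objs(1,2)] by (simp add: upd)
  next
   case 4
   have "f ((ctr as)[j := ract (\<M> (xs ! j) (xs ! Suc (Suc j))) (\<mu> (xs ! j) (xs ! Suc j) (xs ! Suc (Suc j)) (as ! j) (as ! Suc j)) r])
     = f ((ctr as)[Suc j := lact (\<M> (xs ! Suc (Suc j)) (xs ! Suc (Suc (Suc j)))) r (as ! Suc (Suc j))])"
    using blc[of j r] r l i j 4 pj by (simp add: nth_contract_path nth)
   then show ?thesis using 4 r c_ract[OF contract_objs _ aj] by (simp add: upd)
  next
   case 5
   then show ?thesis using blc[of k r] r l i j by (simp add: upd nth_contract_path nth)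
  qed
 qed
qed

lemma contraction_hom: "contraction Sp c xs j:hom (path_group Sp xs) (path_group Sp (cpath j xs))"
 and contraction_pure: "as:words Sp xs ==>
  contraction Sp c xs j (pure Sp xs (Word as)) = pure Sp (cpath j xs) (Word (ctr as))"
proof -
 have len: "length xs \<noteq> 1" "length (cpath j xs) \<noteq> 1" using j nth_contract_path(3)[OF j] by simp_all
 note cp = contract_path_in[OF xs j]
 obtain k where k: "k:hom (path_group Sp xs) (path_group Sp (cpath j xs))"
  "\<And>as. as:words Sp xs ==> k (pure Sp xs (Word as)) = pure Sp (cpath j xs) (Word (ctr as))"
  using words_lift[OF xs len(1) comm_group_path_group[OF cp] slotwise_contract[OF slotwise_pure[OF cp len(2)]]] by blast
 have pc: "pure Sp xs (Word as):car (path_group Sp xs)" if "as:words Sp xs" for as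
  using pure_closed[OF xs, of "Word as"] that len(1) by (simp del: pure.simps add: generators_def)
 have sp: "spans (path_group Sp xs) ((\<lambda>as. pure Sp xs (Word as)) ` words Sp xs)"
  using spans_path_group[OF xs] len(1) by (simp add: generators_def image_image)
 have Q: "contraction Sp c xs j = restrict k (car (path_group Sp xs))"
  unfolding contraction_def
 proof (rule the_hom_eq[OF group_path_group[OF xs] group_path_group[OF cp] k(1) sp])
  show "\<forall>as\<in>words Sp xs. restrict k (car (path_group Sp xs)) (pure Sp xs (Word as)) = pure Sp (cpath j xs)
   (Word (take j as @ [\<mu> (xs ! j) (xs ! Suc j) (xs ! Suc (Suc j)) (as ! j) (as ! Suc j)] @ drop (j + 2) as))"
   using k(2) pc by (simp del: pure.simps add: contract_word_def)
 qed (auto simp del: pure.simps simp: k(2) contract_word_def)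
 show "contraction Sp c xs j:hom (path_group Sp xs) (path_group Sp (cpath j xs))"
  unfolding Q using k(1) by (simp add: hom_restrict_iff group_path_group[OF xs])
 show "as:words Sp xs ==>
  contraction Sp c xs j (pure Sp xs (Word as)) = pure Sp (cpath j xs) (Word (ctr as))"
  unfolding Q using k(2) pc by (simp del: pure.simps)
qed

end

end

section \<open>Stability of the composition ideal under concatenation\<close>

lemma contract_path_append:
 assumes "last ys = hd xs" "ys \<noteq> []" "Suc (Suc j) < length xs"
 shows "length ys = Suc n ==> cpath (n + j) (ys @ tl xs) = ys @ tl (cpath j xs)"
 using assms by (cases xs) (auto simp: contract_path_def)

lemma contract_path_append_left:
 "Suc (Suc j) < length ys ==> cpath j (ys @ tl xs) = cpath j ys @ tl xs"
 by (auto simp: contract_path_def)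

lemma contract_word_append:
 "Suc j < length as ==> contract_word m (length bs + j) (bs @ as) = bs @ contract_word m j as"
 "Suc j < length bs ==> contract_word m j (bs @ as) = contract_word m j bs @ as"
 by (auto simp: contract_word_def nth_append)

context species_composition
begin

abbreviation "I S t h \<equiv> composition_ideal Sp c S t h"
abbreviation "\<delta> t h xs j as \<equiv> E xs (Word as) \<otimes>\<^bsub>\<T> t h\<^esub> inv\<^bsub>\<T> t h\<^esub> E (cpath j xs) (Word (ctr xs j as))"

definition contractible where
 "contractible S t h xs j as \<longleftrightarrow> xs:P t h \<and> Suc (Suc j) < length xs \<and>
  (xs ! j, xs ! Suc j, xs ! Suc (Suc j)):S \<and> as:words Sp xs"

lemma contractibleD:
 assumes "contractible S t h xs j as"
 shows "xs:P t h" "Suc (Suc j) < length xs" "(xs ! j, xs ! Suc j, xs ! Suc (Suc j)):S" "as:words Sp xs"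
  "length xs \<noteq> 1" "length (cpath j xs) \<noteq> 1" "cpath j xs:P t h"
  "Word as:gens Sp xs" "Word (ctr xs j as):gens Sp (cpath j xs)"
  "length xs = Suc (length as)" "Suc j < length as"
proof -
 show *: "xs:P t h" "Suc (Suc j) < length xs" "(xs ! j, xs ! Suc j, xs ! Suc (Suc j)):S" "as:words Sp xs"
  using assms by (auto simp: contractible_def)
 show l: "length xs \<noteq> 1" "length (cpath j xs) \<noteq> 1" using *(2) nth_contract_path(3)[OF *(2)] by simp_all
 show cp: "cpath j xs:P t h" by (rule contract_path_in[OF *(1,2)])
 show "Word as:gens Sp xs" by (rule generator_Word[OF *(1) l(1) *(4)])
 show "Word (ctr xs j as):gens Sp (cpath j xs)" by (rule generator_Word[OF cp l(2) contract_word_in[OF *(1,2,4)]])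
 show "length xs = Suc (length as)" "Suc j < length as" using path_wordsD(1)[OF *(4)] *(2) by simp_all
qed

abbreviation "ideal_relations S t h \<equiv> {in_path Sp xs a \<otimes>\<^bsub>\<T> t h\<^esub> inv\<^bsub>\<T> t h\<^esub> in_path Sp (cpath j xs) (contraction Sp c xs j a) | xs j a.
   xs:P t h \<and> j + 2 < length xs \<and> (xs ! j, xs ! Suc j, xs ! Suc (Suc j)):S \<and> a:car (path_group Sp xs)}"

text \<open>The ideal is generated by relations for arbitrary elements of a path group; additivity
  in that element permits a reduction to single words.\<close>

lemma relation_hom:
 assumes xs: "xs:P t h" and j: "Suc (Suc j) < length xs"
 shows "(\<lambda>a. in_path Sp xs a \<otimes>\<^bsub>\<T> t h\<^esub> inv\<^bsub>\<T> t h\<^esub> in_path Sp (cpath j xs) (contraction Sp c xs j a))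
 :hom (path_group Sp xs) (\<T> t h)"
proof -
 interpret T: comm_group "\<T> t h" by (rule comm_group_tensor_hom)
 have "(\<lambda>x. inv\<^bsub>\<T> t h\<^esub> x):hom (\<T> t h) (\<T> t h)" by (rule homI) (simp_all add: T.inv_mult)
 from hom_pointwise_mult[OF T.comm_group_axioms in_path_hom[OF xs]
   hom_comp[OF hom_comp[OF contraction_hom[OF xs j] in_path_hom[OF contract_path_in[OF xs j]]] this]]
 show ?thesis .
qed

lemma ideal_relations_closed: "ideal_relations S t h \<subseteq> car (\<T> t h)"
 using hom_in_carrier[OF relation_hom] by auto

lemma subgroup_ideal: "subgroup (I S t h) (\<T> t h)"
 unfolding composition_ideal_def
 by (rule group.generate_is_subgroup[OF group_tensor_hom ideal_relations_closed])

lemma \<delta>_in_ideal: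
 assumes "contractible S t h xs j as"
 shows "\<delta> t h xs j as:I S t h"
 unfolding composition_ideal_def
proof (rule generate.incl)
 note C = contractibleD[OF assms]
 have "\<delta> t h xs j as = in_path Sp xs (pure Sp xs (Word as)) \<otimes>\<^bsub>\<T> t h\<^esub>
   inv\<^bsub>\<T> t h\<^esub> in_path Sp (cpath j xs) (contraction Sp c xs j (pure Sp xs (Word as)))"
  by (simp only: contraction_pure[OF C(1,2,4)])
 then show "\<delta> t h xs j as:ideal_relations S t h"
  using C(1,2,3) pure_closed[OF C(1,8)] by (auto simp del: pure.simps)
qed

text \<open>The relations of single words generate all others by additivity, so a homomorphism sends
  the ideal into a subgroup once it does so for them. Both stability under composition and the
  effect of a map of species are derived from this.\<close>

lemma hom_ideal_into:
 assumes K: "group K" and \<phi>: "\<phi>:hom (\<T> t h) K" and H: "subgroup H K"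
  and \<delta>: "\<And>xs j as. contractible S t h xs j as ==> \<phi> (\<delta> t h xs j as):H" and a: "a:I S t h"
 shows "\<phi> a:H"
proof (rule hom_generate_into[OF group_tensor_hom K \<phi> ideal_relations_closed H _ a[unfolded composition_ideal_def]], safe)
 fix xs j a
 assume *: "xs:P t h" "j + 2 < length xs" "(xs ! j, xs ! Suc j, xs ! Suc (Suc j)):S" "a:car (path_group Sp xs)"
 then have j: "Suc (Suc j) < length xs" and len: "length xs \<noteq> 1" by simp_all
 have sp: "spans (path_group Sp xs) ((\<lambda>as. pure Sp xs (Word as)) ` words Sp xs)"
  using spans_path_group[OF *(1)] len by (simp add: generators_def image_image)
 show "\<phi> (in_path Sp xs a \<otimes>\<^bsub>\<T> t h\<^esub> inv\<^bsub>\<T> t h\<^esub> in_path Sp (cpath j xs) (contraction Sp c xs j a)):H"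
 proof (rule hom_spans_into[OF group_path_group[OF *(1)] K hom_comp[OF relation_hom[OF *(1) j] \<phi>] sp H _ *(4)], rule image_subsetI, elim imageE, hypsubst)
  fix as assume as: "as:words Sp xs"
  then have "contractible S t h xs j as" using * j by (simp add: contractible_def)
  from \<delta>[OF this] show "\<phi> (in_path Sp xs (pure Sp xs (Word as)) \<otimes>\<^bsub>\<T> t h\<^esub>
    inv\<^bsub>\<T> t h\<^esub> in_path Sp (cpath j xs) (contraction Sp c xs j (pure Sp xs (Word as)))):H"
   by (simp only: contraction_pure[OF *(1) j as])
 qed
qed

text \<open>A generator composed with the relation of a word gives the relation of the composed
  word: a preceding word shifts the contracted position by its length, and a scalar is absorbed into
  the first letter. The delicate case is a scalar acting on a letter that is being
  contracted.\<close>

lemma conc_contract_right: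
 assumes ys: "ys:P u h" and v: "v:gens Sp ys" and C: "contractible S t u xs j as"
 obtains j' as' where "contractible S t h (ys @ tl xs) j' as'" "conc Sp ys xs v (Word as) = Word as'"
  "cpath j' (ys @ tl xs) = ys @ tl (cpath j xs)"
  "conc Sp ys (cpath j xs) v (Word (ctr xs j as)) = Word (ctr (ys @ tl xs) j' as')"
 using v ys
proof (cases rule: generator_cases)
 case (Scalar r)
 note D = contractibleD[OF C]
 have p: "ys @ tl zs = zs" if "zs:P t u" for zs using Scalar hd_tl_paths[OF that] by simp
 have ne: "as \<noteq> []" "ctr xs j as \<noteq> []" using D(11) by (auto simp: contract_word_def)
 have x0: "xs ! 0 = h" using path_ends(1)[OF D(1,10)] Scalar by simp
 have "0 < length xs" "Suc 0 < length xs" using D(2) by linarith+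
 then have o: "xs ! 0:sp_obj Sp" "xs ! Suc 0:sp_obj Sp" using pathsD(5)[OF D(1)] by blast+
 have a0: "as ! 0:bcar (\<M> (xs ! 0) (xs ! 1))" using path_wordsD(2)[OF D(4), of 0] ne(1) by simp
 let ?as = "as[0 := lact (\<M> (xs ! 0) (xs ! 1)) r (as ! 0)]"
 have w: "?as:words Sp xs"
  using Scalar a0 o x0 by (intro path_words_update[OF D(4)]) (simp add: mod_closed)
 \<comment> \<open>For \<open>j = 0\<close> the first letter belongs to the contracted pair, and
   left linearity of \<open>c\<close> takes the scalar out of the product; otherwise the update and
   the contraction concern different letters.\<close>
 have ct: "(ctr xs j as)[0 := lact (\<M> (cpath j xs ! 0) (cpath j xs ! 1)) r (ctr xs j as ! 0)] = ctr xs j ?as"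
 proof (cases j)
  case 0
  have a1: "as ! 1:bcar (\<M> (xs ! 1) (xs ! Suc (Suc 0)))" using path_wordsD(2)[OF D(4), of 1] D(11) 0 by (simp del: length_greater_0_conv)
  have o2: "xs ! Suc (Suc 0):sp_obj Sp" using pathsD(5)[OF D(1), of "Suc (Suc 0)"] D(2) 0 by simp
  show ?thesis
   using D(2,11) 0 c_lact[OF o o2 _ a0[unfolded One_nat_def], of r "as ! 1"] a1 Scalar x0
   by (simp add: contract_word_update nth_contract_word nth_contract_path)
 next
  case (Suc k)
  then show ?thesis using D(2,11) by (simp add: contract_word_update nth_contract_word nth_contract_path)
 qed
 show ?thesis
 proof (rule that[of j ?as])
  show "contractible S t h (ys @ tl xs) j ?as"
   unfolding p[OF D(1)] using w C Scalar by (simp add: contractible_def)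
  show "conc Sp ys xs v (Word as) = Word ?as" unfolding Scalar(4) by (rule conc_scalar_word[OF ne(1)])
  show "cpath j (ys @ tl xs) = ys @ tl (cpath j xs)" unfolding p[OF D(1)] p[OF D(7)] ..
  show "conc Sp ys (cpath j xs) v (Word (ctr xs j as)) = Word (ctr (ys @ tl xs) j ?as)"
   unfolding Scalar(4) conc_scalar_word[OF ne(2)] ct p[OF D(1)] ..
 qed
next
 case (Word bs)
 note D = contractibleD[OF C]
 have e: "last ys = hd xs" using pathsD(4)[OF ys] pathsD(3)[OF D(1)] by simp
 have nth: "(ys @ tl xs) ! (length bs + i) = xs ! i" if "i < length xs" for i
  using nth_path_append(2)[OF e pathsD(1)[OF ys] pathsD(1)[OF D(1)] that] Word by simp
 have n3: "(ys @ tl xs) ! (length bs + j) = xs ! j" "(ys @ tl xs) ! Suc (length bs + j) = xs ! Suc j"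
  "(ys @ tl xs) ! Suc (Suc (length bs + j)) = xs ! Suc (Suc j)"
  using nth[of j] nth[of "Suc j"] nth[of "Suc (Suc j)"] D(2) by simp_all
 show ?thesis
 proof (rule that[of "length bs + j" "bs @ as"])
  show "contractible S t h (ys @ tl xs) (length bs + j) (bs @ as)"
   using paths_append[OF ys D(1)] path_words_append[OF e Word(3) D(4)] D(2,3) Word(5) by (simp add: contractible_def n3)
  show "conc Sp ys xs v (Word as) = Word (bs @ as)" using Word by simp
  show "cpath (length bs + j) (ys @ tl xs) = ys @ tl (cpath j xs)"
   by (rule contract_path_append[OF e pathsD(1)[OF ys] D(2) Word(5)])
  show "conc Sp ys (cpath j xs) v (Word (ctr xs j as)) = Word (ctr (ys @ tl xs) (length bs + j) (bs @ as))"
   unfolding n3 Word(2) conc.simps contract_word_append(1)[OF D(11)] ..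
 qed
qed

lemma conc_contract_left:
 assumes xs: "xs:P t u" and w: "w:gens Sp xs" and C: "contractible S u h ys j bs"
 obtains as' where "contractible S t h (ys @ tl xs) j as'" "conc Sp ys xs (Word bs) w = Word as'"
  "cpath j (ys @ tl xs) = cpath j ys @ tl xs"
  "conc Sp (cpath j ys) xs (Word (ctr ys j bs)) w = Word (ctr (ys @ tl xs) j as')"
 using w xs
proof (cases rule: generator_cases)
 case (Scalar s)
 note D = contractibleD[OF C]
 have p: "zs @ tl xs = zs" for zs using Scalar by simp
 obtain n where n: "length bs = Suc n" "length (ctr ys j bs) = n" "j < n" "length ys = Suc (Suc n)"
  using D(10,11) nth_contract_word(4)[OF D(11)] by (cases bs) auto
 have ne: "bs \<noteq> []" "ctr ys j bs \<noteq> []" using n by auto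
 have lc: "length (cpath j ys) = Suc (length (ctr ys j bs))" using nth_contract_path(3)[OF D(2)] n by simp
 have o: "ys ! n:sp_obj Sp" "ys ! Suc n:sp_obj Sp" using pathsD(5)[OF D(1)] n by simp_all
 have yn: "ys ! Suc n = u" using path_ends(2)[OF D(1) n(4)] .
 have bn: "bs ! n:bcar (\<M> (ys ! n) (ys ! Suc n))" using path_wordsD(2)[OF D(4), of n] n by simp
 let ?bs = "bs[n := ract (\<M> (ys ! n) (ys ! Suc n)) (bs ! n) s]"
 have w: "?bs:words Sp ys"
  using Scalar bn o yn by (intro path_words_update[OF D(4)]) (simp add: mod_closed)
 \<comment> \<open>\<open>n\<close> is the last index of \<open>bs\<close>, and \<open>k\<close> the
   last index after contraction. For \<open>j = k\<close> the last letter is in the contracted pair,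
   and right linearity of \<open>c\<close> is what takes the scalar out.\<close>
 obtain k where k: "n = Suc k" "j \<le> k" using n(3) by (cases n) auto
 have ct: "(ctr ys j bs)[k := ract (\<M> (cpath j ys ! k) (cpath j ys ! n)) (ctr ys j bs ! k) s] = ctr ys j ?bs"
 proof (cases "j = k")
  case True
  have bk: "bs ! k:bcar (\<M> (ys ! k) (ys ! n))" using path_wordsD(2)[OF D(4), of k] n k by simp
  have ok: "ys ! k:sp_obj Sp" using pathsD(5)[OF D(1)] n k by simp
  have "s:car (\<R> (ys ! Suc n))" using Scalar yn by simp
  from c_ract[OF ok o this bk bn] show ?thesis
   using D(2,11) True n k by (simp add: contract_word_update nth_contract_word nth_contract_path)
 next
  case False
  then have "j < k" using k by simp
  then show ?thesis using D(2,11) n k by (simp add: contract_word_update nth_contract_word nth_contract_path)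
 qed
 show ?thesis
 proof (rule that[of ?bs])
  show "contractible S t h (ys @ tl xs) j ?bs"
   unfolding p using w C Scalar by (simp add: contractible_def)
  show "conc Sp ys xs (Word bs) w = Word ?bs" unfolding Scalar(4) conc_word_scalar[OF D(10) ne(1)] using n by simp
  show "cpath j (ys @ tl xs) = cpath j ys @ tl xs" unfolding p ..
  show "conc Sp (cpath j ys) xs (Word (ctr ys j bs)) w = Word (ctr (ys @ tl xs) j ?bs)"
   unfolding Scalar(4) conc_word_scalar[OF lc ne(2)] p ct[symmetric] n(2) using k by simp
 qed
next
 case (Word as)
 note D = contractibleD[OF C]
 have e: "last ys = hd xs" using pathsD(4)[OF D(1)] pathsD(3)[OF xs] by simp
 have n3: "(ys @ tl xs) ! j = ys ! j" "(ys @ tl xs) ! Suc j = ys ! Suc j" "(ys @ tl xs) ! Suc (Suc j) = ys ! Suc (Suc j)"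
  using D(2) by (simp_all add: nth_append)
 show ?thesis
 proof (rule that[of "bs @ as"])
  show "contractible S t h (ys @ tl xs) j (bs @ as)"
   using paths_append[OF D(1) xs] path_words_append[OF e D(4) Word(3)] D(2,3) by (simp add: contractible_def n3)
  show "conc Sp ys xs (Word bs) w = Word (bs @ as)" using Word by simp
  show "cpath j (ys @ tl xs) = cpath j ys @ tl xs" by (rule contract_path_append_left[OF D(2)])
  show "conc Sp (cpath j ys) xs (Word (ctr ys j bs)) w = Word (ctr (ys @ tl xs) j (bs @ as))"
   unfolding n3 Word(2) conc.simps contract_word_append(2)[OF D(11)] ..
 qed
qed

lemma hom_\<delta>:
 assumes "\<phi>:hom (\<T> t u) (\<T> t' u')" "contractible S t u xs j as"
 shows "\<phi> (\<delta> t u xs j as) = \<phi> (E xs (Word as)) \<otimes>\<^bsub>\<T> t' u'\<^esub> inv\<^bsub>\<T> t' u'\<^esub> \<phi> (E (cpath j xs) (Word (ctr xs j as)))"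
proof -
 note D = contractibleD[OF assms(2)]
 interpret group_hom "\<T> t u" "\<T> t' u'" \<phi>
  using assms(1) group_tensor_hom by (simp add: group_hom_def group_hom_axioms_def)
 show ?thesis using E_closed[OF D(1,8)] E_closed[OF D(7,9)] by simp
qed

text \<open>Composition with a generator maps relations of words to relations of words, on either
  side. Arbitrary morphisms follow because composition is additive and the ideal consists of
  subgroups.\<close>

theorem preadditive_ideal_composition: "preadditive_ideal \<C> (I S)"
proof (rule preadditive_ideal.intro[OF preadditive_tensor_category], rule preadditive_ideal_axioms.intro, unfold tensor_category_sel)
 show "subgroup (I S t h) (\<T> t h)" for t h by (rule subgroup_ideal)
 fix t u h
 note bi = biadditiveD[OF biadditive_PComp]
 show "PComp \<C> t u h b a:I S t h" if b: "b:car (\<T> u h)" and a: "a:I S t u" for b a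
 proof -
  have a': "a:car (\<T> t u)" using subgroup.subset[OF subgroup_ideal] a by blast
  have "PComp \<C> t u h (E ys v) a:I S t h" if ys: "ys:P u h" and v: "v:gens Sp ys" for ys v
  proof (rule hom_ideal_into[OF group_tensor_hom bi(1)[OF E_closed[OF ys v]] subgroup_ideal _ a])
   fix xs j as assume C: "contractible S t u xs j as"
   note D = contractibleD[OF C]
   from conc_contract_right[OF ys v C] obtain j' as' where *: "contractible S t h (ys @ tl xs) j' as'"
    "conc Sp ys xs v (Word as) = Word as'" "cpath j' (ys @ tl xs) = ys @ tl (cpath j xs)"
    "conc Sp ys (cpath j xs) v (Word (ctr xs j as)) = Word (ctr (ys @ tl xs) j' as')" .
   show "PComp \<C> t u h (E ys v) (\<delta> t u xs j as):I S t h"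
    unfolding hom_\<delta>[OF bi(1)[OF E_closed[OF ys v]] C] PComp_E[OF ys v D(1,8)] PComp_E[OF ys v D(7,9)] *(2,4) *(3)[symmetric]
    by (rule \<delta>_in_ideal[OF *(1)])
  qed
  then show ?thesis
   by (intro hom_spans_into[OF group_tensor_hom group_tensor_hom bi(2)[OF a'] spans_tensor_hom subgroup_ideal _ b]) auto
 qed
 show "PComp \<C> t u h b a:I S t h" if b: "b:I S u h" and a: "a:car (\<T> t u)" for b a
 proof -
  have b': "b:car (\<T> u h)" using subgroup.subset[OF subgroup_ideal] b by blast
  have "PComp \<C> t u h b (E xs w):I S t h" if xs: "xs:P t u" and w: "w:gens Sp xs" for xs w
  proof (rule hom_ideal_into[OF group_tensor_hom bi(2)[OF E_closed[OF xs w]] subgroup_ideal _ b])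
   fix ys j bs assume C: "contractible S u h ys j bs"
   note D = contractibleD[OF C]
   from conc_contract_left[OF xs w C] obtain as' where *: "contractible S t h (ys @ tl xs) j as'"
    "conc Sp ys xs (Word bs) w = Word as'" "cpath j (ys @ tl xs) = cpath j ys @ tl xs"
    "conc Sp (cpath j ys) xs (Word (ctr ys j bs)) w = Word (ctr (ys @ tl xs) j as')" .
   show "PComp \<C> t u h (\<delta> u h ys j bs) (E xs w):I S t h"
    unfolding hom_\<delta>[OF bi(2)[OF E_closed[OF xs w]] C] PComp_E[OF D(1,8) xs w] PComp_E[OF D(7,9) xs w] *(2,4) *(3)[symmetric]
    by (rule \<delta>_in_ideal[OF *(1)])
  qed
  then show ?thesis
   by (intro hom_spans_into[OF group_tensor_hom group_tensor_hom bi(1)[OF b'] spans_tensor_hom subgroup_ideal _ a]) auto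
 qed
qed

end

section \<open>Induced functors\<close>

text \<open>Maps that fix the objects, as those induced by double transformations do. Passage to the
  quotients is treated here independently of tensor categories.\<close>

locale preadditive_ideal_map = A: preadditive_ideal C I + B: preadditive_ideal C' I'
 for C :: "('o, 'm) preadd" and I and C' :: "('o, 'n) preadd" and I' +
 fixes \<phi> :: "'o \<Rightarrow> 'o \<Rightarrow> 'm \<Rightarrow> 'n"
 assumes PObj_eq: "PObj C' = PObj C"
  and hom: "t:PObj C ==> h:PObj C ==> \<phi> t h:hom (PHom C t h) (PHom C' t h)"
  and PIdent: "x:PObj C ==> \<phi> x x (PIdent C x) = PIdent C' x"
  and PComp: "t:PObj C ==> u:PObj C ==> h:PObj C ==> b:car (PHom C u h) ==> a:car (PHom C t u) ==>
   \<phi> t h (PComp C t u h b a) = PComp C' t u h (\<phi> u h b) (\<phi> t u a)"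
  and ideal: "t:PObj C ==> h:PObj C ==> a:I t h ==> \<phi> t h a:I' t h"
begin

definition quotient_map where
 "quotient_map = curry (\<lambda>(t, h)\<in>PObj C \<times> PObj C. \<lambda>A\<in>car (PHom (quotient_preadd C I) t h).
  \<Union>a\<in>A. I' t h #>\<^bsub>PHom C' t h\<^esub> \<phi> t h a)"

text \<open>Representatives differ by elements of the ideal, which \<phi> sends into the other
  ideal, so the union over representatives collapses to one coset.\<close>

lemma quotient_map_coset:
 assumes o: "t:PObj C" "h:PObj C" and a: "a:car (PHom C t h)"
 shows "quotient_map t h (A.coset t h a) = B.coset t h (\<phi> t h a)"
proof -
 interpret G: group "PHom C t h" by (rule A.group_PHom[OF o])
 interpret IG: subgroup "I t h" "PHom C t h" by (rule A.subgroup[OF o])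
 have o': "t:PObj C'" "h:PObj C'" using o PObj_eq by simp_all
 have "B.coset t h (\<phi> t h a') = B.coset t h (\<phi> t h a)" if a': "a':A.coset t h a" for a'
 proof -
  obtain i where i: "i:I t h" "a' = i \<otimes>\<^bsub>PHom C t h\<^esub> a" using a' by (auto simp: r_coset_def)
  have "\<phi> t h a' = \<phi> t h i \<otimes>\<^bsub>PHom C' t h\<^esub> \<phi> t h a"
   unfolding i(2) using hom_mult[OF hom[OF o]] i(1) a IG.subset by blast
  then show ?thesis using B.coset_eq[OF o' ideal[OF o i(1)] hom_in_carrier[OF hom[OF o] a]] by simp
 qed
 then have 1: "(\<Union>a'\<in>A.coset t h a. B.coset t h (\<phi> t h a')) = (\<Union>a'\<in>A.coset t h a. B.coset t h (\<phi> t h a))"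
  by (rule SUP_cong[OF refl])
 have 2: "A.coset t h a \<noteq> {}" using G.rcos_self[OF a IG.subgroup_axioms] by blast
 have 3: "A.coset t h a:car (PHom A.\<Q> t h)"
  unfolding A.quotient_sel A.carrier_quotient using a by (rule imageI)
 have "quotient_map t h (A.coset t h a) = (\<Union>a'\<in>A.coset t h a. B.coset t h (\<phi> t h a'))"
  unfolding quotient_map_def curry_def restrict_apply'[OF SigmaI[OF o]] case_prod_conv restrict_apply'[OF 3] ..
 then show ?thesis unfolding 1 UN_constant using 2 by (simp only: if_False)
qed

theorem additive_functor_quotient:
 "additive_functor A.\<Q> B.\<Q> (\<lambda>x\<in>PObj C. x) quotient_map"
proof (rule additive_functor.intro[OF A.preadditive_quotient B.preadditive_quotient], rule additive_functor_axioms.intro)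
 have ex: "\<exists>a'\<in>car (PHom C x y). a = A.coset x y a'" if "a:car (PHom A.\<Q> x y)" for x y a
  using that unfolding A.quotient_sel A.carrier_quotient by auto
 note q = quotient_map_coset and cl = hom_in_carrier[OF hom]
 show "(\<lambda>x\<in>PObj C. x):extensional (PObj A.\<Q>)" by simp
 show "case_prod quotient_map:extensional (PObj A.\<Q> \<times> PObj A.\<Q>)"
  by (auto simp: quotient_map_def extensional_def)
 show "(\<lambda>x\<in>PObj C. x) x:PObj B.\<Q>" if "x:PObj A.\<Q>" for x
  using that PObj_eq by simp
 show "quotient_map x x (PIdent A.\<Q> x) = PIdent B.\<Q> ((\<lambda>x\<in>PObj C. x) x)"
  if "x:PObj A.\<Q>" for x
  using that q A.PIdent_closed PIdent by simp
 fix t h assume "t:PObj A.\<Q>" "h:PObj A.\<Q>"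
 then have o: "t:PObj C" "h:PObj C" by simp_all
 then have o': "t:PObj C'" "h:PObj C'" using PObj_eq by simp_all
 interpret G: group "PHom C t h" by (rule A.group_PHom[OF o])
 show "quotient_map t h:extensional (car (PHom A.\<Q> t h))"
  using o by (simp add: quotient_map_def)
 show "quotient_map t h:hom (PHom A.\<Q> t h) (PHom B.\<Q> ((\<lambda>x\<in>PObj C. x) t) ((\<lambda>x\<in>PObj C. x) h))"
 proof (rule homI)
  fix x y assume "x:car (PHom A.\<Q> t h)"
  then obtain a where a: "a:car (PHom C t h)" "x = A.coset t h a" using ex by blast
  show "quotient_map t h x:car (PHom B.\<Q> ((\<lambda>x\<in>PObj C. x) t) ((\<lambda>x\<in>PObj C. x) h))"
   unfolding a(2) B.quotient_sel restrict_apply'[OF o(1)] restrict_apply'[OF o(2)] B.carrier_quotient q[OF o a(1)]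
   using cl[OF o a(1)] by (rule imageI)
  assume "y:car (PHom A.\<Q> t h)"
  then obtain b where b: "b:car (PHom C t h)" "y = A.coset t h b" using ex by blast
  show "quotient_map t h (x \<otimes>\<^bsub>PHom A.\<Q> t h\<^esub> y) = quotient_map t h x
    \<otimes>\<^bsub>PHom B.\<Q> ((\<lambda>x\<in>PObj C. x) t) ((\<lambda>x\<in>PObj C. x) h)\<^esub> quotient_map t h y"
   unfolding a(2) b(2) B.quotient_sel A.quotient_sel restrict_apply'[OF o(1)] restrict_apply'[OF o(2)]
    A.coset_mult[OF o a(1) b(1)] q[OF o a(1)] q[OF o b(1)] q[OF o G.m_closed[OF a(1) b(1)]]
    B.coset_mult[OF o' cl[OF o a(1)] cl[OF o b(1)]] hom_mult[OF hom[OF o] a(1) b(1)] ..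
 qed
 fix u b a assume "u:PObj A.\<Q>" and b: "b:car (PHom A.\<Q> h u)"
  and a: "a:car (PHom A.\<Q> t h)"
 then have u: "u:PObj C" "u:PObj C'" using PObj_eq by simp_all
 obtain a' where a': "a':car (PHom C t h)" "a = A.coset t h a'" using ex[OF a] by blast
 obtain b' where b': "b':car (PHom C h u)" "b = A.coset h u b'" using ex[OF b] by blast
 show "quotient_map t u (PComp A.\<Q> t h u b a) =
   PComp B.\<Q> ((\<lambda>x\<in>PObj C. x) t) ((\<lambda>x\<in>PObj C. x) h) ((\<lambda>x\<in>PObj C. x) u) (quotient_map h u b) (quotient_map t h a)"
  unfolding a'(2) b'(2) restrict_apply'[OF o(1)] restrict_apply'[OF o(2)] restrict_apply'[OF u(1)]
   A.PComp_quotient[OF o u(1) b'(1) a'(1)] q[OF o a'(1)] q[OF o(2) u(1) b'(1)]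
   q[OF o(1) u(1) A.PComp_closed[OF o u(1) b'(1) a'(1)]]
   B.PComp_quotient[OF o' u(2) cl[OF o(2) u(1) b'(1)] cl[OF o a'(1)]] PComp[OF o u(1) b'(1) a'(1)] ..
qed

end

section \<open>Functors induced by maps of species\<close>

locale species_morphism = A: species_composition Sp c + B: species_composition Sp' c'
 for Sp :: "('o, 'r, 'a) species" and c and Sp' :: "('o, 'r, 'a) species" and c' +
 fixes f0 :: "'o \<Rightarrow> 'r \<Rightarrow> 'r" and f1 :: "'o \<Rightarrow> 'o \<Rightarrow> 'a \<Rightarrow> 'a"
 assumes sp_obj_eq: "sp_obj Sp' = sp_obj Sp"
  and f0: "x:sp_obj Sp ==> f0 x:ring_hom (sp_ring Sp x) (sp_ring Sp' x)"
  and f1: "y:sp_obj Sp ==> x:sp_obj Sp ==> f1 y x:hom (bgrp (sp_mod Sp y x)) (bgrp (sp_mod Sp' y x))"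
  and f1_lact: "y:sp_obj Sp ==> x:sp_obj Sp ==> q:car (sp_ring Sp y) ==> a:bcar (sp_mod Sp y x) ==>
   f1 y x (lact (sp_mod Sp y x) q a) = lact (sp_mod Sp' y x) (f0 y q) (f1 y x a)"
  and f1_ract: "y:sp_obj Sp ==> x:sp_obj Sp ==> r:car (sp_ring Sp x) ==> a:bcar (sp_mod Sp y x) ==>
   f1 y x (ract (sp_mod Sp y x) a r) = ract (sp_mod Sp' y x) (f1 y x a) (f0 x r)"
  and f1_c: "z:sp_obj Sp ==> y:sp_obj Sp ==> x:sp_obj Sp ==> b:bcar (sp_mod Sp z y) ==> a:bcar (sp_mod Sp y x) ==>
   f1 z x (c z y x (tensor_elem (sp_mod Sp z y) (sp_mod Sp y x) b a))
    = c' z y x (tensor_elem (sp_mod Sp' z y) (sp_mod Sp' y x) (f1 z y b) (f1 y x a))"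
begin

abbreviation "mg \<equiv> map_generator f0 f1"
abbreviation "mw xs as \<equiv> map (\<lambda>i. f1 (xs ! i) (xs ! Suc i) (as ! i)) [0..<length as]"

lemma f0_closed: "x:sp_obj Sp ==> r:car (sp_ring Sp x) ==> f0 x r:car (sp_ring Sp' x)"
 using ring_hom_closed[OF f0] .

lemma f1_closed: "y:sp_obj Sp ==> x:sp_obj Sp ==> a:bcar (sp_mod Sp y x) ==> f1 y x a:bcar (sp_mod Sp' y x)"
 using hom_in_carrier[OF f1] .

lemma f1_mult: "y:sp_obj Sp ==> x:sp_obj Sp ==> a:bcar (sp_mod Sp y x) ==> b:bcar (sp_mod Sp y x) ==>
  f1 y x (a \<otimes>\<^bsub>bgrp (sp_mod Sp y x)\<^esub> b) = f1 y x a \<otimes>\<^bsub>bgrp (sp_mod Sp' y x)\<^esub> f1 y x b"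
 using hom_mult[OF f1] .

lemma paths_eq: "paths (sp_obj Sp') t h = A.P t h"
 by (simp add: sp_obj_eq)

lemma mw_update: "i < length as ==> mw xs (as[i := a]) = (mw xs as)[i := f1 (xs ! i) (xs ! Suc i) a]"
 by (rule nth_equalityI) (auto simp: nth_list_update)

lemma mw_in:
 assumes "xs:A.P t h" "as:words Sp xs"
 shows "mw xs as:words Sp' xs"
 using assms pathsD(5)[OF assms(1)] path_wordsD[OF assms(2)] by (simp add: path_words_def f1_closed)

text \<open>Letterwise application of \<open>f1\<close>, which is linear along \<open>f0\<close>,
  carries each relation of the source species to one of the target.\<close>

lemma slotwise_mw:
 assumes xs: "xs:A.P t h" and f: "slotwise Sp' xs K f"
 shows "slotwise Sp xs K (\<lambda>as. f (mw xs as))"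
proof (rule slotwiseI)
 fix as assume as: "as:words Sp xs"
 note D = slotwiseD[OF f mw_in[OF xs as]] and o = pathsD(5)[OF xs] and l = path_wordsD[OF as]
 show "f (mw xs as):car K" by (rule D(1))
 fix i
 show "f (mw xs (as[i := a \<otimes>\<^bsub>bgrp (sp_mod Sp (xs ! i) (xs ! Suc i))\<^esub> b])) = f (mw xs (as[i := a])) \<otimes>\<^bsub>K\<^esub> f (mw xs (as[i := b]))"
  if i: "i < length as" and ab: "a:bcar (sp_mod Sp (xs ! i) (xs ! Suc i))" "b:bcar (sp_mod Sp (xs ! i) (xs ! Suc i))" for a b
 proof -
  have o': "xs ! i:sp_obj Sp" "xs ! Suc i:sp_obj Sp" using o l(1) i by simp_all
  show ?thesis unfolding mw_update[OF i] f1_mult[OF o' ab]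
   by (rule D(2)) (use i ab o' f1_closed in simp_all)
 qed
 show "f (mw xs (as[i := ract (sp_mod Sp (xs ! i) (xs ! Suc i)) (as ! i) r]))
   = f (mw xs (as[Suc i := lact (sp_mod Sp (xs ! Suc i) (xs ! Suc (Suc i))) r (as ! Suc i)]))"
  if i: "Suc i < length as" and r: "r:car (sp_ring Sp (xs ! Suc i))" for r
 proof -
  have i': "i < length as" using i by simp
  have o': "xs ! i:sp_obj Sp" "xs ! Suc i:sp_obj Sp" "xs ! Suc (Suc i):sp_obj Sp" using o l(1) i by simp_all
  show ?thesis unfolding mw_update[OF i] mw_update[OF i'] f1_ract[OF o'(1,2) r l(2)[OF i']] f1_lact[OF o'(2,3) r l(2)[OF i]]
   using D(3)[of i "f0 (xs ! Suc i) r"] i f0_closed[OF o'(2) r] by simp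
 qed
qed

lemma mg_closed:
 assumes "xs:A.P t h" "v:gens Sp xs"
 shows "mg xs v:gens Sp' xs"
 using assms(2,1)
proof (cases rule: A.generator_cases)
 case (Word as)
 then show ?thesis using mw_in[OF assms(1) Word(3)] by (simp add: generators_def)
qed (simp add: generators_def f0_closed)

lemma multiadditive_mg: "multiadditive Sp t h (tensor_hom Sp' t h) (\<lambda>xs v. B.E xs (mg xs v))"
proof (rule multiadditiveI)
 fix xs assume xs: "xs:A.P t h" and len: "length xs = 1"
 note xs' = xs[folded paths_eq]
 have "f0 (hd xs):hom (amon (sp_ring Sp (hd xs))) (amon (sp_ring Sp' (hd xs)))"
  using f0[of "hd xs"] path_length1[OF xs len] by (auto simp: ring_hom_def hom_def)
 from hom_comp[OF this B.scalar_E[OF xs' len]]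
 show "(\<lambda>r. B.E xs (mg xs (Scalar r))):hom (amon (sp_ring Sp (hd xs))) (tensor_hom Sp' t h)" by simp
next
 fix xs assume xs: "xs:A.P t h" and len: "length xs \<noteq> 1"
 show "slotwise Sp xs (tensor_hom Sp' t h) (\<lambda>as. B.E xs (mg xs (Word as)))"
  unfolding map_generator.simps by (rule slotwise_mw[OF xs B.slotwise_E[OF xs[folded paths_eq] len]])
qed

abbreviation "\<Phi> \<equiv> tensor_hom_map Sp Sp' f0 f1"

lemma \<Phi>_hom: "\<Phi> t h:hom (tensor_hom Sp t h) (tensor_hom Sp' t h)"
 and \<Phi>_E: "\<And>xs v. xs:A.P t h ==> v:gens Sp xs ==> \<Phi> t h (A.E xs v) = B.E xs (mg xs v)"
proof -
 obtain k where k: "k:hom (tensor_hom Sp t h) (tensor_hom Sp' t h)"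
  "\<And>xs v. xs:A.P t h ==> v:gens Sp xs ==> k (A.E xs v) = B.E xs (mg xs v)"
  using A.tensor_hom_lift[OF B.comm_group_tensor_hom multiadditive_mg] by blast
 have eq: "\<Phi> t h = restrict k (car (tensor_hom Sp t h))"
  unfolding tensor_hom_map_def
  by (rule the_hom_eq[OF A.group_tensor_hom B.group_tensor_hom k(1) A.spans_tensor_hom])
   (auto simp: k(2) A.E_closed)
 show "\<Phi> t h:hom (tensor_hom Sp t h) (tensor_hom Sp' t h)"
  unfolding eq using k(1) by (simp add: hom_restrict_iff[OF A.group_tensor_hom])
 show "\<Phi> t h (A.E xs v) = B.E xs (mg xs v)" if "xs:A.P t h" "v:gens Sp xs" for xs v
  unfolding eq using that by (simp add: k(2) A.E_closed)
qed

lemma \<Phi>_eqI: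
 assumes "k:hom (tensor_hom Sp t h) (tensor_hom Sp' t h)" "a:car (tensor_hom Sp t h)"
  "\<And>xs v. xs:A.P t h ==> v:gens Sp xs ==> k (A.E xs v) = B.E xs (mg xs v)"
 shows "\<Phi> t h a = k a"
 by (rule A.tensor_hom_eq[OF B.group_tensor_hom \<Phi>_hom assms(1) _ assms(2)]) (simp add: \<Phi>_E assms(3))

text \<open>Scalars enter a word through the bimodule actions, which \<open>f1\<close> respects
  along \<open>f0\<close>; two words are mapped letter by letter, the second at shifted vertices of
  the glued path.\<close>

lemma mg_conc:
 assumes ys: "ys:A.P u h" and v: "v:gens Sp ys" and xs: "xs:A.P t u" and w: "w:gens Sp xs"
 shows "mg (ys @ tl xs) (conc Sp ys xs v w) = conc Sp' ys xs (mg ys v) (mg xs w)"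
 using v ys
proof (cases rule: A.generator_cases)
 case (Scalar r)
 note S = this
 have p: "ys @ tl xs = xs" using Scalar hd_tl_paths[OF xs] by simp
 from w xs show ?thesis
 proof (cases rule: A.generator_cases)
  case (Scalar s)
  then show ?thesis using S ring_hom_mult[OF f0[of u]] by simp
 next
  case (Word as)
  have pos: "0 < length as" and ne: "mw xs as \<noteq> []" using Word(4) by simp_all
  have m0: "mw xs as ! 0 = f1 (xs ! 0) (xs ! Suc 0) (as ! 0)" using pos by (simp del: length_greater_0_conv)
  show ?thesis
   unfolding p Word(2) S(4) conc_scalar_word[OF Word(4)] map_generator.simps conc_scalar_word[OF ne] mw_update[OF pos]
   using A.obj[OF xs Word(1,3), of 0] path_wordsD(2)[OF Word(3), of 0] A.path_ends(1)[OF xs Word(5)] S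
Word(4) m0 by (simp add: f1_lact)
 qed
next
 case (Word bs)
 note B = this
 from w xs show ?thesis
 proof (cases rule: A.generator_cases)
  case (Scalar s)
  have p: "ys @ tl xs = ys" using Scalar by simp
  obtain n where n: "length bs = Suc n" "n < length bs" using B(4) by (cases bs) auto
  have ne: "length ys = Suc (length (mw ys bs))" "mw ys bs \<noteq> []" using B(4,5) by simp_all
  show ?thesis
   unfolding p Scalar(4) B(2) conc_word_scalar[OF B(5,4)] map_generator.simps conc_word_scalar[OF ne]
   using A.obj[OF ys B(1,3) n(2)] path_wordsD(2)[OF B(3) n(2)] A.path_ends(2)[OF ys B(5)] n Scalar
   by (subst mw_update, simp) (simp add: f1_ract nth_append)
 next
  case (Word as)
  have e: "last ys = hd xs" using pathsD(4)[OF ys] pathsD(3)[OF xs] by simp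
  note nth = nth_path_append[OF e pathsD(1)[OF ys] pathsD(1)[OF xs]]
  have "mw (ys @ tl xs) (bs @ as) = mw ys bs @ mw xs as"
  proof (rule nth_equalityI)
   fix i assume i: "i < length (mw (ys @ tl xs) (bs @ as))"
   show "mw (ys @ tl xs) (bs @ as) ! i = (mw ys bs @ mw xs as) ! i"
   proof (cases "i < length bs")
    case True
    then show ?thesis using i B(5) by (simp add: nth_append[of "mw ys bs"] nth_append[of bs] nth(1) del: upt_conv_Cons)
   next
    case False
    define j where "j = i - length bs"
    have j: "i = length bs + j" "j < length as" using i False by (simp_all add: j_def)
    have "(ys @ tl xs) ! (length bs + j) = xs ! j" "(ys @ tl xs) ! Suc (length bs + j) = xs ! Suc j"
     using nth(2)[of j "length bs"] nth(2)[of "Suc j" "length bs"] B(5) Word(5) j(2) by simp_all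
    moreover have "(mw ys bs @ mw xs as) ! i = mw xs as ! j"
     using nth_append_length_plus[of "mw ys bs" "mw xs as" j] j(1) by simp
    ultimately show ?thesis using j by simp
   qed
  qed simp
  then show ?thesis unfolding B(2) Word(2) conc.simps map_generator.simps by simp
 qed
qed

lemma \<Phi>_PComp:
 assumes b: "b:car (tensor_hom Sp u h)" and a: "a:car (tensor_hom Sp t u)"
 shows "\<Phi> t h (PComp A.\<C> t u h b a) = PComp B.\<C> t u h (\<Phi> u h b) (\<Phi> t u a)"
proof -
 note bi = biadditiveD[OF A.biadditive_PComp] and bi' = biadditiveD[OF B.biadditive_PComp]
  and eq = A.tensor_hom_eq[OF B.group_tensor_hom] and cl = hom_in_carrier[OF \<Phi>_hom]
 have 1: "\<Phi> t h (PComp A.\<C> t u h (A.E ys v) (A.E xs w)) = PComp B.\<C> t u h (\<Phi> u h (A.E ys v)) (\<Phi> t u (A.E xs w))"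
  if *: "ys:A.P u h" "v:gens Sp ys" "xs:A.P t u" "w:gens Sp xs" for ys v xs w
  unfolding A.PComp_E[OF *] \<Phi>_E[OF paths_append[OF *(1,3)] A.conc_closed[OF *]] \<Phi>_E[OF *(1,2)] \<Phi>_E[OF *(3,4)]
   B.PComp_E[OF *(1)[folded paths_eq] mg_closed[OF *(1,2)] *(3)[folded paths_eq] mg_closed[OF *(3,4)]] mg_conc[OF *] ..
 have 2: "\<Phi> t h (PComp A.\<C> t u h (A.E ys v) a) = PComp B.\<C> t u h (\<Phi> u h (A.E ys v)) (\<Phi> t u a)"
  if *: "ys:A.P u h" "v:gens Sp ys" for ys v
  by (rule eq[OF hom_comp[OF bi(1)[OF A.E_closed[OF *]] \<Phi>_hom] hom_comp[OF \<Phi>_hom bi'(1)[OF cl[OF A.E_closed[OF *]]]] 1[OF *] a])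
 show ?thesis
  by (rule eq[OF hom_comp[OF bi(2)[OF a] \<Phi>_hom] hom_comp[OF \<Phi>_hom bi'(2)[OF cl[OF a]]] 2 b])
qed

text \<open>The assumption \<open>f1_c\<close> is used at the contracted letter; every other letter
  is the same on both sides up to the shift of indices.\<close>

lemma mw_contract:
 assumes C: "A.contractible S t h xs j as"
 shows "mw (cpath j xs) (A.ctr xs j as) = B.ctr xs j (mw xs as)"
proof (rule nth_equalityI)
 note D = A.contractibleD[OF C]
 have jm: "Suc j < length (mw xs as)" using D(11) by simp
 show "length (mw (cpath j xs) (A.ctr xs j as)) = length (B.ctr xs j (mw xs as))"
  unfolding nth_contract_word(4)[OF jm] length_map length_upt nth_contract_word(4)[OF D(11)] by simp
 fix i assume "i < length (mw (cpath j xs) (A.ctr xs j as))"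
 then have i: "i < length (A.ctr xs j as)" "i < length as - 1" using nth_contract_word(4)[OF D(11)] by simp_all
 have m: "mw (cpath j xs) (A.ctr xs j as) ! i
   = f1 (cpath j xs ! i) (cpath j xs ! Suc i) (A.ctr xs j as ! i)" using i by simp
 consider "i < j" | "i = j" | "j < i" by linarith
 then show "mw (cpath j xs) (A.ctr xs j as) ! i = B.ctr xs j (mw xs as) ! i"
 proof cases
  case 1
  then show ?thesis unfolding m using D(2,11) i(2) by (simp add: nth_contract_word[OF jm] nth_contract_word nth_contract_path)
 next
  case 2
  have o: "xs ! j:sp_obj Sp" "xs ! Suc j:sp_obj Sp" "xs ! Suc (Suc j):sp_obj Sp"
   using A.contract_objs[OF D(1,2)] .
  have "as ! j:bcar (sp_mod Sp (xs ! j) (xs ! Suc j))" "as ! Suc j:bcar (sp_mod Sp (xs ! Suc j) (xs ! Suc (Suc j)))"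
   using path_wordsD(2)[OF D(4)] D(11) by simp_all
  from f1_c[OF o this] show ?thesis unfolding m unfolding 2
   using D(2,11) by (simp add: nth_contract_word(2)[OF jm] nth_contract_word nth_contract_path)
 next
  case 3
  then show ?thesis unfolding m using D(2,10,11) i(2) by (simp add: nth_contract_word(3)[OF jm] nth_contract_word nth_contract_path)
 qed
qed

text \<open>The relation of a word is sent to the relation of the mapped word at the same position,
  along the same path.\<close>

lemma \<Phi>_ideal:
 assumes a: "a:A.I S t h"
 shows "\<Phi> t h a:B.I S t h"
proof (rule A.hom_ideal_into[OF B.group_tensor_hom \<Phi>_hom B.subgroup_ideal _ a])
 fix xs j as assume C: "A.contractible S t h xs j as"
 note D = A.contractibleD[OF C]
 have C': "B.contractible S t h xs j (mw xs as)"
  using D(2,3) mw_in[OF D(1,4)] D(1)[folded paths_eq] by (simp add: B.contractible_def)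
 interpret group_hom "tensor_hom Sp t h" "tensor_hom Sp' t h" "\<Phi> t h"
  using \<Phi>_hom A.group_tensor_hom B.group_tensor_hom by (simp add: group_hom_def group_hom_axioms_def)
 have "\<Phi> t h (A.\<delta> t h xs j as) = B.\<delta> t h xs j (mw xs as)"
  unfolding hom_mult[OF A.E_closed[OF D(1,8)] G.inv_closed[OF A.E_closed[OF D(7,9)]]] hom_inv[OF A.E_closed[OF D(7,9)]]
   \<Phi>_E[OF D(1,8)] \<Phi>_E[OF D(7,9)] map_generator.simps mw_contract[OF C] ..
 then show "\<Phi> t h (A.\<delta> t h xs j as):B.I S t h" using B.\<delta>_in_ideal[OF C'] by simp
qed

theorem preadditive_ideal_map: "preadditive_ideal_map A.\<C> (A.I S) B.\<C> (B.I S) \<Phi>"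
proof (rule preadditive_ideal_map.intro[OF A.preadditive_ideal_composition B.preadditive_ideal_composition],
  rule preadditive_ideal_map_axioms.intro, unfold A.tensor_category_sel B.tensor_category_sel)
 fix x assume x: "x:sp_obj Sp"
 interpret R: ring "sp_ring Sp x" by (rule A.sp_ring[OF x])
 have "[x]:A.P x x" using x by (simp add: paths_def)
 then show "\<Phi> x x (A.E [x] (Scalar \<one>\<^bsub>sp_ring Sp x\<^esub>)) = B.E [x] (Scalar \<one>\<^bsub>sp_ring Sp' x\<^esub>)"
  using \<Phi>_E[OF _ A.generator_Scalar[OF R.one_closed]] ring_hom_one[OF f0[OF x]] by (simp del: pure.simps)
qed (simp_all only: sp_obj_eq \<Phi>_hom \<Phi>_PComp \<Phi>_ideal)

end

section \<open>The categories of preadditive categories and of double functors\<close>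

lemma family_eqI:
 assumes "case_prod f:extensional (X \<times> X)" "case_prod g:extensional (X \<times> X)"
  "\<And>t h. t:X ==> h:X ==> f t h = g t h"
 shows "f = g"
proof -
 have "case_prod f = case_prod g" by (rule extensionalityI[OF assms(1,2)]) (use assms(3) in auto)
 then show ?thesis by (metis curry_case_prod)
qed

lemma curry_restrict:
 "case_prod (curry (\<lambda>(t, h)\<in>X \<times> X. g t h)):extensional (X \<times> X)"
 "t:X ==> h:X ==> curry (\<lambda>(t, h)\<in>X \<times> X. g t h) t h = g t h"
 by simp_all

lemma additive_functor_id:
 assumes "preadditive_category C"
 shows "additive_functor C C (\<lambda>x\<in>PObj C. x) (curry (\<lambda>(t, h)\<in>PObj C \<times> PObj C. \<lambda>a\<in>car (PHom C t h). a))"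
proof (rule additive_functor.intro[OF assms assms], rule additive_functor_axioms.intro)
 interpret preadditive_category C by fact
 have g: "group (PHom C t h)" if "t:PObj C" "h:PObj C" for t h using comm_group[OF that] by (simp add: comm_group_def)
 fix t u h assume o: "t:PObj C" "u:PObj C" "h:PObj C"
 note bi = biadditiveD(3)[OF biadditive[OF o]]
 show "curry (\<lambda>(t, h)\<in>PObj C \<times> PObj C. \<lambda>a\<in>car (PHom C t h). a) t h (PComp C t u h b a) =
   PComp C ((\<lambda>x\<in>PObj C. x) t) ((\<lambda>x\<in>PObj C. x) u) ((\<lambda>x\<in>PObj C. x) h)
    (curry (\<lambda>(t, h)\<in>PObj C \<times> PObj C. \<lambda>a\<in>car (PHom C t h). a) u h b)
    (curry (\<lambda>(t, h)\<in>PObj C \<times> PObj C. \<lambda>a\<in>car (PHom C t h). a) t u a)"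
  if "b:car (PHom C u h)" "a:car (PHom C t u)" for b a
  using o that bi[OF that] by simp
next
 interpret preadditive_category C by fact
 have g: "group (PHom C t h)" if "t:PObj C" "h:PObj C" for t h using comm_group[OF that] by (simp add: comm_group_def)
 fix t h assume o: "t:PObj C" "h:PObj C"
 have "(\<lambda>a. a):hom (PHom C t h) (PHom C t h)" by (simp add: hom_def)
 then show "curry (\<lambda>(t, h)\<in>PObj C \<times> PObj C. \<lambda>a\<in>car (PHom C t h). a) t h
   :hom (PHom C t h) (PHom C ((\<lambda>x\<in>PObj C. x) t) ((\<lambda>x\<in>PObj C. x) h))"
  using o by (simp add: hom_restrict_iff[OF g[OF o]])
qed (use preadditive_category.PIdent_closed[OF assms] in \<open>simp_all\<close>)

lemma additive_functor_comp:
 assumes "additive_functor C C' fo fm" "additive_functor C' C'' go gm"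
 shows "additive_functor C C'' (compose (PObj C) go fo)
  (curry (\<lambda>(t, h)\<in>PObj C \<times> PObj C. compose (car (PHom C t h)) (gm (fo t) (fo h)) (fm t h)))"
proof -
 interpret f: additive_functor C C' fo fm by fact
 interpret g: additive_functor C' C'' go gm by fact
 let ?m = "curry (\<lambda>(t, h)\<in>PObj C \<times> PObj C. compose (car (PHom C t h)) (gm (fo t) (fo h)) (fm t h))"
 have gr: "group (PHom C t h)" if "t:PObj C" "h:PObj C" for t h
  using f.C.comm_group[OF that] by (simp add: comm_group_def)
 have v: "?m t h = compose (car (PHom C t h)) (gm (fo t) (fo h)) (fm t h)" if "t:PObj C" "h:PObj C" for t h
  using that by simp
 have w: "?m t h a = gm (fo t) (fo h) (fm t h a)" if "t:PObj C" "h:PObj C" "a:car (PHom C t h)" for t h a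
  using that by (simp add: compose_def)
 have o: "compose (PObj C) go fo x = go (fo x)" if "x:PObj C" for x using that by (simp add: compose_def)
 note cl = hom_in_carrier[OF f.fm_hom]
 show ?thesis
 proof (rule additive_functor.intro[OF f.C.preadditive_category_axioms g.C'.preadditive_category_axioms], rule additive_functor_axioms.intro)
  fix t u h b a assume p: "t:PObj C" "u:PObj C" "h:PObj C" "b:car (PHom C u h)" "a:car (PHom C t u)"
  have c: "PComp C t u h b a:car (PHom C t h)" using biadditiveD(3)[OF f.C.biadditive[OF p(1-3)] p(4,5)] .
  show "?m t h (PComp C t u h b a) = PComp C'' (compose (PObj C) go fo t) (compose (PObj C) go fo u) (compose (PObj C) go fo h) (?m u h b) (?m t u a)"
   unfolding w[OF p(1,3) c] w[OF p(2,3,4)] w[OF p(1,2,5)] o[OF p(1)] o[OF p(2)] o[OF p(3)] f.fm_PComp[OF p]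
   by (rule g.fm_PComp[OF f.fo_PObj[OF p(1)] f.fo_PObj[OF p(2)] f.fo_PObj[OF p(3)] cl[OF p(2,3,4)] cl[OF p(1,2,5)]])
 next
  fix t h assume p: "t:PObj C" "h:PObj C"
  show "?m t h:extensional (car (PHom C t h))" unfolding v[OF p] by (simp add: compose_def)
  show "?m t h:hom (PHom C t h) (PHom C'' (compose (PObj C) go fo t) (compose (PObj C) go fo h))"
   unfolding v[OF p] o[OF p(1)] o[OF p(2)] unfolding compose_def hom_restrict_iff[OF gr[OF p]]
   by (rule hom_comp[OF f.fm_hom[OF p] g.fm_hom[OF f.fo_PObj[OF p(1)] f.fo_PObj[OF p(2)]]])
 next
  fix x assume x: "x:PObj C"
  show "compose (PObj C) go fo x:PObj C''" unfolding o[OF x] by (rule g.fo_PObj[OF f.fo_PObj[OF x]])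
  show "?m x x (PIdent C x) = PIdent C'' (compose (PObj C) go fo x)"
   unfolding w[OF x x f.C.PIdent_closed[OF x]] o[OF x] f.fm_PIdent[OF x] by (rule g.fm_PIdent[OF f.fo_PObj[OF x]])
 qed (simp_all add: compose_def)
qed

lemma preadd_cat_sel [simp]:
 "Obj preadd_cat = {C. preadditive_category C}"
 "Arr preadd_cat = {k. additive_functor (src k) (tgt k) (fst (fn k)) (snd (fn k))}"
 "Dom preadd_cat = src" "Cod preadd_cat = tgt"
 by (simp_all add: preadd_cat_def)

text \<open>Composites are cut down to their carriers, so the unit laws rely on extensionality of
  the given functor: composing with an identity returns its normal form, which is the functor
  itself.\<close>

theorem category_preadd_cat: "category (preadd_cat :: (('o, 'm) preadd, ('o, 'm) preadd_functor) category)"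
proof (rule category.intro, unfold preadd_cat_sel mem_Collect_eq)
 fix C :: "('o, 'm) preadd"
 show "additive_functor (src (Ident preadd_cat C)) (tgt (Ident preadd_cat C)) (fst (fn (Ident preadd_cat C))) (snd (fn (Ident preadd_cat C)))"
  if "preadditive_category C"
  using additive_functor_id[OF that] by (simp add: preadd_cat_def)
 show "src (Ident preadd_cat C) = C" "tgt (Ident preadd_cat C) = C" by (simp_all add: preadd_cat_def)
next
 fix f :: "('o, 'm) preadd_functor"
 assume f: "additive_functor (src f) (tgt f) (fst (fn f)) (snd (fn f))"
 show "preadditive_category (src f)" "preadditive_category (tgt f)"
  using additive_functor.axioms(1,2)[OF f] .
 interpret f: additive_functor "src f" "tgt f" "fst (fn f)" "snd (fn f)" by (rule f)
 obtain S fo fm T where F: "f = \<lparr>src = S, fn = (fo, fm), tgt = T\<rparr>" by (cases f) auto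
 interpret F: additive_functor S T fo fm using f unfolding F by simp
 have 1: "compose (PObj S) (\<lambda>x\<in>PObj T. x) fo = fo"
  by (rule extensionalityI[of _ "PObj S"]) (use F.extensional(1) F.fo_PObj in \<open>auto simp: compose_def\<close>)
 have 2: "curry (\<lambda>(t, h)\<in>PObj S \<times> PObj S. compose (car (PHom S t h))
   (curry (\<lambda>(t, h)\<in>PObj T \<times> PObj T. \<lambda>a\<in>car (PHom T t h). a) (fo t) (fo h)) (fm t h)) = fm"
 proof (rule family_eqI[OF curry_restrict(1) F.extensional(2)])
  fix t h assume o: "t:PObj S" "h:PObj S"
  show "curry (\<lambda>(t, h)\<in>PObj S \<times> PObj S. compose (car (PHom S t h))
   (curry (\<lambda>(t, h)\<in>PObj T \<times> PObj T. \<lambda>a\<in>car (PHom T t h). a) (fo t) (fo h)) (fm t h)) t h = fm t h"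
   by (rule extensionalityI[OF _ F.extensional(3)[OF o]])
    (use o F.fo_PObj hom_in_carrier[OF F.fm_hom[OF o]] in \<open>auto simp: compose_def\<close>)
 qed
 have 3: "compose (PObj S) fo (\<lambda>x\<in>PObj S. x) = fo"
  by (rule extensionalityI[of _ "PObj S"]) (use F.extensional(1) in \<open>auto simp: compose_def\<close>)
 have 4: "curry (\<lambda>(t, h)\<in>PObj S \<times> PObj S. compose (car (PHom S t h)) (fm ((\<lambda>x\<in>PObj S. x) t) ((\<lambda>x\<in>PObj S. x) h))
   (curry (\<lambda>(t, h)\<in>PObj S \<times> PObj S. \<lambda>a\<in>car (PHom S t h). a) t h)) = fm"
 proof (rule family_eqI[OF curry_restrict(1) F.extensional(2)])
  fix t h assume o: "t:PObj S" "h:PObj S"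
  show "curry (\<lambda>(t, h)\<in>PObj S \<times> PObj S. compose (car (PHom S t h)) (fm ((\<lambda>x\<in>PObj S. x) t) ((\<lambda>x\<in>PObj S. x) h))
   (curry (\<lambda>(t, h)\<in>PObj S \<times> PObj S. \<lambda>a\<in>car (PHom S t h). a) t h)) t h = fm t h"
   by (rule extensionalityI[OF _ F.extensional(3)[OF o]]) (use o in \<open>auto simp: compose_def\<close>)
 qed
 show "Ident preadd_cat (tgt f) \<cdot>\<^bsub>preadd_cat\<^esub> f = f" unfolding F preadd_cat_def category.simps arrow.simps preadd.simps fst_conv snd_conv 1 2 ..
 show "f \<cdot>\<^bsub>preadd_cat\<^esub> Ident preadd_cat (src f) = f" unfolding F preadd_cat_def category.simps arrow.simps preadd.simps fst_conv snd_conv 3 4 ..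
next
 fix g f :: "('o, 'm) preadd_functor"
 show "src (g \<cdot>\<^bsub>preadd_cat\<^esub> f) = src f" "tgt (g \<cdot>\<^bsub>preadd_cat\<^esub> f) = tgt g" by (simp_all add: preadd_cat_def)
 assume g: "additive_functor (src g) (tgt g) (fst (fn g)) (snd (fn g))"
  and f: "additive_functor (src f) (tgt f) (fst (fn f)) (snd (fn f))" and e: "src g = tgt f"
 show "additive_functor (src (g \<cdot>\<^bsub>preadd_cat\<^esub> f)) (tgt (g \<cdot>\<^bsub>preadd_cat\<^esub> f)) (fst (fn (g \<cdot>\<^bsub>preadd_cat\<^esub> f))) (snd (fn (g \<cdot>\<^bsub>preadd_cat\<^esub> f)))"
  using additive_functor_comp[OF f g[unfolded e]] by (simp add: preadd_cat_def)
 fix h :: "('o, 'm) preadd_functor"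
 assume e': "src h = tgt g"
 obtain S fo fm T where F: "f = \<lparr>src = S, fn = (fo, fm), tgt = T\<rparr>" by (cases f) auto
 interpret F: additive_functor S T fo fm using f unfolding F by simp
 obtain go gm U where G: "g = \<lparr>src = T, fn = (go, gm), tgt = U\<rparr>" using e F by (cases g) auto
 obtain ho hm V where H: "h = \<lparr>src = U, fn = (ho, hm), tgt = V\<rparr>" using e' G by (cases h) auto
 have 1: "compose (PObj S) (compose (PObj T) ho go) fo = compose (PObj S) ho (compose (PObj S) go fo)"
  using F.fo_PObj by (auto simp: compose_def fun_eq_iff)
 have 2: "curry (\<lambda>(t, h)\<in>PObj S \<times> PObj S. compose (car (PHom S t h))
    (curry (\<lambda>(t, h)\<in>PObj T \<times> PObj T. compose (car (PHom T t h)) (hm (go t) (go h)) (gm t h)) (fo t) (fo h)) (fm t h))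
  = curry (\<lambda>(t, h)\<in>PObj S \<times> PObj S. compose (car (PHom S t h)) (hm (compose (PObj S) go fo t) (compose (PObj S) go fo h))
    (curry (\<lambda>(t, h)\<in>PObj S \<times> PObj S. compose (car (PHom S t h)) (gm (fo t) (fo h)) (fm t h)) t h))"
 proof (rule family_eqI[OF curry_restrict(1) curry_restrict(1)])
  fix t h assume o: "t:PObj S" "h:PObj S"
  have "compose (car (PHom S t h)) (compose (car (PHom T (fo t) (fo h))) (hm (go (fo t)) (go (fo h))) (gm (fo t) (fo h))) (fm t h)
   = compose (car (PHom S t h)) (hm (go (fo t)) (go (fo h))) (compose (car (PHom S t h)) (gm (fo t) (fo h)) (fm t h))"
   using hom_in_carrier[OF F.fm_hom[OF o]] by (auto simp: compose_def fun_eq_iff)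
  then show "curry (\<lambda>(t, h)\<in>PObj S \<times> PObj S. compose (car (PHom S t h))
    (curry (\<lambda>(t, h)\<in>PObj T \<times> PObj T. compose (car (PHom T t h)) (hm (go t) (go h)) (gm t h)) (fo t) (fo h)) (fm t h)) t h
  = curry (\<lambda>(t, h)\<in>PObj S \<times> PObj S. compose (car (PHom S t h)) (hm (compose (PObj S) go fo t) (compose (PObj S) go fo h))
    (curry (\<lambda>(t, h)\<in>PObj S \<times> PObj S. compose (car (PHom S t h)) (gm (fo t) (fo h)) (fm t h)) t h)) t h"
   unfolding curry_restrict(2)[OF o] curry_restrict(2)[OF F.fo_PObj[OF o(1)] F.fo_PObj[OF o(2)]] compose_eq[OF o(1)] compose_eq[OF o(2)] .
 qed
 show "(h \<cdot>\<^bsub>preadd_cat\<^esub> g) \<cdot>\<^bsub>preadd_cat\<^esub> f = h \<cdot>\<^bsub>preadd_cat\<^esub> (g \<cdot>\<^bsub>preadd_cat\<^esub> f)"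
  unfolding F G H preadd_cat_def category.simps arrow.simps preadd.simps fst_conv snd_conv 1 2 ..
qed

text \<open>Four conditions on a composite of double transformations are instances of this pasting
  of two commuting squares: the two naturalities and the compatibilities with \<open>FComp\<close>
  and \<open>FUnit\<close>.\<close>

lemma (in category) paste:
 assumes "t:hom_arr C x y" "u:hom_arr C y z" "t':hom_arr C x' y'" "u':hom_arr C y' z'"
  "p:hom_arr C x x'" "q:hom_arr C y y'" "r:hom_arr C z z'" "t' \<cdot> p = q \<cdot> t" "u' \<cdot> q = r \<cdot> u"
 shows "(u' \<cdot> t') \<cdot> p = r \<cdot> (u \<cdot> t)"
proof -
 have "(u' \<cdot> t') \<cdot> p = u' \<cdot> (q \<cdot> t)" using assms by (simp add: hom_arr_def Comp_assoc)
 also have "\<dots> = (r \<cdot> u) \<cdot> t" using assms by (simp add: hom_arr_def flip: Comp_assoc)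
 finally show ?thesis using assms by (simp add: hom_arr_def Comp_assoc)
qed

lemma (in category) hom_Comp: "t:hom_arr C x y ==> u:hom_arr C y z ==> u \<cdot> t:hom_arr C x z"
 by (simp add: hom_arr_def Comp_Arr Dom_Comp Cod_Comp)

lemma (in category) hom_Ident: "x:Obj C ==> Ident C x:hom_arr C x x"
 by (simp add: hom_arr_def Ident_Arr Dom_Ident Cod_Ident)

lemma (in category) Ident_hom:
 assumes "p:hom_arr C x y"
 shows "Ident C y \<cdot> p = p" "p \<cdot> Ident C x = p" "x:Obj C" "y:Obj C"
 using assms Comp_Ident_left[of p] Comp_Ident_right[of p] Dom_Obj[of p] Cod_Obj[of p] by (auto simp: hom_arr_def)

lemma (in cat_functor) AMap_hom: "f:hom_arr A x y ==> AMap F f:hom_arr B (OMap F x) (OMap F y)"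
 by (auto simp: hom_arr_def AMap_Arr Dom_AMap Cod_AMap)

section \<open>Composition of double transformations\<close>

lemma (in double_category) HComp_hom:
 assumes "\<delta>:hom_arr (Horz D) g g'" "\<epsilon>:hom_arr (Horz D) f f'" "AMap (Rgt D) \<delta> = AMap (Lft D) \<epsilon>"
 shows "\<delta> \<star>\<star> \<epsilon>:hom_arr (Horz D) (g \<star> f) (g' \<star> f')"
 using HComp.AMap_hom[of "(\<delta>, \<epsilon>)" "(g, f)" "(g', f')"] assms by (simp add: hom_arr_def pullback_cat_def)

lemma (in double_category) interchange:
 assumes "\<delta>:hom_arr (Horz D) g g'" "\<epsilon>:hom_arr (Horz D) f f'" "AMap (Rgt D) \<delta> = AMap (Lft D) \<epsilon>"
  and "\<delta>':hom_arr (Horz D) g' g''" "\<epsilon>':hom_arr (Horz D) f' f''" "AMap (Rgt D) \<delta>' = AMap (Lft D) \<epsilon>'"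
 shows "(\<delta>' \<cdot>\<^bsub>Horz D\<^esub> \<delta>) \<star>\<star> (\<epsilon>' \<cdot>\<^bsub>Horz D\<^esub> \<epsilon>) = (\<delta>' \<star>\<star> \<epsilon>') \<cdot>\<^bsub>Horz D\<^esub> (\<delta> \<star>\<star> \<epsilon>)"
 using HComp.AMap_Comp[of "(\<delta>', \<epsilon>')" "(\<delta>, \<epsilon>)"] assms by (simp add: hom_arr_def pullback_cat_def)

text \<open>For compatibility with \<open>FComp\<close>, the interchange law first splits the
  horizontal composite of the vertical composites; for \<open>FUnit\<close>, functoriality of
  \<open>Delta\<close> does so. Then the squares are pasted.\<close>

lemma double_transformation_comp:
 assumes "double_transformation D E F F' T0 T1" "double_transformation D E F' F'' U0 U1"
 shows "double_transformation D E F F'' (\<lambda>x\<in>Obj (Vert D). U0 x \<cdot>\<^bsub>Vert E\<^esub> T0 x) (\<lambda>f\<in>Obj (Horz D). U1 f \<cdot>\<^bsub>Horz E\<^esub> T1 f)"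
proof -
 let ?W0 = "\<lambda>x\<in>Obj (Vert D). U0 x \<cdot>\<^bsub>Vert E\<^esub> T0 x"
 let ?W1 = "\<lambda>f\<in>Obj (Horz D). U1 f \<cdot>\<^bsub>Horz E\<^esub> T1 f"
 interpret T: double_transformation D E F F' T0 T1 by fact
 interpret U: double_transformation D E F' F'' U0 U1 by fact
 have F'': "double_functor D E F''" by (rule double_transformation.axioms(2)[OF assms(2)])
 have hD: "\<theta>:Arr (Vert D) ==> \<theta>:hom_arr (Vert D) (Dom (Vert D) \<theta>) (Cod (Vert D) \<theta>)"
  "\<epsilon>:Arr (Horz D) ==> \<epsilon>:hom_arr (Horz D) (Dom (Horz D) \<epsilon>) (Cod (Horz D) \<epsilon>)" for \<theta> \<epsilon>
  by (simp_all add: hom_arr_def)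
 note oD = T.F.D.Delta.A.Dom_Obj T.F.D.Delta.A.Cod_Obj T.F.D.Delta.B.Dom_Obj T.F.D.Delta.B.Cod_Obj
 show ?thesis
 proof (rule double_transformation.intro[OF T.F.double_functor_axioms F''], rule double_transformation_axioms.intro)
  show "(?W0) x:hom_arr (Vert E) (OMap (Fun0 F) x) (OMap (Fun0 F'') x)"
   if "x:Obj (Vert D)" for x using T.F.E.Delta.A.hom_Comp[OF T.T0_hom U.T0_hom] that by simp
  show "(?W1) f:hom_arr (Horz E) (OMap (Fun1 F) f) (OMap (Fun1 F'') f)"
   if "f:Obj (Horz D)" for f using T.F.E.Delta.B.hom_Comp[OF T.T1_hom U.T1_hom] that by simp
  show "(?W0) (Cod (Vert D) \<theta>) \<cdot>\<^bsub>Vert E\<^esub> AMap (Fun0 F) \<theta> =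
    AMap (Fun0 F'') \<theta> \<cdot>\<^bsub>Vert E\<^esub> (?W0) (Dom (Vert D) \<theta>)"
   if t: "\<theta>:Arr (Vert D)" for \<theta>
   unfolding restrict_apply'[OF oD(1)[OF t]] restrict_apply'[OF oD(2)[OF t]]
   by (rule T.F.E.Delta.A.paste[OF T.T0_hom[OF oD(1)[OF t]] U.T0_hom[OF oD(1)[OF t]] T.T0_hom[OF oD(2)[OF t]] U.T0_hom[OF oD(2)[OF t]]
    T.F.Fun0.AMap_hom[OF hD(1)[OF t]] T.F'.Fun0.AMap_hom[OF hD(1)[OF t]] U.F'.Fun0.AMap_hom[OF hD(1)[OF t]]
    T.T0_natural[OF t] U.T0_natural[OF t]])
  show "(?W1) (Cod (Horz D) \<epsilon>) \<cdot>\<^bsub>Horz E\<^esub> AMap (Fun1 F) \<epsilon> =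
    AMap (Fun1 F'') \<epsilon> \<cdot>\<^bsub>Horz E\<^esub> (?W1) (Dom (Horz D) \<epsilon>)"
   if t: "\<epsilon>:Arr (Horz D)" for \<epsilon>
   unfolding restrict_apply'[OF oD(3)[OF t]] restrict_apply'[OF oD(4)[OF t]]
   by (rule T.F.E.Delta.B.paste[OF T.T1_hom[OF oD(3)[OF t]] U.T1_hom[OF oD(3)[OF t]] T.T1_hom[OF oD(4)[OF t]] U.T1_hom[OF oD(4)[OF t]]
    T.F.Fun1.AMap_hom[OF hD(2)[OF t]] T.F'.Fun1.AMap_hom[OF hD(2)[OF t]] U.F'.Fun1.AMap_hom[OF hD(2)[OF t]]
    T.T1_natural[OF t] U.T1_natural[OF t]])
 next
  fix f assume f: "f:Obj (Horz D)"
  have o: "OMap (Lft D) f:Obj (Vert D)" "OMap (Rgt D) f:Obj (Vert D)"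
   using T.F.D.Lft.OMap_Obj[OF f] T.F.D.Rgt.OMap_Obj[OF f] .
  note h = T.T1_hom[OF f, unfolded hom_arr_def] U.T1_hom[OF f, unfolded hom_arr_def]
  show "AMap (Lft E) ((?W1) f) = (?W0) (OMap (Lft D) f)"
   "AMap (Rgt E) ((?W1) f) = (?W0) (OMap (Rgt D) f)"
   unfolding restrict_apply'[OF f] restrict_apply'[OF o(1)] restrict_apply'[OF o(2)]
   using h T.F.E.Lft.AMap_Comp[of "U1 f" "T1 f"] T.F.E.Rgt.AMap_Comp[of "U1 f" "T1 f"]
   by (simp_all add: T.Lft_T1[OF f] U.Lft_T1[OF f] T.Rgt_T1[OF f] U.Rgt_T1[OF f])
 next
  fix g f assume gf: "(g, f):Obj (hcomposable D)"
  then have o: "g:Obj (Horz D)" "f:Obj (Horz D)" "OMap (Rgt D) g = OMap (Lft D) f" by (auto simp: pullback_cat_def)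
  have m: "AMap (Rgt E) (T1 g) = AMap (Lft E) (T1 f)" "AMap (Rgt E) (U1 g) = AMap (Lft E) (U1 f)"
   using o by (simp_all add: T.Rgt_T1 T.Lft_T1 U.Rgt_T1 U.Lft_T1)
  have c: "g \<star>\<^bsub>D\<^esub> f:Obj (Horz D)" using T.F.D.HComp.OMap_Obj[OF gf] .
  show "(?W1) (g \<star>\<^bsub>D\<^esub> f) \<cdot>\<^bsub>Horz E\<^esub> FComp F (g, f) =
    FComp F'' (g, f) \<cdot>\<^bsub>Horz E\<^esub> ((?W1) g \<star>\<star>\<^bsub>E\<^esub> (?W1) f)"
   unfolding restrict_apply'[OF c] restrict_apply'[OF o(1)] restrict_apply'[OF o(2)]
    T.F.E.interchange[OF T.T1_hom[OF o(1)] T.T1_hom[OF o(2)] m(1) U.T1_hom[OF o(1)] U.T1_hom[OF o(2)] m(2)]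
   by (rule T.F.E.Delta.B.paste[OF T.F.E.HComp_hom[OF T.T1_hom[OF o(1)] T.T1_hom[OF o(2)] m(1)] T.F.E.HComp_hom[OF U.T1_hom[OF o(1)] U.T1_hom[OF o(2)] m(2)]
    T.T1_hom[OF c] U.T1_hom[OF c] T.F.FComp_hom[OF gf] T.F'.FComp_hom[OF gf] U.F'.FComp_hom[OF gf] T.T1_FComp[OF gf] U.T1_FComp[OF gf]])
 next
  fix x assume x: "x:Obj (Vert D)"
  have c: "OMap (Delta D) x:Obj (Horz D)" using T.F.D.Delta.OMap_Obj[OF x] .
  have e: "AMap (Delta E) (U0 x \<cdot>\<^bsub>Vert E\<^esub> T0 x) = AMap (Delta E) (U0 x) \<cdot>\<^bsub>Horz E\<^esub> AMap (Delta E) (T0 x)"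
   using T.T0_hom[OF x] U.T0_hom[OF x] by (intro T.F.E.Delta.AMap_Comp) (simp_all add: hom_arr_def)
  show "(?W1) (OMap (Delta D) x) \<cdot>\<^bsub>Horz E\<^esub> FUnit F x =
    FUnit F'' x \<cdot>\<^bsub>Horz E\<^esub> AMap (Delta E) ((?W0) x)"
   unfolding restrict_apply'[OF c] restrict_apply'[OF x] e
   by (rule T.F.E.Delta.B.paste[OF T.F.E.Delta.AMap_hom[OF T.T0_hom[OF x]] T.F.E.Delta.AMap_hom[OF U.T0_hom[OF x]] T.T1_hom[OF c] U.T1_hom[OF c]
    T.F.FUnit_hom[OF x] T.F'.FUnit_hom[OF x] U.F'.FUnit_hom[OF x] T.T1_FUnit[OF x] U.T1_FUnit[OF x]])
 qed simp_all
qed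

lemma double_transformation_id:
 assumes "double_functor D E F"
 shows "double_transformation D E F F (\<lambda>x\<in>Obj (Vert D). Ident (Vert E) (OMap (Fun0 F) x)) (\<lambda>f\<in>Obj (Horz D). Ident (Horz E) (OMap (Fun1 F) f))"
proof -
 let ?W0 = "\<lambda>x\<in>Obj (Vert D). Ident (Vert E) (OMap (Fun0 F) x)"
 let ?W1 = "\<lambda>f\<in>Obj (Horz D). Ident (Horz E) (OMap (Fun1 F) f)"
 interpret F: double_functor D E F by fact
 have hD: "\<theta>:Arr (Vert D) ==> \<theta>:hom_arr (Vert D) (Dom (Vert D) \<theta>) (Cod (Vert D) \<theta>)"
  "\<epsilon>:Arr (Horz D) ==> \<epsilon>:hom_arr (Horz D) (Dom (Horz D) \<epsilon>) (Cod (Horz D) \<epsilon>)" for \<theta> \<epsilon>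
  by (simp_all add: hom_arr_def)
 note oD = F.D.Delta.A.Dom_Obj F.D.Delta.A.Cod_Obj F.D.Delta.B.Dom_Obj F.D.Delta.B.Cod_Obj
 show ?thesis
 proof (rule double_transformation.intro[OF assms assms], rule double_transformation_axioms.intro)
  show "(?W0) x:hom_arr (Vert E) (OMap (Fun0 F) x) (OMap (Fun0 F) x)"
   if "x:Obj (Vert D)" for x using F.E.Delta.A.hom_Ident[OF F.Fun0.OMap_Obj] that by simp
  show "(?W1) f:hom_arr (Horz E) (OMap (Fun1 F) f) (OMap (Fun1 F) f)"
   if "f:Obj (Horz D)" for f using F.E.Delta.B.hom_Ident[OF F.Fun1.OMap_Obj] that by simp
  show "(?W0) (Cod (Vert D) \<theta>) \<cdot>\<^bsub>Vert E\<^esub> AMap (Fun0 F) \<theta> =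
    AMap (Fun0 F) \<theta> \<cdot>\<^bsub>Vert E\<^esub> (?W0) (Dom (Vert D) \<theta>)"
   if t: "\<theta>:Arr (Vert D)" for \<theta>
   using oD(1,2)[OF t] F.E.Delta.A.Ident_hom(1,2)[OF F.Fun0.AMap_hom[OF hD(1)[OF t]]] by simp
  show "(?W1) (Cod (Horz D) \<epsilon>) \<cdot>\<^bsub>Horz E\<^esub> AMap (Fun1 F) \<epsilon> =
    AMap (Fun1 F) \<epsilon> \<cdot>\<^bsub>Horz E\<^esub> (?W1) (Dom (Horz D) \<epsilon>)"
   if t: "\<epsilon>:Arr (Horz D)" for \<epsilon>
   using oD(3,4)[OF t] F.E.Delta.B.Ident_hom(1,2)[OF F.Fun1.AMap_hom[OF hD(2)[OF t]]] by simp
 next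
  fix f assume f: "f:Obj (Horz D)"
  show "AMap (Lft E) ((?W1) f) = (?W0) (OMap (Lft D) f)"
   "AMap (Rgt E) ((?W1) f) = (?W0) (OMap (Rgt D) f)"
   using f F.D.Lft.OMap_Obj[OF f] F.D.Rgt.OMap_Obj[OF f] F.E.Lft.AMap_Ident[OF F.Fun1.OMap_Obj[OF f]]
    F.E.Rgt.AMap_Ident[OF F.Fun1.OMap_Obj[OF f]] F.Lft_Obj[OF f] F.Rgt_Obj[OF f] by simp_all
 next
  fix g f assume gf: "(g, f):Obj (hcomposable D)"
  then have o: "g:Obj (Horz D)" "f:Obj (Horz D)" "OMap (Rgt D) g = OMap (Lft D) f" by (auto simp: pullback_cat_def)
  have c: "g \<star>\<^bsub>D\<^esub> f:Obj (Horz D)" using F.D.HComp.OMap_Obj[OF gf] .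
  have e: "(OMap (Fun1 F) g, OMap (Fun1 F) f):Obj (hcomposable E)"
   using o F.Fun1.OMap_Obj F.Rgt_Obj F.Lft_Obj by (simp add: pullback_cat_def)
  have "Ident (Horz E) (OMap (Fun1 F) g) \<star>\<star>\<^bsub>E\<^esub> Ident (Horz E) (OMap (Fun1 F) f) = Ident (Horz E) (OMap (Fun1 F) g \<star>\<^bsub>E\<^esub> OMap (Fun1 F) f)"
   using F.E.HComp.AMap_Ident[OF e] by (simp add: pullback_cat_def)
  then show "(?W1) (g \<star>\<^bsub>D\<^esub> f) \<cdot>\<^bsub>Horz E\<^esub> FComp F (g, f) =
    FComp F (g, f) \<cdot>\<^bsub>Horz E\<^esub> ((?W1) g \<star>\<star>\<^bsub>E\<^esub> (?W1) f)"
   unfolding restrict_apply'[OF c] restrict_apply'[OF o(1)] restrict_apply'[OF o(2)]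
   using F.E.Delta.B.Ident_hom(1,2)[OF F.FComp_hom[OF gf]] by simp
 next
  fix x assume x: "x:Obj (Vert D)"
  show "(?W1) (OMap (Delta D) x) \<cdot>\<^bsub>Horz E\<^esub> FUnit F x =
    FUnit F x \<cdot>\<^bsub>Horz E\<^esub> AMap (Delta E) ((?W0) x)"
   unfolding restrict_apply'[OF F.D.Delta.OMap_Obj[OF x]] restrict_apply'[OF x] F.E.Delta.AMap_Ident[OF F.Fun0.OMap_Obj[OF x]]
   using F.E.Delta.B.Ident_hom(1,2)[OF F.FUnit_hom[OF x]] by simp
 qed simp_all
qed

lemma double_functor_cat_sel [simp]:
 "Obj (double_functor_cat D E) = {F. double_functor D E F}"
 "Arr (double_functor_cat D E) = {t. double_transformation D E (src t) (tgt t) (fst (fn t)) (snd (fn t))}"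
 "Dom (double_functor_cat D E) = src" "Cod (double_functor_cat D E) = tgt"
 by (simp_all add: double_functor_cat_def)

theorem category_double_functor_cat:
 fixes D :: "('o, 'v, 'h, 's) double_cat" and E :: "('o1, 'v1, 'h1, 's1) double_cat"
 shows "category (double_functor_cat D E)"
proof (rule category.intro, unfold double_functor_cat_sel mem_Collect_eq)
 fix F :: "('o, 'v, 'h, 's, 'o1, 'v1, 'h1, 's1) double_fctr"
 show "double_transformation D E (src (Ident (double_functor_cat D E) F)) (tgt (Ident (double_functor_cat D E) F))
   (fst (fn (Ident (double_functor_cat D E) F))) (snd (fn (Ident (double_functor_cat D E) F)))"
  if "double_functor D E F"
  using double_transformation_id[OF that] by (simp add: double_functor_cat_def)
 show "src (Ident (double_functor_cat D E) F) = F" "tgt (Ident (double_functor_cat D E) F) = F" by (simp_all add: double_functor_cat_def)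
next
 fix t :: "('o, 'v, 'h, 's, 'o1, 'v1, 'h1, 's1) double_trans"
 assume t: "double_transformation D E (src t) (tgt t) (fst (fn t)) (snd (fn t))"
 show "double_functor D E (src t)" "double_functor D E (tgt t)" using double_transformation.axioms(1,2)[OF t] .
 obtain F T0 T1 F' where T: "t = \<lparr>src = F, fn = (T0, T1), tgt = F'\<rparr>" by (cases t) auto
 interpret T: double_transformation D E F F' T0 T1 using t unfolding T by simp
 have 1: "(\<lambda>x\<in>Obj (Vert D). (\<lambda>x\<in>Obj (Vert D). Ident (Vert E) (OMap (Fun0 F') x)) x \<cdot>\<^bsub>Vert E\<^esub> T0 x) = T0"
  "(\<lambda>x\<in>Obj (Vert D). T0 x \<cdot>\<^bsub>Vert E\<^esub> (\<lambda>x\<in>Obj (Vert D). Ident (Vert E) (OMap (Fun0 F) x)) x) = T0"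
  by (rule extensionalityI[OF _ T.extensional(1)]; use T.F.E.Delta.A.Ident_hom(1,2)[OF T.T0_hom] in simp)+
 have 2: "(\<lambda>x\<in>Obj (Horz D). (\<lambda>x\<in>Obj (Horz D). Ident (Horz E) (OMap (Fun1 F') x)) x \<cdot>\<^bsub>Horz E\<^esub> T1 x) = T1"
  "(\<lambda>x\<in>Obj (Horz D). T1 x \<cdot>\<^bsub>Horz E\<^esub> (\<lambda>x\<in>Obj (Horz D). Ident (Horz E) (OMap (Fun1 F) x)) x) = T1"
  by (rule extensionalityI[OF _ T.extensional(2)]; use T.F.E.Delta.B.Ident_hom(1,2)[OF T.T1_hom] in simp)+
 show "Ident (double_functor_cat D E) (tgt t) \<cdot>\<^bsub>double_functor_cat D E\<^esub> t = t"
  "t \<cdot>\<^bsub>double_functor_cat D E\<^esub> Ident (double_functor_cat D E) (src t) = t"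
  unfolding T double_functor_cat_def category.simps arrow.simps fst_conv snd_conv 1 2 by (rule refl)+
next
 fix g f :: "('o, 'v, 'h, 's, 'o1, 'v1, 'h1, 's1) double_trans"
 let ?K = "double_functor_cat D E"
 show "src (g \<cdot>\<^bsub>?K\<^esub> f) = src f" "tgt (g \<cdot>\<^bsub>?K\<^esub> f) = tgt g" by (simp_all add: double_functor_cat_def)
 assume g: "double_transformation D E (src g) (tgt g) (fst (fn g)) (snd (fn g))"
  and f: "double_transformation D E (src f) (tgt f) (fst (fn f)) (snd (fn f))" and e: "src g = tgt f"
 show "double_transformation D E (src (g \<cdot>\<^bsub>?K\<^esub> f)) (tgt (g \<cdot>\<^bsub>?K\<^esub> f)) (fst (fn (g \<cdot>\<^bsub>?K\<^esub> f))) (snd (fn (g \<cdot>\<^bsub>?K\<^esub> f)))"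
  using double_transformation_comp[OF f g[unfolded e]] by (simp add: double_functor_cat_def)
 fix h :: "('o, 'v, 'h, 's, 'o1, 'v1, 'h1, 's1) double_trans"
 assume h: "double_transformation D E (src h) (tgt h) (fst (fn h)) (snd (fn h))" and e': "src h = tgt g"
 interpret F: double_transformation D E "src f" "tgt f" "fst (fn f)" "snd (fn f)" by (rule f)
 interpret G: double_transformation D E "src g" "tgt g" "fst (fn g)" "snd (fn g)" by (rule g)
 interpret H: double_transformation D E "src h" "tgt h" "fst (fn h)" "snd (fn h)" by (rule h)
 have 1: "(fst (fn h) x \<cdot>\<^bsub>Vert E\<^esub> fst (fn g) x) \<cdot>\<^bsub>Vert E\<^esub> fst (fn f) x = fst (fn h) x \<cdot>\<^bsub>Vert E\<^esub> (fst (fn g) x \<cdot>\<^bsub>Vert E\<^esub> fst (fn f) x)"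
  if "x:Obj (Vert D)" for x
  using F.T0_hom[OF that] G.T0_hom[OF that] H.T0_hom[OF that] e e' by (intro F.F.E.Delta.A.Comp_assoc) (simp_all add: hom_arr_def)
 have 2: "(snd (fn h) x \<cdot>\<^bsub>Horz E\<^esub> snd (fn g) x) \<cdot>\<^bsub>Horz E\<^esub> snd (fn f) x = snd (fn h) x \<cdot>\<^bsub>Horz E\<^esub> (snd (fn g) x \<cdot>\<^bsub>Horz E\<^esub> snd (fn f) x)"
  if "x:Obj (Horz D)" for x
  using F.T1_hom[OF that] G.T1_hom[OF that] H.T1_hom[OF that] e e' by (intro F.F.E.Delta.B.Comp_assoc) (simp_all add: hom_arr_def)
 show "(h \<cdot>\<^bsub>?K\<^esub> g) \<cdot>\<^bsub>?K\<^esub> f = h \<cdot>\<^bsub>?K\<^esub> (g \<cdot>\<^bsub>?K\<^esub> f)"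
  by (simp add: double_functor_cat_def 1 2 cong: restrict_cong)
qed

section \<open>The species of a double functor\<close>

lemma sum_group_hom_eq:
 assumes G: "\<And>i. i:I ==> group (G i)" and "group K" "h:hom (sum_group I G) K" "k:hom (sum_group I G) K"
  "\<And>i x. i:I ==> x:car (G i) ==> h (summand I G i x) = k (summand I G i x)" "a:car (sum_group I G)"
 shows "h a = k a"
proof (rule spans_hom_eq[OF sum_group[OF G] assms(2-4) _ _ assms(6)])
 show "spans (sum_group I G) (\<Union>i\<in>I. summand I G i ` car (G i))"
  by (rule spans_sum_group[OF G]) (auto simp: spans_def intro: generate.incl)
qed (use assms(5) in auto)

lemma sum_group_biadditive_eq:
 assumes G: "\<And>i. i:I ==> group (G i)" and H: "\<And>j. j:J ==> group (H j)" and K: "group K"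
  and m: "biadditive (sum_group I G) (sum_group J H) K m" and m': "biadditive (sum_group I G) (sum_group J H) K m'"
  and eq: "\<And>i j x y. i:I ==> j:J ==> x:car (G i) ==> y:car (H j) ==>
   m (summand I G i x) (summand J H j y) = m' (summand I G i x) (summand J H j y)"
  and "a:car (sum_group I G)" "b:car (sum_group J H)"
 shows "m a b = m' a b"
proof (rule biadditive_spans_eq[OF sum_group[OF G] sum_group[OF H] K m m' _ _ _ assms(7,8)])
 show "spans (sum_group I G) (\<Union>i\<in>I. summand I G i ` car (G i))" "spans (sum_group J H) (\<Union>j\<in>J. summand J H j ` car (H j))"
  by (rule spans_sum_group; (auto simp: spans_def G H intro: generate.incl))+
qed (use eq in auto)

text \<open>Currying again: for fixed \<open>i\<close> and \<open>x\<close> the maps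
  \<open>m i j x\<close> lift over the second sum, and these lifts depend additively on
  \<open>x\<close>, so that they lift over the first.\<close>

lemma sum_group_bilift:
 assumes G: "\<And>i. i:I ==> group (G i)" and H: "\<And>j. j:J ==> group (H j)" and K: "comm_group K"
  and m: "\<And>i j. i:I ==> j:J ==> biadditive (G i) (H j) K (m i j)"
 obtains M where "biadditive (sum_group I G) (sum_group J H) K M"
  "\<And>i j x y. i:I ==> j:J ==> x:car (G i) ==> y:car (H j) ==>
   M (summand I G i x) (summand J H j y) = m i j x y"
proof -
 let ?S = "sum_group J H" and ?L = "hom_group (sum_group J H) K"
 interpret K: comm_group K by fact
 have gS: "group ?S" by (rule sum_group[OF H])
 have "\<forall>i x. \<exists>k. i:I \<longrightarrow> x:car (G i) \<longrightarrow> k:car ?L \<and> (\<forall>j\<in>J. \<forall>y\<in>car (H j). k (summand J H j y) = m i j x y)"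
 proof (intro allI)
  fix i x
  show "\<exists>k. i:I \<longrightarrow> x:car (G i) \<longrightarrow> k:car ?L \<and> (\<forall>j\<in>J. \<forall>y\<in>car (H j). k (summand J H j y) = m i j x y)"
  proof (cases "i:I \<and> x:car (G i)")
   case True
   obtain k where k: "k:hom ?S K" "\<And>j y. j:J ==> y:car (H j) ==> k (summand J H j y) = m i j x y"
    by (rule sum_group_lift[of J H K "\<lambda>j. m i j x"]) (use True H K biadditiveD(1)[OF m] in auto)
   show ?thesis
    by (intro exI[of _ "restrict k (car ?S)"])
     (use k in \<open>auto simp: hom_group_def hom_restrict_iff[OF gS] summand_closed[OF H]\<close>)
  qed auto
 qed
 then obtain l where l: "\<And>i x. i:I ==> x:car (G i) ==> l i x:car ?L"
  "\<And>i x j y. i:I ==> x:car (G i) ==> j:J ==> y:car (H j) ==> l i x (summand J H j y) = m i j x y" by metis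
 have L: "comm_group ?L" by (rule comm_group_hom_group[OF gS K])
 interpret L: comm_group ?L by (rule L)
 have lh: "l i:hom (G i) ?L" if i: "i:I" for i
 proof (rule homI)
  fix x y assume x: "x:car (G i)" and y: "y:car (G i)"
  interpret Gi: group "G i" by (rule G[OF i])
  show "l i (x \<otimes>\<^bsub>G i\<^esub> y) = l i x \<otimes>\<^bsub>?L\<^esub> l i y"
  proof (rule extensionalityI[of _ "car ?S"])
   show "l i (x \<otimes>\<^bsub>G i\<^esub> y):extensional (car ?S)" "l i x \<otimes>\<^bsub>?L\<^esub> l i y:extensional (car ?S)"
    using l(1)[OF i Gi.m_closed[OF x y]] by (simp_all add: hom_group_def)
   fix b assume b: "b:car ?S"
   show "l i (x \<otimes>\<^bsub>G i\<^esub> y) b = (l i x \<otimes>\<^bsub>?L\<^esub> l i y) b"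
   proof (rule sum_group_hom_eq[OF H K.is_group _ _ _ b])
    show "l i (x \<otimes>\<^bsub>G i\<^esub> y):hom ?S K" "l i x \<otimes>\<^bsub>?L\<^esub> l i y:hom ?S K"
     using l(1)[OF i Gi.m_closed[OF x y]] L.m_closed[OF l(1)[OF i x] l(1)[OF i y]] by (simp_all add: hom_group_def)
    fix j z assume j: "j:J" and z: "z:car (H j)"
    have sc: "summand J H j z:car ?S" by (rule summand_closed) (use H j z in auto)
    show "l i (x \<otimes>\<^bsub>G i\<^esub> y) (summand J H j z) = (l i x \<otimes>\<^bsub>?L\<^esub> l i y) (summand J H j z)"
     using i j x y z sc biadditiveD(4)[OF m[OF i j] x y z]
     by (simp add: l(2) hom_group_def)
   qed
  qed
 qed (use l(1) that in blast)
 obtain M where M: "M:hom (sum_group I G) ?L" "\<And>i x. i:I ==> x:car (G i) ==> M (summand I G i x) = l i x"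
  by (rule sum_group_lift[of I G ?L l]) (use G L lh in auto)
 show ?thesis
  by (rule that[OF biadditive_hom_group[OF sum_group[OF G] gS M(1)]]) (simp_all add: M(2) l(2))
qed

text \<open>A homomorphism preserves the unit, so acting coordinatewise can only shrink the
  support.\<close>

lemma sum_group_map:
 assumes G: "\<And>i. i:I ==> group (G i)" and H: "\<And>i. i:I ==> group (H i)"
  and h: "\<And>i. i:I ==> h i:hom (G i) (H i)"
 shows "(\<lambda>a. \<lambda>i\<in>I. h i (a i)):hom (sum_group I G) (sum_group I H)"
  and "i:I ==> (\<lambda>j\<in>I. h j (summand I G i x j)) = summand I H i (h i x)"
proof -
 have one: "h i \<one>\<^bsub>G i\<^esub> = \<one>\<^bsub>H i\<^esub>" if "i:I" for i
  by (rule hom_one[OF h[OF that] G[OF that] H[OF that]])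
 have fin: "finite {i:I. h i (a i) \<noteq> \<one>\<^bsub>H i\<^esub>}" if "finite {i:I. a i \<noteq> \<one>\<^bsub>G i\<^esub>}" for a
  by (rule finite_subset[OF _ that]) (use one in auto)
 have cl: "a:car (sum_group I G) ==> i:I ==> a i:car (G i)" for a i
  using carrier_sum_group[of I G] G by (auto simp: PiE_def Pi_def)
 show "(\<lambda>a. \<lambda>i\<in>I. h i (a i)):hom (sum_group I G) (sum_group I H)"
 proof (rule homI)
  fix a assume a: "a:car (sum_group I G)"
  show "(\<lambda>i\<in>I. h i (a i)):car (sum_group I H)"
   using cl[OF a] hom_in_carrier[OF h] fin[of a] a carrier_sum_group[of I G] carrier_sum_group[of I H] G H
   by (auto cong: conj_cong)
  fix b assume b: "b:car (sum_group I G)"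
  show "(\<lambda>i\<in>I. h i ((a \<otimes>\<^bsub>sum_group I G\<^esub> b) i)) = (\<lambda>i\<in>I. h i (a i)) \<otimes>\<^bsub>sum_group I H\<^esub> (\<lambda>i\<in>I. h i (b i))"
   using cl[OF a] cl[OF b] hom_mult[OF h] by (auto simp: fun_eq_iff)
 qed
 show "i:I ==> (\<lambda>j\<in>I. h j (summand I G i x j)) = summand I H i (h i x)"
  by (auto simp: summand_def fun_eq_iff one)
qed

text \<open>The bimodules of the species of a double functor have this form, with horizontal
  morphisms between two given objects as indices; the bimodule laws are proved with index set and
  summands left abstract.\<close>

definition sum_bimod :: "'r ring \<Rightarrow> 'r ring \<Rightarrow> 'i set \<Rightarrow> ('i \<Rightarrow> ('r, 'a) bimod) \<Rightarrow> ('r, 'i \<Rightarrow> 'a) bimod" where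
 "sum_bimod Q R I M = \<lparr>lring = Q, rring = R, bgrp = sum_group I (\<lambda>i. bgrp (M i)),
  lact = (\<lambda>q a. \<lambda>i\<in>I. lact (M i) q (a i)), ract = (\<lambda>a r. \<lambda>i\<in>I. ract (M i) (a i) r)\<rparr>"

lemma sum_bimod_sel [simp]:
 "lring (sum_bimod Q R I M) = Q" "rring (sum_bimod Q R I M) = R"
 "bgrp (sum_bimod Q R I M) = sum_group I (\<lambda>i. bgrp (M i))"
 by (simp_all add: sum_bimod_def)

locale bimodule_family =
 fixes Q R :: "'r ring" and I :: "'i set" and M :: "'i \<Rightarrow> ('r, 'a) bimod"
 assumes Q: "ring Q" and R: "ring R"
  and bimodule: "i:I ==> bimodule (M i)" and lring: "i:I ==> lring (M i) = Q" and rring: "i:I ==> rring (M i) = R"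
begin

abbreviation "\<iota> \<equiv> summand I (\<lambda>i. bgrp (M i))"

lemma group: "i:I ==> group (bgrp (M i))"
 by (rule bimodule_group[OF bimodule])

lemma comm_group_sum: "comm_group (sum_group I (\<lambda>i. bgrp (M i)))"
 by (rule comm_group_sum_group) (rule bimodule.comm_group[OF bimodule])

lemma component: "a:bcar (sum_bimod Q R I M) ==> i:I ==> a i:bcar (M i)"
 using carrier_sum_group[of I "\<lambda>i. bgrp (M i)"] group by (auto simp: PiE_def Pi_def)

lemma eqI:
 assumes "a:extensional I" "b:extensional I" "\<And>i. i:I ==> a i = b i"
 shows "a = b"
 using extensionalityI[OF assms] .

lemma ext: "a:bcar (sum_bimod Q R I M) ==> a:extensional I"
 using carrier_sum_group[of I "\<lambda>i. bgrp (M i)"] group by (auto simp: PiE_def)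

lemma lact_sum_hom: "q:car Q ==> lact (sum_bimod Q R I M) q:hom (bgrp (sum_bimod Q R I M)) (bgrp (sum_bimod Q R I M))"
 and lact_\<iota>: "q:car Q ==> i:I ==> lact (sum_bimod Q R I M) q (\<iota> i x) = \<iota> i (lact (M i) q x)"
 using sum_group_map[of I "\<lambda>i. bgrp (M i)" "\<lambda>i. bgrp (M i)" "\<lambda>i. lact (M i) q"] group lact_hom[OF bimodule, of _ q] lring
 by (simp_all add: sum_bimod_def)

lemma ract_sum_hom: "r:car R ==> (\<lambda>a. ract (sum_bimod Q R I M) a r):hom (bgrp (sum_bimod Q R I M)) (bgrp (sum_bimod Q R I M))"
 and ract_\<iota>: "r:car R ==> i:I ==> ract (sum_bimod Q R I M) (\<iota> i x) r = \<iota> i (ract (M i) x r)"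
 using sum_group_map[of I "\<lambda>i. bgrp (M i)" "\<lambda>i. bgrp (M i)" "\<lambda>i x. ract (M i) x r"] group ract_hom[OF bimodule, of _ r] rring
 by (simp_all add: sum_bimod_def)

lemma bimodule_sum: "bimodule (sum_bimod Q R I M)"
proof (rule bimodule.intro, unfold sum_bimod_sel)
 let ?S = "sum_bimod Q R I M"
 have cS: "bcar ?S = car (sum_group I (\<lambda>i. bgrp (M i)))" by simp
 have v: "lact ?S q a = (\<lambda>i\<in>I. lact (M i) q (a i))" "ract ?S a r = (\<lambda>i\<in>I. ract (M i) (a i) r)" for q a r
  by (simp_all add: sum_bimod_def)
 note c = component[unfolded cS] and e = ext[unfolded cS]
 show "ring Q" "ring R" by (rule Q, rule R)
 show "comm_group (sum_group I (\<lambda>i. bgrp (M i)))" by (rule comm_group_sum)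
 note lh = lact_sum_hom[unfolded sum_bimod_sel] and rh = ract_sum_hom[unfolded sum_bimod_sel]
 fix q q' r r' a b
 assume a: "a:car (sum_group I (\<lambda>i. bgrp (M i)))"
 {
  assume q: "q:car Q"
  show "lact ?S q a:car (sum_group I (\<lambda>i. bgrp (M i)))" by (rule hom_in_carrier[OF lh[OF q] a])
  show "lact ?S q (a \<otimes>\<^bsub>sum_group I (\<lambda>i. bgrp (M i))\<^esub> b) = lact ?S q a \<otimes>\<^bsub>sum_group I (\<lambda>i. bgrp (M i))\<^esub> lact ?S q b"
   if b: "b:car (sum_group I (\<lambda>i. bgrp (M i)))" by (rule hom_mult[OF lh[OF q] a b])
  show "lact ?S (q \<oplus>\<^bsub>Q\<^esub> q') a = lact ?S q a \<otimes>\<^bsub>sum_group I (\<lambda>i. bgrp (M i))\<^esub> lact ?S q' a" if "q':car Q"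
   unfolding v mult_sum_group using bimodule.add_lact[OF bimodule, of _ q q'] c[OF a] lring q that by (auto simp: fun_eq_iff)
  show "lact ?S (q \<otimes>\<^bsub>Q\<^esub> q') a = lact ?S q (lact ?S q' a)" if "q':car Q"
   unfolding v using bimodule.mult_lact[OF bimodule, of _ q q'] c[OF a] lring q that by (auto simp: fun_eq_iff)
  show "ract ?S (lact ?S q a) r = lact ?S q (ract ?S a r)" if "r:car R"
   unfolding v using bimodule.lact_ract[OF bimodule, of _ q _ r] c[OF a] lring rring q that by (auto simp: fun_eq_iff)
 }
 {
  assume r: "r:car R"
  show "ract ?S a r:car (sum_group I (\<lambda>i. bgrp (M i)))" by (rule hom_in_carrier[OF rh[OF r] a])
  show "ract ?S (a \<otimes>\<^bsub>sum_group I (\<lambda>i. bgrp (M i))\<^esub> b) r = ract ?S a r \<otimes>\<^bsub>sum_group I (\<lambda>i. bgrp (M i))\<^esub> ract ?S b r"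
   if b: "b:car (sum_group I (\<lambda>i. bgrp (M i)))" by (rule hom_mult[OF rh[OF r] a b])
  show "ract ?S a (r \<oplus>\<^bsub>R\<^esub> r') = ract ?S a r \<otimes>\<^bsub>sum_group I (\<lambda>i. bgrp (M i))\<^esub> ract ?S a r'" if "r':car R"
   unfolding v mult_sum_group using bimodule.add_ract[OF bimodule, of _ r r'] c[OF a] rring r that by (auto simp: fun_eq_iff)
  show "ract ?S a (r \<otimes>\<^bsub>R\<^esub> r') = ract ?S (ract ?S a r) r'" if "r':car R"
   unfolding v using bimodule.mult_ract[OF bimodule, of _ r r'] c[OF a] rring r that by (auto simp: fun_eq_iff)
 }
 show "lact ?S \<one>\<^bsub>Q\<^esub> a = a" unfolding v
  by (rule eqI[OF _ e[OF a]]) (use bimodule.one_lact[OF bimodule] c[OF a] lring in auto)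
 show "ract ?S a \<one>\<^bsub>R\<^esub> = a" unfolding v
  by (rule eqI[OF _ e[OF a]]) (use bimodule.one_ract[OF bimodule] c[OF a] rring in auto)
qed

end

section \<open>Composition maps of a double functor into bimodules\<close>

locale bimod_functor = double_functor D "BIMOD :: ('u::infinite ring, 'u ring_map, ('u, 'u) bimod, 'u square) double_cat" F
 for D :: "('o, 'v, 'h, 's) double_cat" and F :: "('o, 'v, 'h, 's, 'u::infinite) bimod_fctr"
begin

abbreviation "V \<equiv> Obj (Vert D)"
abbreviation "H y x \<equiv> horizontals D y x"
abbreviation "F0 x \<equiv> OMap (Fun0 F) x"
abbreviation "F1 f \<equiv> OMap (Fun1 F) f"
abbreviation "M y x \<equiv> sp_mod (species_of D F) y x"
abbreviation "\<kappa> g f b a \<equiv> fn (FComp F (g, f)) (tens (F1 g) (F1 f) b a)"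
abbreviation "\<iota> y x \<equiv> summand (H y x) (\<lambda>f. bgrp (F1 f))"

lemma species_of_sel [simp]:
 "sp_obj (species_of D F) = V" "sp_ring (species_of D F) x = F0 x"
 "sp_mod (species_of D F) y x = sum_bimod (F0 y) (F0 x) (H y x) (\<lambda>f. F1 f)"
 by (simp_all add: species_of_def sum_bimod_def)

lemma horizontal:
 assumes "f:H y x"
 shows "bimodule (F1 f)" "lring (F1 f) = F0 y" "rring (F1 f) = F0 x" "f:Obj (Horz D)"
 using assms Fun1.OMap_Obj[of f] Lft_Obj[of f] Rgt_Obj[of f] by (auto simp: horizontals_def)

lemma family: "y:V ==> x:V ==> bimodule_family (F0 y) (F0 x) (H y x) (\<lambda>f. F1 f)"
 by (rule bimodule_family.intro) (use Fun0.OMap_Obj horizontal in auto)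

lemma hcomp:
 assumes g: "g:H z y" and f: "f:H y x"
 shows "(g, f):Obj (hcomposable D)" "g \<star>\<^bsub>D\<^esub> f:H z x" "FComp F (g, f):squares"
  "src (FComp F (g, f)) = btens (F1 g) (F1 f)" "tgt (FComp F (g, f)) = F1 (g \<star>\<^bsub>D\<^esub> f)"
  "lmor (FComp F (g, f)) = rid (F0 z)" "rmor (FComp F (g, f)) = rid (F0 x)"
proof -
 show *: "(g, f):Obj (hcomposable D)" using g f by (simp add: horizontals_def pullback_cat_sel)
 show "g \<star>\<^bsub>D\<^esub> f:H z x"
  using D.HComp.OMap_Obj[OF *] D.Lft_HComp_Obj[OF *] D.Rgt_HComp_Obj[OF *] g f by (simp add: horizontals_def)
 show "FComp F (g, f):squares" "src (FComp F (g, f)) = btens (F1 g) (F1 f)" "tgt (FComp F (g, f)) = F1 (g \<star>\<^bsub>D\<^esub> f)"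
  using FComp_hom[OF *] by (simp_all add: hom_arr_def)
 show "lmor (FComp F (g, f)) = rid (F0 z)" "rmor (FComp F (g, f)) = rid (F0 x)"
  using Lft_FComp[OF *] Rgt_FComp[OF *] g f by (simp_all add: horizontals_def)
qed

lemma pair: "g:H z y ==> f:H y x ==> ubimodule_pair (F1 g) (F1 f)"
 by (rule ubimodule_pairI) (simp_all add: horizontal)

lemma balanced_\<kappa>:
 assumes "g:H z y" "f:H y x"
 shows "balanced (F1 g) (F1 f) (bgrp (F1 (g \<star>\<^bsub>D\<^esub> f))) (\<kappa> g f)"
proof (rule balanced_hom[OF ubimodule_pair.balanced_tens[OF pair[OF assms]]])
 show "fn (FComp F (g, f)):hom (uten (F1 g) (F1 f)) (bgrp (F1 (g \<star>\<^bsub>D\<^esub> f)))"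
  using squaresD(9)[OF hcomp(3)[OF assms]] hcomp(4,5)[OF assms] by simp
qed

text \<open>The comparison square \<open>FComp F (g, f)\<close> has identity ring maps on its
  boundary, so it is linear over the outer rings in the plain sense.\<close>

lemma \<kappa>_lact:
 assumes "g:H z y" "f:H y x" "q:car (F0 z)" "b:bcar (F1 g)" "a:bcar (F1 f)"
 shows "\<kappa> g f (lact (F1 g) q b) a = lact (F1 (g \<star>\<^bsub>D\<^esub> f)) q (\<kappa> g f b a)"
 using square_lact[OF hcomp(3)[OF assms(1,2)], of q "tens (F1 g) (F1 f) b a"] hcomp(4-6)[OF assms(1,2)]
  horizontal[OF assms(1)] horizontal[OF assms(2)] assms(3-5) by simp

lemma \<kappa>_ract:
 assumes "g:H z y" "f:H y x" "r:car (F0 x)" "b:bcar (F1 g)" "a:bcar (F1 f)"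
 shows "\<kappa> g f b (ract (F1 f) a r) = ract (F1 (g \<star>\<^bsub>D\<^esub> f)) (\<kappa> g f b a) r"
 using square_ract[OF hcomp(3)[OF assms(1,2)], of "tens (F1 g) (F1 f) b a" r] hcomp(4,5,7)[OF assms(1,2)]
  horizontal[OF assms(1)] horizontal[OF assms(2)] assms(3-5) by simp

context
 fixes z y x
 assumes o: "z:V" "y:V" "x:V"
begin

interpretation ZY: bimodule_family "F0 z" "F0 y" "H z y" "\<lambda>f. F1 f" by (rule family[OF o(1,2)])
interpretation YX: bimodule_family "F0 y" "F0 x" "H y x" "\<lambda>f. F1 f" by (rule family[OF o(2,3)])
interpretation ZX: bimodule_family "F0 z" "F0 x" "H z x" "\<lambda>f. F1 f" by (rule family[OF o(1,3)])

lemma M_pair: "bimodule_pair (M z y) (M y x)"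
 unfolding species_of_sel
 by (intro bimodule_pair.intro bimodule_pair_axioms.intro ZY.bimodule_sum YX.bimodule_sum) simp

lemma biadditive_M_eq:
 assumes "group K" "biadditive (bgrp (M z y)) (bgrp (M y x)) K m" "biadditive (bgrp (M z y)) (bgrp (M y x)) K m'"
  "\<And>g f b a. g:H z y ==> f:H y x ==> b:bcar (F1 g) ==> a:bcar (F1 f) ==> m (\<iota> z y g b) (\<iota> y x f a) = m' (\<iota> z y g b) (\<iota> y x f a)"
  "b:bcar (M z y)" "a:bcar (M y x)"
 shows "m b a = m' b a"
 by (rule sum_group_biadditive_eq[OF ZY.group YX.group assms(1) assms(2)[unfolded species_of_sel sum_bimod_sel]
  assms(3)[unfolded species_of_sel sum_bimod_sel] assms(4) assms(5)[unfolded species_of_sel sum_bimod_sel] assms(6)[unfolded species_of_sel sum_bimod_sel]])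

text \<open>The maps \<kappa> for pairs of horizontal morphisms are first assembled to a biadditive
  map \<open>m\<close> on the two direct sums. It is balanced over the middle ring and therefore
  descends to the tensor product, where it is identified with the \<open>THE\<close> in the
  definition.\<close>

lemma compositions_hom: "compositions_of D F z y x:hom (tensor_group (M z y) (M y x)) (bgrp (M z x))"
 and compositions_\<iota>: "\<And>g f b a. g:H z y ==> f:H y x ==> b:bcar (F1 g) ==> a:bcar (F1 f) ==>
   compositions_of D F z y x (tensor_elem (M z y) (M y x) (\<iota> z y g b) (\<iota> y x f a)) = \<iota> z x (g \<star>\<^bsub>D\<^esub> f) (\<kappa> g f b a)"
proof -
 let ?K = "sum_group (H z x) (\<lambda>f. bgrp (F1 f))"
 have bi: "biadditive (bgrp (F1 g)) (bgrp (F1 f)) ?K (\<lambda>b a. \<iota> z x (g \<star>\<^bsub>D\<^esub> f) (\<kappa> g f b a))"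
  if "g:H z y" "f:H y x" for g f
  using balanced_hom[OF balanced_\<kappa>[OF that] summand_hom[of "H z x" "\<lambda>f. bgrp (F1 f)", OF ZX.group hcomp(2)[OF that]]] by (simp add: balanced_def)
 obtain m where m: "biadditive (sum_group (H z y) (\<lambda>f. bgrp (F1 f))) (sum_group (H y x) (\<lambda>f. bgrp (F1 f))) ?K m"
  "\<And>g f b a. g:H z y ==> f:H y x ==> b:bcar (F1 g) ==> a:bcar (F1 f) ==>
   m (\<iota> z y g b) (\<iota> y x f a) = \<iota> z x (g \<star>\<^bsub>D\<^esub> f) (\<kappa> g f b a)"
 proof (rule sum_group_bilift[of "H z y" "\<lambda>f. bgrp (F1 f)" "H y x" "\<lambda>f. bgrp (F1 f)" ?K
   "\<lambda>g f b a. \<iota> z x (g \<star>\<^bsub>D\<^esub> f) (\<kappa> g f b a)", OF ZY.group YX.group ZX.comm_group_sum bi])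
  fix k assume k: "biadditive (sum_group (H z y) (\<lambda>f. bgrp (F1 f))) (sum_group (H y x) (\<lambda>f. bgrp (F1 f))) ?K k"
   "\<And>g f b a. g:H z y ==> f:H y x ==> b:bcar (F1 g) ==> a:bcar (F1 f) ==>
    k (\<iota> z y g b) (\<iota> y x f a) = \<iota> z x (g \<star>\<^bsub>D\<^esub> f) (\<kappa> g f b a)"
  show thesis by (rule that[of k]) (rule k(1), rule k(2))
 qed
 have m': "biadditive (bgrp (M z y)) (bgrp (M y x)) ?K m" using m(1) by simp
 have gK: "group ?K" using ZX.comm_group_sum by (simp add: comm_group_def)
 note mD = biadditiveD[OF m']
 interpret P: bimodule_pair "M z y" "M y x" by (rule M_pair)
 \<comment> \<open>Balancedness is itself an equation between biadditive maps on direct sums, so it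
   reduces to summands, where it is the balancedness of \<kappa>.\<close>
 have bal: "m (ract (M z y) b r) a = m b (lact (M y x) r a)" if r: "r:car (F0 y)" and b: "b:bcar (M z y)" and a: "a:bcar (M y x)" for r b a
 proof (rule biadditive_M_eq[OF gK _ _ _ b a])
  have rh: "(\<lambda>b. ract (M z y) b r):hom (bgrp (M z y)) (bgrp (M z y))" using ZY.ract_sum_hom[OF r] by simp
  have lh: "lact (M y x) r:hom (bgrp (M y x)) (bgrp (M y x))" using YX.lact_sum_hom[OF r] by simp
  show "biadditive (bgrp (M z y)) (bgrp (M y x)) ?K (\<lambda>b a. m (ract (M z y) b r) a)"
   by (rule biadditiveI) (simp_all only: mD hom_in_carrier[OF rh] hom_mult[OF rh])
  show "biadditive (bgrp (M z y)) (bgrp (M y x)) ?K (\<lambda>b a. m b (lact (M y x) r a))"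
   by (rule biadditiveI) (simp_all only: mD hom_in_carrier[OF lh] hom_mult[OF lh])
  fix g f b a assume g: "g:H z y" and f: "f:H y x" and b: "b:bcar (F1 g)" and a: "a:bcar (F1 f)"
  have r': "r:car (rring (F1 g))" "r:car (lring (F1 f))" using r horizontal[OF g] horizontal[OF f] by simp_all
  show "m (ract (M z y) (\<iota> z y g b) r) (\<iota> y x f a) = m (\<iota> z y g b) (lact (M y x) r (\<iota> y x f a))"
   unfolding species_of_sel ZY.ract_\<iota>[OF r g] YX.lact_\<iota>[OF r f]
    m(2)[OF g f bimodule.ract_closed[OF horizontal(1)[OF g] b r'(1)] a]
    m(2)[OF g f b bimodule.lact_closed[OF horizontal(1)[OF f] r'(2) a]]
    balancedD(4)[OF balanced_\<kappa>[OF g f] b r'(1) a] ..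
 qed
 have "balanced (M z y) (M y x) ?K m" using m' bal by (simp add: balanced_def)
 then obtain h where h: "h:hom (tensor_group (M z y) (M y x)) ?K"
  "\<And>b a. b:bcar (M z y) ==> a:bcar (M y x) ==> h (tensor_elem (M z y) (M y x) b a) = m b a"
  using P.tensor_group_lift[of ?K m, OF ZX.comm_group_sum] by metis
 have h': "h:hom (tensor_group (M z y) (M y x)) (bgrp (M z x))" using h(1) by simp
 have gT: "group (tensor_group (M z y) (M y x))" using P.comm_group_tensor_group by (simp add: comm_group_def)
 have i: "\<iota> z y g b:bcar (M z y)" if "g:H z y" "b:bcar (F1 g)" for g b
  using summand_closed[of "H z y" "\<lambda>f. bgrp (F1 f)"] ZY.group that by simp
 have i': "\<iota> y x f a:bcar (M y x)" if "f:H y x" "a:bcar (F1 f)" for f a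
  using summand_closed[of "H y x" "\<lambda>f. bgrp (F1 f)"] YX.group that by simp
 have gK': "group (bgrp (M z x))" using gK by simp
 have eq: "compositions_of D F z y x = restrict h (car (tensor_group (M z y) (M y x)))"
  unfolding compositions_of_def Let_def
 proof (rule the_hom_eq[OF gT gK' h' P.spans_tensor_group])
  show "\<forall>g\<in>H z y. \<forall>f\<in>H y x. \<forall>b\<in>bcar (F1 g). \<forall>a\<in>bcar (F1 f).
    restrict h (car (tensor_group (M z y) (M y x))) (tensor_elem (M z y) (M y x) (\<iota> z y g b) (\<iota> y x f a)) = \<iota> z x (g \<star>\<^bsub>D\<^esub> f) (\<kappa> g f b a)"
   by (intro ballI) (simp only: restrict_apply'[OF P.tensor_elem_closed[OF i i']] h(2)[OF i i'] m(2))
  fix k t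
  assume k: "k:hom (tensor_group (M z y) (M y x)) (bgrp (M z x))"
   and K: "\<forall>g\<in>H z y. \<forall>f\<in>H y x. \<forall>b\<in>bcar (F1 g). \<forall>a\<in>bcar (F1 f).
    k (tensor_elem (M z y) (M y x) (\<iota> z y g b) (\<iota> y x f a)) = \<iota> z x (g \<star>\<^bsub>D\<^esub> f) (\<kappa> g f b a)"
   and t: "t:case_prod (tensor_elem (M z y) (M y x)) ` (bcar (M z y) \<times> bcar (M y x))"
  from t obtain p where p: "t = case_prod (tensor_elem (M z y) (M y x)) p" "p:bcar (M z y) \<times> bcar (M y x)" by (rule imageE)
  obtain b a where "p = (b, a)" by (cases p)
  with p have ba: "t = tensor_elem (M z y) (M y x) b a" "b:bcar (M z y)" "a:bcar (M y x)"
   by (simp_all only: case_prod_conv mem_Sigma_iff)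
  have "biadditive (bgrp (M z y)) (bgrp (M y x)) (bgrp (M z x)) (\<lambda>b a. k (tensor_elem (M z y) (M y x) b a))"
   using balanced_hom[OF P.balanced_tensor_elem k] by (simp only: balanced_def)
  moreover have "biadditive (bgrp (M z y)) (bgrp (M y x)) (bgrp (M z x)) (\<lambda>b a. h (tensor_elem (M z y) (M y x) b a))"
   using balanced_hom[OF P.balanced_tensor_elem h'] by (simp only: balanced_def)
  \<comment> \<open>The specification prescribes \<open>k\<close> only on tensors of elements of
    single summands; biadditivity extends the agreement to all pure tensors, which span.\<close>
  ultimately have "k (tensor_elem (M z y) (M y x) b a) = h (tensor_elem (M z y) (M y x) b a)"
  proof (rule biadditive_M_eq[OF gK' _ _ _ ba(2,3)])
   fix g f b a assume g: "g:H z y" and f: "f:H y x" and b: "b:bcar (F1 g)" and a: "a:bcar (F1 f)"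
   show "k (tensor_elem (M z y) (M y x) (\<iota> z y g b) (\<iota> y x f a)) = h (tensor_elem (M z y) (M y x) (\<iota> z y g b) (\<iota> y x f a))"
    unfolding K[rule_format, OF g f b a] h(2)[OF i[OF g b] i'[OF f a]] m(2)[OF g f b a] ..
  qed
  then show "k t = h t" unfolding ba(1) .
 qed
 show "compositions_of D F z y x:hom (tensor_group (M z y) (M y x)) (bgrp (M z x))"
  unfolding eq hom_restrict_iff[OF gT] by (rule h')
 fix g f b a assume g: "g:H z y" and f: "f:H y x" and b: "b:bcar (F1 g)" and a: "a:bcar (F1 f)"
 show "compositions_of D F z y x (tensor_elem (M z y) (M y x) (\<iota> z y g b) (\<iota> y x f a)) = \<iota> z x (g \<star>\<^bsub>D\<^esub> f) (\<kappa> g f b a)"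
  unfolding eq restrict_apply'[OF P.tensor_elem_closed[OF i[OF g b] i'[OF f a]]] h(2)[OF i[OF g b] i'[OF f a]] by (rule m(2)[OF g f b a])
qed

abbreviation (input) "\<mu> b a \<equiv> compositions_of D F z y x (tensor_elem (M z y) (M y x) b a)"

lemma biadditive_\<mu>: "biadditive (bgrp (M z y)) (bgrp (M y x)) (bgrp (M z x)) (\<lambda>b a. \<mu> b a)"
 using balanced_hom[OF bimodule_pair.balanced_tensor_elem[OF M_pair] compositions_hom] by (simp only: balanced_def)

lemma group_M: "group (bgrp (M z x))"
 using ZX.comm_group_sum by (simp add: comm_group_def)

lemma compositions_lact:
 assumes q: "q:car (F0 z)" and b: "b:bcar (M z y)" and a: "a:bcar (M y x)"
 shows "\<mu> (lact (M z y) q b) a = lact (M z x) q (\<mu> b a)"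
proof (rule biadditive_M_eq[OF group_M _ _ _ b a])
 note mD = biadditiveD[OF biadditive_\<mu>]
 have lh: "lact (M z y) q:hom (bgrp (M z y)) (bgrp (M z y))" using ZY.lact_sum_hom[OF q] by simp
 have lh': "lact (M z x) q:hom (bgrp (M z x)) (bgrp (M z x))" using ZX.lact_sum_hom[OF q] by simp
 show "biadditive (bgrp (M z y)) (bgrp (M y x)) (bgrp (M z x)) (\<lambda>b a. \<mu> (lact (M z y) q b) a)"
  by (rule biadditiveI) (simp_all only: mD hom_in_carrier[OF lh] hom_mult[OF lh])
 show "biadditive (bgrp (M z y)) (bgrp (M y x)) (bgrp (M z x)) (\<lambda>b a. lact (M z x) q (\<mu> b a))"
  by (rule biadditiveI) (simp_all only: mD hom_in_carrier[OF lh'] hom_mult[OF lh'])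
 fix g f b a assume g: "g:H z y" and f: "f:H y x" and b: "b:bcar (F1 g)" and a: "a:bcar (F1 f)"
 have q': "q:car (lring (F1 g))" using q horizontal[OF g] by simp
 have "lact (M z y) q (\<iota> z y g b) = \<iota> z y g (lact (F1 g) q b)" using ZY.lact_\<iota>[OF q g] by simp
 moreover have "lact (M z x) q (\<iota> z x (g \<star>\<^bsub>D\<^esub> f) c) = \<iota> z x (g \<star>\<^bsub>D\<^esub> f) (lact (F1 (g \<star>\<^bsub>D\<^esub> f)) q c)" for c
  using ZX.lact_\<iota>[OF q hcomp(2)[OF g f]] by simp
 ultimately show "\<mu> (lact (M z y) q (\<iota> z y g b)) (\<iota> y x f a) = lact (M z x) q (\<mu> (\<iota> z y g b) (\<iota> y x f a))"
  by (simp only: compositions_\<iota>[OF g f bimodule.lact_closed[OF horizontal(1)[OF g] q' b] a] compositions_\<iota>[OF g f b a] \<kappa>_lact[OF g f q b a])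
qed

lemma compositions_ract:
 assumes r: "r:car (F0 x)" and b: "b:bcar (M z y)" and a: "a:bcar (M y x)"
 shows "\<mu> b (ract (M y x) a r) = ract (M z x) (\<mu> b a) r"
proof (rule biadditive_M_eq[OF group_M _ _ _ b a])
 note mD = biadditiveD[OF biadditive_\<mu>]
 have rh: "(\<lambda>a. ract (M y x) a r):hom (bgrp (M y x)) (bgrp (M y x))" using YX.ract_sum_hom[OF r] by simp
 have rh': "(\<lambda>a. ract (M z x) a r):hom (bgrp (M z x)) (bgrp (M z x))" using ZX.ract_sum_hom[OF r] by simp
 show "biadditive (bgrp (M z y)) (bgrp (M y x)) (bgrp (M z x)) (\<lambda>b a. \<mu> b (ract (M y x) a r))"
  by (rule biadditiveI) (simp_all only: mD hom_in_carrier[OF rh] hom_mult[OF rh])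
 show "biadditive (bgrp (M z y)) (bgrp (M y x)) (bgrp (M z x)) (\<lambda>b a. ract (M z x) (\<mu> b a) r)"
  by (rule biadditiveI) (simp_all only: mD hom_in_carrier[OF rh'] hom_mult[OF rh'])
 fix g f b a assume g: "g:H z y" and f: "f:H y x" and b: "b:bcar (F1 g)" and a: "a:bcar (F1 f)"
 have r': "r:car (rring (F1 f))" using r horizontal[OF f] by simp
 have "ract (M y x) (\<iota> y x f a) r = \<iota> y x f (ract (F1 f) a r)" using YX.ract_\<iota>[OF r f] by simp
 moreover have "ract (M z x) (\<iota> z x (g \<star>\<^bsub>D\<^esub> f) c) r = \<iota> z x (g \<star>\<^bsub>D\<^esub> f) (ract (F1 (g \<star>\<^bsub>D\<^esub> f)) c r)" for c
  using ZX.ract_\<iota>[OF r hcomp(2)[OF g f]] by simp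
 ultimately show "\<mu> (\<iota> z y g b) (ract (M y x) (\<iota> y x f a) r) = ract (M z x) (\<mu> (\<iota> z y g b) (\<iota> y x f a)) r"
  by (simp only: compositions_\<iota>[OF g f b bimodule.ract_closed[OF horizontal(1)[OF f] a r']] compositions_\<iota>[OF g f b a] \<kappa>_ract[OF g f r b a])
qed

end

theorem species_composition_of: "species_composition (species_of D F) (compositions_of D F)"
proof (rule species_composition.intro)
 show "species (species_of D F)"
  by (rule species.intro) (use Fun0.OMap_Obj bimodule_family.bimodule_sum[OF family] in simp_all)
 show "species_composition_axioms (species_of D F) (compositions_of D F)"
  by (rule species_composition_axioms.intro)
   (use compositions_hom compositions_lact compositions_ract in \<open>simp_all only: species_of_sel(1,2)\<close>)
qed

end

section \<open>Double transformations as maps of species\<close>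

lemma double_transformation_square:
 assumes "double_transformation D BIMOD F F' T0 T1" "f:horizontals D y x"
 shows "T1 f:squares" "src (T1 f) = OMap (Fun1 F) f" "tgt (T1 f) = OMap (Fun1 F') f" "lmor (T1 f) = T0 y" "rmor (T1 f) = T0 x"
proof -
 interpret double_transformation D BIMOD F F' T0 T1 by fact
 have f: "f:Obj (Horz D)" "OMap (Lft D) f = y" "OMap (Rgt D) f = x" using assms(2) by (simp_all add: horizontals_def)
 show "T1 f:squares" "src (T1 f) = OMap (Fun1 F) f" "tgt (T1 f) = OMap (Fun1 F') f" "lmor (T1 f) = T0 y" "rmor (T1 f) = T0 x"
  using T1_hom[OF f(1)] Lft_T1[OF f(1)] Rgt_T1[OF f(1)] f(2,3) by (simp_all add: hom_arr_def)
qed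

definition species_map :: "('o, 'v, 'h, 's) double_cat \<Rightarrow> ('h \<Rightarrow> 'u square) \<Rightarrow> 'o \<Rightarrow> 'o \<Rightarrow> ('h \<Rightarrow> 'u) \<Rightarrow> 'h \<Rightarrow> 'u" where
 "species_map D T1 y x a = (\<lambda>f\<in>horizontals D y x. fn (T1 f) (a f))"

text \<open>The functions of the squares \<open>T1 f\<close> assemble to a map of direct sums,
  linear because each square is. Compatibility with the composition maps is the axiom relating
  \<open>T1\<close> to \<open>FComp\<close>, evaluated at a pure tensor from two summands and
  extended by biadditivity.\<close>

theorem species_morphism_of:
 fixes D :: "('o, 'v, 'h, 's) double_cat" and F F' :: "('o, 'v, 'h, 's, 'u::infinite) bimod_fctr"
 assumes "double_transformation D BIMOD F F' T0 T1"
 shows "species_morphism (species_of D F) (compositions_of D F) (species_of D F') (compositions_of D F')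
  (\<lambda>x. fn (T0 x)) (species_map D T1)"
proof -
 interpret A: bimod_functor D F by (rule bimod_functor.intro[OF double_transformation.axioms(1)[OF assms]])
 interpret B: bimod_functor D F' by (rule bimod_functor.intro[OF double_transformation.axioms(2)[OF assms]])
 note sq = double_transformation_square[OF assms]
 have T0: "T0 x:ring_maps" "src (T0 x) = A.F0 x" "tgt (T0 x) = B.F0 x" if "x:A.V" for x
  using double_transformation.T0_hom[OF assms that] by (simp_all add: hom_arr_def)
 have h: "fn (T1 f):hom (bgrp (A.F1 f)) (bgrp (B.F1 f))" if "f:A.H y x" for f y x
  using squaresD(9)[OF sq(1)[OF that]] sq(2,3)[OF that] by simp
 have gr: "group (bgrp (A.F1 f))" "group (bgrp (B.F1 f))" if "f:A.H y x" for f y x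
  using bimodule_group[OF A.horizontal(1)[OF that]] bimodule_group[OF B.horizontal(1)[OF that]] .
 have hom: "species_map D T1 y x:hom (bgrp (A.M y x)) (bgrp (B.M y x))" for y x
  unfolding A.species_of_sel B.species_of_sel sum_bimod_sel species_map_def
  by (rule sum_group_map(1)) (use h gr in blast)+
 have \<iota>: "species_map D T1 y x (A.\<iota> y x f a) = B.\<iota> y x f (fn (T1 f) a)" if "f:A.H y x" for y x f a
  unfolding species_map_def
  by (rule sum_group_map(2)) (use that h gr in blast)+
 have comp: "a f:bcar (A.F1 f)" if "y:A.V" "x:A.V" "a:bcar (A.M y x)" "f:A.H y x" for y x a f
  using bimodule_family.component[OF A.family[OF that(1,2)] _ that(4)] that(3) by simp
 have \<kappa>: "fn (T1 (g \<star>\<^bsub>D\<^esub> f)) (A.\<kappa> g f b a) = B.\<kappa> g f (fn (T1 g) b) (fn (T1 f) a)"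
  if g: "g:A.H z y" and f: "f:A.H y x" and b: "b:bcar (A.F1 g)" and a: "a:bcar (A.F1 f)" for g f b a z y x
 proof -
  have t: "tens (A.F1 g) (A.F1 f) b a:bcar (btens (A.F1 g) (A.F1 f))"
   using A.horizontal[OF g] A.horizontal[OF f] a b by simp
  have "fn (T1 (g \<star>\<^bsub>D\<^esub> f) \<bullet> FComp F (g, f)) (tens (A.F1 g) (A.F1 f) b a)
   = fn (FComp F' (g, f) \<bullet> (T1 g \<diamondop> T1 f)) (tens (A.F1 g) (A.F1 f) b a)"
   by (simp only: double_transformation.T1_FComp[OF assms A.hcomp(1)[OF g f]])
  then show ?thesis
   using t A.hcomp(4)[OF g f] sq[OF g] sq[OF f] a b by simp
 qed
 have c: "species_map D T1 z x (compositions_of D F z y x (tensor_elem (A.M z y) (A.M y x) b a))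
   = compositions_of D F' z y x (tensor_elem (B.M z y) (B.M y x) (species_map D T1 z y b) (species_map D T1 y x a))"
  if o: "z:A.V" "y:A.V" "x:A.V" and b: "b:bcar (A.M z y)" and a: "a:bcar (A.M y x)" for z y x b a
 proof (rule A.biadditive_M_eq[OF o B.group_M[OF o] _ _ _ b a])
  note aD = biadditiveD[OF A.biadditive_\<mu>[OF o]] and bD = biadditiveD[OF B.biadditive_\<mu>[OF o]]
  show "biadditive (bgrp (A.M z y)) (bgrp (A.M y x)) (bgrp (B.M z x))
    (\<lambda>b a. species_map D T1 z x (compositions_of D F z y x (tensor_elem (A.M z y) (A.M y x) b a)))"
   by (rule biadditiveI) (simp_all only: aD hom_in_carrier[OF hom] hom_mult[OF hom])
  show "biadditive (bgrp (A.M z y)) (bgrp (A.M y x)) (bgrp (B.M z x))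
    (\<lambda>b a. compositions_of D F' z y x (tensor_elem (B.M z y) (B.M y x) (species_map D T1 z y b) (species_map D T1 y x a)))"
   by (rule biadditiveI) (simp_all only: bD hom_in_carrier[OF hom] hom_mult[OF hom])
  fix g f b a assume g: "g:A.H z y" and f: "f:A.H y x" and b: "b:bcar (A.F1 g)" and a: "a:bcar (A.F1 f)"
  show "species_map D T1 z x (compositions_of D F z y x (tensor_elem (A.M z y) (A.M y x) (A.\<iota> z y g b) (A.\<iota> y x f a)))
   = compositions_of D F' z y x (tensor_elem (B.M z y) (B.M y x) (species_map D T1 z y (A.\<iota> z y g b)) (species_map D T1 y x (A.\<iota> y x f a)))"
   unfolding A.compositions_\<iota>[OF o g f b a] \<iota>[OF A.hcomp(2)[OF g f]] \<iota>[OF g] \<iota>[OF f]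
    B.compositions_\<iota>[OF o g f hom_in_carrier[OF h[OF g] b] hom_in_carrier[OF h[OF f] a]] \<kappa>[OF g f b a] ..
 qed
 show ?thesis
 proof (rule species_morphism.intro[OF A.species_composition_of B.species_composition_of], rule species_morphism_axioms.intro,
   unfold A.species_of_sel(1,2) B.species_of_sel(1,2))
  fix y x assume o: "y:A.V" "x:A.V"
  show "fn (T0 x):ring_hom (A.F0 x) (B.F0 x)" using ring_mapsD(3)[OF T0(1)[OF o(2)]] T0(2,3)[OF o(2)] by simp
  fix a assume a: "a:bcar (A.M y x)"
  show "species_map D T1 y x (lact (A.M y x) q a) = lact (B.M y x) (fn (T0 y) q) (species_map D T1 y x a)"
   if q: "q:car (A.F0 y)" for q
  proof -
   have "fn (T1 f) (lact (A.F1 f) q (a f)) = lact (B.F1 f) (fn (T0 y) q) (fn (T1 f) (a f))" if f: "f:A.H y x" for f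
    using square_lact[OF sq(1)[OF f], of q "a f"] sq[OF f] A.horizontal[OF f] q comp[OF o a f] by simp
   then show ?thesis unfolding A.species_of_sel B.species_of_sel by (simp add: species_map_def sum_bimod_def cong: restrict_cong)
  qed
  show "species_map D T1 y x (ract (A.M y x) a r) = ract (B.M y x) (species_map D T1 y x a) (fn (T0 x) r)"
   if r: "r:car (A.F0 x)" for r
  proof -
   have "fn (T1 f) (ract (A.F1 f) (a f) r) = ract (B.F1 f) (fn (T1 f) (a f)) (fn (T0 x) r)" if f: "f:A.H y x" for f
    using square_ract[OF sq(1)[OF f], of "a f" r] sq[OF f] A.horizontal[OF f] r comp[OF o a f] by simp
   then show ?thesis unfolding A.species_of_sel B.species_of_sel by (simp add: species_map_def sum_bimod_def cong: restrict_cong)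
  qed
 qed (rule refl hom c; assumption?)+
qed

lemma (in species_morphism) mg_id:
 assumes "\<And>x r. x:sp_obj Sp ==> r:car (sp_ring Sp x) ==> f0 x r = r"
  and "\<And>y x a. y:sp_obj Sp ==> x:sp_obj Sp ==> a:bcar (sp_mod Sp y x) ==> f1 y x a = a"
  and xs: "xs:A.P t h" and v: "v:gens Sp xs"
 shows "mg xs v = v"
 using v xs
proof (cases rule: A.generator_cases)
 case (Word as)
 have "mw xs as = as"
  by (rule nth_equalityI) (use A.obj[OF xs Word(1,3)] path_wordsD(2)[OF Word(3)] assms(2) in auto)
 then show ?thesis by (simp add: Word(2))
qed (use assms(1) in auto)

lemma tensor_hom_map_id:
 assumes "species_morphism Sp c Sp c f0 f1"
  and id: "\<And>x r. x:sp_obj Sp ==> r:car (sp_ring Sp x) ==> f0 x r = r"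
   "\<And>y x a. y:sp_obj Sp ==> x:sp_obj Sp ==> a:bcar (sp_mod Sp y x) ==> f1 y x a = a"
  and a: "a:car (tensor_hom Sp t h)"
 shows "tensor_hom_map Sp Sp f0 f1 t h a = a"
proof -
 interpret species_morphism Sp c Sp c f0 f1 by fact
 show ?thesis by (rule \<Phi>_eqI[OF _ a]) (simp_all add: hom_def mg_id[OF id])
qed

text \<open>The third morphism is given separately and agrees with the composite on carriers only,
  because a composite of double transformations is normalised and need not be the composite of
  functions elsewhere.\<close>

lemma tensor_hom_map_comp:
 assumes f: "species_morphism Sp c Sp' c' f0 f1" and g: "species_morphism Sp' c' Sp'' c'' g0 g1"
  and h: "species_morphism Sp c Sp'' c'' h0 h1"
  and c0: "\<And>x r. x:sp_obj Sp ==> r:car (sp_ring Sp x) ==> h0 x r = g0 x (f0 x r)"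
  and c1: "\<And>y x a. y:sp_obj Sp ==> x:sp_obj Sp ==> a:bcar (sp_mod Sp y x) ==> h1 y x a = g1 y x (f1 y x a)"
  and a: "a:car (tensor_hom Sp t h)"
 shows "tensor_hom_map Sp Sp'' h0 h1 t h a = tensor_hom_map Sp' Sp'' g0 g1 t h (tensor_hom_map Sp Sp' f0 f1 t h a)"
proof (rule species_morphism.\<Phi>_eqI[OF h hom_comp[OF species_morphism.\<Phi>_hom[OF f] species_morphism.\<Phi>_hom[OF g]] a])
 interpret F: species_morphism Sp c Sp' c' f0 f1 by (rule f)
 interpret G: species_morphism Sp' c' Sp'' c'' g0 g1 by (rule g)
 fix xs v assume xs: "xs:paths (sp_obj Sp) t h" and v: "v:gens Sp xs"
 have xs': "xs:paths (sp_obj Sp') t h" using xs by (simp add: F.sp_obj_eq)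
 have "map_generator g0 g1 xs (map_generator f0 f1 xs v) = map_generator h0 h1 xs v"
  using v xs
 proof (cases rule: F.A.generator_cases)
  case (Word as)
  have "map (\<lambda>i. g1 (xs ! i) (xs ! Suc i) (map (\<lambda>i. f1 (xs ! i) (xs ! Suc i) (as ! i)) [0..<length as] ! i)) [0..<length as]
   = map (\<lambda>i. h1 (xs ! i) (xs ! Suc i) (as ! i)) [0..<length as]"
   by (rule nth_equalityI) (use F.A.obj[OF xs Word(1,3)] path_wordsD(2)[OF Word(3)] c1 in auto)
  then show ?thesis by (simp add: Word(2))
 qed (use c0 in auto)
 then show "tensor_hom_map Sp' Sp'' g0 g1 t h (tensor_hom_map Sp Sp' f0 f1 t h (in_path Sp xs (pure Sp xs v)))
   = in_path Sp'' xs (pure Sp'' xs (map_generator h0 h1 xs v))"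
  by (simp only: F.\<Phi>_E[OF xs v] G.\<Phi>_E[OF xs' F.mg_closed[OF xs v]])
qed

section \<open>The quotient construction as a functor\<close>

lemma species_category_sel:
 "PObj (tensor_category Sp) = sp_obj Sp" "PHom (tensor_category Sp) = tensor_hom Sp" "sp_obj (species_of D F) = Obj (Vert D)"
 by (simp_all add: tensor_category_def species_of_def)

abbreviation "quotient_map_of D S F F' T0 T1 \<equiv>
 preadditive_ideal_map.quotient_map (tensor_category (species_of D F)) (ideal_of D S F)
  (tensor_category (species_of D F')) (ideal_of D S F')
  (tensor_hom_map (species_of D F) (species_of D F') (\<lambda>x. fn (T0 x)) (species_map D T1))"

lemma preadditive_ideal_map_of:
 fixes D :: "('o, 'v, 'h, 's) double_cat" and F F' :: "('o, 'v, 'h, 's, 'u::infinite) bimod_fctr"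
 assumes "double_transformation D BIMOD F F' T0 T1"
 shows "preadditive_ideal_map (tensor_category (species_of D F)) (ideal_of D S F)
  (tensor_category (species_of D F')) (ideal_of D S F')
  (tensor_hom_map (species_of D F) (species_of D F') (\<lambda>x. fn (T0 x)) (species_map D T1))"
 using species_morphism.preadditive_ideal_map[OF species_morphism_of[OF assms]] unfolding ideal_of_def .

text \<open>Identifies the explicit union of cosets with the general map of quotients, so that its
  additivity and its values on cosets are at hand.\<close>

lemma quotient_functor_of_eq:
 fixes D :: "('o, 'v, 'h, 's) double_cat" and F F' :: "('o, 'v, 'h, 's, 'u::infinite) bimod_fctr"
 assumes "double_transformation D BIMOD F F' T0 T1"
 shows "quotient_functor_of D S \<lparr>src = F, fn = (T0, T1), tgt = F'\<rparr> =
  \<lparr>src = quotient_cat_of D S F, fn = (\<lambda>x\<in>Obj (Vert D). x, quotient_map_of D S F F' T0 T1), tgt = quotient_cat_of D S F'\<rparr>"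
 unfolding quotient_functor_of_def Let_def arrow.simps fst_conv snd_conv
  preadditive_ideal_map.quotient_map_def[OF preadditive_ideal_map_of[OF assms]] quotient_cat_of_def
 unfolding species_map_def[abs_def]
 by (simp only: species_category_sel)

lemma PObj_quotient_cat_of [simp]: "PObj (quotient_cat_of D S F) = Obj (Vert D)"
 by (simp add: quotient_cat_of_def quotient_preadd_def species_category_sel)

lemma preadditive_quotient_cat_of:
 fixes D :: "('o, 'v, 'h, 's) double_cat" and F :: "('o, 'v, 'h, 's, 'u::infinite) bimod_fctr"
 assumes "double_functor D BIMOD F"
 shows "preadditive_category (quotient_cat_of D S F)"
 unfolding quotient_cat_of_def ideal_of_def
 by (rule preadditive_ideal.preadditive_quotient[OF species_composition.preadditive_ideal_composition[OF
    bimod_functor.species_composition_of[OF bimod_functor.intro[OF assms]]]])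

lemma additive_functor_of:
 fixes D :: "('o, 'v, 'h, 's) double_cat" and F F' :: "('o, 'v, 'h, 's, 'u::infinite) bimod_fctr"
 assumes "double_transformation D BIMOD F F' T0 T1"
 shows "additive_functor (quotient_cat_of D S F) (quotient_cat_of D S F') (\<lambda>x\<in>Obj (Vert D). x) (quotient_map_of D S F F' T0 T1)"
 using preadditive_ideal_map.additive_functor_quotient[OF preadditive_ideal_map_of[OF assms, of S]]
 unfolding quotient_cat_of_def[symmetric] by (simp only: species_category_sel)

lemma quotient_map_of_coset:
 fixes D :: "('o, 'v, 'h, 's) double_cat" and F F' :: "('o, 'v, 'h, 's, 'u::infinite) bimod_fctr"
 assumes "double_transformation D BIMOD F F' T0 T1" "t:Obj (Vert D)" "h:Obj (Vert D)"
  "a:car (tensor_hom (species_of D F) t h)"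
 shows "quotient_map_of D S F F' T0 T1 t h (ideal_of D S F t h #>\<^bsub>tensor_hom (species_of D F) t h\<^esub> a) =
  ideal_of D S F' t h #>\<^bsub>tensor_hom (species_of D F') t h\<^esub>
   tensor_hom_map (species_of D F) (species_of D F') (\<lambda>x. fn (T0 x)) (species_map D T1) t h a"
 using preadditive_ideal_map.quotient_map_coset[OF preadditive_ideal_map_of[OF assms(1), of S], of t h a] assms(2-4)
 by (simp only: species_category_sel)

lemma carrier_quotient_cat_of:
 "car (PHom (quotient_cat_of D S F) t h) =
  (\<lambda>a. ideal_of D S F t h #>\<^bsub>tensor_hom (species_of D F) t h\<^esub> a) ` car (tensor_hom (species_of D F) t h)"
 by (simp add: quotient_cat_of_def quotient_preadd_def species_category_sel carrier_FactGroup)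

text \<open>Every morphism of the quotient is a coset, and on cosets the induced map is computed
  from a representative, which the identity transformation fixes. Extensionality of both families
  turns this into an equality.\<close>

lemma quotient_functor_of_Ident:
 fixes D :: "('o, 'v, 'h, 's) double_cat" and F :: "('o, 'v, 'h, 's, 'u::infinite) bimod_fctr"
 assumes "double_functor D BIMOD F"
 shows "quotient_functor_of D S (Ident (double_functor_cat D BIMOD) F) = Ident preadd_cat (quotient_cat_of D S F)"
proof -
 interpret bimod_functor D F by (rule bimod_functor.intro[OF assms])
 let ?T0 = "\<lambda>x\<in>Obj (Vert D). Ident (Vert BIMOD) (F0 x)" and ?T1 = "\<lambda>f\<in>Obj (Horz D). Ident (Horz BIMOD) (F1 f)"
 note T = double_transformation_id[OF assms]
 let ?\<Phi> = "tensor_hom_map (species_of D F) (species_of D F) (\<lambda>x. fn (?T0 x)) (species_map D ?T1)"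
 have id: "?\<Phi> t h a = a" if "a:car (tensor_hom (species_of D F) t h)" for t h a
 proof (rule tensor_hom_map_id[OF species_morphism_of[OF T] _ _ that])
  show "fn (?T0 x) r = r" if "x:sp_obj (species_of D F)" "r:car (sp_ring (species_of D F) x)" for x r
   using that by simp
  show "species_map D ?T1 y x a = a" if o: "y:sp_obj (species_of D F)" "x:sp_obj (species_of D F)" and a: "a:bcar (M y x)" for y x a
  proof -
   interpret N: bimodule_family "F0 y" "F0 x" "H y x" "\<lambda>f. F1 f" by (rule family) (use o in simp_all)
   have a': "a:bcar (sum_bimod (F0 y) (F0 x) (H y x) (\<lambda>f. F1 f))" using a by simp
   show ?thesis unfolding species_map_def
    by (rule extensionalityI[OF _ N.ext[OF a']]) (use N.component[OF a'] horizontal(4) in auto)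
  qed
 qed
 have "quotient_map_of D S F F ?T0 ?T1 = curry (\<lambda>(t, h)\<in>Obj (Vert D) \<times> Obj (Vert D). \<lambda>a\<in>car (PHom (quotient_cat_of D S F) t h). a)"
 proof (rule family_eqI[OF _ curry_restrict(1)])
  note af = additive_functor_of[OF T, of S]
  show "case_prod (quotient_map_of D S F F ?T0 ?T1):extensional (Obj (Vert D) \<times> Obj (Vert D))"
   using additive_functor.extensional(2)[OF af] by simp
  fix t h assume o: "t:Obj (Vert D)" "h:Obj (Vert D)"
  show "quotient_map_of D S F F ?T0 ?T1 t h = curry (\<lambda>(t, h)\<in>Obj (Vert D) \<times> Obj (Vert D). \<lambda>a\<in>car (PHom (quotient_cat_of D S F) t h). a) t h"
   unfolding curry_restrict(2)[OF o]
  proof (rule extensionalityI[of _ "car (PHom (quotient_cat_of D S F) t h)"])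
   show "quotient_map_of D S F F ?T0 ?T1 t h:extensional (car (PHom (quotient_cat_of D S F) t h))"
    using additive_functor.extensional(3)[OF af] o by simp
   fix A assume A: "A:car (PHom (quotient_cat_of D S F) t h)"
   then obtain a where a: "a:car (tensor_hom (species_of D F) t h)"
    "A = ideal_of D S F t h #>\<^bsub>tensor_hom (species_of D F) t h\<^esub> a" unfolding carrier_quotient_cat_of by (rule imageE)
   show "quotient_map_of D S F F ?T0 ?T1 t h A = (\<lambda>a\<in>car (PHom (quotient_cat_of D S F) t h). a) A"
    unfolding restrict_apply'[OF A] unfolding a(2) quotient_map_of_coset[OF T o a(1)] id[OF a(1)] ..
  qed simp
 qed
 then show ?thesis
  unfolding double_functor_cat_def category.simps quotient_functor_of_eq[OF T] by (simp add: preadd_cat_def)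
qed

text \<open>Computed on cosets, where the induced maps act on representatives and the composition
  law of the tensor maps applies; on objects both functors are the identity.\<close>

lemma quotient_functor_of_Comp:
 fixes D :: "('o, 'v, 'h, 's) double_cat" and F F' F'' :: "('o, 'v, 'h, 's, 'u::infinite) bimod_fctr"
 assumes T: "double_transformation D BIMOD F F' T0 T1" and U: "double_transformation D BIMOD F' F'' U0 U1"
 shows "quotient_functor_of D S (\<lparr>src = F', fn = (U0, U1), tgt = F''\<rparr> \<cdot>\<^bsub>double_functor_cat D BIMOD\<^esub> \<lparr>src = F, fn = (T0, T1), tgt = F'\<rparr>)
  = quotient_functor_of D S \<lparr>src = F', fn = (U0, U1), tgt = F''\<rparr> \<cdot>\<^bsub>preadd_cat\<^esub> quotient_functor_of D S \<lparr>src = F, fn = (T0, T1), tgt = F'\<rparr>"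
proof -
 interpret A: bimod_functor D F by (rule bimod_functor.intro[OF double_transformation.axioms(1)[OF T]])
 let ?V0 = "\<lambda>x\<in>Obj (Vert D). U0 x \<cdot>\<^bsub>Vert BIMOD\<^esub> T0 x" and ?V1 = "\<lambda>f\<in>Obj (Horz D). U1 f \<bullet> T1 f"
 note V = double_transformation_comp[OF T U]
 let ?Q = "quotient_cat_of D S"
 have comp: "tensor_hom_map (species_of D F) (species_of D F'') (\<lambda>x. fn (?V0 x)) (species_map D ?V1) t h a
   = tensor_hom_map (species_of D F') (species_of D F'') (\<lambda>x. fn (U0 x)) (species_map D U1) t h
    (tensor_hom_map (species_of D F) (species_of D F') (\<lambda>x. fn (T0 x)) (species_map D T1) t h a)"
  if "a:car (tensor_hom (species_of D F) t h)" for t h a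
 proof (rule tensor_hom_map_comp[OF species_morphism_of[OF T] species_morphism_of[OF U] species_morphism_of[OF V] _ _ that])
  show "fn (?V0 x) r = fn (U0 x) (fn (T0 x) r)" if "x:sp_obj (species_of D F)" "r:car (sp_ring (species_of D F) x)" for x r
   using that double_transformation.T0_hom[OF T, of x] by (simp add: hom_arr_def ring_map_comp_def compose_eq)
  show "species_map D ?V1 y x a = species_map D U1 y x (species_map D T1 y x a)"
   if o: "y:sp_obj (species_of D F)" "x:sp_obj (species_of D F)" and a: "a:bcar (A.M y x)" for y x a
  proof -
   interpret N: bimodule_family "A.F0 y" "A.F0 x" "A.H y x" "\<lambda>f. A.F1 f" by (rule A.family) (use o in simp_all)
   have a': "a:bcar (sum_bimod (A.F0 y) (A.F0 x) (A.H y x) (\<lambda>f. A.F1 f))" using a by simp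
   have "fn (?V1 f) (a f) = fn (U1 f) (fn (T1 f) (a f))" if f: "f:A.H y x" for f
    using N.component[OF a' f] A.horizontal(4)[OF f] double_transformation_square(2)[OF T f] by simp
   then show ?thesis unfolding species_map_def by (simp cong: restrict_cong)
  qed
 qed
 note afT = additive_functor_of[OF T, of S] and afU = additive_functor_of[OF U, of S] and afV = additive_functor_of[OF V, of S]
 have "quotient_map_of D S F F'' ?V0 ?V1 = curry (\<lambda>(t, h)\<in>Obj (Vert D) \<times> Obj (Vert D). compose (car (PHom (?Q F) t h))
   (quotient_map_of D S F' F'' U0 U1 ((\<lambda>x\<in>Obj (Vert D). x) t) ((\<lambda>x\<in>Obj (Vert D). x) h)) (quotient_map_of D S F F' T0 T1 t h))"
 proof (rule family_eqI[OF _ curry_restrict(1)])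
  show "case_prod (quotient_map_of D S F F'' ?V0 ?V1):extensional (Obj (Vert D) \<times> Obj (Vert D))"
   using additive_functor.extensional(2)[OF afV] by simp
  fix t h assume o: "t:Obj (Vert D)" "h:Obj (Vert D)"
  show "quotient_map_of D S F F'' ?V0 ?V1 t h = curry (\<lambda>(t, h)\<in>Obj (Vert D) \<times> Obj (Vert D). compose (car (PHom (?Q F) t h))
   (quotient_map_of D S F' F'' U0 U1 ((\<lambda>x\<in>Obj (Vert D). x) t) ((\<lambda>x\<in>Obj (Vert D). x) h)) (quotient_map_of D S F F' T0 T1 t h)) t h"
   unfolding curry_restrict(2)[OF o] restrict_apply'[OF o(1)] restrict_apply'[OF o(2)]
  proof (rule extensionalityI[of _ "car (PHom (?Q F) t h)"])
   show "quotient_map_of D S F F'' ?V0 ?V1 t h:extensional (car (PHom (?Q F) t h))"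
    using additive_functor.extensional(3)[OF afV] o by simp
   fix A assume A: "A:car (PHom (?Q F) t h)"
   then obtain a where a: "a:car (tensor_hom (species_of D F) t h)"
    "A = ideal_of D S F t h #>\<^bsub>tensor_hom (species_of D F) t h\<^esub> a" unfolding carrier_quotient_cat_of by (rule imageE)
   show "quotient_map_of D S F F'' ?V0 ?V1 t h A = compose (car (PHom (?Q F) t h))
     (quotient_map_of D S F' F'' U0 U1 t h) (quotient_map_of D S F F' T0 T1 t h) A"
    unfolding compose_eq[OF A]
    unfolding a(2) quotient_map_of_coset[OF T o a(1)] quotient_map_of_coset[OF V o a(1)]
     quotient_map_of_coset[OF U o hom_in_carrier[OF species_morphism.\<Phi>_hom[OF species_morphism_of[OF T]] a(1)]] comp[OF a(1)] ..
  qed (simp add: compose_def)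
 qed
 moreover have "compose (Obj (Vert D)) (\<lambda>x\<in>Obj (Vert D). x) (\<lambda>x\<in>Obj (Vert D). x) = (\<lambda>x\<in>Obj (Vert D). x)"
  by (auto simp: compose_def)
 ultimately show ?thesis
  unfolding double_functor_cat_def category.simps arrow.simps fst_conv snd_conv
   quotient_functor_of_eq[OF T] quotient_functor_of_eq[OF U] quotient_functor_of_eq[OF V]
   preadd_cat_def PObj_quotient_cat_of by (simp only:)
qed

theorem quotient_functor:
 fixes D :: "('o, 'v, 'h, 's) double_cat"
 shows "cat_functor (double_functor_cat D (BIMOD :: ('u::infinite ring, 'u ring_map, ('u, 'u) bimod, 'u square) double_cat))
  preadd_cat \<lparr>OMap = quotient_cat_of D S, AMap = quotient_functor_of D S\<rparr>"
proof (rule cat_functor.intro[OF category_double_functor_cat category_preadd_cat], rule cat_functor_axioms.intro,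
  unfold double_functor_cat_sel preadd_cat_sel mem_Collect_eq fctr.simps)
 fix F :: "('o, 'v, 'h, 's, 'u) bimod_fctr" assume F: "double_functor D BIMOD F"
 show "preadditive_category (quotient_cat_of D S F)" by (rule preadditive_quotient_cat_of[OF F])
 show "quotient_functor_of D S (Ident (double_functor_cat D BIMOD) F) = Ident preadd_cat (quotient_cat_of D S F)"
  by (rule quotient_functor_of_Ident[OF F])
next
 fix g f :: "('o, 'v, 'h, 's, 'u ring, 'u ring_map, ('u, 'u) bimod, 'u square) double_trans"
 assume f: "double_transformation D BIMOD (src f) (tgt f) (fst (fn f)) (snd (fn f))"
 obtain F T0 T1 F' where T: "f = \<lparr>src = F, fn = (T0, T1), tgt = F'\<rparr>" by (cases f) auto
 have t: "double_transformation D BIMOD F F' T0 T1" using f unfolding T by simp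
 show "additive_functor (src (quotient_functor_of D S f)) (tgt (quotient_functor_of D S f))
   (fst (fn (quotient_functor_of D S f))) (snd (fn (quotient_functor_of D S f)))"
  "src (quotient_functor_of D S f) = quotient_cat_of D S (src f)" "tgt (quotient_functor_of D S f) = quotient_cat_of D S (tgt f)"
  unfolding T quotient_functor_of_eq[OF t] using additive_functor_of[OF t] by simp_all
 assume g: "double_transformation D BIMOD (src g) (tgt g) (fst (fn g)) (snd (fn g))" and e: "src g = tgt f"
 obtain U0 U1 F'' where U: "g = \<lparr>src = F', fn = (U0, U1), tgt = F''\<rparr>" using e T by (cases g) auto
 have u: "double_transformation D BIMOD F' F'' U0 U1" using g unfolding U by simp
 show "quotient_functor_of D S (g \<cdot>\<^bsub>double_functor_cat D BIMOD\<^esub> f) = quotient_functor_of D S g \<cdot>\<^bsub>preadd_cat\<^esub> quotient_functor_of D S f"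
  unfolding T U by (rule quotient_functor_of_Comp[OF t u])
qed

theorem theorem1p4:
  "(\<exists>(\<Phi> :: ('u::infinite ring, 'u ring, 'u ring_map, 'u ring_map,
              'u ring, 'u ring_map, ('u, 'u) bimod, 'u square) double_fctr)
      (\<Psi> :: ('u ring, 'u ring, 'u ring_map, 'u ring_map,
              'u ring, 'u ring, 'u central, 'u central_square) double_fctr)
      (\<Omega> :: ('u ring, 'u ring, 'u central, 'u central_square,
              'u ring, 'u ring_map, ('u, 'u) bimod, 'u square) double_fctr).
      double_functor RING BIMOD \<Phi> \<and> double_functor RING CENTRAL \<Psi> \<and> double_functor CENTRAL BIMOD \<Omega> \<and>
      (\<forall>R. ring R \<longrightarrow> OMap (Fun0 \<Phi>) R = R) \<and>
      (\<forall>\<sigma>\<in>ring_maps. OMap (Fun1 \<Phi>) \<sigma> = restriction_bimod \<sigma>) \<and>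
      (\<forall>R. ring R \<longrightarrow> OMap (Fun0 \<Psi>) R = centre_ring R) \<and>
      (\<forall>\<sigma>\<in>ring_maps. OMap (Fun1 \<Psi>) \<sigma> = centralizer_central \<sigma>) \<and>
      (\<forall>A. cring A \<longrightarrow> OMap (Fun0 \<Omega>) A = A) \<and>
      (\<forall>X\<in>centrals. OMap (Fun1 \<Omega>) X = central_bimod X)) \<and>
   (\<forall>(D :: ('o, 'v, 'h, 's) double_cat) S.
      double_category D \<and> S \<subseteq> Obj (Vert D) \<times> Obj (Vert D) \<times> Obj (Vert D) \<longrightarrow>
      cat_functor (double_functor_cat D (BIMOD :: ('u ring, 'u ring_map, ('u, 'u) bimod, 'u square) double_cat))
        preadd_cat
        \<lparr>OMap = quotient_cat_of D S, AMap = quotient_functor_of D S\<rparr>)"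
proof (intro conjI allI impI quotient_functor, intro exI conjI)
  show "double_functor RING BIMOD Phi_fct" by (rule double_functor_ring_bimod)
  show "double_functor RING CENTRAL Psi_fct" by (rule double_functor_ring_central)
  show "double_functor CENTRAL BIMOD Omega_fct" by (rule double_functor_central_bimod)
qed simp_all

end
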